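(* Let $\omega\in\mathcal W^*$ and $\phi\in\mathcal B^\omega_0$. Let $\rho:(0,\infty)\to(0,\infty)$ be increasing such that $x\mapsto\rho(x)/x^A$ is decreasing for some $A>0$. If $\mathcal R^+_{\phi,\omega}(x)=O(1/\rho(x))$ as $x\to\infty$, then $s_n(H_{\bar\phi})=O(1/\rho(n))$ as $n\to\infty$.
   Context: $\mathbb D$ is the unit disc, $dA$ Lebesgue area measure. A weight is a Lebesgue-integrable function $\omega:\mathbb D\to(0,\infty)$ bounded below by a positive constant on compact subsets; $A^2_\omega$ the holomorphic functions with $\|f\|_\omega^2=\int_{\mathbb D}|f|^2\omega\,dA<\infty$; $L^2_\omega=L^2(\mathbb D,\omega dA)$; $P_\omega$ the orthogonal projection onto $A^2_\omega$; $K$ the reproducing kernel, $K_z=K(\cdot,z)$; $\tau_\omega(z)=1/(\omega(z)^{1/2}\|K_z\|_\omega)$; $d\lambda_\omega=\tau_\omega^{-2}dA$. The class $\mathcal W$: (i) $\|K_z\|_\omega\to\infty$ as $|z|\to1^-$ and, for fixed $\zeta$, $|K(\zeta,z)|=o(\|K_z\|_\omega)$ as $|z|\to1^-$; (ii) $\tau_\omega(z)=O(1-|z|)$; (iii) there is $\eta>0$ such that $|z-\zeta|\le\eta\tau_\omega(z)$ implies $\tau_\omega(z)\asymp\tau_\omega(\zeta)$ and $\|K_z\|_\omega\|K_\zeta\|_\omega\lesssim|K(\zeta,z)|$. With $\Delta=\partial\bar\partial$, $\mathcal W^*$ consists of $\omega=e^{-\varphi}\in\mathcal W$, $\varphi\in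 C^2(\mathbb D)$ real, such that either $\tau_\omega^2\Delta\varphi\gtrsim1$, or there exist a subharmonic $\psi\ge0$ and $\delta>0$, $t\in(-1,0)$ with $\tau_\omega^2\Delta\psi\ge\delta$, $\Delta\varphi\ge t\Delta\psi$, $|\partial\psi|^2\le\Delta\psi$ on $\mathbb D$. $H_{\bar\phi}f=\bar\phi f-P_\omega(\bar\phi f)$ is the Hankel operator; $\mathcal B^\omega_0$: holomorphic $\phi$ with $\tau_\omega(z)|\phi'(z)|\to0$ as $|z|\to1^-$ (then $H_{\bar\phi}$ is compact with singular values $s_1\ge s_2\ge\cdots$). $\mathcal R_{\phi,\omega}(t)=\lambda_\omega(\{z:\tau_\omega(z)|\phi'(z)|>t\})$ and $\mathcal R^+_{\phi,\omega}(x)=\sup\{t\in(0,\|\tau_\omega\phi'\|_\infty]:\mathcal R_{\phi,\omega}(t)\ge x\}$. *)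

theory Defs
  imports "HOL-Analysis.Analysis" "HOL-Library.Landau_Symbols"
begin

definition disc :: "complex set" where
  "disc = ball 0 1"

definition to_bdry :: "complex filter" where
  "to_bdry = filtercomap cmod (at_left 1)"

definition is_weight :: "(complex \<Rightarrow> real) \<Rightarrow> bool" where
  "is_weight w \<longleftrightarrow> set_integrable lebesgue disc w \<and> (\<forall>z\<in>disc. w z > 0) \<and>
     (\<forall>S. compact S \<and> S \<subseteq> disc \<longrightarrow> (\<exists>c>0. \<forall>z\<in>S. c \<le> w z))"

text \<open>Squared weighted norm (in ennreal, so it is always defined).\<close>
definition nsq :: "(complex \<Rightarrow> real) \<Rightarrow> (complex \<Rightarrow> complex) \<Rightarrow> ennreal" where
  "nsq w f = (\<integral>\<^sup>+ z\<in>disc. ennreal ((cmod (f z))\<^sup>2 * w z) \<partial>lebesgue)"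

definition wnorm :: "(complex \<Rightarrow> real) \<Rightarrow> (complex \<Rightarrow> complex) \<Rightarrow> real" where
  "wnorm w f = sqrt (enn2real (nsq w f))"

definition L2w :: "(complex \<Rightarrow> real) \<Rightarrow> (complex \<Rightarrow> complex) set" where
  "L2w w = {f. set_borel_measurable lebesgue disc f \<and> nsq w f < \<infinity>}"

definition winner :: "(complex \<Rightarrow> real) \<Rightarrow> (complex \<Rightarrow> complex) \<Rightarrow> (complex \<Rightarrow> complex) \<Rightarrow> complex" where
  "winner w f g = (LINT z:disc|lebesgue. f z * cnj (g z) * complex_of_real (w z))"

definition A2w :: "(complex \<Rightarrow> real) \<Rightarrow> (complex \<Rightarrow> complex) set" where
  "A2w w = {f. f holomorphic_on disc \<and> f \<in> L2w w}"

definition kern :: "(complex \<Rightarrow> real) \<Rightarrow> complex \<Rightarrow> complex \<Rightarrow> complex" where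
  "kern w z = (SOME k. k \<in> A2w w \<and> (\<forall>f\<in>A2w w. f z = winner w f k))"

definition K :: "(complex \<Rightarrow> real) \<Rightarrow> complex \<Rightarrow> complex \<Rightarrow> complex" where
  "K w \<zeta> z = kern w z \<zeta>"

definition knorm :: "(complex \<Rightarrow> real) \<Rightarrow> complex \<Rightarrow> real" where
  "knorm w z = wnorm w (kern w z)"

definition tau :: "(complex \<Rightarrow> real) \<Rightarrow> complex \<Rightarrow> real" where
  "tau w z = 1 / (sqrt (w z) * knorm w z)"

definition proj :: "(complex \<Rightarrow> real) \<Rightarrow> (complex \<Rightarrow> complex) \<Rightarrow> (complex \<Rightarrow> complex)" where
  "proj w f = (SOME g. g \<in> A2w w \<and> (\<forall>h\<in>A2w w. winner w (\<lambda>z. f z - g z) h = 0))"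

definition hankel :: "(complex \<Rightarrow> real) \<Rightarrow> (complex \<Rightarrow> complex) \<Rightarrow> (complex \<Rightarrow> complex) \<Rightarrow> (complex \<Rightarrow> complex)" where
  "hankel w b f = (\<lambda>z. cnj (b z) * f z - proj w (\<lambda>x. cnj (b x) * f x) z)"

definition hdom :: "(complex \<Rightarrow> real) \<Rightarrow> (complex \<Rightarrow> complex) \<Rightarrow> (complex \<Rightarrow> complex) set" where
  "hdom w b = {f \<in> A2w w. (\<lambda>z. cnj (b z) * f z) \<in> L2w w}"

text \<open>Bounded operators of rank < n from A^2_w into L^2_w: f \<mapsto> sum_{i<m} <f,u_i> v_i, m < n.\<close>
definition finrank :: "(complex \<Rightarrow> real) \<Rightarrow> nat \<Rightarrow> ((complex \<Rightarrow> complex) \<Rightarrow> (complex \<Rightarrow> complex)) set" where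
  "finrank w n = {F. \<exists>m<n. \<exists>u v. (\<forall>i<m. u i \<in> L2w w \<and> v i \<in> L2w w) \<and>
      F = (\<lambda>f z. \<Sum>i<m. winner w f (u i) * v i z)}"

text \<open>Singular values s_n (n >= 1) as approximation numbers:
  s_n(H)^2 = inf over F of rank < n of the squared operator norm of H - F.\<close>
definition sv_sq :: "(complex \<Rightarrow> real) \<Rightarrow> (complex \<Rightarrow> complex) \<Rightarrow> nat \<Rightarrow> ennreal" where
  "sv_sq w b n = Inf ((\<lambda>F. Sup ((\<lambda>f. nsq w (\<lambda>z. hankel w b f z - F f z)) `
        {f \<in> hdom w b. nsq w f \<le> 1})) ` finrank w n)"

definition hankel_sv :: "(complex \<Rightarrow> real) \<Rightarrow> (complex \<Rightarrow> complex) \<Rightarrow> nat \<Rightarrow> real" where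
  "hankel_sv w b n = sqrt (enn2real (sv_sq w b n))"

definition classW :: "(complex \<Rightarrow> real) \<Rightarrow> bool" where
  "classW w \<longleftrightarrow> is_weight w \<and>
     filterlim (knorm w) at_top to_bdry \<and>
     (\<forall>\<zeta>\<in>disc. (\<lambda>z. cmod (K w \<zeta> z)) \<in> o[to_bdry](knorm w)) \<and>
     (\<exists>C. \<forall>z\<in>disc. tau w z \<le> C * (1 - cmod z)) \<and>
     (\<exists>\<eta>>0. \<exists>C>0. \<forall>z\<in>disc. \<forall>\<zeta>\<in>disc. cmod (z - \<zeta>) \<le> \<eta> * tau w z \<longrightarrow>
         tau w z \<le> C * tau w \<zeta> \<and> tau w \<zeta> \<le> C * tau w z \<and>
         knorm w z * knorm w \<zeta> \<le> C * cmod (K w \<zeta> z))"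

definition pd :: "(complex \<Rightarrow> real) \<Rightarrow> complex \<Rightarrow> complex \<Rightarrow> real" where
  "pd u e z = deriv (\<lambda>t. u (z + of_real t * e)) 0"

definition pd_exists :: "(complex \<Rightarrow> real) \<Rightarrow> complex \<Rightarrow> complex \<Rightarrow> bool" where
  "pd_exists u e z \<longleftrightarrow> (\<lambda>t. u (z + of_real t * e)) differentiable (at 0)"

definition C2_on :: "complex set \<Rightarrow> (complex \<Rightarrow> real) \<Rightarrow> bool" where
  "C2_on S u \<longleftrightarrow> continuous_on S u \<and>
     (\<forall>e\<in>{1, \<i>}. (\<forall>z\<in>S. pd_exists u e z) \<and> continuous_on S (pd u e) \<and>
        (\<forall>e'\<in>{1, \<i>}. (\<forall>z\<in>S. pd_exists (pd u e) e' z) \<and> continuous_on S (pd (pd u e) e')))"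

text \<open>Delta = d dbar = (1/4)(u_xx + u_yy);  |d u|^2 = (u_x^2 + u_y^2)/4 for real u.\<close>
definition lap :: "(complex \<Rightarrow> real) \<Rightarrow> complex \<Rightarrow> real" where
  "lap u z = (pd (pd u 1) 1 z + pd (pd u \<i>) \<i> z) / 4"

definition dsq :: "(complex \<Rightarrow> real) \<Rightarrow> complex \<Rightarrow> real" where
  "dsq u z = ((pd u 1 z)\<^sup>2 + (pd u \<i> z)\<^sup>2) / 4"

definition classWstar :: "(complex \<Rightarrow> real) \<Rightarrow> bool" where
  "classWstar w \<longleftrightarrow> classW w \<and>
     (\<exists>\<phi>. C2_on disc \<phi> \<and> (\<forall>z\<in>disc. w z = exp (- \<phi> z)) \<and>
        ((\<exists>c>0. \<forall>z\<in>disc. (tau w z)\<^sup>2 * lap \<phi> z \<ge> c) \<or>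
         (\<exists>\<psi> \<delta> t. C2_on disc \<psi> \<and> (\<forall>z\<in>disc. \<psi> z \<ge> 0 \<and> lap \<psi> z \<ge> 0) \<and>
            \<delta> > 0 \<and> -1 < t \<and> t < 0 \<and>
            (\<forall>z\<in>disc. (tau w z)\<^sup>2 * lap \<psi> z \<ge> \<delta> \<and> lap \<phi> z \<ge> t * lap \<psi> z \<and>
                       dsq \<psi> z \<le> lap \<psi> z))))"

definition B0w :: "(complex \<Rightarrow> real) \<Rightarrow> (complex \<Rightarrow> complex) set" where
  "B0w w = {b. b holomorphic_on disc \<and> ((\<lambda>z. tau w z * cmod (deriv b z)) \<longlongrightarrow> 0) to_bdry}"

definition Rfun :: "(complex \<Rightarrow> real) \<Rightarrow> (complex \<Rightarrow> complex) \<Rightarrow> real \<Rightarrow> ennreal" where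
  "Rfun w b t = (\<integral>\<^sup>+ z\<in>{z\<in>disc. tau w z * cmod (deriv b z) > t}.
                    ennreal (1 / (tau w z)\<^sup>2) \<partial>lebesgue)"

definition supn :: "(complex \<Rightarrow> real) \<Rightarrow> (complex \<Rightarrow> complex) \<Rightarrow> real" where
  "supn w b = Sup ((\<lambda>z. tau w z * cmod (deriv b z)) ` disc)"

text \<open>R^+(x) = sup{t in (0, ||tau b'||_inf] : R(t) >= x}, with sup of the empty set = 0.\<close>
definition Rplus :: "(complex \<Rightarrow> real) \<Rightarrow> (complex \<Rightarrow> complex) \<Rightarrow> real \<Rightarrow> real" where
  "Rplus w b x = Sup ({t. 0 < t \<and> t \<le> supn w b \<and> Rfun w b t \<ge> ennreal x} \<union> {0})"

end

theory Submission
  imports Defs "HOL-Complex_Analysis.Complex_Analysis"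
begin

text \<open>The function \<open>H f\<close> is the solution of minimal norm of \<open>\<partial>\<close>-bar \<open>v = f cnj b'\<close>, so a weighted \<open>L\<^sup>2\<close> estimate
(Morrey-Kohn, twisted by \<open>\<psi>\<close> in the second case of the definition of the weight class) gives
\<open>norm (H f) \<le> C norm (\<tau> b' f)\<close>. Where \<open>\<tau> \<bar>b'\<bar> \<le> s\<close> this is already small. The remaining set is covered by
boundedly overlapping discs of radius comparable to \<open>\<tau>(z)\<close>, \<open>z \<in> Z\<close>; on such a disc \<open>f / K\<^sub>z\<close> is holomorphic and
controlled by the local norm of \<open>f\<close>, so replacing it by its Taylor polynomial with \<open>N z\<close> terms gains a factor
\<open>2 ^ - N z\<close> at the price of \<open>N z\<close> dimensions. It suffices that \<open>N z\<close> is about \<open>1 + log (G z / s)\<close>, with \<open>G z\<close> a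
local \<open>L\<^sup>p\<close> mean of \<open>\<tau> \<bar>b'\<bar>\<close>, and this is at most a multiple of \<open>(G z / s)\<^sup>p\<close>. By the sub-mean value property of
\<open>\<bar>b'\<bar>\<^sup>p\<close> and a dyadic layer cake decomposition, the total rank is at most a multiple of \<open>x\<close> as soon as
\<open>R (2^k t) \<le> x \<theta>^k\<close> for all \<open>k\<close>, where \<open>s\<close> is comparable to \<open>t\<close> and \<open>2\<^sup>p \<theta> < 1\<close>. For \<open>t\<close> a multiple of
\<open>1 / \<rho> x\<close> the growth condition on \<open>\<rho>\<close> provides this with \<open>\<theta> = 2 powr (- 1 / A)\<close>, and \<open>p < 1 / A\<close> is allowed
because \<open>p\<close> may be arbitrarily small.\<close>

section \<open>Square integrable functions\<close>

text \<open>The truncated pieces of \<open>f\<close> do not glue to a holomorphic function, so the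
  Hankel operator cannot be applied to them. Instead the data is truncated: each
  \<open>cnj (deriv b \<zeta>) * (\<zeta> - z)^i * kern w z \<zeta>\<close>, cut off to a disjoint
  part of the covering, gets its own minimal solution, and the approximant is the combination of
  these solutions with the Taylor coefficients of \<open>f / kern w z\<close>. Its difference from
  \<open>H f\<close> again solves the Cauchy-Riemann equation, with the truncation error as data.
  The a priori bound must therefore hold for every weak solution orthogonal to \<open>A2w w\<close>;
  this needs uniqueness, which is Weyl's lemma in \<open>L2 M\<close>. The same lemma gives the
  Riesz representation inside the Bergman space on which kernel and projection, both defined by
  choice, rest. A second obstacle is a circularity in the count: the cells also see the part of
  \<open>tau w z * cmod (deriv b z)\<close> below \<open>t\<close>, whose contribution is
  proportional to the number of cells. Taking \<open>s = \<kappa> * t\<close> with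
  \<open>\<kappa>\<close> large lets it be absorbed. Dividing by \<open>kern w z\<close> turns
  weighted local norms into unweighted ones, because \<open>w * knorm^2 * tau^2 = 1\<close>.\<close>

definition sqn :: "'a measure \<Rightarrow> ('a \<Rightarrow> complex) \<Rightarrow> ennreal" where
  "sqn M f = (\<integral>\<^sup>+x. ennreal ((cmod (f x))\<^sup>2) \<partial>M)"

definition L2 :: "'a measure \<Rightarrow> ('a \<Rightarrow> complex) set" where
  "L2 M = {f. f \<in> borel_measurable M \<and> integrable M (\<lambda>x. (cmod (f x))\<^sup>2)}"

definition ip :: "'a measure \<Rightarrow> ('a \<Rightarrow> complex) \<Rightarrow> ('a \<Rightarrow> complex) \<Rightarrow> complex" where
  "ip M f g = (LINT x|M. f x * cnj (g x))"

definition nrm :: "'a measure \<Rightarrow> ('a \<Rightarrow> complex) \<Rightarrow> real" where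
  "nrm M f = sqrt (LINT x|M. (cmod (f x))\<^sup>2)"

lemma L2_meas: "f \<in> L2 M \<Longrightarrow> f \<in> borel_measurable M"
  by (simp add: L2_def)

lemma nrm_nonneg [simp]: "0 \<le> nrm M f"
  by (simp add: nrm_def)

lemma nrm_sq: "(nrm M f)\<^sup>2 = (LINT x|M. (cmod (f x))\<^sup>2)"
  by (simp add: nrm_def)

lemma L2_iff_sqn: "f \<in> L2 M \<longleftrightarrow> f \<in> borel_measurable M \<and> sqn M f < \<infinity>"
  by (auto simp: L2_def sqn_def integrable_iff_bounded)

lemma sqn_L2: "f \<in> L2 M \<Longrightarrow> sqn M f = ennreal ((nrm M f)\<^sup>2)"
  by (simp add: L2_def sqn_def nrm_sq nn_integral_eq_integral)

lemma cmod_add_sq_le: "(cmod (a + b))\<^sup>2 \<le> 2 * (cmod a)\<^sup>2 + 2 * (cmod b)\<^sup>2"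
proof -
  have "(cmod (a + b))\<^sup>2 \<le> (cmod a + cmod b)\<^sup>2"
    by (intro power_mono norm_triangle_ineq) auto
  also have "\<dots> \<le> 2 * (cmod a)\<^sup>2 + 2 * (cmod b)\<^sup>2"
    using sum_squares_ge_zero[of "cmod a - cmod b" 0] by (simp add: power2_eq_square algebra_simps)
  finally show ?thesis .
qed

lemma L2_lin:
  assumes "f \<in> L2 M" "g \<in> L2 M"
  shows "(\<lambda>x. c * f x + g x) \<in> L2 M"
proof -
  have [measurable]: "f \<in> borel_measurable M" "g \<in> borel_measurable M"
    using assms by (auto simp: L2_def)
  have "integrable M (\<lambda>x. (cmod (c * f x + g x))\<^sup>2)"
  proof (rule Bochner_Integration.integrable_bound)
    show "integrable M (\<lambda>x. 2 * (cmod c)\<^sup>2 * (cmod (f x))\<^sup>2 + 2 * (cmod (g x))\<^sup>2)"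
      using assms by (auto simp: L2_def)
    show "AE x in M. norm ((cmod (c * f x + g x))\<^sup>2) \<le> norm (2 * (cmod c)\<^sup>2 * (cmod (f x))\<^sup>2 + 2 * (cmod (g x))\<^sup>2)"
      using cmod_add_sq_le[of "c * f _" "g _"] by (auto simp: norm_mult power_mult_distrib mult.assoc)
  qed measurable
  then show ?thesis by (simp add: L2_def)
qed

lemma L2_zero: "(\<lambda>x. 0) \<in> L2 M"
  by (simp add: L2_def)

lemma L2_diff: "f \<in> L2 M \<Longrightarrow> g \<in> L2 M \<Longrightarrow> (\<lambda>x. f x - g x) \<in> L2 M"
  using L2_lin[of g M f "-1"] by simp

lemma L2_bound:
  assumes "g \<in> L2 M" "f \<in> borel_measurable M" "\<And>x. x \<in> space M \<Longrightarrow> cmod (f x) \<le> c * cmod (g x)"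
  shows "f \<in> L2 M"
proof -
  note [measurable] = assms(2)
  have "integrable M (\<lambda>x. (cmod (f x))\<^sup>2)"
  proof (rule Bochner_Integration.integrable_bound)
    show "integrable M (\<lambda>x. c\<^sup>2 * (cmod (g x))\<^sup>2)"
      using assms by (auto simp: L2_def)
    show "AE x in M. norm ((cmod (f x))\<^sup>2) \<le> norm (c\<^sup>2 * (cmod (g x))\<^sup>2)"
      using assms(3) by (intro AE_I2) (auto simp flip: power_mult_distrib intro!: power_mono)
  qed measurable
  then show ?thesis using assms by (simp add: L2_def)
qed

lemma cnj_borel_measurable [measurable]: "cnj \<in> borel_measurable borel"
  by (intro borel_measurable_continuous_onI continuous_intros)

lemma L2_prod_integrable:
  assumes "f \<in> L2 M" "g \<in> L2 M"
  shows "integrable M (\<lambda>x. f x * cnj (g x))" "integrable M (\<lambda>x. f x * g x)"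
proof -
  have [measurable]: "f \<in> borel_measurable M" "g \<in> borel_measurable M"
    using assms by (auto simp: L2_def)
  have i: "integrable M (\<lambda>x. (cmod (f x))\<^sup>2 + (cmod (g x))\<^sup>2)"
    using assms by (auto simp: L2_def)
  have b: "cmod (f x) * cmod (g x) \<le> (cmod (f x))\<^sup>2 + (cmod (g x))\<^sup>2" for x
    using sum_squares_bound[of "cmod (f x)" "cmod (g x)"] mult_nonneg_nonneg[OF norm_ge_zero norm_ge_zero, of "f x" "g x"]
    by linarith
  show "integrable M (\<lambda>x. f x * cnj (g x))"
    by (rule Bochner_Integration.integrable_bound[OF i]) (use b in \<open>auto simp: norm_mult\<close>)
  show "integrable M (\<lambda>x. f x * g x)"
    by (rule Bochner_Integration.integrable_bound[OF i]) (use b in \<open>auto simp: norm_mult\<close>)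
qed

lemma ip_lin_left:
  assumes "f \<in> L2 M" "g \<in> L2 M" "h \<in> L2 M"
  shows "ip M (\<lambda>x. c * f x + g x) h = c * ip M f h + ip M g h"
  using L2_prod_integrable(1)[OF assms(1,3)] L2_prod_integrable(1)[OF assms(2,3)]
  by (simp add: ip_def algebra_simps)

lemma ip_diff_left:
  "f \<in> L2 M \<Longrightarrow> g \<in> L2 M \<Longrightarrow> h \<in> L2 M \<Longrightarrow> ip M (\<lambda>x. f x - g x) h = ip M f h - ip M g h"
  using ip_lin_left[of g M f h "-1"] by simp

lemma ip_cnj: "ip M g f = cnj (ip M f g)"
  unfolding ip_def Bochner_Integration.integral_cnj[symmetric] complex_cnj_mult complex_cnj_cnj by (simp only: mult.commute)

lemma ip_self: "ip M f f = of_real ((nrm M f)\<^sup>2)"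
  by (simp only: ip_def nrm_sq complex_norm_square[symmetric] integral_complex_of_real)

lemma ip_diff_right:
  "f \<in> L2 M \<Longrightarrow> g \<in> L2 M \<Longrightarrow> h \<in> L2 M \<Longrightarrow> ip M h (\<lambda>x. f x - g x) = ip M h f - ip M h g"
  by (simp add: ip_cnj[of M h] ip_diff_left)

lemma nrm_lin_sq:
  assumes "f \<in> L2 M" "g \<in> L2 M"
  shows "(nrm M (\<lambda>x. c * f x + g x))\<^sup>2 = (cmod c)\<^sup>2 * (nrm M f)\<^sup>2 + 2 * Re (c * ip M f g) + (nrm M g)\<^sup>2"
proof -
  let ?h = "\<lambda>x. c * f x + g x"
  have h: "?h \<in> L2 M" by (intro L2_lin assms)
  have "ip M ?h ?h = c * ip M f ?h + ip M g ?h"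
    by (rule ip_lin_left[OF assms h])
  also have "ip M f ?h = cnj (c * ip M f f + ip M g f)"
    by (subst ip_cnj, subst ip_lin_left) (use assms in auto)
  also have "ip M g ?h = cnj (c * ip M f g + ip M g g)"
    by (subst ip_cnj, subst ip_lin_left) (use assms in auto)
  also have "ip M g f = cnj (ip M f g)" by (rule ip_cnj)
  finally have "complex_of_real ((nrm M ?h)\<^sup>2) = c * cnj c * of_real ((nrm M f)\<^sup>2)
      + (c * ip M f g + cnj (c * ip M f g)) + of_real ((nrm M g)\<^sup>2)"
    by (simp add: ip_self algebra_simps)
  also have "\<dots> = complex_of_real ((cmod c)\<^sup>2 * (nrm M f)\<^sup>2 + 2 * Re (c * ip M f g) + (nrm M g)\<^sup>2)"
    by (simp only: complex_add_cnj complex_norm_square[symmetric]) simp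
  finally show ?thesis by (simp only: of_real_eq_iff)
qed

text \<open>The discriminant inequality for complex \<open>c\<close>, tested on
  \<open>c = - t * cnj z\<close> with real \<open>t\<close>. It serves twice: for Cauchy-Schwarz,
  and in \<open>L2_Riesz\<close>, where \<open>E\<close> measures how far a point is from
  minimising.\<close>

lemma quadratic_nonneg_imp:
  assumes q: "\<And>c::complex. 0 \<le> (cmod c)\<^sup>2 * P + 2 * Re (c * z) + E" and P: "0 \<le> P"
  shows "(cmod z)\<^sup>2 \<le> P * E"
proof -
  have r: "0 \<le> t\<^sup>2 * (cmod z)\<^sup>2 * P - 2 * t * (cmod z)\<^sup>2 + E" for t :: real
  proof -
    have "Re (of_real (-t) * cnj z * z) = - t * (cmod z)\<^sup>2"
      by (simp add: cmod_power2) (simp add: power2_eq_square algebra_simps)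
    then show ?thesis
      using q[of "of_real (-t) * cnj z"] by (simp add: norm_mult power_mult_distrib)
  qed
  show ?thesis
  proof (cases "P = 0")
    case True
    have "cmod z = 0"
    proof (rule ccontr)
      assume z: "cmod z \<noteq> 0"
      \<comment> \<open>With \<open>P = 0\<close> the expression is affine in \<open>t\<close>; this
        value of \<open>t\<close> brings it down to \<open>-1\<close>.\<close>
      have "0 \<le> E - 2 * ((E+1) / (2 * (cmod z)\<^sup>2)) * (cmod z)\<^sup>2"
        using r[of "(E+1) / (2 * (cmod z)\<^sup>2)"] True by simp
      also have "\<dots> = -1" using z by (simp add: field_simps)
      finally show False by simp
    qed
    then show ?thesis using True by simp
  next
    case False
    then have "0 \<le> (cmod z)\<^sup>2 / P - 2 * (cmod z)\<^sup>2 / P + E"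
      using r[of "1 / P"] by (simp add: power2_eq_square)
    then have "(cmod z)\<^sup>2 / P \<le> E" by simp
    then show ?thesis using False P by (simp add: field_simps)
  qed
qed

section \<open>Cauchy-Schwarz, completeness and Riesz representation\<close>

lemma L2_Cauchy_Schwarz:
  assumes "f \<in> L2 M" "g \<in> L2 M"
  shows "cmod (ip M f g) \<le> nrm M f * nrm M g"
proof -
  have "(cmod (ip M f g))\<^sup>2 \<le> (nrm M f)\<^sup>2 * (nrm M g)\<^sup>2"
    by (rule quadratic_nonneg_imp) (use nrm_lin_sq[OF assms] in \<open>metis zero_le_power2\<close>, simp)
  then show ?thesis
    by (simp add: power_mult_distrib[symmetric] power2_le_iff_abs_le)
qed

lemma nrm_triangle:
  assumes "f \<in> L2 M" "g \<in> L2 M"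
  shows "nrm M (\<lambda>x. f x + g x) \<le> nrm M f + nrm M g"
proof (rule power2_le_imp_le)
  have "Re (ip M f g) \<le> nrm M f * nrm M g"
    using L2_Cauchy_Schwarz[OF assms] complex_Re_le_cmod[of "ip M f g"] by linarith
  then show "(nrm M (\<lambda>x. f x + g x))\<^sup>2 \<le> (nrm M f + nrm M g)\<^sup>2"
    using nrm_lin_sq[OF assms, of 1] by (simp add: power2_sum algebra_simps)
qed simp

lemma sqn_le_imp:
  assumes "f \<in> borel_measurable M" "sqn M f \<le> ennreal (B\<^sup>2)" "0 \<le> B"
  shows "f \<in> L2 M" "nrm M f \<le> B"
proof -
  show L: "f \<in> L2 M"
    using assms by (auto simp: L2_iff_sqn intro: le_less_trans[OF _ ennreal_less_top])
  then have "(nrm M f)\<^sup>2 \<le> B\<^sup>2" using assms by (simp add: sqn_L2 ennreal_le_iff)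
  then show "nrm M f \<le> B" using assms(3) by (rule power2_le_imp_le)
qed

text \<open>A subsequence with consecutive distances at most \<open>2^-k\<close> converges almost
  everywhere, because the sum of \<open>2^k * |h (k+1) - h k|^2\<close> has finite integral. Fatou's
  lemma then makes the pointwise limit the \<open>L2\<close> limit of the whole sequence.\<close>

theorem Riesz_Fischer:
  assumes f: "\<And>n. f n \<in> L2 M"
    and cauchy: "\<And>e. 0 < e \<Longrightarrow> \<exists>N. \<forall>m\<ge>N. \<forall>n\<ge>N. nrm M (\<lambda>x. f m x - f n x) \<le> e"
  obtains g where "g \<in> L2 M" "(\<lambda>n. nrm M (\<lambda>x. f n x - g x)) \<longlonglongrightarrow> 0"
proof -
  have [measurable]: "f n \<in> borel_measurable M" for n using f by (rule L2_meas)
  have "\<exists>N. \<forall>k. \<forall>m\<ge>N k. \<forall>n\<ge>N k. nrm M (\<lambda>x. f m x - f n x) \<le> (1/2)^k"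
    using cauchy[of "(1/2)^_"] by (intro choice) simp
  then obtain N where N: "\<And>k m n. N k \<le> m \<Longrightarrow> N k \<le> n \<Longrightarrow> nrm M (\<lambda>x. f m x - f n x) \<le> (1/2)^k"
    by blast
  \<comment> \<open>The maximum makes \<open>r\<close> monotone and at least \<open>N j\<close> for
    every \<open>j \<le> k\<close>; the summand \<open>k\<close> makes the indices go to
    infinity.\<close>
  define r where "r k = k + Max (N ` {..k})" for k
  have rN: "N k \<le> r k" for k unfolding r_def by (intro trans_le_add2 Max_ge) auto
  have rk: "k \<le> r k" for k by (simp add: r_def)
  have rmono: "r k \<le> r (Suc k)" for k unfolding r_def by (intro add_mono Max_mono) auto
  define h where "h k = f (r k)" for k
  have hL: "h k \<in> L2 M" for k using f by (simp add: h_def)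
  have [measurable]: "h k \<in> borel_measurable M" for k by (simp add: h_def)
  have hd: "nrm M (\<lambda>x. h (Suc k) x - h k x) \<le> (1/2)^k" for k
    unfolding h_def using N[of k] rN[of k] rmono[of k] by (meson le_trans)
  have "(\<integral>\<^sup>+x. (\<Sum>k. ennreal (2^k * (cmod (h (Suc k) x - h k x))\<^sup>2)) \<partial>M) =
        (\<Sum>k. \<integral>\<^sup>+x. ennreal (2^k * (cmod (h (Suc k) x - h k x))\<^sup>2) \<partial>M)"
    by (rule nn_integral_suminf) measurable
  also have "\<dots> = (\<Sum>k. ennreal (2^k * (nrm M (\<lambda>x. h (Suc k) x - h k x))\<^sup>2))"
  proof (rule suminf_cong)
    fix k
    have "(\<integral>\<^sup>+x. ennreal (2^k * (cmod (h (Suc k) x - h k x))\<^sup>2) \<partial>M) = ennreal (2^k) * sqn M (\<lambda>x. h (Suc k) x - h k x)"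
      unfolding sqn_def by (subst nn_integral_cmult[symmetric]) (auto simp: ennreal_mult')
    then show "(\<integral>\<^sup>+x. ennreal (2^k * (cmod (h (Suc k) x - h k x))\<^sup>2) \<partial>M) = ennreal (2^k * (nrm M (\<lambda>x. h (Suc k) x - h k x))\<^sup>2)"
      by (simp add: sqn_L2 L2_diff hL ennreal_mult')
  qed
  also have "\<dots> \<le> (\<Sum>k. ennreal ((1/2)^k))"
  proof (intro suminf_le ennreal_leI)
    fix k
    have "(nrm M (\<lambda>x. h (Suc k) x - h k x))\<^sup>2 \<le> ((1/2)^k)\<^sup>2"
      by (intro power_mono hd) auto
    then have "2^k * (nrm M (\<lambda>x. h (Suc k) x - h k x))\<^sup>2 \<le> 2^k * ((1/2)^k)\<^sup>2"
      by (intro mult_left_mono) auto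
    also have "\<dots> = (1/2)^k" by (simp add: power2_eq_square power_one_over)
    finally show "2^k * (nrm M (\<lambda>x. h (Suc k) x - h k x))\<^sup>2 \<le> (1/2)^k" .
  qed auto
  also have "\<dots> = ennreal (\<Sum>k. (1/2)^k)"
    by (rule suminf_ennreal2) (auto intro: summable_geometric)
  finally have "(\<integral>\<^sup>+x. (\<Sum>k. ennreal (2^k * (cmod (h (Suc k) x - h k x))\<^sup>2)) \<partial>M) \<noteq> \<infinity>"
    by (metis ennreal_neq_top infinity_ennreal_def neq_top_trans)
  then have "AE x in M. (\<Sum>k. ennreal (2^k * (cmod (h (Suc k) x - h k x))\<^sup>2)) \<noteq> \<infinity>"
    by (intro nn_integral_noteq_infinite) auto
  then have conv: "AE x in M. (\<lambda>k. h k x) \<longlonglongrightarrow> lim (\<lambda>k. h k x)"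
  proof eventually_elim
    case (elim x)
    have s1: "summable (\<lambda>k. 2^k * (cmod (h (Suc k) x - h k x))\<^sup>2)"
      by (rule summable_suminf_not_top) (use elim in auto)
    have "summable (\<lambda>k. h (Suc k) x - h k x)"
    proof (rule summable_comparison_test')
      show "summable (\<lambda>k. (1/2::real)^k + 2^k * (cmod (h (Suc k) x - h k x))\<^sup>2)"
        by (intro summable_add s1 summable_geometric) auto
      fix k :: nat assume "k \<ge> 0"
      define a where "a = cmod (h (Suc k) x - h k x)"
      \<comment> \<open>Either \<open>a\<close> is at most \<open>2^-k\<close>, or
        \<open>2^k * a \<ge> 1\<close> and then \<open>a \<le> 2^k * a^2\<close>. So the weighted
        square sum controls the plain sum.\<close>
      have "a \<le> (1/2)^k + 2^k * a\<^sup>2"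
      proof (cases "a \<le> (1/2)^k")
        case False
        then have "1 \<le> 2^k * a" by (simp add: field_simps power_one_over)
        then have "1 * a \<le> (2^k * a) * a" by (intro mult_right_mono) (auto simp: a_def)
        then show ?thesis by (simp add: power2_eq_square add_increasing mult.assoc)
      next
        case True then show ?thesis by (simp add: add_increasing2)
      qed
      then show "cmod (h (Suc k) x - h k x) \<le> (1/2)^k + 2^k * (cmod (h (Suc k) x - h k x))\<^sup>2"
        by (simp add: a_def)
    qed
    then have "convergent (\<lambda>n. \<Sum>k<n. h (Suc k) x - h k x)"
      by (simp add: summable_iff_convergent)
    then have "convergent (\<lambda>n. h n x - h 0 x)"
      by (simp only: sum_lessThan_telescope[of "\<lambda>k. h k x"])
    then have "convergent (\<lambda>n. (h n x - h 0 x) + h 0 x)"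
      by (intro convergent_add convergent_const)
    then have "convergent (\<lambda>n. h n x)" by simp
    then show ?case by (simp add: convergent_LIMSEQ_iff)
  qed
  define g where "g x = lim (\<lambda>k. h k x)" for x
  have [measurable]: "g \<in> borel_measurable M"
    unfolding g_def by (rule borel_measurable_lim_metric) auto
  \<comment> \<open>Fatou's lemma in the second index: a bound valid against all late members of the
    sequence passes to the limit \<open>g\<close>.\<close>
  have est: "sqn M (\<lambda>x. f n x - g x) \<le> ennreal (e\<^sup>2)"
    if "\<And>m. m \<ge> K \<Longrightarrow> nrm M (\<lambda>x. f n x - f m x) \<le> e" "0 \<le> e" for n e K
  proof -
    have "sqn M (\<lambda>x. f n x - g x) = (\<integral>\<^sup>+x. liminf (\<lambda>k. ennreal ((cmod (f n x - h k x))\<^sup>2)) \<partial>M)"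
      unfolding sqn_def
    proof (rule nn_integral_cong_AE)
      show "AE x in M. ennreal ((cmod (f n x - g x))\<^sup>2) = liminf (\<lambda>k. ennreal ((cmod (f n x - h k x))\<^sup>2))"
        using conv
      proof eventually_elim
        case (elim x)
        then have "(\<lambda>k. ennreal ((cmod (f n x - h k x))\<^sup>2)) \<longlonglongrightarrow> ennreal ((cmod (f n x - g x))\<^sup>2)"
          unfolding g_def by (intro tendsto_intros)
        then show ?case by (intro lim_imp_Liminf[symmetric]) auto
      qed
    qed
    also have "\<dots> \<le> liminf (\<lambda>k. sqn M (\<lambda>x. f n x - h k x))"
      unfolding sqn_def by (rule nn_integral_liminf) auto
    also have "\<dots> \<le> limsup (\<lambda>k. sqn M (\<lambda>x. f n x - h k x))"
      by (rule Liminf_le_Limsup) auto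
    also have "\<dots> \<le> ennreal (e\<^sup>2)"
    proof (rule Limsup_bounded)
      show "\<forall>\<^sub>F k in sequentially. sqn M (\<lambda>x. f n x - h k x) \<le> ennreal (e\<^sup>2)"
        using eventually_ge_at_top[of K]
      proof eventually_elim
        case (elim k)
        then have "nrm M (\<lambda>x. f n x - h k x) \<le> e"
          unfolding h_def using that(1)[of "r k"] rk[of k] by linarith
        then show ?case
          using that(2) by (auto simp: sqn_L2 L2_diff f hL intro!: ennreal_leI power_mono)
      qed
    qed
    finally show ?thesis .
  qed
  have m: "(\<lambda>x. f n x - g x) \<in> borel_measurable M" for n by measurable
  show ?thesis
  proof
    obtain n where n: "\<forall>m\<ge>n. \<forall>k\<ge>n. nrm M (\<lambda>x. f m x - f k x) \<le> 1" using cauchy[of 1] by auto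
    have "sqn M (\<lambda>x. f n x - g x) \<le> ennreal (1\<^sup>2)" using n by (intro est[of n]) auto
    then have "(\<lambda>x. f n x - g x) \<in> L2 M" by (intro sqn_le_imp(1)[OF m, of n 1]) auto
    then show "g \<in> L2 M" using L2_diff[OF f[of n], of "\<lambda>x. f n x - g x"] by simp
    show "(\<lambda>n. nrm M (\<lambda>x. f n x - g x)) \<longlonglongrightarrow> 0"
    proof (rule LIMSEQ_I)
      fix e :: real assume "0 < e"
      then obtain N where N: "\<forall>m\<ge>N. \<forall>k\<ge>N. nrm M (\<lambda>x. f m x - f k x) \<le> e/2"
        using cauchy[of "e/2"] by auto
      have "nrm M (\<lambda>x. f n x - g x) \<le> e/2" if "n \<ge> N" for n
        using N that \<open>0 < e\<close> by (intro sqn_le_imp(2)[OF m] est[of N]) auto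
      then show "\<exists>N. \<forall>n\<ge>N. norm (nrm M (\<lambda>x. f n x - g x) - 0) < e"
        using \<open>0 < e\<close> by (intro exI[of _ N]) fastforce
    qed
  qed
qed

text \<open>Riesz representation on the closure of the range of \<open>D\<close>, obtained by
  minimising \<open>nrm (D \<alpha>)^2 - 2 * Re (l \<alpha>)\<close>. An arbitrary linear
  \<open>D\<close> is allowed so that the lemma covers both \<open>A2w w\<close> with the identity
  and \<open>test\<close> with \<open>Dw\<close>. The minimising sequence is part of the conclusion:
  through it, closed conditions satisfied by every \<open>D \<alpha>\<close> pass to
  \<open>v\<close>.\<close>

lemma L2_Riesz:
  fixes T :: "('b \<Rightarrow> complex) set" and D :: "('b \<Rightarrow> complex) \<Rightarrow> 'a \<Rightarrow> complex" and l :: "('b \<Rightarrow> complex) \<Rightarrow> complex"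
  assumes T0: "T \<noteq> {}"
    and Tlin: "\<And>c \<alpha> \<beta>. \<alpha> \<in> T \<Longrightarrow> \<beta> \<in> T \<Longrightarrow> (\<lambda>x. c * \<alpha> x + \<beta> x) \<in> T"
    and DL: "\<And>\<alpha>. \<alpha> \<in> T \<Longrightarrow> D \<alpha> \<in> L2 M"
    and Dlin: "\<And>c \<alpha> \<beta>. \<alpha> \<in> T \<Longrightarrow> \<beta> \<in> T \<Longrightarrow> D (\<lambda>x. c * \<alpha> x + \<beta> x) = (\<lambda>x. c * D \<alpha> x + D \<beta> x)"
    and llin: "\<And>c \<alpha> \<beta>. \<alpha> \<in> T \<Longrightarrow> \<beta> \<in> T \<Longrightarrow> l (\<lambda>x. c * \<alpha> x + \<beta> x) = c * l \<alpha> + l \<beta>"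
    and lB: "\<And>\<alpha>. \<alpha> \<in> T \<Longrightarrow> cmod (l \<alpha>) \<le> B * nrm M (D \<alpha>)" and B: "0 \<le> B"
  obtains v s where "v \<in> L2 M" "\<And>n::nat. s n \<in> T" "(\<lambda>n. nrm M (\<lambda>x. D (s n) x - v x)) \<longlonglongrightarrow> 0"
    "\<And>\<alpha>. \<alpha> \<in> T \<Longrightarrow> ip M (D \<alpha>) v = l \<alpha>" "nrm M v \<le> B"
proof -
  define J where "J \<alpha> = (nrm M (D \<alpha>))\<^sup>2 - 2 * Re (l \<alpha>)" for \<alpha>
  have Jlow: "- B\<^sup>2 \<le> J \<alpha>" if "\<alpha> \<in> T" for \<alpha>
  proof -
    have "Re (l \<alpha>) \<le> B * nrm M (D \<alpha>)" using lB[OF that] complex_Re_le_cmod[of "l \<alpha>"] by linarith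
    then show ?thesis
      using zero_le_power2[of "nrm M (D \<alpha>) - B"] unfolding J_def power2_diff by (simp add: mult.commute)
  qed
  define m where "m = Inf (J ` T)"
  have bdd: "bdd_below (J ` T)" using Jlow by (intro bdd_belowI2)
  have mJ: "m \<le> J \<alpha>" if "\<alpha> \<in> T" for \<alpha>
    unfolding m_def using that by (intro cInf_lower bdd) auto
  have "\<exists>\<alpha>\<in>T. J \<alpha> < m + (1 / real (Suc n))" for n
  proof -
    have "Inf (J ` T) < m + (1 / real (Suc n))" unfolding m_def by simp
    then show ?thesis using cInf_lessD[of "J ` T"] T0 by auto
  qed
  then obtain s where sT: "\<And>n. s n \<in> T" and sJ: "\<And>n. J (s n) < m + 1 / real (Suc n)" by metis
  define \<epsilon> where "\<epsilon> n = sqrt (J (s n) - m)" for n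
  have e0: "\<epsilon> \<longlonglongrightarrow> 0"
  proof -
    have "(\<lambda>n. J (s n) - m) \<longlonglongrightarrow> 0"
    proof (rule tendsto_sandwich[of "\<lambda>_. 0" _ _ "\<lambda>n. 1 / real (Suc n)"])
      show "\<forall>\<^sub>F n in sequentially. J (s n) - m \<le> 1 / real (Suc n)"
        using sJ by (intro always_eventually allI) (simp add: less_imp_le algebra_simps)
      show "(\<lambda>n. 1 / real (Suc n)) \<longlonglongrightarrow> 0" by (rule LIMSEQ_inverse_real_of_nat[unfolded inverse_eq_divide])
    qed (use mJ sT in auto)
    then show ?thesis unfolding \<epsilon>_def using tendsto_real_sqrt by fastforce
  qed
  \<comment> \<open>Approximate Euler equation: perturbing \<open>s n\<close> by
    \<open>c * \<delta>\<close> cannot lower \<open>J\<close> by more than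
    \<open>J (s n) - m\<close>, and the discriminant inequality turns this into an error of size
    \<open>\<epsilon> n\<close>.\<close>
  have key: "cmod (ip M (D \<delta>) (D (s n)) - l \<delta>) \<le> nrm M (D \<delta>) * \<epsilon> n" if "\<delta> \<in> T" for \<delta> n
  proof -
    have "(cmod (ip M (D \<delta>) (D (s n)) - l \<delta>))\<^sup>2 \<le> (nrm M (D \<delta>))\<^sup>2 * (J (s n) - m)"
    proof (rule quadratic_nonneg_imp)
      fix c :: complex
      have "m \<le> J (\<lambda>x. c * \<delta> x + s n x)" by (intro mJ Tlin that sT)
      also have "\<dots> = (cmod c)\<^sup>2 * (nrm M (D \<delta>))\<^sup>2 + 2 * Re (c * (ip M (D \<delta>) (D (s n)) - l \<delta>)) + J (s n)"
        unfolding J_def Dlin[OF that sT] llin[OF that sT] nrm_lin_sq[OF DL[OF that] DL[OF sT]]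
        by (simp add: algebra_simps)
      finally show "0 \<le> (cmod c)\<^sup>2 * (nrm M (D \<delta>))\<^sup>2 + 2 * Re (c * (ip M (D \<delta>) (D (s n)) - l \<delta>)) + (J (s n) - m)"
        by simp
    qed simp
    also have "\<dots> = (nrm M (D \<delta>) * \<epsilon> n)\<^sup>2"
      using mJ[OF sT[of n]] by (simp add: \<epsilon>_def power_mult_distrib)
    finally show ?thesis
      by (rule power2_le_imp_le) (use mJ[OF sT[of n]] in \<open>simp add: \<epsilon>_def\<close>)
  qed
  \<comment> \<open>Both approximate equations are tested on \<open>\<delta> = s i - s j\<close>;
    one factor \<open>nrm M (D \<delta>)\<close> cancels, so the sequence is Cauchy.\<close>
  have diff: "nrm M (\<lambda>x. D (s i) x - D (s j) x) \<le> \<epsilon> i + \<epsilon> j" for i j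
  proof -
    define \<delta> where "\<delta> = (\<lambda>x. - 1 * s j x + s i x)"
    have dT: "\<delta> \<in> T" unfolding \<delta>_def by (intro Tlin sT)
    have D\<delta>: "D \<delta> = (\<lambda>x. D (s i) x - D (s j) x)"
      unfolding \<delta>_def by (subst Dlin) (use sT in auto)
    have "(nrm M (D \<delta>))\<^sup>2 = cmod (ip M (D \<delta>) (D \<delta>))" by (simp add: ip_self norm_power)
    also have "ip M (D \<delta>) (D \<delta>) = (ip M (D \<delta>) (D (s i)) - l \<delta>) - (ip M (D \<delta>) (D (s j)) - l \<delta>)"
      by (subst (2) D\<delta>, subst ip_diff_right) (use DL sT dT in auto)
    also have "cmod \<dots> \<le> cmod (ip M (D \<delta>) (D (s i)) - l \<delta>) + cmod (ip M (D \<delta>) (D (s j)) - l \<delta>)"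
      by (rule norm_triangle_ineq4)
    also have "\<dots> \<le> nrm M (D \<delta>) * \<epsilon> i + nrm M (D \<delta>) * \<epsilon> j"
      by (intro add_mono key dT)
    finally have "nrm M (D \<delta>) * nrm M (D \<delta>) \<le> nrm M (D \<delta>) * (\<epsilon> i + \<epsilon> j)"
      by (simp add: power2_eq_square algebra_simps)
    moreover have "0 \<le> \<epsilon> i + \<epsilon> j" using mJ[OF sT] by (simp add: \<epsilon>_def)
    ultimately have "nrm M (D \<delta>) \<le> \<epsilon> i + \<epsilon> j"
      using nrm_nonneg[of M "D \<delta>"] by (metis mult_left_le_imp_le less_eq_real_def)
    then show ?thesis by (simp add: D\<delta>)
  qed
  obtain v where vL: "v \<in> L2 M" and v: "(\<lambda>n. nrm M (\<lambda>x. D (s n) x - v x)) \<longlonglongrightarrow> 0"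
  proof (rule Riesz_Fischer[of "\<lambda>n. D (s n)" M])
    fix e :: real assume "0 < e"
    then obtain N where N: "\<And>n. n \<ge> N \<Longrightarrow> \<bar>\<epsilon> n\<bar> < e/2"
      using LIMSEQ_D[OF e0, of "e/2"] by auto
    have "nrm M (\<lambda>x. D (s i) x - D (s j) x) \<le> e" if "i \<ge> N" "j \<ge> N" for i j
      using diff[of i j] N[OF that(1)] N[OF that(2)] by linarith
    then show "\<exists>N. \<forall>m\<ge>N. \<forall>n\<ge>N. nrm M (\<lambda>x. D (s m) x - D (s n) x) \<le> e" by blast
  qed (use DL sT in auto)
  have lim: "(\<lambda>n. ip M g (D (s n))) \<longlonglongrightarrow> ip M g v" if "g \<in> L2 M" for g
  proof -
    have "(\<lambda>n. ip M g (D (s n)) - ip M g v) \<longlonglongrightarrow> 0"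
    proof (rule Lim_null_comparison)
      show "(\<lambda>n. nrm M g * nrm M (\<lambda>x. D (s n) x - v x)) \<longlonglongrightarrow> 0"
        using tendsto_mult_right_zero[OF v] .
      show "\<forall>\<^sub>F n in sequentially. norm (ip M g (D (s n)) - ip M g v) \<le> nrm M g * nrm M (\<lambda>x. D (s n) x - v x)"
        using L2_Cauchy_Schwarz[OF that L2_diff[OF DL[OF sT] vL]]
        by (intro always_eventually allI) (simp add: ip_diff_right that DL sT vL)
    qed
    then show ?thesis by (simp add: LIM_zero_iff)
  qed
  have rep: "ip M (D \<alpha>) v = l \<alpha>" if "\<alpha> \<in> T" for \<alpha>
  proof -
    have "(\<lambda>n. ip M (D \<alpha>) (D (s n)) - l \<alpha>) \<longlonglongrightarrow> 0"
    proof (rule Lim_null_comparison)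
      show "(\<lambda>n. nrm M (D \<alpha>) * \<epsilon> n) \<longlonglongrightarrow> 0" using tendsto_mult_right_zero[OF e0] .
    qed (use key that in auto)
    then have "(\<lambda>n. ip M (D \<alpha>) (D (s n))) \<longlonglongrightarrow> l \<alpha>" by (simp add: LIM_zero_iff)
    with lim[OF DL[OF that]] show ?thesis using LIMSEQ_unique by blast
  qed
  \<comment> \<open>The bound \<open>nrm M v \<le> B\<close> comes from pairing \<open>v\<close>
    with its own approximants, on which the pairing is given by \<open>l\<close>.\<close>
  have "(\<lambda>n. cmod (ip M v (D (s n)))) \<longlonglongrightarrow> (nrm M v)\<^sup>2"
    using tendsto_norm[OF lim[OF vL]] by (simp add: ip_self norm_power)
  moreover have "(\<lambda>n. B * (nrm M (\<lambda>x. D (s n) x - v x) + nrm M v)) \<longlonglongrightarrow> B * (0 + nrm M v)"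
    by (intro tendsto_intros v)
  moreover have "cmod (ip M v (D (s n))) \<le> B * (nrm M (\<lambda>x. D (s n) x - v x) + nrm M v)" for n
  proof -
    have "cmod (ip M v (D (s n))) = cmod (l (s n))"
      by (subst ip_cnj) (simp add: rep sT)
    also have "\<dots> \<le> B * nrm M (D (s n))" by (intro lB sT)
    also have "\<dots> \<le> B * (nrm M (\<lambda>x. D (s n) x - v x) + nrm M v)"
      using nrm_triangle[OF L2_diff[OF DL[OF sT[of n]] vL] vL] B by (intro mult_left_mono) auto
    finally show ?thesis .
  qed
  ultimately have "(nrm M v)\<^sup>2 \<le> B * (0 + nrm M v)"
    by (intro LIMSEQ_le) auto
  then have "nrm M v * nrm M v \<le> B * nrm M v" by (simp add: power2_eq_square)
  then have "nrm M v \<le> B"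
    using B nrm_nonneg[of M v] by (metis mult_right_le_imp_le less_eq_real_def)
  then show ?thesis using that[of v s] vL sT v rep by blast
qed

section \<open>Partial derivatives and test functions\<close>

text \<open>Only differentiability along the line in direction \<open>e\<close> is demanded. As a
  relation it carries an explicit derivative through products and chains, so that mixed derivatives
  can be compared as functions.\<close>

definition has_pd :: "complex \<Rightarrow> (complex \<Rightarrow> 'a::real_normed_vector) \<Rightarrow> (complex \<Rightarrow> 'a) \<Rightarrow> complex set \<Rightarrow> bool" where
  "has_pd e f g S \<longleftrightarrow> (\<forall>z\<in>S. ((\<lambda>t::real. f (z + of_real t * e)) has_vector_derivative g z) (at 0))"

definition pdv :: "complex \<Rightarrow> (complex \<Rightarrow> complex) \<Rightarrow> complex \<Rightarrow> complex" where
  "pdv e f z = vector_derivative (\<lambda>t. f (z + of_real t * e)) (at 0)"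

definition dz :: "(complex \<Rightarrow> complex) \<Rightarrow> complex \<Rightarrow> complex" where
  "dz f z = (pdv 1 f z - \<i> * pdv \<i> f z) / 2"

definition dzb :: "(complex \<Rightarrow> complex) \<Rightarrow> complex \<Rightarrow> complex" where
  "dzb f z = (pdv 1 f z + \<i> * pdv \<i> f z) / 2"

lemma has_pd_pdv: "has_pd e f g S \<Longrightarrow> z \<in> S \<Longrightarrow> pdv e f z = g z"
  unfolding has_pd_def pdv_def by (auto intro: vector_derivative_at)

lemma has_pd_subset: "has_pd e f g S \<Longrightarrow> S' \<subseteq> S \<Longrightarrow> has_pd e f g S'"
  unfolding has_pd_def by auto

lemma has_pd_const: "has_pd e (\<lambda>z. c) (\<lambda>z. 0) S"
  unfolding has_pd_def by auto

lemma has_pd_add: "has_pd e f f' S \<Longrightarrow> has_pd e g g' S \<Longrightarrow> has_pd e (\<lambda>z. f z + g z) (\<lambda>z. f' z + g' z) S"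
  unfolding has_pd_def by (auto intro!: has_vector_derivative_add)

lemma has_pd_diff: "has_pd e f f' S \<Longrightarrow> has_pd e g g' S \<Longrightarrow> has_pd e (\<lambda>z. f z - g z) (\<lambda>z. f' z - g' z) S"
  unfolding has_pd_def by (auto intro!: has_vector_derivative_diff)

lemma has_pd_mult:
  fixes f g :: "complex \<Rightarrow> 'a::real_normed_algebra"
  shows "has_pd e f f' S \<Longrightarrow> has_pd e g g' S \<Longrightarrow> has_pd e (\<lambda>z. f z * g z) (\<lambda>z. f z * g' z + f' z * g z) S"
  unfolding has_pd_def
  by (auto dest!: bspec intro!: has_vector_derivative_eq_rhs[OF has_vector_derivative_mult])

lemma has_pd_cmult:
  fixes f :: "complex \<Rightarrow> 'a::real_normed_algebra"
  shows "has_pd e f f' S \<Longrightarrow> has_pd e (\<lambda>z. c * f z) (\<lambda>z. c * f' z) S"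
  using has_pd_mult[OF has_pd_const[of e c S], of f f'] by simp

lemma has_pd_linear:
  "bounded_linear L \<Longrightarrow> has_pd e f f' S \<Longrightarrow> has_pd e (\<lambda>z. L (f z)) (\<lambda>z. L (f' z)) S"
  unfolding has_pd_def by (auto intro: bounded_linear.has_vector_derivative)

lemmas has_pd_of_real = has_pd_linear[OF bounded_linear_of_real]
  and has_pd_cnj = has_pd_linear[OF bounded_linear_cnj]
  and has_pd_Re = has_pd_linear[OF bounded_linear_Re]
  and has_pd_Im = has_pd_linear[OF bounded_linear_Im]

lemma has_pd_chain:
  fixes f f' :: "complex \<Rightarrow> real"
  assumes "has_pd e f f' S" "\<And>z. z \<in> S \<Longrightarrow> (F has_real_derivative F' (f z)) (at (f z))"
  shows "has_pd e (\<lambda>z. F (f z)) (\<lambda>z. F' (f z) * f' z) S"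
  unfolding has_pd_def
proof
  fix z assume z: "z \<in> S"
  have "((\<lambda>t::real. f (z + of_real t * e)) has_real_derivative f' z) (at 0)"
    using assms(1) z by (simp add: has_pd_def has_real_derivative_iff_has_vector_derivative)
  moreover have "(F has_real_derivative F' (f z)) (at (f (z + of_real 0 * e)))"
    using assms(2)[OF z] by simp
  ultimately have "(F \<circ> (\<lambda>t::real. f (z + of_real t * e)) has_real_derivative F' (f z) * f' z) (at 0)"
    by (intro DERIV_chain)
  then show "((\<lambda>t. F (f (z + of_real t * e))) has_vector_derivative F' (f z) * f' z) (at 0)"
    by (simp add: has_real_derivative_iff_has_vector_derivative o_def)
qed

lemma has_pd_cong:
  assumes "has_pd e f f' S" "\<And>z. f z = g z" "\<And>z. z \<in> S \<Longrightarrow> f' z = g' z"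
  shows "has_pd e g g' S"
proof -
  have "f = g" using assms(2) by auto
  then show ?thesis using assms(1,3) by (simp add: has_pd_def)
qed

lemma has_pd_ident: "has_pd e (\<lambda>z. z) (\<lambda>z. e) S"
proof -
  have "((\<lambda>t. z + of_real t * e) has_vector_derivative e) (at 0)" for z
    by (auto intro!: derivative_eq_intros simp: has_vector_derivative_def scaleR_conv_of_real)
  then show ?thesis by (simp add: has_pd_def)
qed

lemma has_pd_holomorphic:
  assumes "f holomorphic_on S" "open S"
  shows "has_pd e f (\<lambda>z. e * deriv f z) S"
  unfolding has_pd_def
proof
  fix z assume z: "z \<in> S"
  have "(f has_field_derivative deriv f z) (at (z + of_real 0 * e))"
    using holomorphic_derivI[OF assms z] by simp
  then have "(f \<circ> (\<lambda>t. z + of_real t * e) has_vector_derivative e * deriv f z) (at 0)"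
    by (rule field_vector_diff_chain_at[rotated])
       (auto intro!: derivative_eq_intros simp: has_vector_derivative_def scaleR_conv_of_real)
  then show "((\<lambda>t. f (z + of_real t * e)) has_vector_derivative e * deriv f z) (at 0)"
    by (simp add: o_def)
qed

section \<open>Extension by zero and integration by parts\<close>

lemma has_vector_derivative_quotient:
  fixes f :: "real \<Rightarrow> 'a::real_normed_vector"
  assumes "((\<lambda>t. f t) has_vector_derivative D) (at 0)"
  shows "((\<lambda>h. (f h - f 0) /\<^sub>R h) \<longlongrightarrow> D) (at 0)"
proof -
  have "((\<lambda>h. norm (f (0 + h) - f 0 - h *\<^sub>R D) / norm h) \<longlongrightarrow> 0) (at 0)"
    using assms by (simp add: has_vector_derivative_def has_derivative_at)
  moreover have "\<forall>\<^sub>F h in at 0. norm (f (0 + h) - f 0 - h *\<^sub>R D) / norm h = norm ((f h - f 0) /\<^sub>R h - D)"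
  proof (rule eventually_at_filter[THEN iffD2, OF always_eventually], intro allI impI)
    fix h :: real assume h: "h \<noteq> 0"
    have "(f h - f 0) /\<^sub>R h - D = (f h - f 0 - h *\<^sub>R D) /\<^sub>R h" using h by (simp add: scaleR_diff_right)
    then show "norm (f (0 + h) - f 0 - h *\<^sub>R D) / norm h = norm ((f h - f 0) /\<^sub>R h - D)"
      by (simp add: divide_inverse mult.commute)
  qed
  ultimately have "((\<lambda>h. norm ((f h - f 0) /\<^sub>R h - D)) \<longlongrightarrow> 0) (at 0)"
    by (simp cong: tendsto_cong)
  then show ?thesis using tendsto_norm_zero_iff LIM_zero_cancel by blast
qed

lemma has_pd_zero:
  assumes "open U" "\<And>z. z \<in> U \<Longrightarrow> f z = 0"
  shows "has_pd e f (\<lambda>z. 0) U"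
  unfolding has_pd_def
proof
  fix z assume z: "z \<in> U"
  have "isCont (\<lambda>t::real. z + of_real t * e) 0" by (intro continuous_intros)
  then have "((\<lambda>t::real. z + of_real t * e) \<longlongrightarrow> z) (at 0)" by (simp add: isCont_def)
  then have "\<forall>\<^sub>F t in at (0::real). z + of_real t * e \<in> U"
    using z assms(1) by (intro topological_tendstoD) auto
  then have ev: "\<forall>\<^sub>F t in at (0::real). 0 = f (z + of_real t * e)"
    by eventually_elim (use assms(2) in auto)
  have "((\<lambda>t::real. 0) has_vector_derivative 0) (at 0)" by simp
  then show "((\<lambda>t. f (z + of_real t * e)) has_vector_derivative 0) (at 0)"
    unfolding has_vector_derivative_def
    by (rule has_derivative_transform_eventually)
       (use ev z assms(2) in auto)
qed

lemma has_pd_Un: "has_pd e f g U \<Longrightarrow> has_pd e f g V \<Longrightarrow> has_pd e f g (U \<union> V)"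
  by (auto simp: has_pd_def)

text \<open>The open sets \<open>U\<close> and the complement of \<open>S\<close> cover the plane,
  so nothing has to be known about \<open>f\<close> near the boundary of \<open>U\<close>. This is
  how products of a test function with a function living only on \<open>disc\<close> become
  global.\<close>

lemma has_pd_extend:
  assumes "has_pd e f g U" "closed S" "S \<subseteq> U" "\<And>z. z \<notin> S \<Longrightarrow> f z = 0" "\<And>z. z \<notin> S \<Longrightarrow> g z = 0"
  shows "has_pd e f g UNIV"
proof -
  have "has_pd e f (\<lambda>z. 0) (- S)" by (rule has_pd_zero) (use assms in auto)
  then have "has_pd e f g (- S)" using assms(5) by (auto simp: has_pd_def)
  from has_pd_Un[OF this assms(1)] show ?thesis using assms(3) by (auto intro: has_pd_subset)
qed

lemma has_pd_zero_outside:
  assumes "has_pd e f g UNIV" "closed S" "\<And>z. z \<notin> S \<Longrightarrow> f z = 0" "z \<notin> S"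
  shows "g z = 0"
proof -
  have "has_pd e f (\<lambda>z. 0) (- S)" by (rule has_pd_zero) (use assms in auto)
  then show ?thesis using assms(1,4) unfolding has_pd_def
    by (auto intro: vector_derivative_unique_at)
qed

lemma integrable_continuous_compact_support:
  fixes f :: "complex \<Rightarrow> 'a::{banach, second_countable_topology}"
  assumes "continuous_on UNIV f" "compact S" "\<And>z. z \<notin> S \<Longrightarrow> f z = 0"
  shows "integrable lborel f" "integrable lebesgue f"
proof -
  have "integrable lborel (\<lambda>x. indicator S x *\<^sub>R f x)"
    using assms by (intro borel_integrable_compact) (auto intro: continuous_on_subset)
  also have "(\<lambda>x. indicator S x *\<^sub>R f x) = f"
    using assms(3) by (auto simp: indicator_def fun_eq_iff)
  finally show "integrable lborel f" .
  then show "integrable lebesgue f" by (simp add: integrable_completion)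
qed

text \<open>Translation invariance makes every difference quotient of \<open>P\<close> have integral
  zero; dominated convergence passes to \<open>Q\<close>.\<close>

lemma integral_has_pd_eq_0:
  fixes P Q :: "complex \<Rightarrow> 'a::euclidean_space"
  assumes P: "continuous_on UNIV P" and Q: "continuous_on UNIV Q" and S: "compact S"
    and z: "\<And>z. z \<notin> S \<Longrightarrow> P z = 0" and pd: "has_pd e P Q UNIV"
  shows "integral\<^sup>L lebesgue Q = 0"
proof -
  have Qz: "Q z = 0" if "z \<notin> S" for z
    by (rule has_pd_zero_outside[OF pd compact_imp_closed[OF S]]) (use z that in auto)
  obtain B where B: "\<And>z. z \<in> S \<Longrightarrow> norm (Q z) \<le> B" "B > 0"
  proof -
    have "bounded (Q ` S)"
      by (intro compact_imp_bounded compact_continuous_image S continuous_on_subset[OF Q]) auto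
    then show ?thesis using that by (auto simp: bounded_pos)
  qed
  have B': "norm (Q z) \<le> B" for z using B Qz by (cases "z \<in> S") auto
  \<comment> \<open>Supplies the domination: difference quotients along \<open>e\<close> are bounded
    by the bound \<open>B\<close> of \<open>Q\<close>.\<close>
  have lip: "norm (P (z + of_real h * e) - P z) \<le> B * \<bar>h\<bar>" for z h
  proof -
    have d: "((\<lambda>t. P (z + of_real t * e)) has_vector_derivative Q (z + of_real t * e)) (at t)" for t
    proof -
      have "((\<lambda>u. P ((z + of_real t * e) + of_real u * e)) has_vector_derivative Q (z + of_real t * e)) (at (t - t))"
        using pd by (simp add: has_pd_def)
      then have "(((\<lambda>u. P ((z + of_real t * e) + of_real u * e)) \<circ> (\<lambda>u. u - t)) has_vector_derivative 1 *\<^sub>R Q (z + of_real t * e)) (at t)"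
        by (intro vector_diff_chain_at) (auto intro!: derivative_eq_intros)
      then show ?thesis by (simp add: o_def algebra_simps)
    qed
    have "norm (P (z + of_real h * e) - P (z + of_real 0 * e)) \<le> B * norm (h - 0)"
    proof (rule differentiable_bound[where S = UNIV])
      show "((\<lambda>t. P (z + of_real t * e)) has_derivative (\<lambda>x. x *\<^sub>R Q (z + of_real t * e))) (at t within UNIV)" for t
        using d[of t] by (simp add: has_vector_derivative_def)
      show "onorm (\<lambda>x. x *\<^sub>R Q (z + of_real t * e)) \<le> B" for t
        by (rule onorm_bound) (use B(2) B' in \<open>auto simp: mult.commute[of B] intro!: mult_left_mono\<close>)
    qed auto
    then show ?thesis by simp
  qed
  obtain R where R: "S \<subseteq> cball 0 R"
    using compact_imp_bounded[OF S] unfolding bounded_iff subset_iff mem_cball_0 by blast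
  define s where "s n z = (P (z + of_real (inverse (real (Suc n))) * e) - P z) /\<^sub>R inverse (real (Suc n))" for n z
  have Pm [measurable]: "P \<in> borel_measurable borel" by (rule borel_measurable_continuous_onI[OF P])
  have Qm [measurable]: "Q \<in> borel_measurable borel" by (rule borel_measurable_continuous_onI[OF Q])
  have int0: "integral\<^sup>L lborel (s n) = 0" for n
  proof -
    let ?c = "of_real (inverse (real (Suc n))) * e"
    have i: "integrable lborel P" by (rule integrable_continuous_compact_support[OF P S z])
    have e: "integral\<^sup>L lborel (\<lambda>z. P (z + ?c)) = integral\<^sup>L lborel P"
    proof -
      have "integral\<^sup>L (distr lborel borel ((+) ?c)) P = integral\<^sup>L lborel (\<lambda>z. P (?c + z))"
        by (rule integral_distr) auto
      then show ?thesis by (simp only: lborel_distr_plus add.commute[of ?c])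
    qed
    have i2: "integrable lborel (\<lambda>z. P (z + ?c))"
    proof -
      have "integrable (distr lborel borel ((+) ?c)) P" using i by (simp only: lborel_distr_plus)
      then have "integrable lborel (\<lambda>z. P (?c + z))" by (subst (asm) integrable_distr_eq) auto
      then show ?thesis by (simp only: add.commute[of ?c])
    qed
    show ?thesis unfolding s_def using i i2 e by simp
  qed
  have "(\<lambda>n. integral\<^sup>L lborel (s n)) \<longlonglongrightarrow> integral\<^sup>L lborel Q"
  proof (rule integral_dominated_convergence[where w = "\<lambda>z. B * indicator (cball 0 (R + norm e)) z"])
    \<comment> \<open>The disc is enlarged by \<open>norm e\<close> because the step lengths are at
      most 1, so all translated supports lie in it.\<close>
    show "integrable lborel (\<lambda>z::complex. B * indicator (cball 0 (R + norm e)) z)"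
      by (intro integrable_mult_right integrable_real_indicator) (use emeasure_bounded_finite[of "cball (0::complex) (R + norm e)"] in auto)
    show "AE z in lborel. (\<lambda>n. s n z) \<longlonglongrightarrow> Q z"
    proof (rule AE_I2)
      fix z
      have "((\<lambda>t. P (z + of_real t * e)) has_vector_derivative Q z) (at 0)" using pd by (simp add: has_pd_def)
      then have "((\<lambda>h. (P (z + of_real h * e) - P z) /\<^sub>R h) \<longlongrightarrow> Q z) (at 0)"
        using has_vector_derivative_quotient[of "\<lambda>t. P (z + of_real t * e)"] by simp
      then show "(\<lambda>n. s n z) \<longlonglongrightarrow> Q z"
        unfolding s_def
        by (rule filterlim_compose) (use LIMSEQ_inverse_real_of_nat in \<open>auto simp: filterlim_at\<close>)
    qed
    show "AE z in lborel. norm (s n z) \<le> B * indicator (cball 0 (R + norm e)) z" for n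
    proof (rule AE_I2)
      fix z :: complex
      let ?h = "inverse (real (Suc n))"
      show "norm (s n z) \<le> B * indicator (cball 0 (R + norm e)) z"
      proof (cases "z \<in> cball 0 (R + norm e)")
        case True
        have "norm (s n z) \<le> (B * \<bar>?h\<bar>) / ?h"
        proof -
          have "norm (s n z) = norm (P (z + of_real ?h * e) - P z) / ?h"
            unfolding s_def norm_scaleR by (simp only: divide_inverse abs_inverse abs_of_nat mult.commute)
          also have "\<dots> \<le> (B * \<bar>?h\<bar>) / ?h" by (intro divide_right_mono lip) simp
          finally show ?thesis .
        qed
        then show ?thesis using True by simp
      next
        case False
        then have zn: "norm z > R + norm e" by simp
        have "norm (of_real ?h * e) = ?h * norm e" unfolding norm_mult norm_of_real by simp
        also have "\<dots> \<le> 1 * norm e" by (intro mult_right_mono) (auto simp: field_simps)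
        finally have "norm (of_real ?h * e) \<le> norm e" by simp
        then have "norm (z + of_real ?h * e) > R" using zn norm_triangle_ineq4[of "z + of_real ?h * e" "of_real ?h * e"] by simp
        moreover have Rs: "norm x \<le> R" if "x \<in> S" for x using R that by (auto simp: subset_iff)
        ultimately have "z + of_real ?h * e \<notin> S" by fastforce
        moreover have "z \<notin> S" using Rs[of z] zn norm_ge_zero[of e] by linarith
        ultimately have "z + of_real ?h * e \<notin> S" "z \<notin> S" by auto

        then show ?thesis using False z by (simp add: s_def)
      qed
    qed
    show "s n \<in> borel_measurable lborel" for n unfolding s_def[abs_def] by measurable
  qed auto
  then have "integral\<^sup>L lborel Q = 0" using int0 LIMSEQ_unique by (simp add: LIMSEQ_const_iff)
  then show ?thesis by (simp add: integral_completion)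
qed

text \<open>The mixed second derivative \<open>pq\<close> is shared by \<open>p\<close> and \<open>q\<close>, so that
Schwarz's theorem is not needed.\<close>

definition test :: "(complex \<Rightarrow> complex) set" where
  "test = {\<xi>. (\<exists>S. compact S \<and> S \<subseteq> disc \<and> (\<forall>z. z \<notin> S \<longrightarrow> \<xi> z = 0)) \<and>
     (\<exists>p q pp pq qq. continuous_on UNIV \<xi> \<and> continuous_on UNIV p \<and> continuous_on UNIV q \<and>
        continuous_on UNIV pp \<and> continuous_on UNIV pq \<and> continuous_on UNIV qq \<and>
        has_pd 1 \<xi> p UNIV \<and> has_pd \<i> \<xi> q UNIV \<and> has_pd 1 p pp UNIV \<and> has_pd \<i> p pq UNIV \<and>
        has_pd 1 q pq UNIV \<and> has_pd \<i> q qq UNIV)}"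

lemma testI:
  assumes "compact S" "S \<subseteq> disc" "\<And>z. z \<notin> S \<Longrightarrow> \<xi> z = 0"
    "has_pd 1 \<xi> p UNIV" "has_pd \<i> \<xi> q UNIV" "has_pd 1 p pp UNIV" "has_pd \<i> p pq UNIV"
    "has_pd 1 q pq UNIV" "has_pd \<i> q qq UNIV"
    "continuous_on UNIV \<xi>" "continuous_on UNIV p" "continuous_on UNIV q"
    "continuous_on UNIV pp" "continuous_on UNIV pq" "continuous_on UNIV qq"
  shows "\<xi> \<in> test"
  unfolding test_def mem_Collect_eq
proof (rule conjI)
  show "\<exists>S. compact S \<and> S \<subseteq> disc \<and> (\<forall>z. z \<notin> S \<longrightarrow> \<xi> z = 0)"
    using assms(1-3) by blast
  show "\<exists>p q pp pq qq. continuous_on UNIV \<xi> \<and> continuous_on UNIV p \<and> continuous_on UNIV q \<and>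
        continuous_on UNIV pp \<and> continuous_on UNIV pq \<and> continuous_on UNIV qq \<and>
        has_pd 1 \<xi> p UNIV \<and> has_pd \<i> \<xi> q UNIV \<and> has_pd 1 p pp UNIV \<and> has_pd \<i> p pq UNIV \<and>
        has_pd 1 q pq UNIV \<and> has_pd \<i> q qq UNIV"
    by (rule exI[of _ p], rule exI[of _ q], rule exI[of _ pp], rule exI[of _ pq], rule exI[of _ qq])
       (intro conjI assms)
qed

lemma pdv_eq: "has_pd e \<xi> p UNIV \<Longrightarrow> pdv e \<xi> = p"
  by (rule ext) (simp add: has_pd_pdv)

definition test_data :: "(complex \<Rightarrow> complex) \<Rightarrow> complex set \<Rightarrow> (complex \<Rightarrow> complex) \<Rightarrow> (complex \<Rightarrow> complex) \<Rightarrow> (complex \<Rightarrow> complex) \<Rightarrow> bool" where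
  "test_data \<xi> S pp pq qq \<longleftrightarrow> compact S \<and> S \<subseteq> disc \<and> (\<forall>z. z \<notin> S \<longrightarrow> \<xi> z = 0) \<and>
    (\<forall>z. z \<notin> S \<longrightarrow> pdv 1 \<xi> z = 0) \<and> (\<forall>z. z \<notin> S \<longrightarrow> pdv \<i> \<xi> z = 0) \<and>
    continuous_on UNIV \<xi> \<and> continuous_on UNIV (pdv 1 \<xi>) \<and> continuous_on UNIV (pdv \<i> \<xi>) \<and>
    continuous_on UNIV pp \<and> continuous_on UNIV pq \<and> continuous_on UNIV qq \<and>
    has_pd 1 \<xi> (pdv 1 \<xi>) UNIV \<and> has_pd \<i> \<xi> (pdv \<i> \<xi>) UNIV \<and>
    has_pd 1 (pdv 1 \<xi>) pp UNIV \<and> has_pd \<i> (pdv 1 \<xi>) pq UNIV \<and>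
    has_pd 1 (pdv \<i> \<xi>) pq UNIV \<and> has_pd \<i> (pdv \<i> \<xi>) qq UNIV"

lemma test_dataD:
  assumes "test_data \<xi> S pp pq qq"
  shows "compact S" "S \<subseteq> disc" "\<And>z. z \<notin> S \<Longrightarrow> \<xi> z = 0"
    "\<And>z. z \<notin> S \<Longrightarrow> pdv 1 \<xi> z = 0" "\<And>z. z \<notin> S \<Longrightarrow> pdv \<i> \<xi> z = 0"
    "continuous_on UNIV \<xi>" "continuous_on UNIV (pdv 1 \<xi>)" "continuous_on UNIV (pdv \<i> \<xi>)"
    "continuous_on UNIV pp" "continuous_on UNIV pq" "continuous_on UNIV qq"
    "has_pd 1 \<xi> (pdv 1 \<xi>) UNIV" "has_pd \<i> \<xi> (pdv \<i> \<xi>) UNIV"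
    "has_pd 1 (pdv 1 \<xi>) pp UNIV" "has_pd \<i> (pdv 1 \<xi>) pq UNIV"
    "has_pd 1 (pdv \<i> \<xi>) pq UNIV" "has_pd \<i> (pdv \<i> \<xi>) qq UNIV"
  using assms unfolding test_data_def by auto

lemma testE:
  assumes "\<xi> \<in> test"
  obtains S pp pq qq where "test_data \<xi> S pp pq qq"
proof -
  from assms obtain S p q pp pq qq where *: "compact S" "S \<subseteq> disc" "\<And>z. z \<notin> S \<Longrightarrow> \<xi> z = 0"
    "continuous_on UNIV \<xi>" "continuous_on UNIV p" "continuous_on UNIV q"
    "continuous_on UNIV pp" "continuous_on UNIV pq" "continuous_on UNIV qq"
    "has_pd 1 \<xi> p UNIV" "has_pd \<i> \<xi> q UNIV"
    "has_pd 1 p pp UNIV" "has_pd \<i> p pq UNIV"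
    "has_pd 1 q pq UNIV" "has_pd \<i> q qq UNIV" unfolding test_def by auto
  have e: "pdv 1 \<xi> = p" "pdv \<i> \<xi> = q" using *(10,11) by (auto intro: pdv_eq)
  have "p z = 0" "q z = 0" if "z \<notin> S" for z
    using has_pd_zero_outside[OF *(10) compact_imp_closed[OF *(1)] *(3) that]
      has_pd_zero_outside[OF *(11) compact_imp_closed[OF *(1)] *(3) that] by auto
  with * e show ?thesis using that[of S pp pq qq] by (auto simp: test_data_def)
qed

lemma test_zero: "(\<lambda>z. 0) \<in> test"
  by (rule testI[of "{}" _ "\<lambda>z. 0" "\<lambda>z. 0" "\<lambda>z. 0" "\<lambda>z. 0" "\<lambda>z. 0"]) (auto simp: has_pd_const)

lemma test_lin:
  assumes "\<alpha> \<in> test" "\<beta> \<in> test"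
  shows "(\<lambda>z. c * \<alpha> z + \<beta> z) \<in> test"
    and "dz (\<lambda>z. c * \<alpha> z + \<beta> z) = (\<lambda>z. c * dz \<alpha> z + dz \<beta> z)"
proof -
  obtain S pp pq qq where "test_data \<alpha> S pp pq qq"
    using testE[OF assms(1)] .
  note a = test_dataD[OF this]
  obtain S' pp' pq' qq' where "test_data \<beta> S' pp' pq' qq'"
    using testE[OF assms(2)] .
  note b = test_dataD[OF this]
  let ?L = "\<lambda>f g z. c * f z + g z :: complex"
  have L: "has_pd e f f' UNIV \<Longrightarrow> has_pd e g g' UNIV \<Longrightarrow> has_pd e (?L f g) (?L f' g') UNIV" for e f f' g g'
    by (intro has_pd_add has_pd_cmult)
  have C: "continuous_on UNIV f \<Longrightarrow> continuous_on UNIV g \<Longrightarrow> continuous_on UNIV (?L f g)" for f g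
    by (intro continuous_intros)
  show "(\<lambda>z. c * \<alpha> z + \<beta> z) \<in> test"
  proof (rule testI[of "S \<union> S'"])
    show "has_pd 1 (?L \<alpha> \<beta>) (?L (pdv 1 \<alpha>) (pdv 1 \<beta>)) UNIV" "has_pd \<i> (?L \<alpha> \<beta>) (?L (pdv \<i> \<alpha>) (pdv \<i> \<beta>)) UNIV"
      "has_pd 1 (?L (pdv 1 \<alpha>) (pdv 1 \<beta>)) (?L pp pp') UNIV" "has_pd \<i> (?L (pdv 1 \<alpha>) (pdv 1 \<beta>)) (?L pq pq') UNIV"
      "has_pd 1 (?L (pdv \<i> \<alpha>) (pdv \<i> \<beta>)) (?L pq pq') UNIV" "has_pd \<i> (?L (pdv \<i> \<alpha>) (pdv \<i> \<beta>)) (?L qq qq') UNIV"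
      by (intro L a b)+
  qed (use a b in \<open>auto intro!: C\<close>)
  have "pdv 1 (?L \<alpha> \<beta>) = ?L (pdv 1 \<alpha>) (pdv 1 \<beta>)" "pdv \<i> (?L \<alpha> \<beta>) = ?L (pdv \<i> \<alpha>) (pdv \<i> \<beta>)"
    by (intro pdv_eq L a b)+
  then show "dz (\<lambda>z. c * \<alpha> z + \<beta> z) = (\<lambda>z. c * dz \<alpha> z + dz \<beta> z)"
    by (auto simp: dz_def fun_eq_iff field_simps)
qed

lemma continuous_on_extend_zero:
  fixes f :: "complex \<Rightarrow> 'a::real_normed_vector"
  assumes "continuous_on U f" "open U" "closed S" "S \<subseteq> U" "\<And>z. z \<notin> S \<Longrightarrow> f z = 0"
  shows "continuous_on UNIV f"
proof -
  have "continuous_on (- S) f"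
    using continuous_on_cong[of "- S" "- S" f "\<lambda>_. 0"] assms(5) by auto
  then have "continuous_on (U \<union> - S) f"
    using assms by (intro continuous_on_open_Un) auto
  then show ?thesis using assms(4) by (metis UNIV_eq_I UnCI UnI1 ComplI subsetD)
qed

lemma open_disc [simp]: "open disc"
  by (simp add: disc_def)

text \<open>\<open>(Fx + \<i> * Fy) / 2\<close> is the \<open>\<partial>\<close>-bar derivative of
  \<open>F\<close>. In each direction \<open>F * \<xi>\<close> extends by zero to the plane and its
  derivative integrates to zero, so \<open>F\<close> may be arbitrary near the unit circle.\<close>

lemma test_by_parts:
  assumes "\<xi> \<in> test" and F: "has_pd 1 F Fx disc" "has_pd \<i> F Fy disc"
    and c: "continuous_on disc F" "continuous_on disc Fx" "continuous_on disc Fy"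
  shows "(LINT z|lebesgue. F z * dzb \<xi> z) = - (LINT z|lebesgue. (Fx z + \<i> * Fy z) / 2 * \<xi> z)"
proof -
  obtain S pp pq qq where "test_data \<xi> S pp pq qq"
    using testE[OF assms(1)] .
  note a = test_dataD[OF this]
  note cs = compact_imp_closed[OF a(1)]
  have ci: "continuous_on UNIV (\<lambda>z. G z * h z)" if "continuous_on disc G" "continuous_on UNIV h" "\<And>z. z \<notin> S \<Longrightarrow> h z = 0"
    for G h :: "complex \<Rightarrow> complex"
    by (rule continuous_on_extend_zero[OF _ _ cs a(2)])
       (use that in \<open>auto intro!: continuous_intros intro: continuous_on_subset\<close>)
  have ii: "integrable lebesgue (\<lambda>z. G z * h z)" if "continuous_on disc G" "continuous_on UNIV h" "\<And>z. z \<notin> S \<Longrightarrow> h z = 0"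
    for G h :: "complex \<Rightarrow> complex"
    by (rule integrable_continuous_compact_support(2)[OF ci[OF that] a(1)]) (use that in auto)
  have *: "(LINT z|lebesgue. F z * pdv e \<xi> z) + (LINT z|lebesgue. Fe z * \<xi> z) = 0"
    if e: "has_pd e \<xi> (pdv e \<xi>) UNIV" "continuous_on UNIV (pdv e \<xi>)" "has_pd e F Fe disc" "continuous_on disc Fe"
      "\<And>z. z \<notin> S \<Longrightarrow> pdv e \<xi> z = 0" for e Fe
  proof -
    have "(LINT z|lebesgue. F z * pdv e \<xi> z + Fe z * \<xi> z) = 0"
    proof (rule integral_has_pd_eq_0[where P = "\<lambda>z. F z * \<xi> z" and S = S])
      show "has_pd e (\<lambda>z. F z * \<xi> z) (\<lambda>z. F z * pdv e \<xi> z + Fe z * \<xi> z) UNIV"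
      proof (rule has_pd_extend[OF _ cs a(2)])
        show "has_pd e (\<lambda>z. F z * \<xi> z) (\<lambda>z. F z * pdv e \<xi> z + Fe z * \<xi> z) disc"
          by (intro has_pd_mult e has_pd_subset[OF e(1)]) auto
      qed (use a e in auto)
    qed (use a e c in \<open>auto intro!: continuous_on_add ci\<close>)
    then show ?thesis by (subst (asm) Bochner_Integration.integral_add) (use ii a e c in auto)
  qed
  have "(LINT z|lebesgue. F z * dzb \<xi> z) = (LINT z|lebesgue. (F z * pdv 1 \<xi> z + \<i> * (F z * pdv \<i> \<xi> z)) / 2)"
    by (simp add: dzb_def algebra_simps)
  also have "\<dots> = ((LINT z|lebesgue. F z * pdv 1 \<xi> z) + \<i> * (LINT z|lebesgue. F z * pdv \<i> \<xi> z)) / 2"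
    using ii[OF c(1) a(7,4)] ii[OF c(1) a(8,5)] by simp
  also have "\<dots> = - ((LINT z|lebesgue. Fx z * \<xi> z) + \<i> * (LINT z|lebesgue. Fy z * \<xi> z)) / 2"
    using *[OF a(12,7) F(1) c(2) a(4)] *[OF a(13,8) F(2) c(3) a(5)]
    by (simp only: eq_neg_iff_add_eq_0[symmetric]) (simp add: field_simps)
  also have "\<dots> = - (LINT z|lebesgue. (Fx z * \<xi> z + \<i> * (Fy z * \<xi> z)) / 2)"
    using ii[OF c(2) a(6,3)] ii[OF c(3) a(6,3)] by (simp add: add_divide_distrib diff_divide_distrib)
  finally show ?thesis by (simp add: algebra_simps)
qed

lemma holomorphic_test_0:
  assumes "f holomorphic_on disc" "\<xi> \<in> test"
  shows "(LINT z|lebesgue. f z * dzb \<xi> z) = 0"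
proof -
  have d: "continuous_on disc (deriv f)"
    by (intro holomorphic_on_imp_continuous_on holomorphic_deriv assms open_disc)
  have "(LINT z|lebesgue. f z * dzb \<xi> z) = - (LINT z|lebesgue. (1 * deriv f z + \<i> * (\<i> * deriv f z)) / 2 * \<xi> z)"
    by (intro test_by_parts assms has_pd_holomorphic open_disc holomorphic_on_imp_continuous_on continuous_intros d)
  then show ?thesis by (simp add: mult.assoc[symmetric])
qed

text \<open>Powers of \<open>max 0 (s - \<bar>\<zeta> - z\<bar>\<^sup>2)\<close> are used as cut-offs because both their derivative in
\<open>s\<close> and their \<open>\<partial>\<close>-derivative in \<open>\<zeta>\<close> are multiples of the next lower power.\<close>

definition bump :: "nat \<Rightarrow> real \<Rightarrow> complex \<Rightarrow> complex \<Rightarrow> real" where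
  "bump n s z \<zeta> = (max 0 (s - (cmod (\<zeta> - z))\<^sup>2)) ^ n"

lemma bump_nonneg [simp]: "0 \<le> bump n s z \<zeta>"
  by (simp add: bump_def)

lemma bump_continuous [continuous_intros]: "continuous_on A (bump n s z)"
  unfolding bump_def by (intro continuous_intros)

lemma bump_zero: "n > 0 \<Longrightarrow> s \<le> (cmod (\<zeta> - z))\<^sup>2 \<Longrightarrow> bump n s z \<zeta> = 0"
  by (simp add: bump_def)

lemma bump_pd_base:
  "has_pd 1 (\<lambda>\<zeta>. s - (cmod (\<zeta> - z))\<^sup>2) (\<lambda>\<zeta>. - 2 * Re (\<zeta> - z)) UNIV"
  "has_pd \<i> (\<lambda>\<zeta>. s - (cmod (\<zeta> - z))\<^sup>2) (\<lambda>\<zeta>. - 2 * Im (\<zeta> - z)) UNIV"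
proof -
  have R: "has_pd e (\<lambda>\<zeta>. Re (\<zeta> - z)) (\<lambda>\<zeta>. Re (e - 0)) UNIV" and I: "has_pd e (\<lambda>\<zeta>. Im (\<zeta> - z)) (\<lambda>\<zeta>. Im (e - 0)) UNIV" for e
    by (intro has_pd_Re has_pd_Im has_pd_diff has_pd_ident has_pd_const)+
  have *: "has_pd e (\<lambda>\<zeta>. s - (Re (\<zeta> - z) * Re (\<zeta> - z) + Im (\<zeta> - z) * Im (\<zeta> - z)))
      (\<lambda>\<zeta>. 0 - ((Re (\<zeta> - z) * Re (e - 0) + Re (e - 0) * Re (\<zeta> - z)) + (Im (\<zeta> - z) * Im (e - 0) + Im (e - 0) * Im (\<zeta> - z)))) UNIV" for e
    by (intro has_pd_diff has_pd_add has_pd_mult R I has_pd_const)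
  show "has_pd 1 (\<lambda>\<zeta>. s - (cmod (\<zeta> - z))\<^sup>2) (\<lambda>\<zeta>. - 2 * Re (\<zeta> - z)) UNIV"
    by (rule has_pd_cong[OF *]) (simp_all only: cmod_power2, simp_all add: power2_eq_square)
  show "has_pd \<i> (\<lambda>\<zeta>. s - (cmod (\<zeta> - z))\<^sup>2) (\<lambda>\<zeta>. - 2 * Im (\<zeta> - z)) UNIV"
    by (rule has_pd_cong[OF *]) (simp_all only: cmod_power2, simp_all add: power2_eq_square)
qed

lemma max_power_deriv:
  "((\<lambda>x::real. max 0 x ^ Suc (Suc n)) has_real_derivative real (Suc (Suc n)) * max 0 x ^ Suc n) (at x)"
proof -
  consider "x > 0" | "x < 0" | "x = 0" by linarith
  then show ?thesis
  proof cases
    case 1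
    have "((\<lambda>x::real. x ^ Suc (Suc n)) has_real_derivative real (Suc (Suc n)) * x ^ Suc n) (at x)"
      by (rule derivative_eq_intros refl)+ simp
    then have "((\<lambda>x::real. max 0 x ^ Suc (Suc n)) has_real_derivative real (Suc (Suc n)) * x ^ Suc n) (at x)"
      by (rule has_field_derivative_transform_within_open[where S = "{0<..}"]) (use 1 in auto)
    then show ?thesis using 1 by simp
  next
    case 2
    have "((\<lambda>x::real. 0) has_real_derivative 0) (at x)" by simp
    then have "((\<lambda>x::real. max 0 x ^ Suc (Suc n)) has_real_derivative 0) (at x)"
      by (rule has_field_derivative_transform_within_open[where S = "{..<0}"]) (use 2 in auto)
    then show ?thesis using 2 by simp
  next
    case 3
    have "((\<lambda>h. (max 0 (0 + h) ^ Suc (Suc n) - max 0 0 ^ Suc (Suc n)) / h) \<longlongrightarrow> 0) (at (0::real))"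
    proof (rule Lim_null_comparison)
      show "\<forall>\<^sub>F h in at (0::real). norm ((max 0 (0 + h) ^ Suc (Suc n) - max 0 0 ^ Suc (Suc n)) / h) \<le> \<bar>h\<bar> ^ Suc n"
      proof (intro always_eventually allI)
        fix h :: real
        show "norm ((max 0 (0 + h) ^ Suc (Suc n) - max 0 0 ^ Suc (Suc n)) / h) \<le> \<bar>h\<bar> ^ Suc n"
        proof (cases "h > 0")
          case False
          then have "norm ((max 0 (0 + h) ^ Suc (Suc n) - max 0 0 ^ Suc (Suc n)) / h) = 0" by simp
          also have "0 \<le> \<bar>h\<bar> ^ Suc n" by (intro zero_le_power abs_ge_zero)
          finally show ?thesis .
        qed (auto simp: abs_mult max_def)
      qed
      have "((\<lambda>h. \<bar>h\<bar> ^ Suc n) \<longlongrightarrow> \<bar>0\<bar> ^ Suc n) (at (0::real))" by (intro tendsto_intros)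
      then show "((\<lambda>h. \<bar>h\<bar> ^ Suc n) \<longlongrightarrow> 0) (at (0::real))" by simp
    qed
    then show ?thesis using 3 by (simp add: DERIV_def)
  qed
qed

lemma bump_pd:
  "has_pd 1 (bump (Suc (Suc n)) s z) (\<lambda>\<zeta>. (real (Suc (Suc n)) * bump (Suc n) s z \<zeta>) * (- 2 * Re (\<zeta> - z))) UNIV"
  "has_pd \<i> (bump (Suc (Suc n)) s z) (\<lambda>\<zeta>. (real (Suc (Suc n)) * bump (Suc n) s z \<zeta>) * (- 2 * Im (\<zeta> - z))) UNIV"
  unfolding bump_def
  by (rule has_pd_chain[where F = "\<lambda>x. max 0 x ^ Suc (Suc n)" and F' = "\<lambda>x. real (Suc (Suc n)) * max 0 x ^ Suc n"],
      rule bump_pd_base, rule max_power_deriv)+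

text \<open>The cube is the smallest power of the truncated function that is twice continuously
  differentiable. The hypotheses make \<open>A\<close> affine; the cases used are \<open>1\<close>
  and \<open>cnj (\<zeta> - z)\<close>.\<close>

lemma bump_test:
  assumes s: "0 < s" "sqrt s < 1 - cmod z"
    and A: "has_pd 1 A (\<lambda>_. a) UNIV" "has_pd \<i> A (\<lambda>_. c) UNIV" "continuous_on UNIV A"
  shows "(\<lambda>\<zeta>. A \<zeta> * of_real (bump 3 s z \<zeta>)) \<in> test"
    and "dzb (\<lambda>\<zeta>. A \<zeta> * of_real (bump 3 s z \<zeta>)) = (\<lambda>\<zeta>. (a + \<i> * c) / 2 * of_real (bump 3 s z \<zeta>) - 3 * A \<zeta> * of_real (bump 2 s z \<zeta>) * (\<zeta> - z))"
proof -
  let ?X = "\<lambda>\<zeta>. - 2 * Re (\<zeta> - z)" and ?Y = "\<lambda>\<zeta>. - 2 * Im (\<zeta> - z)"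
  define k where "k n \<zeta> = complex_of_real (bump n s z \<zeta>)" for n \<zeta>
  define X Y where "X \<zeta> = complex_of_real (?X \<zeta>)" and "Y \<zeta> = complex_of_real (?Y \<zeta>)" for \<zeta>
  have k: "has_pd 1 (k 3) (\<lambda>\<zeta>. 3 * k 2 \<zeta> * X \<zeta>) UNIV" "has_pd \<i> (k 3) (\<lambda>\<zeta>. 3 * k 2 \<zeta> * Y \<zeta>) UNIV"
    "has_pd 1 (k 2) (\<lambda>\<zeta>. 2 * k 1 \<zeta> * X \<zeta>) UNIV" "has_pd \<i> (k 2) (\<lambda>\<zeta>. 2 * k 1 \<zeta> * Y \<zeta>) UNIV"
    using has_pd_of_real[OF bump_pd(1)[of 1 s z], where 'a = complex] has_pd_of_real[OF bump_pd(2)[of 1 s z], where 'a = complex]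
      has_pd_of_real[OF bump_pd(1)[of 0 s z], where 'a = complex] has_pd_of_real[OF bump_pd(2)[of 0 s z], where 'a = complex]
    unfolding k_def X_def Y_def by (simp_all add: numeral_2_eq_2 numeral_3_eq_3)
  have X: "has_pd 1 X (\<lambda>_. -2) UNIV" "has_pd \<i> X (\<lambda>_. 0) UNIV" "has_pd 1 Y (\<lambda>_. 0) UNIV" "has_pd \<i> Y (\<lambda>_. -2) UNIV"
  proof -
    have R: "has_pd e X (\<lambda>\<zeta>. complex_of_real (- 2 * Re (e - 0))) UNIV"
      and I: "has_pd e Y (\<lambda>\<zeta>. complex_of_real (- 2 * Im (e - 0))) UNIV" for e
      unfolding X_def Y_def by (intro has_pd_of_real has_pd_cmult has_pd_Re has_pd_Im has_pd_diff has_pd_ident has_pd_const)+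
    show "has_pd 1 X (\<lambda>_. -2) UNIV" "has_pd \<i> X (\<lambda>_. 0) UNIV" "has_pd 1 Y (\<lambda>_. 0) UNIV" "has_pd \<i> Y (\<lambda>_. -2) UNIV"
      using R[of 1] R[of \<i>] I[of 1] I[of \<i>] by simp_all
  qed
  have cc: "continuous_on UNIV (k n)" "continuous_on UNIV X" "continuous_on UNIV Y" for n
    unfolding k_def X_def Y_def by (intro continuous_intros)+
  let ?\<xi> = "\<lambda>\<zeta>. A \<zeta> * k 3 \<zeta>"
  let ?p = "\<lambda>\<zeta>. a * k 3 \<zeta> + 3 * (A \<zeta> * (k 2 \<zeta> * X \<zeta>))"
  let ?q = "\<lambda>\<zeta>. c * k 3 \<zeta> + 3 * (A \<zeta> * (k 2 \<zeta> * Y \<zeta>))"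
  let ?pp = "\<lambda>\<zeta>. a * (3 * k 2 \<zeta> * X \<zeta>) + 3 * (A \<zeta> * (k 2 \<zeta> * (-2) + 2 * k 1 \<zeta> * X \<zeta> * X \<zeta>) + a * (k 2 \<zeta> * X \<zeta>))"
  let ?pq = "\<lambda>\<zeta>. a * (3 * k 2 \<zeta> * Y \<zeta>) + 3 * (A \<zeta> * (k 2 \<zeta> * 0 + 2 * k 1 \<zeta> * Y \<zeta> * X \<zeta>) + c * (k 2 \<zeta> * X \<zeta>))"
  let ?qp = "\<lambda>\<zeta>. c * (3 * k 2 \<zeta> * X \<zeta>) + 3 * (A \<zeta> * (k 2 \<zeta> * 0 + 2 * k 1 \<zeta> * X \<zeta> * Y \<zeta>) + a * (k 2 \<zeta> * Y \<zeta>))"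
  let ?qq = "\<lambda>\<zeta>. c * (3 * k 2 \<zeta> * Y \<zeta>) + 3 * (A \<zeta> * (k 2 \<zeta> * (-2) + 2 * k 1 \<zeta> * Y \<zeta> * Y \<zeta>) + c * (k 2 \<zeta> * Y \<zeta>))"
  have p: "has_pd 1 ?\<xi> ?p UNIV"
    by (rule has_pd_cong[OF has_pd_mult[OF A(1) k(1)]]) (auto simp: algebra_simps)
  have q: "has_pd \<i> ?\<xi> ?q UNIV"
    by (rule has_pd_cong[OF has_pd_mult[OF A(2) k(2)]]) (auto simp: algebra_simps)
  have pp: "has_pd 1 ?p ?pp UNIV" by (intro has_pd_add has_pd_cmult has_pd_mult A X k)
  have pq: "has_pd \<i> ?p ?pq UNIV" by (intro has_pd_add has_pd_cmult has_pd_mult A X k)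
  have qp: "has_pd 1 ?q ?qp UNIV" by (intro has_pd_add has_pd_cmult has_pd_mult A X k)
  have qq: "has_pd \<i> ?q ?qq UNIV" by (intro has_pd_add has_pd_cmult has_pd_mult A X k)
  \<comment> \<open>\<open>test\<close> asks for one common function as both mixed
    derivatives.\<close>
  have e: "?qp = ?pq" by (auto simp: algebra_simps)
  have "?\<xi> \<in> test"
  proof (rule testI[OF _ _ _ p q pp pq qp[unfolded e] qq])
    show "compact (cball z (sqrt s))" by simp
    show "cball z (sqrt s) \<subseteq> disc"
    proof
      fix x assume "x \<in> cball z (sqrt s)"
      then have "cmod (x - z) \<le> sqrt s" by (simp add: dist_norm norm_minus_commute)
      then have "cmod x < 1" using s norm_triangle_ineq2[of x z] by linarith
      then show "x \<in> disc" by (simp add: disc_def)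
    qed
    show "?\<xi> x = 0" if "x \<notin> cball z (sqrt s)" for x
    proof -
      from that have "sqrt s \<le> cmod (x - z)" by (simp add: dist_norm norm_minus_commute)
      then have "s \<le> (cmod (x - z))\<^sup>2" by (rule sqrt_le_D)
      then show "?\<xi> x = 0" by (simp add: k_def bump_zero)
    qed
  qed (intro continuous_intros cc A)+
  then show "(\<lambda>\<zeta>. A \<zeta> * of_real (bump 3 s z \<zeta>)) \<in> test" by (simp add: k_def)
  have "dzb ?\<xi> = (\<lambda>\<zeta>. (a + \<i> * c) / 2 * k 3 \<zeta> - 3 * A \<zeta> * k 2 \<zeta> * (\<zeta> - z))"
  proof
    fix \<zeta>
    have "X \<zeta> + \<i> * Y \<zeta> = - 2 * (\<zeta> - z)" by (auto simp: X_def Y_def complex_eq_iff)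
    then have XY: "X \<zeta> = - 2 * (\<zeta> - z) - \<i> * Y \<zeta>" by (simp add: eq_diff_eq)
    have "dzb ?\<xi> \<zeta> = (?p \<zeta> + \<i> * ?q \<zeta>) / 2"
      unfolding dzb_def pdv_eq[OF p] pdv_eq[OF q] ..
    also have "\<dots> = (a + \<i> * c) / 2 * k 3 \<zeta> - 3 * A \<zeta> * k 2 \<zeta> * (\<zeta> - z)"
      unfolding XY by (simp add: field_simps)
    finally show "dzb ?\<xi> \<zeta> = (a + \<i> * c) / 2 * k 3 \<zeta> - 3 * A \<zeta> * k 2 \<zeta> * (\<zeta> - z)" .
  qed
  then show "dzb (\<lambda>\<zeta>. A \<zeta> * of_real (bump 3 s z \<zeta>)) = (\<lambda>\<zeta>. (a + \<i> * c) / 2 * of_real (bump 3 s z \<zeta>) - 3 * A \<zeta> * of_real (bump 2 s z \<zeta>) * (\<zeta> - z))"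
    by (simp add: k_def)
qed

section \<open>Weyl's lemma\<close>

definition locint :: "(complex \<Rightarrow> complex) \<Rightarrow> bool" where
  "locint f \<longleftrightarrow> (\<forall>S. compact S \<and> S \<subseteq> disc \<longrightarrow> integrable lebesgue (\<lambda>z. indicator S z *\<^sub>R f z))"

definition wkhol :: "(complex \<Rightarrow> complex) \<Rightarrow> bool" where
  "wkhol f \<longleftrightarrow> locint f \<and> (\<forall>\<xi>\<in>test. (LINT z|lebesgue. f z * dzb \<xi> z) = 0)"

text \<open>Unnormalised average of \<open>f\<close> against a radial cut-off. For locally
  integrable \<open>f\<close> and \<open>n > 0\<close> it is meaningful as long as
  \<open>sqrt s < 1 - cmod z\<close>.\<close>

definition Bi :: "nat \<Rightarrow> (complex \<Rightarrow> complex) \<Rightarrow> real \<Rightarrow> complex \<Rightarrow> complex" where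
  "Bi n f s z = (LINT \<zeta>|lebesgue. f \<zeta> * of_real (bump n s z \<zeta>))"

lemma integrable_mult_bounded_continuous:
  fixes g h :: "complex \<Rightarrow> complex"
  assumes "integrable lebesgue g" "continuous_on UNIV h" "\<And>x. g x \<noteq> 0 \<Longrightarrow> cmod (h x) \<le> B"
  shows "integrable lebesgue (\<lambda>x. g x * h x)"
proof (rule Bochner_Integration.integrable_bound)
  have "h \<in> borel_measurable lebesgue"
    using borel_measurable_continuous_onI[OF assms(2)] by (intro measurable_completion) simp
  then show "(\<lambda>x. g x * h x) \<in> borel_measurable lebesgue" using assms(1) by measurable
  show "integrable lebesgue (\<lambda>x. B * cmod (g x))" using assms(1) by auto
  show "AE x in lebesgue. norm (g x * h x) \<le> norm (B * cmod (g x))"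
  proof (rule AE_I2)
    fix x show "norm (g x * h x) \<le> norm (B * cmod (g x))"
      using assms(3)[of x]
      by (cases "g x = 0") (auto simp: norm_mult mult.commute intro!: mult_left_mono order_trans[OF _ abs_ge_self])
  qed
qed

lemma cball_subset_disc: "r < 1 - cmod z \<Longrightarrow> cball z r \<subseteq> disc"
  unfolding disc_def by (auto simp: dist_norm norm_minus_commute) (smt (verit) norm_minus_commute norm_triangle_sub)

lemma integrable_locint_mult:
  assumes "locint f" "compact S" "S \<subseteq> disc" "continuous_on UNIV h" "\<And>x. x \<notin> S \<Longrightarrow> h x = 0"
  shows "integrable lebesgue (\<lambda>x. f x * h x)"
proof -
  have "bounded (h ` S)"
    by (intro compact_imp_bounded compact_continuous_image assms continuous_on_subset[OF assms(4)]) auto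
  then obtain B where B: "\<And>x. x \<in> S \<Longrightarrow> cmod (h x) \<le> B" by (auto simp: bounded_iff)
  have "integrable lebesgue (\<lambda>x. (indicator S x *\<^sub>R f x) * h x)"
  proof (rule integrable_mult_bounded_continuous)
    show "integrable lebesgue (\<lambda>x. indicator S x *\<^sub>R f x)" using assms by (auto simp: locint_def)
    show "cmod (h x) \<le> B" if "indicator S x *\<^sub>R f x \<noteq> 0" for x
      using that B by (auto simp: indicator_def split: if_splits)
  qed fact
  also have "(\<lambda>x. (indicator S x *\<^sub>R f x) * h x) = (\<lambda>x. f x * h x)"
    using assms(5) by (auto simp: indicator_def fun_eq_iff)
  finally show ?thesis .
qed

lemma bump_outside: "n > 0 \<Longrightarrow> \<zeta> \<notin> cball z (sqrt s) \<Longrightarrow> bump n s z \<zeta> = 0"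
  by (intro bump_zero) (auto simp: dist_norm norm_minus_commute intro: sqrt_le_D)

lemma locint_bump_integrable:
  assumes "locint f" "n > 0" "sqrt s < 1 - cmod z" "continuous_on UNIV h"
  shows "integrable lebesgue (\<lambda>\<zeta>. f \<zeta> * (h \<zeta> * of_real (bump n s z \<zeta>)))"
  by (rule integrable_locint_mult[OF assms(1) compact_cball[of z "sqrt s"] cball_subset_disc[OF assms(3)]])
     (use assms bump_outside[of n _ z s] in \<open>auto intro!: continuous_intros\<close>)

lemma locint_bump_integrable':
  assumes "locint f" "n > 0" "sqrt s < 1 - cmod z"
  shows "integrable lebesgue (\<lambda>\<zeta>. f \<zeta> * of_real (bump n s z \<zeta>))"
  using locint_bump_integrable[OF assms, of "\<lambda>_. 1"] by simp

lemma locint_continuous: "continuous_on disc f \<Longrightarrow> locint f"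
  unfolding locint_def
proof (intro allI impI)
  fix S assume "continuous_on disc f" "compact S \<and> S \<subseteq> disc"
  then have "integrable lborel (\<lambda>x. indicator S x *\<^sub>R f x)"
    by (intro borel_integrable_compact) (auto intro: continuous_on_subset)
  then show "integrable lebesgue (\<lambda>x. indicator S x *\<^sub>R f x)" by (simp add: integrable_completion)
qed

lemma wkhol_holomorphic: "f holomorphic_on disc \<Longrightarrow> wkhol f"
  by (simp add: wkhol_def locint_continuous holomorphic_on_imp_continuous_on holomorphic_test_0)

lemma integrable_test_mult:
  assumes "locint f" "\<xi> \<in> test"
  shows "integrable lebesgue (\<lambda>x. f x * dzb \<xi> x)" "integrable lebesgue (\<lambda>x. f x * \<xi> x)"
    "integrable lebesgue (\<lambda>x. f x * dz \<xi> x)" "integrable lebesgue (\<lambda>x. f x * cnj (dz \<xi> x))" "integrable lebesgue (\<lambda>x. f x * cnj (\<xi> x))"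
proof -
  obtain S pp pq qq where "test_data \<xi> S pp pq qq"
    using testE[OF assms(2)] .
  note a = test_dataD[OF this]
  show "integrable lebesgue (\<lambda>x. f x * dzb \<xi> x)" "integrable lebesgue (\<lambda>x. f x * \<xi> x)"
    "integrable lebesgue (\<lambda>x. f x * dz \<xi> x)" "integrable lebesgue (\<lambda>x. f x * cnj (dz \<xi> x))" "integrable lebesgue (\<lambda>x. f x * cnj (\<xi> x))"
    by (intro integrable_locint_mult[OF assms(1) a(1,2)];
        use a(3-8) in \<open>auto simp: dzb_def dz_def intro!: continuous_intros\<close>)+
qed

lemma wkhol_diff:
  assumes "wkhol f" "wkhol g" shows "wkhol (\<lambda>z. f z - g z)"
proof -
  have l: "locint (\<lambda>z. f z - g z)"
    using assms by (auto simp: wkhol_def locint_def scaleR_diff_right)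
  have "(LINT z|lebesgue. (f z - g z) * dzb \<xi> z) = 0" if "\<xi> \<in> test" for \<xi>
    using integrable_test_mult(1)[of f \<xi>] integrable_test_mult(1)[of g \<xi>] assms that
    by (simp add: wkhol_def left_diff_distrib)
  with l show ?thesis by (simp add: wkhol_def)
qed

text \<open>A quadratic remainder that is uniform across the break at 0. It justifies
  differentiation under the integral sign: integrated against \<open>f\<close> it is still of order
  \<open>h^2\<close>.\<close>

lemma cube_taylor:
  fixes s h :: real
  shows "\<bar>(max 0 (s + h))^3 - (max 0 s)^3 - 3 * h * (max 0 s)\<^sup>2\<bar> \<le> 3 * (\<bar>s\<bar> + \<bar>h\<bar>) * h\<^sup>2"
proof -
  consider "s \<ge> 0" "s + h \<ge> 0" | "s < 0" "s + h \<ge> 0" | "s < 0" "s + h < 0" | "s \<ge> 0" "s + h < 0" by linarith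
  then show ?thesis
  proof cases
    case 1
    have "(max 0 (s + h))^3 - (max 0 s)^3 - 3 * h * (max 0 s)\<^sup>2 = (3 * s + h) * h\<^sup>2"
      using 1 by (simp add: power2_eq_square power3_eq_cube algebra_simps)
    then have "\<bar>(max 0 (s + h))^3 - (max 0 s)^3 - 3 * h * (max 0 s)\<^sup>2\<bar> = \<bar>3 * s + h\<bar> * h\<^sup>2"
      by (simp add: abs_mult)
    also have "\<dots> \<le> 3 * (\<bar>s\<bar> + \<bar>h\<bar>) * h\<^sup>2" by (intro mult_right_mono) auto
    finally show ?thesis .
  next
    case 2
    have "\<bar>(max 0 (s + h))^3 - (max 0 s)^3 - 3 * h * (max 0 s)\<^sup>2\<bar> = (s + h) * (s + h)\<^sup>2"
      using 2 by (simp add: power3_eq_cube power2_eq_square)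
    also have "\<dots> \<le> (3 * (\<bar>s\<bar> + \<bar>h\<bar>)) * h\<^sup>2"
      using 2 by (intro mult_mono power_mono) auto
    finally show ?thesis .
  next
    case 3 then show ?thesis by simp
  next
    case 4
    have "(max 0 (s + h))^3 - (max 0 s)^3 - 3 * h * (max 0 s)\<^sup>2 = - (s + 3 * h) * s\<^sup>2"
      using 4 by (simp add: power2_eq_square power3_eq_cube algebra_simps)
    then have "\<bar>(max 0 (s + h))^3 - (max 0 s)^3 - 3 * h * (max 0 s)\<^sup>2\<bar> = \<bar>s + 3 * h\<bar> * s\<^sup>2"
      by (simp add: abs_mult) (metis abs_minus_cancel add_uminus_conv_diff minus_diff_eq minus_add_distrib)
    also have "\<dots> \<le> (3 * (\<bar>s\<bar> + \<bar>h\<bar>)) * h\<^sup>2"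
      using 4 by (intro mult_mono) (auto simp: abs_le_square_iff[symmetric])
    finally show ?thesis .
  qed
qed

lemma has_derivative_quadratic_remainder:
  fixes f :: "'a::real_normed_vector \<Rightarrow> 'b::real_normed_vector"
  assumes "bounded_linear L" "0 < \<delta>"
    and b: "\<And>h. norm h < \<delta> \<Longrightarrow> norm (f (x + h) - f x - L h) \<le> C * (norm h)\<^sup>2"
  shows "(f has_derivative L) (at x)"
  unfolding has_derivative_at
proof
  show "(\<lambda>h. norm (f (x + h) - f x - L h) / norm h) \<midarrow>0\<rightarrow> 0"
  proof (rule Lim_null_comparison)
    show "\<forall>\<^sub>F h in at 0. norm (norm (f (x + h) - f x - L h) / norm h) \<le> C * norm h"
      unfolding eventually_at
    proof (intro exI[of _ \<delta>] conjI ballI impI)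
      fix h :: 'a assume h: "h \<noteq> 0 \<and> dist h 0 < \<delta>"
      then have "norm (f (x + h) - f x - L h) / norm h \<le> (C * (norm h)\<^sup>2) / norm h"
        by (intro divide_right_mono b) auto
      then show "norm (norm (f (x + h) - f x - L h) / norm h) \<le> C * norm h"
        using h by (simp add: power2_eq_square)
    qed fact
    have "((\<lambda>h::'a. norm h) \<longlongrightarrow> norm (0::'a)) (at 0)" by (rule tendsto_norm) (rule tendsto_ident_at)
    then show "(\<lambda>h::'a. C * norm h) \<midarrow>0\<rightarrow> (0::real)" by (intro tendsto_mult_right_zero) simp
  qed
qed fact

lemma norm_integral_remainder:
  fixes g :: "complex \<Rightarrow> complex"
  assumes g: "integrable lebesgue g" and r: "\<And>\<zeta>. g \<zeta> \<noteq> 0 \<Longrightarrow> cmod (R \<zeta>) \<le> e" "continuous_on UNIV R"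
  shows "cmod (LINT \<zeta>|lebesgue. g \<zeta> * R \<zeta>) \<le> e * (LINT \<zeta>|lebesgue. cmod (g \<zeta>))"
proof -
  have i: "integrable lebesgue (\<lambda>\<zeta>. g \<zeta> * R \<zeta>)"
    by (rule integrable_mult_bounded_continuous[OF g r(2,1)])
  have "cmod (LINT \<zeta>|lebesgue. g \<zeta> * R \<zeta>) \<le> (LINT \<zeta>|lebesgue. cmod (g \<zeta> * R \<zeta>))"
    by (rule integral_norm_bound)
  also have "\<dots> \<le> (LINT \<zeta>|lebesgue. e * cmod (g \<zeta>))"
  proof (rule integral_mono)
    show "integrable lebesgue (\<lambda>\<zeta>. e * cmod (g \<zeta>))" using g by auto
    show "integrable lebesgue (\<lambda>\<zeta>. cmod (g \<zeta> * R \<zeta>))" using i by auto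
    show "cmod (g \<zeta> * R \<zeta>) \<le> e * cmod (g \<zeta>)" for \<zeta>
      using r(1)[of \<zeta>] by (cases "g \<zeta> = 0") (auto simp: norm_mult mult.commute intro!: mult_left_mono)
  qed
  finally show ?thesis by simp
qed

section \<open>Dependence of the averages on scale and centre\<close>

lemma sqrt_room:
  assumes "0 < s" "sqrt s < 1 - cmod z"
  obtains r where "sqrt s < r" "r < 1 - cmod z" "0 < r" "s < r\<^sup>2" "r \<le> 1" "r\<^sup>2 \<le> 1" "s \<le> 1"
proof -
  obtain r where r: "sqrt s < r" "r < 1 - cmod z" using dense[OF assms(2)] by auto
  have r0: "0 < r" using r(1) assms(1) real_sqrt_ge_zero[of s] by linarith
  have r1: "r \<le> 1" using r norm_ge_zero[of z] by linarith
  have s: "s < r\<^sup>2" using r(1) r0 assms(1) by (metis less_eq_real_def real_sqrt_less_iff real_sqrt_unique)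
  have "r\<^sup>2 \<le> 1" using r1 r0 by (simp add: power_le_one)
  then show ?thesis using that[of r] r r0 r1 s by auto
qed

lemma Bi_restrict:
  assumes "n > 0" "\<And>\<zeta>. \<zeta> \<notin> S \<Longrightarrow> bump n s z \<zeta> = 0"
  shows "Bi n f s z = (LINT \<zeta>|lebesgue. (indicator S \<zeta> *\<^sub>R f \<zeta>) * of_real (bump n s z \<zeta>))"
  unfolding Bi_def by (rule Bochner_Integration.integral_cong) (use assms in \<open>auto simp: indicator_def\<close>)

text \<open>\<open>f\<close> is only locally integrable, so it is first cut to a disc of radius
  \<open>r\<close> slightly above \<open>sqrt s\<close>, which contains the supports for all nearby
  scales. The factor 6 in the remainder is \<open>3 * (1 + 1)\<close> from
  \<open>cube_taylor\<close>.\<close>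

lemma Bi_deriv_s:
  assumes f: "locint f" and s: "0 < s" "sqrt s < 1 - cmod z"
  shows "((\<lambda>s. Bi 3 f s z) has_vector_derivative 3 * Bi 2 f s z) (at s)"
proof -
  obtain r where r: "sqrt s < r" "r < 1 - cmod z" "0 < r" "s < r\<^sup>2" "r \<le> 1" "r\<^sup>2 \<le> 1" "s \<le> 1"
    by (rule sqrt_room[OF s])
  define g where "g \<zeta> = indicator (cball z r) \<zeta> *\<^sub>R f \<zeta>" for \<zeta>
  have g: "integrable lebesgue g"
    using f cball_subset_disc[OF r(2)] compact_cball by (auto simp: locint_def g_def[abs_def])
  have out: "bump n s' z \<zeta> = 0" if "\<zeta> \<notin> cball z r" "s' \<le> r\<^sup>2" "n > 0" for s' \<zeta> n
  proof -
    have "r < cmod (\<zeta> - z)" using that by (simp add: dist_norm norm_minus_commute)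
    then have "r\<^sup>2 \<le> (cmod (\<zeta> - z))\<^sup>2" using r by (intro power_mono) auto
    then show ?thesis using that by (intro bump_zero) auto
  qed
  have Bg: "Bi n f s' z = (LINT \<zeta>|lebesgue. g \<zeta> * of_real (bump n s' z \<zeta>))" if "s' \<le> r\<^sup>2" "n > 0" for s' n
    unfolding g_def by (rule Bi_restrict) (use that out in auto)
  have ib: "integrable lebesgue (\<lambda>\<zeta>. g \<zeta> * of_real (bump n s' z \<zeta>))" for n s'
  proof (rule integrable_mult_bounded_continuous[OF g])
    show "cmod (complex_of_real (bump n s' z x)) \<le> (max 0 s') ^ n" for x
      unfolding norm_of_real by (simp add: bump_def) (intro power_mono, smt (verit) zero_le_power2, simp)
  qed (intro continuous_intros)
  have "((\<lambda>s. Bi 3 f s z) has_derivative (\<lambda>h. h *\<^sub>R (3 * Bi 2 f s z))) (at s)"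
  proof (rule has_derivative_quadratic_remainder[where C = "6 * (LINT \<zeta>|lebesgue. cmod (g \<zeta>))"])
    show "0 < min 1 (r\<^sup>2 - s)" using r by auto
    fix h :: real assume "norm h < min 1 (r\<^sup>2 - s)"
    then have h: "\<bar>h\<bar> \<le> 1" "s + h \<le> r\<^sup>2" by auto
    let ?R = "\<lambda>\<zeta>. complex_of_real (bump 3 (s+h) z \<zeta> - bump 3 s z \<zeta> - 3 * h * bump 2 s z \<zeta>)"
    have "Bi 3 f (s + h) z - Bi 3 f s z - h *\<^sub>R (3 * Bi 2 f s z) = (LINT \<zeta>|lebesgue. g \<zeta> * ?R \<zeta>)"
    proof -
      have "g \<zeta> * ?R \<zeta> = g \<zeta> * of_real (bump 3 (s+h) z \<zeta>) - g \<zeta> * of_real (bump 3 s z \<zeta>) - 3 * h * (g \<zeta> * of_real (bump 2 s z \<zeta>))" for \<zeta>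
        by (simp add: algebra_simps)
      then show ?thesis
        using ib[of 3 "s+h"] ib[of 3 s] ib[of 2 s] r h by (simp add: Bg scaleR_conv_of_real)
    qed
    also have "cmod \<dots> \<le> (6 * h\<^sup>2) * (LINT \<zeta>|lebesgue. cmod (g \<zeta>))"
    proof (rule norm_integral_remainder[OF g])
      fix \<zeta> assume "g \<zeta> \<noteq> 0"
      then have "cmod (\<zeta> - z) \<le> r" by (auto simp: g_def indicator_def dist_norm norm_minus_commute split: if_splits)
      then have "(cmod (\<zeta> - z))\<^sup>2 \<le> 1" using r by (metis order_trans norm_ge_zero power_mono)
      then have \<sigma>: "\<bar>s - (cmod (\<zeta> - z))\<^sup>2\<bar> \<le> 1" using r s by (smt (verit) zero_le_power2)
      have "cmod (?R \<zeta>) \<le> 3 * (\<bar>s - (cmod (\<zeta> - z))\<^sup>2\<bar> + \<bar>h\<bar>) * h\<^sup>2"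
        using cube_taylor[of "s - (cmod (\<zeta> - z))\<^sup>2" h] unfolding norm_of_real bump_def
        by (simp add: algebra_simps)
      also have "\<dots> \<le> 6 * h\<^sup>2" using \<sigma> h by (intro mult_right_mono) auto
      finally show "cmod (?R \<zeta>) \<le> 6 * h\<^sup>2" .
    qed (intro continuous_intros)
    finally show "norm (Bi 3 f (s + h) z - Bi 3 f s z - h *\<^sub>R (3 * Bi 2 f s z)) \<le> 6 * (LINT \<zeta>|lebesgue. cmod (g \<zeta>)) * (norm h)\<^sup>2"
      by (simp add: mult_ac)
  qed (rule bounded_linear_scaleR_left)
  then show ?thesis by (simp add: has_vector_derivative_def)
qed

text \<open>Testing against \<open>cnj (\<zeta> - z) * bump 3\<close> produces
  \<open>bump 3 - 3 * |\<zeta> - z|^2 * bump 2\<close>, and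
  \<open>|\<zeta> - z|^2 * bump 2 = s * bump 2 - bump 3\<close>.\<close>

lemma Bi_radial_identity:
  assumes f: "wkhol f" and s: "0 < s" "sqrt s < 1 - cmod z"
  shows "4 * Bi 3 f s z = 3 * of_real s * Bi 2 f s z"
proof -
  have l: "locint f" using f by (simp add: wkhol_def)
  have A: "has_pd 1 (\<lambda>\<zeta>. cnj (\<zeta> - z)) (\<lambda>_. cnj (1 - 0)) UNIV" "has_pd \<i> (\<lambda>\<zeta>. cnj (\<zeta> - z)) (\<lambda>_. cnj (\<i> - 0)) UNIV"
    by (intro has_pd_cnj has_pd_diff has_pd_ident has_pd_const)+
  have c: "continuous_on UNIV (\<lambda>\<zeta>. cnj (\<zeta> - z))" by (intro continuous_intros)
  note t = bump_test[OF s A c]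
  have "dzb (\<lambda>\<zeta>. cnj (\<zeta> - z) * of_real (bump 3 s z \<zeta>)) \<zeta> = 4 * of_real (bump 3 s z \<zeta>) - 3 * of_real s * of_real (bump 2 s z \<zeta>)" for \<zeta>
  proof -
    have e: "(cmod (\<zeta> - z))\<^sup>2 * bump 2 s z \<zeta> = s * bump 2 s z \<zeta> - bump 3 s z \<zeta>"
      by (cases "s \<le> (cmod (\<zeta> - z))\<^sup>2")
         (auto simp: bump_def max_def power2_eq_square power3_eq_cube algebra_simps)
    have "cnj (\<zeta> - z) * (\<zeta> - z) = of_real ((cmod (\<zeta> - z))\<^sup>2)"
      by (metis complex_norm_square mult.commute)
    then have "3 * cnj (\<zeta> - z) * of_real (bump 2 s z \<zeta>) * (\<zeta> - z) = 3 * complex_of_real ((cmod (\<zeta> - z))\<^sup>2 * bump 2 s z \<zeta>)"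
      by (metis (no_types, lifting) mult.assoc mult.commute of_real_mult)
    then show ?thesis unfolding t(2) e by (simp add: algebra_simps)
  qed
  then have "(LINT \<zeta>|lebesgue. f \<zeta> * (4 * of_real (bump 3 s z \<zeta>) - 3 * of_real s * of_real (bump 2 s z \<zeta>))) = 0"
    using f t(1) by (auto simp: wkhol_def dest!: bspec)
  moreover have i: "f \<zeta> * (4 * of_real (bump 3 s z \<zeta>) - 3 * of_real s * of_real (bump 2 s z \<zeta>))
      = 4 * (f \<zeta> * of_real (bump 3 s z \<zeta>)) - 3 * of_real s * (f \<zeta> * of_real (bump 2 s z \<zeta>))" for \<zeta>
    by (simp add: algebra_simps)
  moreover have "(LINT \<zeta>|lebesgue. f \<zeta> * (4 * of_real (bump 3 s z \<zeta>) - 3 * of_real s * of_real (bump 2 s z \<zeta>))) = 4 * Bi 3 f s z - 3 * of_real s * Bi 2 f s z"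
    using locint_bump_integrable'[OF l _ s(2), of 3] locint_bump_integrable'[OF l _ s(2), of 2]
    unfolding i by (simp add: Bi_def)
  ultimately show ?thesis by simp
qed

text \<open>Together, \<open>Bi_deriv_s\<close> and \<open>Bi_radial_identity\<close> are the differential equation \<open>s u' = 4 u\<close> for
\<open>u s = Bi 3 f s z\<close>.\<close>

lemma Bi_homogeneous:
  assumes f: "wkhol f" and z: "z \<in> disc"
  obtains L where "\<And>s. 0 < s \<Longrightarrow> sqrt s < 1 - cmod z \<Longrightarrow> Bi 3 f s z = of_real (s^4) * L"
proof -
  have l: "locint f" using f by (simp add: wkhol_def)
  let ?I = "{0<..<(1 - cmod z)\<^sup>2}"
  have z1: "cmod z < 1" using z by (simp add: disc_def)
  have I: "s \<in> ?I \<longleftrightarrow> 0 < s \<and> sqrt s < 1 - cmod z" for s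
  proof -
    have "sqrt ((1 - cmod z)\<^sup>2) = 1 - cmod z" using z1 by simp
    then show ?thesis by (metis greaterThanLessThan_iff real_sqrt_less_iff)
  qed
  \<comment> \<open>Integrating factor: for \<open>u = Bi 3 f s z\<close> the derivative of
    \<open>s^-4 * u\<close> is \<open>s^-5 * (s * u' - 4 * u)\<close>.\<close>
  have d: "((\<lambda>s. (inverse s ^ 4) *\<^sub>R Bi 3 f s z) has_vector_derivative 0) (at s within ?I)" if "s \<in> ?I" for s
  proof -
    have s: "0 < s" "sqrt s < 1 - cmod z" using that I by auto
    have "((\<lambda>s. inverse s ^ 4) has_real_derivative (4 * inverse s ^ 3 * (- inverse (s^2)))) (at s)"
      using s by (auto intro!: derivative_eq_intros simp: power2_eq_square)
    then have "((\<lambda>s. (inverse s ^ 4) *\<^sub>R Bi 3 f s z) has_vector_derivative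
       (inverse s ^ 4 *\<^sub>R (3 * Bi 2 f s z) + (4 * inverse s ^ 3 * (- inverse (s^2))) *\<^sub>R Bi 3 f s z)) (at s)"
      by (intro has_vector_derivative_scaleR Bi_deriv_s l s)
    moreover have "inverse s ^ 4 *\<^sub>R (3 * Bi 2 f s z) + (4 * inverse s ^ 3 * (- inverse (s^2))) *\<^sub>R Bi 3 f s z
        = of_real (inverse s ^ 5) * (3 * of_real s * Bi 2 f s z - 4 * Bi 3 f s z)"
      using s by (simp add: scaleR_conv_of_real field_simps power_numeral_reduce)
    ultimately show ?thesis
      by (auto simp: Bi_radial_identity[OF f s] intro: has_vector_derivative_at_within)
  qed
  obtain L where L: "\<And>s. s \<in> ?I \<Longrightarrow> (inverse s ^ 4) *\<^sub>R Bi 3 f s z = L"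
    using has_vector_derivative_zero_constant[OF convex_real_interval(8) d] by blast
  show ?thesis
  proof
    fix s assume s: "0 < s" "sqrt s < 1 - cmod z"
    have "of_real (s^4) * L = (s^4 * inverse s ^ 4) *\<^sub>R Bi 3 f s z"
      using L[of s] I[of s] s by (metis scaleR_conv_of_real scaleR_scaleR)
    also have "s^4 * inverse s ^ 4 = 1" using s by (simp add: field_simps)
    finally show "Bi 3 f s z = of_real (s^4) * L" by simp
  qed
qed

lemma bump_le: "bump n s z \<zeta> \<le> (max 0 s) ^ n"
  unfolding bump_def by (intro power_mono max.mono) auto

text \<open>Moving the centre by \<open>h\<close> changes \<open>|\<zeta> - z|^2\<close> to first
  order by a term in \<open>h\<close> and one in \<open>cnj h\<close>. The coefficient of
  \<open>cnj h\<close> is, up to a factor, the pairing of \<open>f\<close> with \<open>dzb\<close>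
  of the cut-off, hence zero for weakly holomorphic \<open>f\<close>; what remains is complex linear
  in \<open>h\<close>.\<close>

lemma Bi_holomorphic:
  assumes f: "wkhol f" and s: "0 < s" "sqrt s < 1 - cmod z"
  shows "\<exists>D. ((\<lambda>z. Bi 3 f s z) has_field_derivative D) (at z)"
proof -
  have l: "locint f" using f by (simp add: wkhol_def)
  obtain r where r: "sqrt s < r" "r < 1 - cmod z" "0 < r" "s < r\<^sup>2" "r \<le> 1" "r\<^sup>2 \<le> 1" "s \<le> 1"
    by (rule sqrt_room[OF s])
  define g where "g \<zeta> = indicator (cball z r) \<zeta> *\<^sub>R f \<zeta>" for \<zeta>
  have g: "integrable lebesgue g"
    using l cball_subset_disc[OF r(2)] compact_cball by (auto simp: locint_def g_def[abs_def])
  have out: "bump n s z' \<zeta> = 0" if "\<zeta> \<notin> cball z r" "cmod (z' - z) \<le> r - sqrt s" "n > 0" for z' \<zeta> n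
  proof (rule bump_outside[OF that(3)])
    show "\<zeta> \<notin> cball z' (sqrt s)"
    proof
      assume "\<zeta> \<in> cball z' (sqrt s)"
      then have "dist z \<zeta> \<le> (r - sqrt s) + sqrt s"
        using that(2) dist_triangle[of z \<zeta> z'] by (simp add: dist_norm norm_minus_commute)
      then show False using that(1) by simp
    qed
  qed
  have Bg: "Bi n f s z' = (LINT \<zeta>|lebesgue. g \<zeta> * of_real (bump n s z' \<zeta>))" if "cmod (z' - z) \<le> r - sqrt s" "n > 0" for z' n
    unfolding g_def by (rule Bi_restrict) (use that out in auto)
  have near: "cmod (\<zeta> - z) \<le> 1" if "g \<zeta> \<noteq> 0" for \<zeta>
    using that r by (auto simp: g_def indicator_def dist_norm norm_minus_commute split: if_splits)
  have b2: "0 \<le> bump 2 s z \<zeta>" "bump 2 s z \<zeta> \<le> 1" for \<zeta>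
  proof -
    have "max 0 (s - (cmod (\<zeta> - z))\<^sup>2) \<le> 1" using r s by (smt (verit) zero_le_power2)
    then show "bump 2 s z \<zeta> \<le> 1" unfolding bump_def by (intro power_le_one) auto
  qed simp
  have ib: "integrable lebesgue (\<lambda>\<zeta>. g \<zeta> * of_real (bump n s z' \<zeta>))" for n z'
  proof (rule integrable_mult_bounded_continuous[OF g])
    show "cmod (complex_of_real (bump n s z' x)) \<le> (max 0 s) ^ n" for x
      using bump_le unfolding norm_of_real by simp
  qed (intro continuous_intros)
  have ic: "integrable lebesgue (\<lambda>\<zeta>. g \<zeta> * (of_real (bump 2 s z \<zeta>) * c \<zeta>))"
    if c: "continuous_on UNIV c" "\<And>\<zeta>. cmod (c \<zeta>) = cmod (\<zeta> - z)" for c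
  proof (rule integrable_mult_bounded_continuous[OF g, where B = 1])
    show "cmod (complex_of_real (bump 2 s z x) * c x) \<le> 1" if "g x \<noteq> 0" for x
      using mult_mono[OF b2(2)[of x] near[OF that]] b2 c by (simp add: norm_mult)
  qed (intro continuous_intros c)
  define D where "D = (LINT \<zeta>|lebesgue. g \<zeta> * (of_real (bump 2 s z \<zeta>) * cnj (\<zeta> - z)))"
  have zero: "(LINT \<zeta>|lebesgue. g \<zeta> * (of_real (bump 2 s z \<zeta>) * (\<zeta> - z))) = 0"
  proof -
    note t = bump_test[OF s has_pd_const has_pd_const continuous_on_const, of "1"]
    have e: "dzb (\<lambda>\<zeta>. 1 * of_real (bump 3 s z \<zeta>)) = (\<lambda>\<zeta>. - 3 * (of_real (bump 2 s z \<zeta>) * (\<zeta> - z)))"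
      unfolding t(2) by (simp add: fun_eq_iff mult.assoc)
    have "(LINT \<zeta>|lebesgue. f \<zeta> * dzb (\<lambda>\<zeta>. 1 * of_real (bump 3 s z \<zeta>)) \<zeta>) = 0"
      using f t(1) unfolding wkhol_def by blast
    then have "(LINT \<zeta>|lebesgue. f \<zeta> * (- 3 * (of_real (bump 2 s z \<zeta>) * (\<zeta> - z)))) = 0"
      unfolding e .
    also have "(LINT \<zeta>|lebesgue. f \<zeta> * (- 3 * (of_real (bump 2 s z \<zeta>) * (\<zeta> - z)))) =
      (LINT \<zeta>|lebesgue. - 3 * (g \<zeta> * (of_real (bump 2 s z \<zeta>) * (\<zeta> - z))))"
    proof (rule Bochner_Integration.integral_cong[OF refl])
      fix \<zeta>
      show "f \<zeta> * (- 3 * (of_real (bump 2 s z \<zeta>) * (\<zeta> - z))) = - 3 * (g \<zeta> * (of_real (bump 2 s z \<zeta>) * (\<zeta> - z)))"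
        using out[of \<zeta> z 2] r by (cases "\<zeta> \<in> cball z r") (auto simp: g_def)
    qed
    finally show ?thesis by simp
  qed
  \<comment> \<open>\<open>111 = 12 * 9 + 3\<close>: the Taylor remainder for an increment of size
    at most \<open>3 * |h|\<close>, plus the second order term
    \<open>3 * bump 2 * |h|^2\<close>.\<close>
  have "((\<lambda>z. Bi 3 f s z) has_derivative (\<lambda>h. 3 * D * h)) (at z)"
  proof (rule has_derivative_quadratic_remainder[where C = "111 * (LINT \<zeta>|lebesgue. cmod (g \<zeta>))"])
    show "0 < min 1 (r - sqrt s)" using r by auto
    show "bounded_linear ((*) (3 * D))" by (rule bounded_linear_mult_right)
    fix h :: complex assume "norm h < min 1 (r - sqrt s)"
    then have h: "cmod h \<le> 1" "cmod h \<le> r - sqrt s" by auto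
    let ?d = "\<lambda>\<zeta>. 2 * Re (cnj (\<zeta> - z) * h) - (cmod h)\<^sup>2"
    let ?\<sigma> = "\<lambda>\<zeta>. s - (cmod (\<zeta> - z))\<^sup>2"
    let ?R = "\<lambda>\<zeta>. complex_of_real (bump 3 s (z + h) \<zeta> - bump 3 s z \<zeta> - 3 * bump 2 s z \<zeta> * (2 * Re (cnj (\<zeta> - z) * h)))"
    have e1: "g \<zeta> * ?R \<zeta> = g \<zeta> * of_real (bump 3 s (z + h) \<zeta>) - g \<zeta> * of_real (bump 3 s z \<zeta>)
        - (3 * h * (g \<zeta> * (of_real (bump 2 s z \<zeta>) * cnj (\<zeta> - z))) + 3 * cnj h * (g \<zeta> * (of_real (bump 2 s z \<zeta>) * (\<zeta> - z))))" for \<zeta>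
    proof -
      have "complex_of_real (2 * Re (cnj (\<zeta> - z) * h)) = cnj (\<zeta> - z) * h + cnj (cnj (\<zeta> - z) * h)"
        by (rule complex_add_cnj[symmetric])
      then have "complex_of_real (2 * Re (cnj (\<zeta> - z) * h)) = cnj (\<zeta> - z) * h + (\<zeta> - z) * cnj h" by simp
      then have "?R \<zeta> = of_real (bump 3 s (z + h) \<zeta>) - of_real (bump 3 s z \<zeta>) - 3 * of_real (bump 2 s z \<zeta>) * (cnj (\<zeta> - z) * h + (\<zeta> - z) * cnj h)"
        by (simp only: of_real_diff of_real_mult[of "3 * bump 2 s z \<zeta>"] of_real_mult[of 3] of_real_numeral)
      then show ?thesis by (simp only:) (simp add: algebra_simps)
    qed
    have "Bi 3 f s (z + h) - Bi 3 f s z - 3 * D * h = (LINT \<zeta>|lebesgue. g \<zeta> * ?R \<zeta>)"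
    proof -
      let ?C = "\<lambda>\<zeta>. g \<zeta> * (of_real (bump 2 s z \<zeta>) * cnj (\<zeta> - z))" and ?E = "\<lambda>\<zeta>. g \<zeta> * (of_real (bump 2 s z \<zeta>) * (\<zeta> - z))"
      have C: "integrable lebesgue ?C" by (rule ic) (auto intro!: continuous_intros simp flip: complex_cnj_diff)
      have E: "integrable lebesgue ?E" by (rule ic) (auto intro!: continuous_intros)
      have "(LINT \<zeta>|lebesgue. g \<zeta> * ?R \<zeta>) = (LINT \<zeta>|lebesgue. g \<zeta> * of_real (bump 3 s (z + h) \<zeta>)) - (LINT \<zeta>|lebesgue. g \<zeta> * of_real (bump 3 s z \<zeta>))
        - (3 * h * (LINT \<zeta>|lebesgue. ?C \<zeta>) + 3 * cnj h * (LINT \<zeta>|lebesgue. ?E \<zeta>))"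
        unfolding e1 using ib[of 3 "z+h"] ib[of 3 z] C E
        by (simp only: Bochner_Integration.integral_diff Bochner_Integration.integral_add Bochner_Integration.integrable_diff
            Bochner_Integration.integrable_add integral_mult_right_zero integrable_mult_right)
      moreover have "Bi 3 f s (z + h) = (LINT \<zeta>|lebesgue. g \<zeta> * of_real (bump 3 s (z + h) \<zeta>))" by (rule Bg) (use h in auto)
      moreover have "Bi 3 f s z = (LINT \<zeta>|lebesgue. g \<zeta> * of_real (bump 3 s z \<zeta>))" by (rule Bg) (use r in auto)
      ultimately show ?thesis unfolding zero D_def[symmetric] by simp
    qed
    also have "cmod \<dots> \<le> (111 * (cmod h)\<^sup>2) * (LINT \<zeta>|lebesgue. cmod (g \<zeta>))"
    proof (rule norm_integral_remainder[OF g])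
      fix \<zeta> assume "g \<zeta> \<noteq> 0"
      then have n: "cmod (\<zeta> - z) \<le> 1" by (rule near)
      then have "(cmod (\<zeta> - z))\<^sup>2 \<le> 1" by (simp add: power_le_one)
      then have \<sigma>: "\<bar>?\<sigma> \<zeta>\<bar> \<le> 1" using r s by (smt (verit) zero_le_power2)
      have dd: "s - (cmod (\<zeta> - (z + h)))\<^sup>2 = ?\<sigma> \<zeta> + ?d \<zeta>"
        unfolding cmod_power2 by (simp add: power2_eq_square algebra_simps)
      have "\<bar>2 * Re (cnj (\<zeta> - z) * h)\<bar> \<le> 2 * cmod h"
        using abs_Re_le_cmod[of "cnj (\<zeta> - z) * h"] mult_right_mono[OF n norm_ge_zero[of h]]
        by (simp add: norm_mult flip: complex_cnj_diff)
      moreover have "(cmod h)\<^sup>2 \<le> cmod h" using h(1) by (simp add: power2_eq_square mult_left_le)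
      ultimately have d3: "\<bar>?d \<zeta>\<bar> \<le> 3 * cmod h" using zero_le_power2[of "cmod h"] by linarith
      then have d2: "(?d \<zeta>)\<^sup>2 \<le> 9 * (cmod h)\<^sup>2"
        using power_mono[of "\<bar>?d \<zeta>\<bar>" "3 * cmod h" 2] by (simp add: power_mult_distrib)
      let ?A = "(max 0 (?\<sigma> \<zeta> + ?d \<zeta>))^3 - (max 0 (?\<sigma> \<zeta>))^3 - 3 * ?d \<zeta> * (max 0 (?\<sigma> \<zeta>))\<^sup>2"
      have "bump 3 s (z + h) \<zeta> - bump 3 s z \<zeta> - 3 * bump 2 s z \<zeta> * (2 * Re (cnj (\<zeta> - z) * h))
         = ?A - 3 * bump 2 s z \<zeta> * (cmod h)\<^sup>2"
        unfolding bump_def dd by (simp only: right_diff_distrib left_diff_distrib mult_ac)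
      moreover have "\<bar>?A\<bar> \<le> 3 * (\<bar>?\<sigma> \<zeta>\<bar> + \<bar>?d \<zeta>\<bar>) * (?d \<zeta>)\<^sup>2" by (rule cube_taylor)
      moreover have "3 * (\<bar>?\<sigma> \<zeta>\<bar> + \<bar>?d \<zeta>\<bar>) * (?d \<zeta>)\<^sup>2 \<le> 12 * (9 * (cmod h)\<^sup>2)"
        by (intro mult_mono d2) (use \<sigma> d3 h in auto)
      moreover have "\<bar>3 * bump 2 s z \<zeta> * (cmod h)\<^sup>2\<bar> \<le> 3 * (cmod h)\<^sup>2"
        using mult_right_mono[OF b2(2)[of \<zeta>] zero_le_power2[of "cmod h"]] b2(1)[of \<zeta>] by (simp add: abs_mult)
      ultimately show "cmod (?R \<zeta>) \<le> 111 * (cmod h)\<^sup>2" unfolding norm_of_real by linarith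
    qed (intro continuous_intros)
    finally show "norm (Bi 3 f s (z + h) - Bi 3 f s z - 3 * D * h) \<le> 111 * (LINT \<zeta>|lebesgue. cmod (g \<zeta>)) * (norm h)\<^sup>2"
      by (simp add: mult_ac)
  qed
  then show ?thesis by (auto simp: has_field_derivative_def)
qed

text \<open>The value \<open>1/4\<close> makes the support of the cut-off lie inside the unit disc; \<open>256 = 4^4\<close> rescales
it, so that \<open>\<integral> bump 3 s z = c0 s^4\<close>.\<close>

definition c0 :: real where
  "c0 = (LINT \<zeta>|lebesgue. bump 3 (1/4) 0 \<zeta>) * 256"

section \<open>Normalisation and the mean value property\<close>

lemma bump_integrable: "integrable lebesgue (bump (Suc n) s z)"
proof (rule integrable_continuous_compact_support(2))
  show "compact (cball z (sqrt s))" by simp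
  show "bump (Suc n) s z \<zeta> = 0" if "\<zeta> \<notin> cball z (sqrt s)" for \<zeta> using that by (intro bump_outside) auto
qed (intro continuous_intros)

lemma bump_borel [measurable]: "bump n s z \<in> borel_measurable borel"
  by (intro borel_measurable_continuous_onI continuous_intros)

lemma Bi_1_real: "Bi n (\<lambda>_. 1) s z = of_real (LINT \<zeta>|lebesgue. bump n s z \<zeta>)"
  by (simp add: Bi_def)

lemma bump_integral_translate: "(LINT \<zeta>|lebesgue. bump n s z \<zeta>) = (LINT \<zeta>|lebesgue. bump n s 0 \<zeta>)"
proof -
  have "(LINT \<zeta>|lborel. bump n s z \<zeta>) = integral\<^sup>L (distr lborel borel ((+) z)) (bump n s z)"
    by (simp only: lborel_distr_plus)
  also have "\<dots> = (LINT \<zeta>|lborel. bump n s z (z + \<zeta>))" by (rule integral_distr) auto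
  also have "\<dots> = (LINT \<zeta>|lborel. bump n s 0 \<zeta>)" by (simp add: bump_def)
  finally show ?thesis by (simp add: integral_completion)
qed

lemma c0_pos: "0 < c0"
proof -
  have "(LINT \<zeta>|lebesgue. (1/8)^3 * indicator (ball 0 (1/4)) (\<zeta>::complex)) \<le> (LINT \<zeta>|lebesgue. bump 3 (1/4) 0 \<zeta>)"
  proof (rule integral_mono)
    show "integrable lebesgue (\<lambda>\<zeta>. (1/8)^3 * indicator (ball 0 (1/4)) (\<zeta>::complex) :: real)"
      by (intro integrable_mult_right integrable_real_indicator) (use emeasure_bounded_finite[of "ball (0::complex) (1/4)"] in auto)
    show "integrable lebesgue (bump 3 (1/4) 0)" using bump_integrable[of 2] by (simp add: numeral_3_eq_3 numeral_2_eq_2)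
    fix \<zeta> :: complex
    show "(1/8)^3 * indicator (ball 0 (1/4)) \<zeta> \<le> bump 3 (1/4) 0 \<zeta>"
    proof (cases "\<zeta> \<in> ball 0 (1/4)")
      case True
      then have "(cmod \<zeta>)\<^sup>2 \<le> (1/4)\<^sup>2" by (intro power_mono) auto
      then have "(cmod \<zeta>)\<^sup>2 \<le> 1/16" by (simp add: power_divide)
      then have "1/8 \<le> max 0 (1/4 - (cmod \<zeta>)\<^sup>2)" by (intro max.coboundedI2) linarith
      then have "(1/8)^3 \<le> (max 0 (1/4 - (cmod \<zeta>)\<^sup>2))^3" by (rule power_mono) simp
      also have "\<dots> = bump 3 (1/4) 0 \<zeta>" by (simp add: bump_def)
      finally have "(1/8)^3 \<le> bump 3 (1/4) 0 \<zeta>" .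
      moreover have "(1/8)^3 * indicator (ball 0 (1/4)) \<zeta> = (1/8::real)^3" using True by simp
      ultimately show ?thesis by (simp only:)
    qed simp
  qed
  moreover have "(LINT \<zeta>|lebesgue. (1/8)^3 * indicator (ball 0 (1/4)) (\<zeta>::complex)) = (1/8)^3 * measure lebesgue (ball (0::complex) (1/4))"
    by simp
  moreover have "measure lebesgue (ball (0::complex) (1/4)) > 0" by (simp add: content_ball_pos)
  ultimately show ?thesis unfolding c0_def by (smt (verit) mult_pos_pos zero_less_power divide_pos_pos)
qed

text \<open>Homogeneity applied to the constant function 1; its value at \<open>s = 1/4\<close> is
  \<open>c0 / 256\<close> by the choice of \<open>c0\<close>, which fixes the constant.\<close>

lemma bump_integral:
  assumes "0 < s" "s < 1"
  shows "(LINT \<zeta>|lebesgue. bump 3 s z \<zeta>) = c0 * s ^ 4"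
proof -
  have "wkhol (\<lambda>_. 1)" by (intro wkhol_holomorphic) simp
  then obtain L where L: "\<And>s. 0 < s \<Longrightarrow> sqrt s < 1 - cmod 0 \<Longrightarrow> Bi 3 (\<lambda>_. 1) s 0 = of_real (s^4) * L"
    using Bi_homogeneous[of "\<lambda>_. 1" 0] by (auto simp: disc_def)
  have "of_real ((1/4)^4) * L = Bi 3 (\<lambda>_. 1) (1/4) 0"
    by (rule L[symmetric]) (auto simp: real_sqrt_divide)
  also have "\<dots> = of_real (c0 / 256)" by (simp add: Bi_1_real c0_def)
  finally have "L = of_real c0" by (simp add: power4_eq_xxxx)
  moreover have "of_real (LINT \<zeta>|lebesgue. bump 3 s 0 \<zeta>) = of_real (s^4) * L"
    using L[OF assms(1)] assms(2) by (simp add: Bi_1_real)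
  ultimately have "complex_of_real (LINT \<zeta>|lebesgue. bump 3 s 0 \<zeta>) = of_real (c0 * s^4)" by simp
  then show ?thesis by (subst bump_integral_translate) (simp only: of_real_eq_iff)
qed

text \<open>Homogeneity leaves one unknown factor \<open>L\<close>. It is identified by letting the
  scale tend to zero, where continuity allows \<open>f\<close> to be replaced by \<open>f z\<close>
  under the cut-off.\<close>

lemma mean_value_bump:
  assumes f: "f holomorphic_on disc" and s: "0 < s" "sqrt s < 1 - cmod z"
  shows "Bi 3 f s z = of_real (c0 * s^4) * f z"
proof -
  have "0 < sqrt s" using s(1) by simp
  then have "cmod z < 1" using s(2) by linarith
  then have zd: "z \<in> disc" by (simp add: disc_def)
  obtain L where L: "\<And>s. 0 < s \<Longrightarrow> sqrt s < 1 - cmod z \<Longrightarrow> Bi 3 f s z = of_real (s^4) * L"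
    using Bi_homogeneous[OF wkhol_holomorphic[OF f] zd] by metis
  have cf: "isCont f z" using f zd by (metis continuous_on_eq_continuous_at holomorphic_on_imp_continuous_on open_disc)
  have lf: "locint f" using wkhol_holomorphic[OF f] by (simp add: wkhol_def)
  have l1: "locint (\<lambda>_. f z)" by (rule locint_continuous) auto
  have "cmod (L - of_real c0 * f z) \<le> e * c0" if e: "0 < e" for e
  proof -
    obtain \<delta> where d: "0 < \<delta>" "\<And>\<zeta>. cmod (\<zeta> - z) < \<delta> \<Longrightarrow> cmod (f \<zeta> - f z) < e"
      using cf e unfolding continuous_at_eps_delta dist_norm by blast
    define q where "q = min (\<delta>/2) ((1 - cmod z)/2)"
    have q1: "q \<le> \<delta>/2" and q2: "q \<le> (1 - cmod z)/2" unfolding q_def by (rule min.cobounded1, rule min.cobounded2)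
    have q3: "0 < q" using d(1) \<open>cmod z < 1\<close> by (simp add: q_def)
    have "2 * q \<le> 1 - cmod z" using q2 by simp
    then have q: "0 < q" "q < \<delta>" "q < 1 - cmod z" using q1 q3 by linarith+
    let ?s = "q\<^sup>2"
    have s': "0 < ?s" "sqrt ?s < 1 - cmod z" using q by auto
    have "q < 1" using q(3) norm_ge_zero[of z] by linarith
    then have s1: "?s < 1" using q(1) by (simp add: power_less_one_iff)
    note i1 = locint_bump_integrable'[OF lf _ s'(2), of 3] and i2 = locint_bump_integrable'[OF l1 _ s'(2), of 3]
    have "of_real (?s^4) * (L - of_real c0 * f z) = Bi 3 f ?s z - f z * of_real (LINT \<zeta>|lebesgue. bump 3 ?s z \<zeta>)"
      unfolding L[OF s'] bump_integral[OF s'(1) s1] by (simp add: algebra_simps)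
    also have "\<dots> = (LINT \<zeta>|lebesgue. f \<zeta> * of_real (bump 3 ?s z \<zeta>) - f z * of_real (bump 3 ?s z \<zeta>))"
      using i1 i2 by (simp add: Bi_def)
    also have "cmod \<dots> \<le> (LINT \<zeta>|lebesgue. cmod (f \<zeta> * of_real (bump 3 ?s z \<zeta>) - f z * of_real (bump 3 ?s z \<zeta>)))"
      by (rule integral_norm_bound)
    also have "\<dots> \<le> (LINT \<zeta>|lebesgue. e * bump 3 ?s z \<zeta>)"
    proof (rule integral_mono)
      show "integrable lebesgue (\<lambda>\<zeta>. cmod (f \<zeta> * of_real (bump 3 ?s z \<zeta>) - f z * of_real (bump 3 ?s z \<zeta>)))"
        using i1 i2 by auto
      show "integrable lebesgue (\<lambda>\<zeta>. e * bump 3 ?s z \<zeta>)" using bump_integrable[of 2] by (auto simp: numeral_3_eq_3 numeral_2_eq_2)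
      fix \<zeta>
      have "cmod (f \<zeta> - f z) * bump 3 ?s z \<zeta> \<le> e * bump 3 ?s z \<zeta>"
      proof (cases "bump 3 ?s z \<zeta> = 0")
        case False
        then have "\<zeta> \<in> cball z q" using bump_outside[of 3 \<zeta> z ?s] q by fastforce
        then have "cmod (f \<zeta> - f z) < e" using d(2)[of \<zeta>] q by (simp add: dist_norm norm_minus_commute)
        then show ?thesis by (intro mult_right_mono) auto
      qed simp
      moreover have "f \<zeta> * of_real (bump 3 ?s z \<zeta>) - f z * of_real (bump 3 ?s z \<zeta>) = (f \<zeta> - f z) * of_real (bump 3 ?s z \<zeta>)"
        by (simp add: algebra_simps)
      ultimately show "cmod (f \<zeta> * of_real (bump 3 ?s z \<zeta>) - f z * of_real (bump 3 ?s z \<zeta>)) \<le> e * bump 3 ?s z \<zeta>"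
        by (simp add: norm_mult)
    qed
    also have "\<dots> = ?s^4 * (e * c0)" by (simp add: bump_integral[OF s'(1) s1])
    finally have "?s^4 * cmod (L - of_real c0 * f z) \<le> ?s^4 * (e * c0)"
      by (simp add: norm_mult norm_power)
    then show ?thesis using s' by (subst (asm) mult_le_cancel_left_pos) auto
  qed
  then have "cmod (L - of_real c0 * f z) \<le> 0 + e" if "0 < e" for e
    using that c0_pos by (smt (verit) divide_pos_pos nonzero_eq_divide_eq)
  then have "cmod (L - of_real c0 * f z) \<le> 0" by (rule field_le_epsilon)
  then show ?thesis using L[OF s] by (simp add: mult_ac)
qed

text \<open>Positive and negative part of \<open>u\<close> on \<open>U\<close> are taken as
  densities of two finite measures. They agree on closed discs in \<open>U\<close>, hence by
  Vitali's covering theorem on open sets, hence everywhere. This does the work of Lebesgue's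
  differentiation theorem.\<close>

lemma lborel_zero_of_cballs:
  fixes u :: "complex \<Rightarrow> real"
  assumes u: "integrable lborel u" and U: "open U"
    and b: "\<And>z r. 0 < r \<Longrightarrow> cball z r \<subseteq> U \<Longrightarrow> (LINT x|lborel. u x * indicator (cball z r) x) = 0"
  shows "AE x in lborel. x \<in> U \<longrightarrow> u x = 0"
proof -
  define f1 f2 where "f1 x = indicator U x * max 0 (u x)" and "f2 x = indicator U x * max 0 (- u x)" for x
  have [measurable]: "u \<in> borel_measurable borel" using u by auto
  have [measurable]: "U \<in> sets borel" using U by auto
  have fm [measurable]: "f1 \<in> borel_measurable borel" "f2 \<in> borel_measurable borel"
    unfolding f1_def[abs_def] f2_def[abs_def] by measurable
  have f0: "0 \<le> f1 x" "0 \<le> f2 x" for x by (auto simp: f1_def f2_def)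
  have fu: "f1 x - f2 x = indicator U x * u x" for x by (auto simp: f1_def f2_def max_def indicator_def)
  have fi: "integrable lborel f1" "integrable lborel f2"
    by (rule Bochner_Integration.integrable_bound[OF u], use fm in simp, intro AE_I2,
        auto simp: f1_def f2_def max_def indicator_def)+
  define M1 M2 where "M1 = density lborel (\<lambda>x. ennreal (f1 x))" and "M2 = density lborel (\<lambda>x. ennreal (f2 x))"
  have s: "sets M1 = sets borel" "sets M2 = sets borel" by (auto simp: M1_def M2_def)
  have em: "emeasure M1 A = ennreal (LINT x|lborel. f1 x * indicator A x)"
    "emeasure M2 A = ennreal (LINT x|lborel. f2 x * indicator A x)" if [measurable]: "A \<in> sets borel" for A
  proof -
    have i: "integrable lborel (\<lambda>x. f1 x * indicator A x)" "integrable lborel (\<lambda>x. f2 x * indicator A x)"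
      using fi that by (auto intro: integrable_real_mult_indicator)
    have "emeasure M1 A = (\<integral>\<^sup>+x. ennreal (f1 x * indicator A x) \<partial>lborel)"
      unfolding M1_def by (subst emeasure_density) (auto simp: indicator_def intro!: nn_integral_cong)
    then show "emeasure M1 A = ennreal (LINT x|lborel. f1 x * indicator A x)"
      using i(1) f0 by (simp add: nn_integral_eq_integral)
    have "emeasure M2 A = (\<integral>\<^sup>+x. ennreal (f2 x * indicator A x) \<partial>lborel)"
      unfolding M2_def by (subst emeasure_density) (auto simp: indicator_def intro!: nn_integral_cong)
    then show "emeasure M2 A = ennreal (LINT x|lborel. f2 x * indicator A x)"
      using i(2) f0 by (simp add: nn_integral_eq_integral)
  qed
  have ball: "emeasure M1 (cball z r) = emeasure M2 (cball z r)" if "0 < r" "cball z r \<subseteq> U" for z r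
  proof -
    have "(LINT x|lborel. f1 x * indicator (cball z r) x) - (LINT x|lborel. f2 x * indicator (cball z r) x)
       = (LINT x|lborel. f1 x * indicator (cball z r) x - f2 x * indicator (cball z r) x)"
      by (rule Bochner_Integration.integral_diff[symmetric]; intro integrable_real_mult_indicator fi) auto
    also have "\<dots> = (LINT x|lborel. u x * indicator (cball z r) x)"
      by (rule Bochner_Integration.integral_cong)
         (use that fu in \<open>auto simp: indicator_def left_diff_distrib[symmetric]\<close>)
    also have "\<dots> = 0" by (rule b[OF that])
    finally show ?thesis by (simp add: em)
  qed
  \<comment> \<open>Up to a null set \<open>V\<close> is a countable disjoint union of closed discs
    inside it, and both measures ignore null sets.\<close>
  have opn: "emeasure M1 V = emeasure M2 V" if V: "open V" "V \<subseteq> U" for V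
  proof -
    define Kk where "Kk = {(a::complex, r). 0 < r \<and> cball a r \<subseteq> V}"
    have cov: "\<exists>i. i \<in> Kk \<and> x \<in> cball (fst i) (snd i) \<and> snd i < d" if "x \<in> V" "0 < d" for x d
    proof -
      obtain e where e: "0 < e" "cball x e \<subseteq> V" using V(1) \<open>x \<in> V\<close> by (meson open_contains_cball)
      have "cball x (min e (d/2)) \<subseteq> cball x e" by (rule subset_cball) simp
      then have "(x, min e (d/2)) \<in> Kk" using that e by (auto simp: Kk_def)
      then show ?thesis using that e by (intro exI[of _ "(x, min e (d/2))"]) auto
    qed
    obtain C where C: "countable C" "C \<subseteq> Kk"
      "pairwise (\<lambda>i j. disjnt (cball (fst i) (snd i)) (cball (fst j) (snd j))) C"
      "negligible (V - (\<Union>i\<in>C. cball (fst i) (snd i)))"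
    proof (rule Vitali_covering_theorem_cballs[of Kk snd V fst])
      show "0 < snd i" if "i \<in> Kk" for i using that by (auto simp: Kk_def)
    qed (use cov in auto)
    let ?W = "\<Union>i\<in>C. cball (fst i) (snd i)"
    have W: "?W \<subseteq> V"
    proof (rule UN_least)
      fix i assume "i \<in> C"
      then have "i \<in> Kk" using C(2) by auto
      then show "cball (fst i) (snd i) \<subseteq> V" by (simp add: Kk_def case_prod_unfold)
    qed
    have Wm [measurable]: "?W \<in> sets borel" using C(1) by (intro sets.countable_UN') auto
    have dj: "disjoint_family_on (\<lambda>i. cball (fst i) (snd i)) C"
      using C(3) by (auto simp: disjoint_family_on_def pairwise_def disjnt_def)
    have n: "emeasure M (V - ?W) = 0" if "M = density lborel (\<lambda>x. ennreal (f x))" "f \<in> borel_measurable borel" for M f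
    proof -
      have "V - ?W \<in> null_sets lborel"
        using C(4) V(1) Wm unfolding negligible_iff_null_sets
        by (subst (asm) null_sets_completion_iff) auto
      then show ?thesis unfolding that(1) using that(2)
        by (subst emeasure_density) (auto simp: null_sets_def intro!: nn_integral_null_set)
    qed
    have "emeasure M V = emeasure M ?W" if "M = density lborel (\<lambda>x. ennreal (f x))" "f \<in> borel_measurable borel" for M f
    proof -
      have "emeasure M V = emeasure M (?W \<union> (V - ?W))" using W by (simp add: Un_absorb1)
      also have "\<dots> = emeasure M ?W + emeasure M (V - ?W)"
        by (rule plus_emeasure[symmetric]) (use that V(1) Wm in auto)
      finally show ?thesis using n[OF that] by simp
    qed
    note eq = this[OF M1_def fm(1)] this[OF M2_def fm(2)]
    have "emeasure M1 ?W = (\<integral>\<^sup>+i. emeasure M1 (cball (fst i) (snd i)) \<partial>count_space C)"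
      by (rule emeasure_UN_countable) (use s C(1) dj in auto)
    also have "\<dots> = (\<integral>\<^sup>+i. emeasure M2 (cball (fst i) (snd i)) \<partial>count_space C)"
    proof (intro nn_integral_cong ball)
      fix i assume "i \<in> space (count_space C)"
      then have "i \<in> Kk" using C(2) by auto
      then show "0 < snd i" "cball (fst i) (snd i) \<subseteq> U" using V(2) by (auto simp only: Kk_def case_prod_unfold mem_Collect_eq)
    qed
    also have "\<dots> = emeasure M2 ?W"
      by (rule emeasure_UN_countable[symmetric]) (use s C(1) dj in auto)
    finally show ?thesis using eq by simp
  qed
  \<comment> \<open>Both densities vanish outside \<open>U\<close>, so only
    \<open>V \<inter> U\<close> counts.\<close>
  have opn': "emeasure M1 V = emeasure M2 V" if V: "open V" for V
  proof -
    have "emeasure M1 V = emeasure M1 (V \<inter> U)" "emeasure M2 V = emeasure M2 (V \<inter> U)"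
      using V U by (auto simp: em f1_def f2_def indicator_def intro!: arg_cong[where f = ennreal] Bochner_Integration.integral_cong)
    then show ?thesis using opn[of "V \<inter> U"] V U by auto
  qed
  have "M1 = M2"
  proof (rule measure_eqI_generator_eq[where E = "{S. open S}" and \<Omega> = UNIV and A = "\<lambda>_. UNIV"])
    show "sets M1 = sigma_sets UNIV {S. open S}" "sets M2 = sigma_sets UNIV {S. open S}"
      using s by (auto simp: borel_def)
  qed (auto simp: Int_stable_def opn' em)
  then have "AE x in lborel. ennreal (f1 x) = ennreal (f2 x)"
    unfolding M1_def M2_def
    by (subst (asm) finite_density_unique) (use fi f0 in \<open>auto simp: nn_integral_eq_integral\<close>)
  then show ?thesis
  proof eventually_elim
    case (elim x)
    then have "f1 x = f2 x" using f0 by simp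
    then show ?case using fu[of x] by (auto simp: indicator_def)
  qed
qed

text \<open>Real and imaginary part are replaced by Borel functions equal to them almost everywhere,
  to which the Borel version applies.\<close>

lemma lebesgue_zero_of_cballs:
  fixes u :: "complex \<Rightarrow> complex"
  assumes u: "integrable lebesgue u" and U: "open U"
    and b: "\<And>z r. 0 < r \<Longrightarrow> cball z r \<subseteq> U \<Longrightarrow> (LINT x|lebesgue. u x * indicator (cball z r) x) = 0"
  shows "AE x in lebesgue. x \<in> U \<longrightarrow> u x = 0"
proof -
  have real: "AE x in lebesgue. x \<in> U \<longrightarrow> v x = 0"
    if v: "integrable lebesgue v" and bv: "\<And>z r. 0 < r \<Longrightarrow> cball z r \<subseteq> U \<Longrightarrow> (LINT x|lebesgue. v x * indicator (cball z r) x) = 0"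
    for v :: "complex \<Rightarrow> real"
  proof -
    obtain v' where v' [measurable]: "v' \<in> borel_measurable lborel" and ae: "AE x in lborel. v x = v' x"
      using completion_ex_borel_measurable_real[of v lborel] v by auto
    have ae': "AE x in lebesgue. v x = v' x" by (rule AE_completion[OF ae])
    have vm: "v \<in> borel_measurable lebesgue" using v by auto
    have vm': "v' \<in> borel_measurable lebesgue" by (rule measurable_completion[OF v'])
    have "integrable lebesgue v'"
      using v integrable_cong_AE[OF vm vm' ae'] by simp
    then have i: "integrable lborel v'" by (simp add: integrable_completion)
    have "AE x in lborel. x \<in> U \<longrightarrow> v' x = 0"
    proof (rule lborel_zero_of_cballs[OF i U])
      fix z r assume zr: "0 < (r::real)" "cball z r \<subseteq> U"
      have [measurable]: "cball z r \<in> sets borel" by simp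
      have "(LINT x|lborel. v' x * indicator (cball z r) x) = (LINT x|lebesgue. v' x * indicator (cball z r) x)"
        by (rule integral_completion[symmetric]) measurable
      also have "\<dots> = (LINT x|lebesgue. v x * indicator (cball z r) x)"
      proof (rule integral_cong_AE)
        show "AE x in lebesgue. v' x * indicator (cball z r) x = v x * indicator (cball z r) x"
          using ae' by eventually_elim simp
      qed (intro borel_measurable_times borel_measurable_indicator vm vm'; auto)+
      also have "\<dots> = 0" by (rule bv[OF zr])
      finally show "(LINT x|lborel. v' x * indicator (cball z r) x) = 0" .
    qed
    then have "AE x in lebesgue. x \<in> U \<longrightarrow> v' x = 0" by (rule AE_completion)
    then show ?thesis using ae' by eventually_elim simp
  qed
  have i: "integrable lebesgue (\<lambda>x. u x * indicator (cball z r) x)" for z r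
  proof -
    have "integrable lebesgue (\<lambda>x. indicator (cball z r) x *\<^sub>R u x)"
      by (rule integrable_mult_indicator) (use u in auto)
    also have "(\<lambda>x. indicator (cball z r) x *\<^sub>R u x) = (\<lambda>x. u x * indicator (cball z r) x)"
      by (auto simp: indicator_def fun_eq_iff)
    finally show ?thesis .
  qed
  have "AE x in lebesgue. x \<in> U \<longrightarrow> Re (u x) = 0"
  proof (rule real)
    fix z r assume zr: "0 < (r::real)" "cball z r \<subseteq> U"
    have "(LINT x|lebesgue. Re (u x * indicator (cball z r) x)) = 0"
      by (subst integral_Re[OF i]) (simp add: b[OF zr])
    also have "(\<lambda>x. Re (u x * indicator (cball z r) x)) = (\<lambda>x. Re (u x) * indicator (cball z r) x)"
      by (auto simp: indicator_def fun_eq_iff)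
    finally show "(LINT x|lebesgue. Re (u x) * indicator (cball z r) x) = 0" .
  qed (use u in auto)
  moreover have "AE x in lebesgue. x \<in> U \<longrightarrow> Im (u x) = 0"
  proof (rule real)
    fix z r assume zr: "0 < (r::real)" "cball z r \<subseteq> U"
    have "(LINT x|lebesgue. Im (u x * indicator (cball z r) x)) = 0"
      by (subst integral_Im[OF i]) (simp add: b[OF zr])
    also have "(\<lambda>x. Im (u x * indicator (cball z r) x)) = (\<lambda>x. Im (u x) * indicator (cball z r) x)"
      by (auto simp: indicator_def fun_eq_iff)
    finally show "(LINT x|lebesgue. Im (u x) * indicator (cball z r) x) = 0" .
  qed (use u in auto)
  ultimately show ?thesis by eventually_elim (auto simp: complex_eq_iff)
qed

text \<open>The third difference of \<open>bump 3\<close> in \<open>s\<close>, divided by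
  \<open>6 * h^3\<close>, is exactly 1 where \<open>|\<zeta> - z|^2 \<le> s\<close> and 0 where it
  is at least \<open>s + 3 * h\<close>. Combinations of the vanishing integrals thus converge to the
  integral over the closed disc.\<close>

lemma integral_cball_0:
  assumes u: "locint u" and z: "\<And>s. 0 < s \<Longrightarrow> sqrt s < 1 - cmod z \<Longrightarrow> Bi 3 u s z = 0"
    and r: "0 < r" "r < 1 - cmod z"
  shows "(LINT x|lebesgue. u x * indicator (cball z r) x) = 0"
proof -
  obtain R where R: "r < R" "R < 1 - cmod z" using dense[OF r(2)] by auto
  define s where "s = r\<^sup>2"
  have s: "0 < s" "sqrt s = r" using r by (auto simp: s_def)
  have sR: "s < R\<^sup>2" unfolding s_def using r R by (intro power_strict_mono) auto
  define h where "h n = (R\<^sup>2 - s) / 3 * inverse (real (Suc n))" for n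
  have h0: "0 < h n" for n using sR by (simp add: h_def)
  have h1: "s + 3 * h n \<le> R\<^sup>2" for n
  proof -
    have "(R\<^sup>2 - s) * inverse (real (Suc n)) \<le> (R\<^sup>2 - s) * 1"
      using sR by (intro mult_left_mono) (auto simp: field_simps)
    then show ?thesis by (simp add: h_def)
  qed
  have hl: "h \<longlonglongrightarrow> 0"
    unfolding h_def by (intro tendsto_mult_right_zero LIMSEQ_inverse_real_of_nat)
  have cR: "cball z R \<subseteq> disc" by (rule cball_subset_disc[OF R(2)])
  define g where "g \<zeta> = indicator (cball z R) \<zeta> *\<^sub>R u \<zeta>" for \<zeta>
  have g: "integrable lebesgue g"
    using u cR compact_cball by (auto simp: locint_def g_def[abs_def])
  define q where "q n \<zeta> = (bump 3 (s + 3 * h n) z \<zeta> - 3 * bump 3 (s + 2 * h n) z \<zeta> + 3 * bump 3 (s + h n) z \<zeta> - bump 3 s z \<zeta>) / (6 * h n ^ 3)" for n \<zeta>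
  have q1: "q n \<zeta> = 1" if "(cmod (\<zeta> - z))\<^sup>2 \<le> s" for n \<zeta>
  proof -
    define t where "t = s - (cmod (\<zeta> - z))\<^sup>2"
    have b: "bump 3 (s + c * h n) z \<zeta> = (t + c * h n)^3" if "0 \<le> c" for c
    proof -
      have "0 \<le> c * h n" using that h0[of n] by simp
      then have "0 \<le> t + c * h n" using \<open>(cmod (\<zeta> - z))\<^sup>2 \<le> s\<close> by (simp add: t_def)
      moreover have "s + c * h n - (cmod (\<zeta> - z))\<^sup>2 = t + c * h n" by (simp add: t_def)
      ultimately show ?thesis by (simp only: bump_def max_absorb2)
    qed
    have "q n \<zeta> = ((t + 3 * h n)^3 - 3 * (t + 2 * h n)^3 + 3 * (t + 1 * h n)^3 - (t + 0 * h n)^3) / (6 * h n ^ 3)"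
      using b[of 3] b[of 2] b[of 1] b[of 0] by (simp add: q_def)
    also have "(t + 3 * h n)^3 - 3 * (t + 2 * h n)^3 + 3 * (t + 1 * h n)^3 - (t + 0 * h n)^3 = 6 * h n ^ 3"
      by (simp add: power3_eq_cube algebra_simps)
    finally show ?thesis using h0[of n] by simp
  qed
  have q0: "q n \<zeta> = 0" if "3 * h n \<le> (cmod (\<zeta> - z))\<^sup>2 - s" for n \<zeta>
    using that h0[of n] by (simp add: q_def bump_zero)
  \<comment> \<open>Outside the disc each cut-off is at most \<open>(3 * h)^3\<close>; the
    coefficients \<open>1, 3, 3, 1\<close> add up to 8, and \<open>8 * 27 / 6 = 36\<close>.\<close>
  have qb: "\<bar>q n \<zeta>\<bar> \<le> 36" for n \<zeta>
  proof (cases "(cmod (\<zeta> - z))\<^sup>2 \<le> s")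
    case False
    have b: "0 \<le> bump 3 (s + c * h n) z \<zeta> \<and> bump 3 (s + c * h n) z \<zeta> \<le> (3 * h n)^3" if "0 \<le> c" "c \<le> 3" for c
    proof -
      have "c * h n \<le> 3 * h n" using that h0[of n] by (intro mult_right_mono) auto
      then have "s + c * h n - (cmod (\<zeta> - z))\<^sup>2 \<le> 3 * h n" using False by linarith
      then have "max 0 (s + c * h n - (cmod (\<zeta> - z))\<^sup>2) \<le> 3 * h n" using h0[of n] by (intro max.boundedI) auto
      then show ?thesis unfolding bump_def by (intro conjI power_mono) simp_all
    qed
    have "\<bar>bump 3 (s + 3 * h n) z \<zeta> - 3 * bump 3 (s + 2 * h n) z \<zeta> + 3 * bump 3 (s + h n) z \<zeta> - bump 3 s z \<zeta>\<bar> \<le> 8 * (3 * h n)^3"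
    proof -
      have "0 \<le> bump 3 (s + 3 * h n) z \<zeta> \<and> bump 3 (s + 3 * h n) z \<zeta> \<le> (3 * h n)^3"
        "0 \<le> bump 3 (s + 2 * h n) z \<zeta> \<and> bump 3 (s + 2 * h n) z \<zeta> \<le> (3 * h n)^3" by (rule b; simp)+
      moreover have "0 \<le> bump 3 (s + h n) z \<zeta> \<and> bump 3 (s + h n) z \<zeta> \<le> (3 * h n)^3"
        "0 \<le> bump 3 s z \<zeta> \<and> bump 3 s z \<zeta> \<le> (3 * h n)^3" using b[of 1] b[of 0] by simp_all
      ultimately show ?thesis by linarith
    qed
    also have "\<dots> = 36 * (6 * h n ^ 3)" by (simp add: power_mult_distrib)
    finally show ?thesis using h0[of n] by (simp add: q_def field_simps)
  qed (simp add: q1)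
  have ib: "integrable lebesgue (\<lambda>\<zeta>. g \<zeta> * of_real (bump 3 s' z \<zeta>))" for s'
  proof (rule integrable_mult_bounded_continuous[OF g])
    show "cmod (complex_of_real (bump 3 s' z x)) \<le> (max 0 s') ^ 3" for x
      using bump_le unfolding norm_of_real by simp
  qed (intro continuous_intros)
  have I0: "(LINT \<zeta>|lebesgue. g \<zeta> * of_real (bump 3 s' z \<zeta>)) = 0" if "0 < s'" "s' \<le> R\<^sup>2" for s'
  proof -
    have sq: "sqrt s' \<le> R" using that R r by (intro real_le_lsqrt) auto
    have "Bi 3 u s' z = (LINT \<zeta>|lebesgue. g \<zeta> * of_real (bump 3 s' z \<zeta>))"
      unfolding g_def by (rule Bi_restrict) (use sq in \<open>auto intro!: bump_outside\<close>)
    moreover have "Bi 3 u s' z = 0" by (rule z) (use that sq R in auto)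
    ultimately show ?thesis by simp
  qed
  have Q0: "(LINT \<zeta>|lebesgue. g \<zeta> * of_real (q n \<zeta>)) = 0" for n
  proof -
    define B where "B c \<zeta> = g \<zeta> * of_real (bump 3 (s + c * h n) z \<zeta>)" for c \<zeta>
    have e: "g \<zeta> * of_real (q n \<zeta>) = (B 3 \<zeta> - 3 * B 2 \<zeta> + 3 * B 1 \<zeta> - B 0 \<zeta>) / of_real (6 * h n ^ 3)" for \<zeta>
      by (simp add: q_def B_def algebra_simps diff_divide_distrib add_divide_distrib)
    have B0: "(LINT \<zeta>|lebesgue. B c \<zeta>) = 0" if "0 \<le> c" "c \<le> 3" for c
      unfolding B_def
    proof (rule I0)
      have "c * h n \<le> 3 * h n" using that h0[of n] by (intro mult_right_mono) auto
      then show "s + c * h n \<le> R\<^sup>2" using h1[of n] by linarith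
      show "0 < s + c * h n" using s that h0[of n] by (simp add: add_pos_nonneg)
    qed
    have Bi: "integrable lebesgue (B c)" for c unfolding B_def[abs_def] by (rule ib)
    show ?thesis unfolding e using Bi B0[of 3] B0[of 2] B0[of 1] B0[of 0] by simp
  qed
  have gm: "g \<in> borel_measurable lebesgue" using g by auto
  have qm: "(\<lambda>\<zeta>. complex_of_real (q n \<zeta>)) \<in> borel_measurable lebesgue" for n
    by (intro measurable_completion) (auto simp: q_def[abs_def])
  have "(\<lambda>n. LINT \<zeta>|lebesgue. g \<zeta> * of_real (q n \<zeta>)) \<longlonglongrightarrow> (LINT x|lebesgue. u x * indicator (cball z r) x)"
  proof (rule integral_dominated_convergence[where w = "\<lambda>\<zeta>. 36 * cmod (g \<zeta>)"])
    have "(\<lambda>x. u x * indicator (cball z r) x) = (\<lambda>x. g x * indicator (cball z r) x)"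
      using R by (auto simp: g_def indicator_def fun_eq_iff)
    moreover have "(\<lambda>x. indicator (cball z r) x :: complex) \<in> borel_measurable lebesgue"
      by (intro borel_measurable_indicator) auto
    ultimately show "(\<lambda>x. u x * indicator (cball z r) x) \<in> borel_measurable lebesgue"
      using gm by (simp add: borel_measurable_times)
    show "integrable lebesgue (\<lambda>\<zeta>. 36 * cmod (g \<zeta>))" using g by auto
    show "(\<lambda>\<zeta>. g \<zeta> * of_real (q n \<zeta>)) \<in> borel_measurable lebesgue" for n
      using gm qm[of n] by (rule borel_measurable_times)
    show "AE \<zeta> in lebesgue. norm (g \<zeta> * of_real (q n \<zeta>)) \<le> 36 * cmod (g \<zeta>)" for n
      using qb[of n] by (auto simp: norm_mult mult.commute intro!: mult_left_mono)
    show "AE \<zeta> in lebesgue. (\<lambda>n. g \<zeta> * of_real (q n \<zeta>)) \<longlonglongrightarrow> u \<zeta> * indicator (cball z r) \<zeta>"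
    proof (rule AE_I2)
      fix \<zeta>
      show "(\<lambda>n. g \<zeta> * of_real (q n \<zeta>)) \<longlonglongrightarrow> u \<zeta> * indicator (cball z r) \<zeta>"
      proof (cases "cmod (\<zeta> - z) \<le> r")
        case True
        then have "(cmod (\<zeta> - z))\<^sup>2 \<le> s" unfolding s_def by (intro power_mono) auto
        moreover have "\<zeta> \<in> cball z r" using True by (simp add: dist_norm norm_minus_commute)
        moreover then have "\<zeta> \<in> cball z R" using R by auto
        ultimately show ?thesis by (simp add: q1 g_def)
      next
        case False
        then have "s < (cmod (\<zeta> - z))\<^sup>2" unfolding s_def using r by (intro power_strict_mono) auto
        then have "\<forall>\<^sub>F n in sequentially. h n < ((cmod (\<zeta> - z))\<^sup>2 - s) / 3"
          using hl by (intro order_tendstoD) auto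
        then have "\<forall>\<^sub>F n in sequentially. g \<zeta> * of_real (q n \<zeta>) = 0"
          by eventually_elim (simp add: q0)
        moreover have "\<zeta> \<notin> cball z r" using False by (simp add: dist_norm norm_minus_commute)
        ultimately show ?thesis by (simp add: tendsto_eventually)
      qed
    qed
  qed
  then show ?thesis using Q0 by (simp add: LIMSEQ_const_iff)
qed

text \<open>\<open>V z\<close> is the common value of all normalised averages of \<open>N\<close>
  around \<open>z\<close>, which by homogeneity does not depend on the scale. Then
  \<open>N - V\<close> has vanishing averages at every point and scale, so its integral over every
  disc is zero and it vanishes almost everywhere.\<close>

theorem Weyl_dbar:
  assumes N: "wkhol N"
  obtains V where "V holomorphic_on disc" "AE z in lebesgue. z \<in> disc \<longrightarrow> N z = V z"
proof -
  have lN: "locint N" using N by (simp add: wkhol_def)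
  have "\<forall>z\<in>disc. \<exists>l. \<forall>s. 0 < s \<longrightarrow> sqrt s < 1 - cmod z \<longrightarrow> Bi 3 N s z = of_real (s^4) * l"
  proof
    fix z assume "z \<in> disc"
    then show "\<exists>l. \<forall>s. 0 < s \<longrightarrow> sqrt s < 1 - cmod z \<longrightarrow> Bi 3 N s z = of_real (s^4) * l"
      by (rule Bi_homogeneous[OF N]) blast
  qed
  from bchoice[OF this] obtain L where
    L: "\<And>z s. z \<in> disc \<Longrightarrow> 0 < s \<Longrightarrow> sqrt s < 1 - cmod z \<Longrightarrow> Bi 3 N s z = of_real (s^4) * L z"
    by blast
  define V where "V z = L z / of_real c0" for z
  have BV: "Bi 3 N s z = of_real (c0 * s^4) * V z" if "z \<in> disc" "0 < s" "sqrt s < 1 - cmod z" for z s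
    using L[OF that] c0_pos by (simp add: V_def)
  have hV: "V holomorphic_on disc"
    unfolding holomorphic_on_open[OF open_disc]
  proof
    fix z assume z: "z \<in> disc"
    \<comment> \<open>The one scale \<open>s = d^2\<close> is admissible for all centres in
      \<open>ball z d\<close>, so near \<open>z\<close> the function \<open>V\<close> is a fixed
      multiple of \<open>Bi 3 N s\<close>.\<close>
    define d where "d = (1 - cmod z) / 2"
    have d: "0 < d" using z by (simp add: d_def disc_def)
    define s where "s = d\<^sup>2"
    have s: "0 < s" "sqrt s = d" using d by (auto simp: s_def)
    obtain D where D: "((\<lambda>z. Bi 3 N s z) has_field_derivative D) (at z)"
      using Bi_holomorphic[OF N s(1), of z] s d by (auto simp: d_def)
    have "((\<lambda>z. Bi 3 N s z / of_real (c0 * s^4)) has_field_derivative D / of_real (c0 * s^4)) (at z)"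
      by (rule DERIV_cdivide[OF D])
    then have "(V has_field_derivative D / of_real (c0 * s^4)) (at z)"
    proof (rule has_field_derivative_transform_within_open)
      show "open (ball z d)" "z \<in> ball z d" using d by auto
      fix y assume "y \<in> ball z d"
      then have "cmod (y - z) < d" by (simp add: dist_norm norm_minus_commute)
      then have "d < 1 - cmod y" using norm_triangle_ineq2[of y z] by (simp add: d_def)
      then show "Bi 3 N s y / of_real (c0 * s^4) = V y"
        using BV[of y s] s d c0_pos by (simp add: disc_def)
    qed
    then show "\<exists>f'. (V has_field_derivative f') (at z)" by blast
  qed
  define u where "u z = N z - V z" for z
  have "wkhol u" unfolding u_def by (intro wkhol_diff N wkhol_holomorphic hV)
  then have lu: "locint u" by (simp add: wkhol_def)
  have lV: "locint V" using wkhol_holomorphic[OF hV] by (simp add: wkhol_def)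
  have Bu: "Bi 3 u s z = 0" if "z \<in> disc" "0 < s" "sqrt s < 1 - cmod z" for s z
  proof -
    have "Bi 3 u s z = Bi 3 N s z - Bi 3 V s z"
      using locint_bump_integrable'[OF lN _ that(3), of 3] locint_bump_integrable'[OF lV _ that(3), of 3]
      by (simp add: Bi_def u_def left_diff_distrib)
    then show ?thesis using BV[OF that] mean_value_bump[OF hV that(2,3)] by simp
  qed
  have cb: "(LINT x|lebesgue. u x * indicator (cball z r) x) = 0" if "0 < r" "r < 1 - cmod z" for z r
    by (rule integral_cball_0[OF lu Bu that]) (use that in \<open>auto simp: disc_def\<close>)
  \<comment> \<open>Exhaustion by smaller discs: \<open>u\<close> is only locally integrable, while
    \<open>lebesgue_zero_of_cballs\<close> needs an integrable function.\<close>
  have ae: "AE x in lebesgue. x \<in> ball 0 (1 - inverse (real (Suc n))) \<longrightarrow> u x = 0" for n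
  proof -
    let ?R = "1 - inverse (real (Suc n))"
    have R: "cball 0 ?R \<subseteq> disc" by (rule cball_subset_disc) simp
    define g where "g x = indicator (cball 0 ?R) x *\<^sub>R u x" for x
    have g: "integrable lebesgue g"
      using lu R compact_cball by (auto simp: locint_def g_def[abs_def])
    have "AE x in lebesgue. x \<in> ball 0 ?R \<longrightarrow> g x = 0"
    proof (rule lebesgue_zero_of_cballs[OF g open_ball])
      fix z :: complex and r :: real assume zr: "0 < r" "cball z r \<subseteq> ball 0 ?R"
      have "cball z r \<subseteq> cball 0 ?R" using zr(2) ball_subset_cball by blast
      from cball_subset_cball_iff[THEN iffD1, OF this] have "dist z 0 + r \<le> ?R" using zr(1) by linarith
      then have r1: "r < 1 - cmod z" 
      proof -
        have "0 < inverse (real (Suc n))" by simp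
        moreover have "dist z 0 = cmod z" by simp
        ultimately show ?thesis using \<open>dist z 0 + r \<le> ?R\<close> by linarith
      qed
      have "(\<lambda>x. g x * indicator (cball z r) x) = (\<lambda>x. u x * indicator (cball z r) x)"
        using \<open>cball z r \<subseteq> cball 0 ?R\<close> by (auto simp: g_def indicator_def fun_eq_iff)
      then show "(LINT x|lebesgue. g x * indicator (cball z r) x) = 0" using cb[OF zr(1) r1] by simp
    qed
    then show ?thesis by eventually_elim (auto simp: g_def)
  qed
  have "AE x in lebesgue. \<forall>n. x \<in> ball 0 (1 - inverse (real (Suc n))) \<longrightarrow> u x = 0"
    unfolding AE_all_countable using ae by blast
  then have "AE x in lebesgue. x \<in> disc \<longrightarrow> N x = V x"
  proof eventually_elim
    case (elim x)
    show ?case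
    proof
      assume "x \<in> disc"
      then have "0 < 1 - cmod x" by (simp add: disc_def)
      then obtain n where "inverse (real (Suc n)) < 1 - cmod x" using reals_Archimedean by blast
      then have "x \<in> ball 0 (1 - inverse (real (Suc n)))" by simp
      then show "N x = V x" using elim by (auto simp: u_def)
    qed
  qed
  then show ?thesis using that hV by blast
qed

section \<open>The Bergman space and its kernel\<close>

lemma test_cnj:
  assumes "\<xi> \<in> test"
  shows "(\<lambda>z. cnj (\<xi> z)) \<in> test" "dz (\<lambda>z. cnj (\<xi> z)) = (\<lambda>z. cnj (dzb \<xi> z))"
proof -
  obtain S pp pq qq where "test_data \<xi> S pp pq qq"
    using testE[OF assms] .
  note a = test_dataD[OF this]
  have p: "has_pd 1 (\<lambda>z. cnj (\<xi> z)) (\<lambda>z. cnj (pdv 1 \<xi> z)) UNIV" "has_pd \<i> (\<lambda>z. cnj (\<xi> z)) (\<lambda>z. cnj (pdv \<i> \<xi> z)) UNIV"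
    by (intro has_pd_cnj a)+
  show "(\<lambda>z. cnj (\<xi> z)) \<in> test"
  proof (rule testI[OF a(1,2) _ p])
    show "has_pd 1 (\<lambda>z. cnj (pdv 1 \<xi> z)) (\<lambda>z. cnj (pp z)) UNIV" "has_pd \<i> (\<lambda>z. cnj (pdv 1 \<xi> z)) (\<lambda>z. cnj (pq z)) UNIV"
      "has_pd 1 (\<lambda>z. cnj (pdv \<i> \<xi> z)) (\<lambda>z. cnj (pq z)) UNIV" "has_pd \<i> (\<lambda>z. cnj (pdv \<i> \<xi> z)) (\<lambda>z. cnj (qq z)) UNIV"
      by (intro has_pd_cnj a)+
  qed (use a in \<open>auto intro!: continuous_intros\<close>)
  show "dz (\<lambda>z. cnj (\<xi> z)) = (\<lambda>z. cnj (dzb \<xi> z))"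
    unfolding dz_def dzb_def pdv_eq[OF p(1)] pdv_eq[OF p(2)] by simp
qed

lemma dz_continuous: "\<xi> \<in> test \<Longrightarrow> continuous_on UNIV (dz \<xi>)"
  by (elim testE) (auto simp: dz_def[abs_def] intro!: continuous_intros dest: test_dataD(7,8))

lemma test_continuous: "\<xi> \<in> test \<Longrightarrow> continuous_on UNIV \<xi>"
  by (elim testE) (rule test_dataD(6))

lemma test_outside: "\<xi> \<in> test \<Longrightarrow> z \<notin> disc \<Longrightarrow> \<xi> z = 0" "\<xi> \<in> test \<Longrightarrow> z \<notin> disc \<Longrightarrow> dz \<xi> z = 0" "\<xi> \<in> test \<Longrightarrow> z \<notin> disc \<Longrightarrow> dzb \<xi> z = 0"
  by (elim testE; use test_dataD(2,3,4,5) in \<open>fastforce simp: dz_def dzb_def\<close>)+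

lemma disc_lebesgue [measurable]: "disc \<in> sets lebesgue" "disc \<in> sets lborel" "disc \<in> sets borel"
  by (auto simp: disc_def)

text \<open>Continuity of \<open>w\<close> comes from \<open>w = exp (- \<phi>)\<close> in the
  application. It gives measurability and upper bounds on compact sets; the lower bounds are part of
  \<open>is_weight\<close>.\<close>

locale weighted =
  fixes w :: "complex \<Rightarrow> real"
  assumes wt: "is_weight w" and wcont: "continuous_on disc w"
begin

abbreviation "Ld \<equiv> lebesgue_on disc"

definition M :: "complex measure" where
  "M = density Ld (\<lambda>z. ennreal (w z))"

lemma w_pos: "z \<in> disc \<Longrightarrow> 0 < w z"
  using wt by (auto simp: is_weight_def)

lemma space_M [simp]: "space M = disc"
  by (simp add: M_def space_restrict_space)

lemma borel_M [simp]: "borel_measurable M = borel_measurable Ld"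
  unfolding M_def by (rule measurable_cong_sets) auto

lemma w_meas [measurable]: "w \<in> borel_measurable Ld"
  by (intro continuous_imp_measurable_on_sets_lebesgue wcont) auto

lemma cont_meas: "continuous_on disc f \<Longrightarrow> f \<in> borel_measurable Ld"
  by (intro continuous_imp_measurable_on_sets_lebesgue) auto

lemma AE_w: "AE z in Ld. 0 \<le> w z"
  using w_pos by (intro AE_I2) (auto simp: space_restrict_space less_imp_le)

lemma meas_Ld_iff: "f \<in> borel_measurable Ld \<longleftrightarrow> (\<lambda>z. indicator disc z *\<^sub>R f z) \<in> borel_measurable lebesgue"
  for f :: "complex \<Rightarrow> 'a::real_normed_vector"
  by (rule borel_measurable_restrict_space_iff) auto

lemma integral_M:
  fixes h :: "complex \<Rightarrow> 'a::{banach, second_countable_topology}"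
  assumes "h \<in> borel_measurable Ld"
  shows "integral\<^sup>L M h = (LINT z|lebesgue. indicator disc z *\<^sub>R (w z *\<^sub>R h z))"
proof -
  have "integral\<^sup>L M h = (LINT z|Ld. w z *\<^sub>R h z)"
    unfolding M_def by (rule integral_density) (use assms AE_w in auto)
  also have "\<dots> = (LINT z|lebesgue. indicator disc z *\<^sub>R (w z *\<^sub>R h z))"
    by (rule integral_restrict_space) auto
  finally show ?thesis .
qed

lemma integrable_M:
  fixes h :: "complex \<Rightarrow> 'a::{banach, second_countable_topology}"
  assumes "h \<in> borel_measurable Ld"
  shows "integrable M h \<longleftrightarrow> integrable lebesgue (\<lambda>z. indicator disc z *\<^sub>R (w z *\<^sub>R h z))"
proof -
  have "integrable M h \<longleftrightarrow> integrable Ld (\<lambda>z. w z *\<^sub>R h z)"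
    unfolding M_def by (rule integrable_density) (use assms AE_w in auto)
  also have "\<dots> \<longleftrightarrow> integrable lebesgue (\<lambda>z. indicator disc z *\<^sub>R (w z *\<^sub>R h z))"
    by (rule integrable_restrict_space) auto
  finally show ?thesis .
qed

lemma nn_integral_M:
  assumes "h \<in> borel_measurable Ld"
  shows "integral\<^sup>N M h = (\<integral>\<^sup>+z. ennreal (w z) * h z * indicator disc z \<partial>lebesgue)"
  unfolding M_def
  by (subst nn_integral_density) (use assms in \<open>auto simp: nn_integral_restrict_space\<close>)

lemma nsq_eq:
  assumes "f \<in> borel_measurable Ld"
  shows "nsq w f = sqn M f"
proof -
  have "(\<lambda>z. ennreal ((cmod (f z))\<^sup>2)) \<in> borel_measurable Ld" using assms by measurable
  then show ?thesis
    unfolding nsq_def sqn_def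
    by (subst nn_integral_M)
       (auto intro!: nn_integral_cong simp: ennreal_mult'' mult.commute indicator_def)
qed

lemma L2w_eq: "L2w w = L2 M"
proof -
  have *: "f \<in> L2w w \<longleftrightarrow> f \<in> borel_measurable Ld \<and> nsq w f < \<infinity>" for f
    by (simp add: L2w_def set_borel_measurable_def meas_Ld_iff)
  show ?thesis
  proof (rule set_eqI)
    fix f show "f \<in> L2w w \<longleftrightarrow> f \<in> L2 M"
      unfolding * L2_iff_sqn borel_M by (rule conj_cong[OF refl]) (simp only: nsq_eq)
  qed
qed

lemma L2M_meas: "f \<in> L2 M \<Longrightarrow> f \<in> borel_measurable Ld"
  using L2_meas[of f M] by simp

lemma nsq_L2: "f \<in> L2 M \<Longrightarrow> nsq w f = ennreal ((nrm M f)\<^sup>2)"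
  using L2M_meas by (simp add: nsq_eq sqn_L2)

lemma wnorm_eq: "f \<in> L2 M \<Longrightarrow> wnorm w f = nrm M f"
  by (simp add: wnorm_def nsq_L2)

lemma winner_eq:
  assumes "f \<in> borel_measurable Ld" "g \<in> borel_measurable Ld"
  shows "winner w f g = ip M f g"
proof -
  have "(\<lambda>z. f z * cnj (g z)) \<in> borel_measurable Ld" using assms by measurable
  then show ?thesis
    unfolding winner_def ip_def set_lebesgue_integral_def
    by (subst integral_M) (auto intro!: Bochner_Integration.integral_cong simp: scaleR_conv_of_real mult_ac)
qed

lemma winner_L2: "f \<in> L2 M \<Longrightarrow> g \<in> L2 M \<Longrightarrow> winner w f g = ip M f g"
  by (intro winner_eq L2M_meas)

lemma w_bounds:
  assumes "compact S" "S \<subseteq> disc"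
  obtains c C where "0 < c" "0 < C" "\<And>z. z \<in> S \<Longrightarrow> c \<le> w z" "\<And>z. z \<in> S \<Longrightarrow> w z \<le> C"
proof -
  obtain c where c: "c > 0" "\<forall>z\<in>S. c \<le> w z" using wt assms by (auto simp: is_weight_def)
  have "bounded (w ` S)"
    by (intro compact_imp_bounded compact_continuous_image assms continuous_on_subset[OF wcont])
  then obtain C where "0 < C" "\<And>z. z \<in> S \<Longrightarrow> \<bar>w z\<bar> \<le> C" by (auto simp: bounded_pos)
  then show ?thesis using c that[of c C] by fastforce
qed

lemma L2_locint:
  assumes "f \<in> L2 M" shows "locint f"
  unfolding locint_def
proof (intro allI impI)
  fix S assume S: "compact S \<and> S \<subseteq> disc"
  obtain c C where c: "0 < c" "\<And>z. z \<in> S \<Longrightarrow> c \<le> w z" using w_bounds[of S] S by metis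
  have fm: "f \<in> borel_measurable Ld" by (rule L2M_meas[OF assms])
  have Sm: "S \<in> sets lebesgue" using S by (intro fmeasurableD lmeasurable_compact) auto
  have "integrable M (\<lambda>x. (cmod (f x))\<^sup>2)" using assms by (auto simp: L2_def)
  then have i: "integrable lebesgue (\<lambda>z. indicator disc z *\<^sub>R (w z *\<^sub>R (cmod (f z))\<^sup>2))"
    by (subst (asm) integrable_M) (use fm in measurable)
  have "integrable lebesgue (\<lambda>z. indicator S z + inverse c * (indicator disc z *\<^sub>R (w z *\<^sub>R (cmod (f z))\<^sup>2)))"
    using i S by (intro Bochner_Integration.integrable_add integrable_mult_right integrable_real_indicator Sm)
       (use lmeasurable_compact[of S] S in \<open>auto simp: fmeasurable_def\<close>)
  then show "integrable lebesgue (\<lambda>z. indicator S z *\<^sub>R f z)"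
  proof (rule Bochner_Integration.integrable_bound)
    have "(\<lambda>z. indicator S z *\<^sub>R (indicator disc z *\<^sub>R f z)) \<in> borel_measurable lebesgue"
      using Sm fm[unfolded meas_Ld_iff] by measurable
    also have "(\<lambda>z. indicator S z *\<^sub>R (indicator disc z *\<^sub>R f z)) = (\<lambda>z. indicator S z *\<^sub>R f z)"
      using S by (auto simp: indicator_def fun_eq_iff)
    finally show "(\<lambda>z. indicator S z *\<^sub>R f z) \<in> borel_measurable lebesgue" .
    show "AE z in lebesgue. norm (indicator S z *\<^sub>R f z) \<le> norm (indicator S z + inverse c * (indicator disc z *\<^sub>R (w z *\<^sub>R (cmod (f z))\<^sup>2)))"
    proof (rule AE_I2)
      fix z
      show "norm (indicator S z *\<^sub>R f z) \<le> norm (indicator S z + inverse c * (indicator disc z *\<^sub>R (w z *\<^sub>R (cmod (f z))\<^sup>2)))"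
      proof (cases "z \<in> S")
        case True
        have "cmod (f z) \<le> 1 + (cmod (f z))\<^sup>2"
          using sum_squares_bound[of 1 "cmod (f z)"] by simp (smt (verit) norm_ge_zero)
        also have "\<dots> \<le> 1 + inverse c * (w z * (cmod (f z))\<^sup>2)"
          using mult_right_mono[OF c(2)[OF True], of "(cmod (f z))\<^sup>2"] c(1) by (simp add: field_simps)
        finally show ?thesis using True S by (auto intro: order_trans[OF _ abs_ge_self])
      qed simp
    qed
  qed
qed

text \<open>\<open>Dw \<xi>\<close> is minus the adjoint of \<open>\<partial>\<close>-bar in \<open>L\<^sup>2(w dA)\<close>, applied to \<open>\<xi> / w\<close>.\<close>

definition Dw :: "(complex \<Rightarrow> complex) \<Rightarrow> complex \<Rightarrow> complex" where
  "Dw \<xi> z = dz \<xi> z / of_real (w z)"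

lemma w_nz: "z \<in> disc \<Longrightarrow> w z \<noteq> 0" using w_pos by fastforce

lemma compact_support_L2:
  assumes S: "compact S" "S \<subseteq> disc" and h: "continuous_on disc h" "\<And>z. z \<notin> S \<Longrightarrow> h z = 0"
  shows "h \<in> L2 M"
proof -
  have "integrable M (\<lambda>z. (cmod (h z))\<^sup>2)"
  proof (subst integrable_M)
    show m: "(\<lambda>z. (cmod (h z))\<^sup>2) \<in> borel_measurable Ld" by (intro cont_meas continuous_intros h)
    have "integrable lebesgue (\<lambda>z. w z *\<^sub>R (cmod (h z))\<^sup>2)"
    proof (rule integrable_continuous_compact_support(2)[OF _ S(1)])
      show "continuous_on UNIV (\<lambda>z. w z *\<^sub>R (cmod (h z))\<^sup>2)"
        by (rule continuous_on_extend_zero[OF _ open_disc compact_imp_closed[OF S(1)] S(2)])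
           (use h wcont in \<open>auto intro!: continuous_intros\<close>)
    qed (use h in auto)
    also have "(\<lambda>z. w z *\<^sub>R (cmod (h z))\<^sup>2) = (\<lambda>z. indicator disc z *\<^sub>R (w z *\<^sub>R (cmod (h z))\<^sup>2))"
      using h(2) S(2) by (auto simp: indicator_def fun_eq_iff)
    finally show "integrable lebesgue (\<lambda>z. indicator disc z *\<^sub>R w z *\<^sub>R (cmod (h z))\<^sup>2)" .
  qed
  then show ?thesis using cont_meas[OF h(1)] by (simp add: L2_def)
qed

lemma div_w_continuous: "continuous_on UNIV h \<Longrightarrow> continuous_on disc (\<lambda>z. h z / complex_of_real (w z))"
  by (intro continuous_intros continuous_on_subset[of UNIV h disc] continuous_on_subset[OF wcont]) (auto dest: w_nz)

lemma Dw_L2: assumes "\<xi> \<in> test" shows "Dw \<xi> \<in> L2 M"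
proof -
  obtain S pp pq qq where "test_data \<xi> S pp pq qq"
    using testE[OF assms] .
  note a = test_dataD[OF this]
  show ?thesis
    unfolding Dw_def[abs_def]
    by (rule compact_support_L2[OF a(1,2) div_w_continuous[OF dz_continuous[OF assms]]])
       (use a in \<open>auto simp: dz_def\<close>)
qed

text \<open>Dividing by \<open>w\<close> cancels the density of \<open>M\<close>, so that pairings
  in \<open>L2 M\<close> become the unweighted integrals of the weak formulation.\<close>

lemma ip_div_w:
  assumes "f \<in> borel_measurable Ld" "continuous_on UNIV h" "\<And>z. z \<notin> disc \<Longrightarrow> h z = 0"
  shows "ip M f (\<lambda>z. h z / of_real (w z)) = (LINT z|lebesgue. f z * cnj (h z))"
proof -
  have "(\<lambda>z. h z / complex_of_real (w z)) \<in> borel_measurable Ld"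
    by (intro cont_meas div_w_continuous assms)
  then have "(\<lambda>z. f z * cnj (h z / of_real (w z))) \<in> borel_measurable Ld" using assms(1) by measurable
  moreover have "h x = 0" if "w x = 0" for x using assms(3) w_nz that by metis
  ultimately show ?thesis
    unfolding ip_def
    by (subst integral_M)
       (auto intro!: Bochner_Integration.integral_cong simp: assms(3) indicator_def scaleR_conv_of_real)
qed

lemma ip_Dw: "f \<in> L2 M \<Longrightarrow> \<xi> \<in> test \<Longrightarrow> ip M f (Dw \<xi>) = (LINT z|lebesgue. f z * cnj (dz \<xi> z))"
  unfolding Dw_def[abs_def] by (intro ip_div_w L2M_meas dz_continuous test_outside)

text \<open>Conjugation maps \<open>test\<close> to itself and exchanges \<open>dz\<close> with
  \<open>dzb\<close>, so orthogonality to the range of \<open>Dw\<close> is the weak Cauchy-Riemann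
  equation.\<close>

lemma wkhol_of_orth:
  assumes "N \<in> L2 M" "\<And>\<xi>. \<xi> \<in> test \<Longrightarrow> ip M N (Dw \<xi>) = 0"
  shows "wkhol N"
  unfolding wkhol_def
proof (intro conjI ballI L2_locint assms)
  fix \<xi> assume t: "\<xi> \<in> test"
  have "ip M N (Dw (\<lambda>z. cnj (\<xi> z))) = 0" by (intro assms test_cnj t)
  then show "(LINT z|lebesgue. N z * dzb \<xi> z) = 0"
    by (simp add: ip_Dw assms(1) test_cnj[OF t])
qed

lemma AE_M_lebesgue: "AE z in lebesgue. z \<in> disc \<longrightarrow> P z \<Longrightarrow> AE z in M. P z"
  unfolding M_def by (subst AE_density) (auto simp: AE_restrict_space_iff)

lemma A2w_eq: "A2w w = {f. f holomorphic_on disc \<and> f \<in> L2 M}"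
  by (simp add: A2w_def L2w_eq)

lemma A2w_L2: "f \<in> A2w w \<Longrightarrow> f \<in> L2 M" by (simp add: A2w_eq)

lemma holomorphic_representative:
  assumes "N \<in> L2 M" "\<And>\<xi>. \<xi> \<in> test \<Longrightarrow> ip M N (Dw \<xi>) = 0"
  obtains V where "V \<in> A2w w" "AE z in M. N z = V z"
proof -
  obtain V where V: "V holomorphic_on disc" "AE z in lebesgue. z \<in> disc \<longrightarrow> N z = V z"
    using Weyl_dbar[OF wkhol_of_orth[OF assms]] by blast
  have Vm: "V \<in> borel_measurable Ld" by (intro cont_meas holomorphic_on_imp_continuous_on V)
  have ae: "AE z in M. N z = V z" by (rule AE_M_lebesgue[OF V(2)])
  have "integrable M (\<lambda>z. (cmod (V z))\<^sup>2) \<longleftrightarrow> integrable M (\<lambda>z. (cmod (N z))\<^sup>2)"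
    by (intro integrable_cong_AE) (use ae Vm L2M_meas[OF assms(1)] in \<open>auto elim!: eventually_mono\<close>)
  then have "V \<in> A2w w" using assms(1) V(1) Vm by (simp add: A2w_eq L2_def)
  then show ?thesis using ae that by blast
qed

lemma ip_A2w_Dw: "f \<in> A2w w \<Longrightarrow> \<xi> \<in> test \<Longrightarrow> ip M f (Dw \<xi>) = 0"
proof -
  assume f: "f \<in> A2w w" and t: "\<xi> \<in> test"
  have "(LINT z|lebesgue. f z * dzb (\<lambda>z. cnj (\<xi> z)) z) = 0"
    using f by (intro holomorphic_test_0 test_cnj t) (simp add: A2w_eq)
  moreover have "cnj (dzb (\<lambda>z. cnj (\<xi> z)) z) = dz (\<lambda>z. cnj (cnj (\<xi> z))) z" for z
    using test_cnj(2)[OF test_cnj(1)[OF t]] by (simp add: fun_eq_iff)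
  then have "dzb (\<lambda>z. cnj (\<xi> z)) z = cnj (dz \<xi> z)" for z
    by (metis (no_types, lifting) complex_cnj_cnj ext)
  ultimately show ?thesis by (simp add: ip_Dw A2w_L2[OF f] t)
qed

lemma ip_limit:
  assumes "\<And>n::nat. s n \<in> L2 M" "v \<in> L2 M" "(\<lambda>n. nrm M (\<lambda>x. s n x - v x)) \<longlonglongrightarrow> 0" "g \<in> L2 M"
  shows "(\<lambda>n. ip M (s n) g) \<longlonglongrightarrow> ip M v g"
proof -
  have "(\<lambda>n. ip M (s n) g - ip M v g) \<longlonglongrightarrow> 0"
  proof (rule Lim_null_comparison)
    show "(\<lambda>n. nrm M (\<lambda>x. s n x - v x) * nrm M g) \<longlonglongrightarrow> 0"
      using tendsto_mult_left_zero[OF assms(3)] .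
    show "\<forall>\<^sub>F n in sequentially. norm (ip M (s n) g - ip M v g) \<le> nrm M (\<lambda>x. s n x - v x) * nrm M g"
      using L2_Cauchy_Schwarz[OF L2_diff[OF assms(1,2)] assms(4)]
      by (intro always_eventually allI) (simp add: ip_diff_left assms)
  qed
  then show ?thesis by (simp add: LIM_zero_iff)
qed

lemma A2w_lin: "\<alpha> \<in> A2w w \<Longrightarrow> \<beta> \<in> A2w w \<Longrightarrow> (\<lambda>x. c * \<alpha> x + \<beta> x) \<in> A2w w"
  by (auto simp: A2w_eq intro!: holomorphic_intros L2_lin)

lemma zero_A2w: "(\<lambda>x. 0) \<in> A2w w"
  by (auto simp: A2w_eq L2_zero)

lemma ip_cong_AE:
  assumes "AE z in M. f z = g z" "f \<in> borel_measurable M" "g \<in> borel_measurable M" "h \<in> borel_measurable M"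
  shows "ip M h f = ip M h g" "ip M f h = ip M g h"
  unfolding ip_def
  by (intro integral_cong_AE; use assms in \<open>auto elim!: eventually_mono\<close>)+

text \<open>The representing \<open>v\<close> is an \<open>L2\<close> limit of members of
  \<open>A2w w\<close>. These are orthogonal to the range of \<open>Dw\<close>, hence so is
  \<open>v\<close>, and Weyl's lemma replaces it by a holomorphic representative.\<close>

lemma A2w_Riesz:
  assumes lin: "\<And>c \<alpha> \<beta>. \<alpha> \<in> A2w w \<Longrightarrow> \<beta> \<in> A2w w \<Longrightarrow> l (\<lambda>x. c * \<alpha> x + \<beta> x) = c * l \<alpha> + l \<beta>"
    and lB: "\<And>\<alpha>. \<alpha> \<in> A2w w \<Longrightarrow> cmod (l \<alpha>) \<le> B * nrm M \<alpha>" and B: "0 \<le> B"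
  obtains V where "V \<in> A2w w" "\<And>\<alpha>. \<alpha> \<in> A2w w \<Longrightarrow> ip M \<alpha> V = l \<alpha>"
proof -
  obtain v s where v: "v \<in> L2 M" "\<And>n::nat. s n \<in> A2w w" "(\<lambda>n. nrm M (\<lambda>x. s n x - v x)) \<longlonglongrightarrow> 0"
    "\<And>\<alpha>. \<alpha> \<in> A2w w \<Longrightarrow> ip M \<alpha> v = l \<alpha>" "nrm M v \<le> B"
    by (rule L2_Riesz[where T = "A2w w" and D = "\<lambda>f. f" and M = M and l = l and B = B])
       (use A2w_lin zero_A2w A2w_L2 lin lB B in auto)
  have "ip M v (Dw \<xi>) = 0" if "\<xi> \<in> test" for \<xi>
  proof -
    have "(\<lambda>n. ip M (s n) (Dw \<xi>)) \<longlonglongrightarrow> ip M v (Dw \<xi>)"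
      by (intro ip_limit A2w_L2 v Dw_L2 that)
    then show ?thesis using ip_A2w_Dw[OF v(2) that] LIMSEQ_unique by (simp add: LIMSEQ_const_iff)
  qed
  then obtain V where V: "V \<in> A2w w" "AE z in M. v z = V z"
    using holomorphic_representative[OF v(1)] by blast
  have "ip M \<alpha> V = l \<alpha>" if "\<alpha> \<in> A2w w" for \<alpha>
    using v(4)[OF that] ip_cong_AE(1)[OF V(2) L2_meas L2_meas L2_meas, of \<alpha>] v(1) V(1) that A2w_L2 by metis
  then show ?thesis using that V by blast
qed

text \<open>The mean value property writes \<open>f z\<close> as a multiple of the pairing of
  \<open>f\<close> with \<open>bump / w\<close>. The norm of the latter is uniformly bounded for
  \<open>cmod z \<le> r\<close>, because its support stays in \<open>cball 0 R\<close>, where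
  \<open>w\<close> has a positive lower bound.\<close>

lemma eval_bound:
  assumes "0 \<le> r" "r < 1"
  obtains B where "0 < B" "\<And>f z. f \<in> A2w w \<Longrightarrow> cmod z \<le> r \<Longrightarrow> cmod (f z) \<le> B * nrm M f"
proof -
  define R where "R = (1 + r) / 2"
  have R: "r < R" "R < 1" using assms by (auto simp: R_def)
  define s where "s = (R - r)\<^sup>2"
  have s: "0 < s" "sqrt s = R - r" using R by (auto simp: s_def)
  have s1: "s \<le> 1" using R assms by (auto simp: s_def power_le_one)
  have S: "compact (cball (0::complex) R)" "cball 0 R \<subseteq> disc" using R by (auto simp: disc_def)
  obtain c C where c: "0 < c" "0 < C" "\<And>z. z \<in> cball 0 R \<Longrightarrow> c \<le> w z" "\<And>z. z \<in> cball 0 R \<Longrightarrow> w z \<le> C"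
    using w_bounds[OF S] by metis
  define I where "I = (LINT z|lebesgue. indicator (cball 0 R) (z::complex) / c)"
  have "cmod (f z) \<le> (sqrt (\<bar>I\<bar> + 1) / (c0 * s^4)) * nrm M f" if f: "f \<in> A2w w" and z: "cmod z \<le> r" for f z
  proof -
    have sz: "sqrt s < 1 - cmod z" using s z R by simp
    have zd: "z \<in> disc" using z assms by (simp add: disc_def)
    let ?g = "\<lambda>\<zeta>. complex_of_real (bump 3 s z \<zeta>) / of_real (w \<zeta>)"
    have out: "bump 3 s z \<zeta> = 0" if "\<zeta> \<notin> cball 0 R" for \<zeta>
    proof (rule bump_outside)
      show "\<zeta> \<notin> cball z (sqrt s)"
      proof
        assume "\<zeta> \<in> cball z (sqrt s)"
        then have "cmod (\<zeta> - z) \<le> R - r" using s by (simp add: dist_norm norm_minus_commute)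
        then show False using that z norm_triangle_ineq2[of \<zeta> z] by simp
      qed
    qed simp
    have outD: "bump 3 s z \<zeta> = 0" if "\<zeta> \<notin> disc" for \<zeta> using out S(2) that by blast
    have gL: "?g \<in> L2 M"
      by (rule compact_support_L2[OF S]) (use out in \<open>auto intro!: div_w_continuous continuous_intros\<close>)
    have "of_real (c0 * s^4) * f z = Bi 3 f s z"
      using f by (intro mean_value_bump[symmetric] s sz) (simp add: A2w_eq)
    also have "\<dots> = ip M f ?g"
      unfolding Bi_def using outD
      by (subst ip_div_w) (auto intro!: L2M_meas A2w_L2 f continuous_intros)
    also have "cmod \<dots> \<le> nrm M f * nrm M ?g" by (intro L2_Cauchy_Schwarz A2w_L2 f gL)
    also have "nrm M ?g \<le> sqrt (\<bar>I\<bar> + 1)"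
    proof -
      have m: "(\<lambda>z. (cmod (?g z))\<^sup>2) \<in> borel_measurable Ld" using L2M_meas[OF gL] by measurable
      have "(nrm M ?g)\<^sup>2 = (LINT \<zeta>|lebesgue. indicator disc \<zeta> *\<^sub>R (w \<zeta> *\<^sub>R (cmod (?g \<zeta>))\<^sup>2))"
        unfolding nrm_sq by (rule integral_M[OF m])
      also have "\<dots> \<le> I" unfolding I_def
      proof (rule integral_mono)
        show "integrable lebesgue (\<lambda>\<zeta>. indicator disc \<zeta> *\<^sub>R (w \<zeta> *\<^sub>R (cmod (?g \<zeta>))\<^sup>2))"
          using gL integrable_M[OF m] by (simp add: L2_def)
        show "integrable lebesgue (\<lambda>z. indicator (cball 0 R) (z::complex) / c)"
          using emeasure_bounded_finite[of "cball (0::complex) R"]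
          by (intro Bochner_Integration.integrable_divide integrable_real_indicator) auto
        fix \<zeta>
        show "indicator disc \<zeta> *\<^sub>R (w \<zeta> *\<^sub>R (cmod (?g \<zeta>))\<^sup>2) \<le> indicator (cball 0 R) \<zeta> / c"
        proof (cases "\<zeta> \<in> cball 0 R")
          case True
          have w: "0 < w \<zeta>" "c \<le> w \<zeta>" "\<zeta> \<in> disc" using True S w_pos c by auto
          have "bump 3 s z \<zeta> \<le> max 0 s ^ 3" by (rule bump_le)
          also have "\<dots> \<le> 1" using s s1 by (simp add: power_le_one)
          finally have "(bump 3 s z \<zeta>)\<^sup>2 \<le> 1" by (simp add: power_le_one)
          moreover have "w \<zeta> * (cmod (?g \<zeta>))\<^sup>2 = (bump 3 s z \<zeta>)\<^sup>2 / w \<zeta>"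
            using w by (simp add: norm_divide power_divide) (simp add: power2_eq_square)
          ultimately have "w \<zeta> * (cmod (?g \<zeta>))\<^sup>2 \<le> 1 / c"
            using w c(1) by (simp add: frac_le)
          then show ?thesis using True w by simp
        next
          case False then show ?thesis using out[OF False] by simp
        qed
      qed
      finally have "(nrm M ?g)\<^sup>2 \<le> \<bar>I\<bar> + 1" by linarith
      then show ?thesis by (rule real_le_rsqrt)
    qed
    finally have "cmod (of_real (c0 * s^4) * f z) \<le> nrm M f * sqrt (\<bar>I\<bar> + 1)"
      by (simp add: mult_left_mono)
    moreover have "cmod (of_real (c0 * s^4) * f z) = (c0 * s^4) * cmod (f z)"
      unfolding norm_mult norm_of_real using c0_pos s by simp
    ultimately show ?thesis using c0_pos s by (simp add: field_simps)
  qed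
  then show ?thesis using that[of "sqrt (\<bar>I\<bar> + 1) / (c0 * s^4)"] c0_pos s by simp
qed

text \<open>\<open>kern\<close> is defined by choice; boundedness of point evaluation shows that
  there is something to choose, and any choice has the reproducing property.\<close>

lemma kern_props:
  assumes z: "z \<in> disc"
  shows "kern w z \<in> A2w w" "\<And>f. f \<in> A2w w \<Longrightarrow> f z = ip M f (kern w z)"
proof -
  obtain B where B: "0 < B" "\<And>f x. f \<in> A2w w \<Longrightarrow> cmod x \<le> cmod z \<Longrightarrow> cmod (f x) \<le> B * nrm M f"
    using eval_bound[of "cmod z"] z by (auto simp: disc_def)
  obtain V where V: "V \<in> A2w w" "\<And>\<alpha>. \<alpha> \<in> A2w w \<Longrightarrow> ip M \<alpha> V = \<alpha> z"
    by (rule A2w_Riesz[of "\<lambda>f. f z" B]) (use B in auto)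
  have "V \<in> A2w w \<and> (\<forall>f\<in>A2w w. f z = winner w f V)"
    using V A2w_L2 by (auto simp: winner_L2)
  then have "kern w z \<in> A2w w \<and> (\<forall>f\<in>A2w w. f z = winner w f (kern w z))"
    unfolding kern_def by (rule someI[where P = "\<lambda>k. k \<in> A2w w \<and> (\<forall>f\<in>A2w w. f z = winner w f k)"])
  then show "kern w z \<in> A2w w" "\<And>f. f \<in> A2w w \<Longrightarrow> f z = ip M f (kern w z)"
    using A2w_L2 by (auto simp: winner_L2)
qed

text \<open>As for \<open>kern\<close>, existence validates the choice; the functional represented
  in \<open>A2w w\<close> is the pairing with \<open>f\<close>.\<close>

lemma proj_props:
  assumes f: "f \<in> L2 M"
  shows "proj w f \<in> A2w w" "\<And>h. h \<in> A2w w \<Longrightarrow> ip M (\<lambda>z. f z - proj w f z) h = 0"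
proof -
  obtain V where V: "V \<in> A2w w" "\<And>\<alpha>. \<alpha> \<in> A2w w \<Longrightarrow> ip M \<alpha> V = ip M \<alpha> f"
  proof (rule A2w_Riesz[of "\<lambda>h. ip M h f" "nrm M f"])
    show "cmod (ip M \<alpha> f) \<le> nrm M f * nrm M \<alpha>" if "\<alpha> \<in> A2w w" for \<alpha>
      using L2_Cauchy_Schwarz[OF A2w_L2[OF that] f] by (simp add: mult.commute)
  qed (auto intro!: ip_lin_left A2w_L2 f)
  have "winner w (\<lambda>z. f z - V z) h = 0" if h: "h \<in> A2w w" for h
  proof -
    have "winner w (\<lambda>z. f z - V z) h = cnj (ip M h f) - cnj (ip M h V)"
      using f h V(1) A2w_L2 by (subst winner_L2) (auto simp: ip_diff_right L2_diff ip_cnj[of M _ h])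
    then show ?thesis using V(2)[OF h] by simp
  qed
  then have "V \<in> A2w w \<and> (\<forall>h\<in>A2w w. winner w (\<lambda>z. f z - V z) h = 0)" using V by blast
  then have p: "proj w f \<in> A2w w \<and> (\<forall>h\<in>A2w w. winner w (\<lambda>z. f z - proj w f z) h = 0)"
    unfolding proj_def
    by (rule someI[where P = "\<lambda>g. g \<in> A2w w \<and> (\<forall>h\<in>A2w w. winner w (\<lambda>z. f z - g z) h = 0)"])
  show "proj w f \<in> A2w w" using p by simp
  show "ip M (\<lambda>z. f z - proj w f z) h = 0" if h: "h \<in> A2w w" for h
  proof -
    have "winner w (\<lambda>z. f z - proj w f z) h = ip M (\<lambda>z. f z - proj w f z) h"
      using p f h A2w_L2 by (intro winner_L2 L2_diff) auto
    then show ?thesis using p h by simp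
  qed
qed

section \<open>Size and measurability of the kernel norm and of \<open>tau\<close>\<close>

lemma one_A2w: "(\<lambda>_. 1) \<in> A2w w"
proof -
  have "integrable lebesgue (\<lambda>z. indicator disc z *\<^sub>R w z)"
    using wt by (simp add: is_weight_def set_integrable_def)
  then have "integrable M (\<lambda>z. (cmod 1)\<^sup>2)" by (subst integrable_M) auto
  then show ?thesis by (simp add: A2w_eq L2_def)
qed

lemma knorm_eq: "z \<in> disc \<Longrightarrow> knorm w z = nrm M (kern w z)"
  unfolding knorm_def by (intro wnorm_eq A2w_L2 kern_props)

lemma eval_le_knorm: "z \<in> disc \<Longrightarrow> f \<in> A2w w \<Longrightarrow> cmod (f z) \<le> nrm M f * knorm w z"
  using L2_Cauchy_Schwarz[of f M "kern w z"] kern_props[of z] A2w_L2 knorm_eq by auto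

text \<open>Integrability of \<open>w\<close> puts the constant 1 into \<open>A2w w\<close>, so the
  kernel function cannot have norm zero.\<close>

lemma knorm_pos: assumes "z \<in> disc" shows "0 < knorm w z"
proof -
  have "cmod 1 \<le> nrm M (\<lambda>_. 1) * knorm w z" using eval_le_knorm[OF assms one_A2w] by simp
  then have "knorm w z \<noteq> 0" by auto
  then show ?thesis using knorm_eq[OF assms] nrm_nonneg[of M "kern w z"] by (auto simp: less_le)
qed

lemma tau_pos: "z \<in> disc \<Longrightarrow> 0 < tau w z"
  by (simp add: tau_def w_pos knorm_pos)

lemma kern_diag: "z \<in> disc \<Longrightarrow> kern w z z = of_real ((knorm w z)\<^sup>2)"
  using kern_props(2)[of z "kern w z"] kern_props(1)[of z] ip_self[of M "kern w z"] by (simp add: knorm_eq)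

text \<open>The kernel norm is the norm of point evaluation. In this form its superlevel sets are
  unions of open sets, so \<open>knorm w\<close> is lower semicontinuous and therefore
  measurable.\<close>

lemma knorm_less_iff:
  assumes z: "z \<in> disc" and a: "0 \<le> a"
  shows "a < knorm w z \<longleftrightarrow> (\<exists>f\<in>A2w w. a * nrm M f < cmod (f z))"
proof
  assume "a < knorm w z"
  then have "a * knorm w z < (knorm w z)\<^sup>2"
    using knorm_pos[OF z] by (simp add: power2_eq_square)
  then show "\<exists>f\<in>A2w w. a * nrm M f < cmod (f z)"
    using kern_props(1)[OF z] kern_diag[OF z] by (intro bexI[of _ "kern w z"]) (auto simp: knorm_eq[OF z, symmetric] norm_power)
next
  assume "\<exists>f\<in>A2w w. a * nrm M f < cmod (f z)"
  then obtain f where f: "f \<in> A2w w" "a * nrm M f < cmod (f z)" by blast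
  then have "a * nrm M f < knorm w z * nrm M f" using eval_le_knorm[OF z f(1)] by (simp add: mult.commute)
  then show "a < knorm w z" using nrm_nonneg[of M f] by (meson mult_right_less_imp_less)
qed

lemma knorm_meas [measurable]: "knorm w \<in> borel_measurable Ld"
proof (rule borel_measurableI_greater)
  fix a :: real
  have "{z \<in> disc. a < knorm w z} \<in> sets lebesgue"
  proof (cases "0 \<le> a")
    case True
    have "{z \<in> disc. a < knorm w z} = (\<Union>f\<in>A2w w. {z \<in> disc. a * nrm M f < cmod (f z)})"
      using knorm_less_iff True by auto
    moreover have "open {z \<in> disc. a * nrm M f < cmod (f z)}" if "f \<in> A2w w" for f
    proof -
      have "continuous_on disc (\<lambda>z. cmod (f z))"
        using that by (intro continuous_intros holomorphic_on_imp_continuous_on) (simp add: A2w_eq)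
      then have "open (disc \<inter> (\<lambda>z. cmod (f z)) -` {a * nrm M f<..})"
        by (rule continuous_open_preimage) auto
      moreover have "disc \<inter> (\<lambda>z. cmod (f z)) -` {a * nrm M f<..} = {z \<in> disc. a * nrm M f < cmod (f z)}" by auto
      ultimately show ?thesis by simp
    qed
    ultimately have "open {z \<in> disc. a < knorm w z}" by auto
    then show ?thesis by auto
  next
    case False
    then have "{z \<in> disc. a < knorm w z} = disc" using knorm_pos by force
    then show ?thesis by simp
  qed
  then show "{z \<in> space Ld. a < knorm w z} \<in> sets Ld"
    by (auto simp: sets_restrict_space_iff space_restrict_space)
qed

lemma tau_meas [measurable]: "tau w \<in> borel_measurable Ld"
  unfolding tau_def[abs_def] by measurable

text \<open>A bound on point evaluations bounds \<open>knorm\<close>, since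
  \<open>kern w z z = knorm^2\<close>. The lower bound on \<open>tau\<close> is what makes separated
  sets in a compact disc finite.\<close>

lemma tau_bounded_below:
  assumes "0 \<le> r" "r < 1"
  obtains c where "0 < c" "\<And>z. cmod z \<le> r \<Longrightarrow> c \<le> tau w z"
proof -
  obtain B where B: "0 < B" "\<And>f z. f \<in> A2w w \<Longrightarrow> cmod z \<le> r \<Longrightarrow> cmod (f z) \<le> B * nrm M f"
    using eval_bound[OF assms] by metis
  have S: "compact (cball (0::complex) r)" "cball 0 r \<subseteq> disc" using assms by (auto simp: disc_def)
  obtain c C where C: "0 < c" "0 < C" "\<And>z. z \<in> cball 0 r \<Longrightarrow> c \<le> w z" "\<And>z. z \<in> cball 0 r \<Longrightarrow> w z \<le> C"
    using w_bounds[OF S] by metis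
  have "1 / (sqrt C * B) \<le> tau w z" if "cmod z \<le> r" for z
  proof -
    have z: "z \<in> disc" using that assms by (simp add: disc_def)
    have "(knorm w z)\<^sup>2 \<le> B * knorm w z"
      using B(2)[OF kern_props(1)[OF z] that] kern_diag[OF z] by (simp add: knorm_eq[OF z, symmetric] norm_power)
    then have "knorm w z \<le> B" using knorm_pos[OF z] by (simp add: power2_eq_square)
    moreover have "sqrt (w z) \<le> sqrt C" using C(4) that by simp
    ultimately have "sqrt (w z) * knorm w z \<le> sqrt C * B"
      using knorm_pos[OF z] w_pos[OF z] C by (intro mult_mono) auto
    then show ?thesis unfolding tau_def using knorm_pos[OF z] w_pos[OF z] B C by (intro divide_left_mono mult_pos_pos) auto
  qed
  then show ?thesis using that[of "1 / (sqrt C * B)"] B C by auto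
qed

end

section \<open>The weighted estimate for the Cauchy-Riemann operator\<close>

lemma C2_pd:
  assumes "C2_on S u" "e \<in> {1, \<i>}"
  shows "has_pd e u (pd u e) S" "continuous_on S u" "continuous_on S (pd u e)"
    "e' \<in> {1, \<i>} \<Longrightarrow> has_pd e' (pd u e) (pd (pd u e) e') S"
    "e' \<in> {1, \<i>} \<Longrightarrow> continuous_on S (pd (pd u e) e')"
proof -
  have *: "has_pd e u (pd u e) S" if "\<forall>z\<in>S. pd_exists u e z" for u e
    using that unfolding has_pd_def pd_exists_def pd_def
    by (simp add: DERIV_deriv_iff_real_differentiable flip: has_real_derivative_iff_has_vector_derivative)
  show "has_pd e u (pd u e) S" "continuous_on S u" "continuous_on S (pd u e)"
    "e' \<in> {1, \<i>} \<Longrightarrow> has_pd e' (pd u e) (pd (pd u e) e') S"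
    "e' \<in> {1, \<i>} \<Longrightarrow> continuous_on S (pd (pd u e) e')"
    using assms unfolding C2_on_def by (auto intro!: *)
qed

lemma has_pd_exp:
  fixes f :: "complex \<Rightarrow> real"
  shows "has_pd e f f' S \<Longrightarrow> has_pd e (\<lambda>z. exp (f z)) (\<lambda>z. exp (f z) * f' z) S"
  by (rule has_pd_chain[where F = exp and F' = exp]) (auto intro!: derivative_eq_intros)

text \<open>The Wirtinger derivative \<open>(u_x - i u_y) / 2\<close> of a real function, in terms
  of the real partial derivatives \<open>pd\<close>.\<close>

definition dzr :: "(complex \<Rightarrow> real) \<Rightarrow> complex \<Rightarrow> complex" where
  "dzr u z = Complex (pd u 1 z / 2) (- pd u \<i> z / 2)"

lemma dsq_dzr: "dsq u z = (cmod (dzr u z))\<^sup>2"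
  by (simp add: dsq_def dzr_def cmod_power2 power_divide)

text \<open>Twisting \<open>dz\<close> by \<open>\<psi>\<close> replaces the curvature \<open>\<Delta>\<phi>\<close> by that of \<open>\<phi> + 2 \<psi>\<close>. The integrand of the
difference is half the divergence of \<open>exp \<phi> (F, G)\<close> below plus a square, which is dropped.\<close>

lemma Morrey_Kohn_inequality:
  assumes t: "\<xi> \<in> test" and \<phi>: "C2_on disc \<phi>" and \<psi>: "C2_on disc \<psi>"
  shows "integrable lebesgue (\<lambda>z. (lap \<phi> z + 2 * lap \<psi> z) * (cmod (\<xi> z))\<^sup>2 * exp (\<phi> z))"
    and "integrable lebesgue (\<lambda>z. (cmod (dz \<xi> z - \<xi> z * dzr \<psi> z))\<^sup>2 * exp (\<phi> z))"
    and "(LINT z|lebesgue. (lap \<phi> z + 2 * lap \<psi> z) * (cmod (\<xi> z))\<^sup>2 * exp (\<phi> z))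
      \<le> (LINT z|lebesgue. (cmod (dz \<xi> z - \<xi> z * dzr \<psi> z))\<^sup>2 * exp (\<phi> z))"
proof -
  obtain S pp pq qq where "test_data \<xi> S pp pq qq"
    using testE[OF t] .
  note A = test_dataD[OF this]
  note cs = compact_imp_closed[OF A(1)]
  \<comment> \<open>Real and imaginary parts are separated so that the divergence identity
    \<open>key\<close> becomes a polynomial identity between real functions.\<close>
  define a b ax ay bx by' where d: "a z = Re (\<xi> z)" "b z = Im (\<xi> z)" "ax z = Re (pdv 1 \<xi> z)" "ay z = Re (pdv \<i> \<xi> z)"
    "bx z = Im (pdv 1 \<xi> z)" "by' z = Im (pdv \<i> \<xi> z)" for z
  define axy ayy bxy byy axx bxx where d2: "axy z = Re (pq z)" "ayy z = Re (qq z)" "bxy z = Im (pq z)" "byy z = Im (qq z)"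
    "axx z = Re (pp z)" "bxx z = Im (pp z)" for z
  have pdab: "has_pd 1 a ax disc" "has_pd \<i> a ay disc" "has_pd 1 b bx disc" "has_pd \<i> b by' disc"
    "has_pd 1 ax axx disc" "has_pd \<i> ax axy disc" "has_pd 1 ay axy disc" "has_pd \<i> ay ayy disc"
    "has_pd 1 bx bxx disc" "has_pd \<i> bx bxy disc" "has_pd 1 by' bxy disc" "has_pd \<i> by' byy disc"
    unfolding d[abs_def] d2[abs_def] by (intro has_pd_Re has_pd_Im has_pd_subset[OF A(12)] has_pd_subset[OF A(13)]
        has_pd_subset[OF A(14)] has_pd_subset[OF A(15)] has_pd_subset[OF A(16)] has_pd_subset[OF A(17)] subset_UNIV)+
  note cA = A(6-11)[THEN continuous_on_subset, OF subset_UNIV]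
  have cab: "continuous_on disc a" "continuous_on disc b" "continuous_on disc ax" "continuous_on disc ay" "continuous_on disc bx" "continuous_on disc by'"
    "continuous_on disc axy" "continuous_on disc ayy" "continuous_on disc bxy" "continuous_on disc byy" "continuous_on disc axx" "continuous_on disc bxx"
    unfolding d[abs_def] d2[abs_def] by (intro continuous_intros cA)+
  define fx fy fxx fyy where df: "fx = pd \<phi> 1" "fy = pd \<phi> \<i>" "fxx = pd (pd \<phi> 1) 1" "fyy = pd (pd \<phi> \<i>) \<i>"
  define gx gy gxx gyy where dg: "gx = pd \<psi> 1" "gy = pd \<psi> \<i>" "gxx = pd (pd \<psi> 1) 1" "gyy = pd (pd \<psi> \<i>) \<i>"
  have pf: "has_pd 1 \<phi> fx disc" "has_pd \<i> \<phi> fy disc" "has_pd 1 fx fxx disc" "has_pd \<i> fy fyy disc"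
    "has_pd 1 gx gxx disc" "has_pd \<i> gy gyy disc"
    unfolding df dg by (auto intro!: C2_pd[OF \<phi>] C2_pd[OF \<psi>])
  have cf: "continuous_on disc \<phi>" "continuous_on disc fx" "continuous_on disc fy" "continuous_on disc fxx" "continuous_on disc fyy"
    "continuous_on disc gx" "continuous_on disc gy" "continuous_on disc gxx" "continuous_on disc gyy"
    using C2_pd(2)[OF \<phi>, of 1] unfolding df dg by (auto intro!: C2_pd[OF \<phi>] C2_pd[OF \<psi>])
  have z0: "a z = 0" "b z = 0" "ax z = 0" "ay z = 0" "bx z = 0" "by' z = 0" if "z \<notin> S" for z
    using A(3,4,5)[OF that] by (auto simp: d)
  define F G where "F z = a z * by' z - b z * ay z - (a z * a z + b z * b z) * (gx z + 1/2 * fx z)"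
    and "G z = b z * ax z - a z * bx z - (a z * a z + b z * b z) * (gy z + 1/2 * fy z)" for z
  define Fx where "Fx z = ((a z * bxy z + ax z * by' z) - (b z * axy z + bx z * ay z))
     - ((a z * a z + b z * b z) * (gxx z + 1/2 * fxx z) + ((a z * ax z + ax z * a z) + (b z * bx z + bx z * b z)) * (gx z + 1/2 * fx z))" for z
  define Gy where "Gy z = ((b z * axy z + by' z * ax z) - (a z * bxy z + ay z * bx z))
     - ((a z * a z + b z * b z) * (gyy z + 1/2 * fyy z) + ((a z * ay z + ay z * a z) + (b z * by' z + by' z * b z)) * (gy z + 1/2 * fy z))" for z
  have pF: "has_pd 1 F Fx disc" unfolding F_def[abs_def] Fx_def[abs_def]
    by (intro has_pd_diff has_pd_add has_pd_mult has_pd_cmult pdab pf)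
  have pG: "has_pd \<i> G Gy disc" unfolding G_def[abs_def] Gy_def[abs_def]
    by (intro has_pd_diff has_pd_add has_pd_mult has_pd_cmult pdab pf)
  have cFG: "continuous_on disc F" "continuous_on disc G" "continuous_on disc Fx" "continuous_on disc Gy"
    unfolding F_def[abs_def] Fx_def[abs_def] G_def[abs_def] Gy_def[abs_def]
    by (intro continuous_intros cab cf)+
  have ze: "F z = 0" "G z = 0" "Fx z = 0" "Gy z = 0" if "z \<notin> S" for z
    using z0[OF that] by (auto simp: F_def G_def Fx_def Gy_def)
  have ext: "continuous_on UNIV h" if "continuous_on disc h" "\<And>z. z \<notin> S \<Longrightarrow> h z = 0" for h :: "complex \<Rightarrow> real"
    by (rule continuous_on_extend_zero[OF that(1) open_disc cs A(2) that(2)])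
  have intg: "integrable lebesgue h" if "continuous_on disc h" "\<And>z. z \<notin> S \<Longrightarrow> h z = 0" for h :: "complex \<Rightarrow> real"
    by (rule integrable_continuous_compact_support(2)[OF ext[OF that] A(1) that(2)])
  have IP: "(LINT z|lebesgue. exp (\<phi> z) * Fx z + exp (\<phi> z) * fx z * F z) = 0"
  proof (rule integral_has_pd_eq_0[where P = "\<lambda>z. exp (\<phi> z) * F z" and S = S and e = 1])
    show "has_pd 1 (\<lambda>z. exp (\<phi> z) * F z) (\<lambda>z. exp (\<phi> z) * Fx z + exp (\<phi> z) * fx z * F z) UNIV"
      by (rule has_pd_extend[OF _ cs A(2)]) (use ze in \<open>auto intro!: has_pd_mult has_pd_exp pf pF\<close>)
    show "continuous_on UNIV (\<lambda>z. exp (\<phi> z) * F z)"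
      by (rule ext) (auto simp: ze intro!: continuous_intros cf cFG)
    show "continuous_on UNIV (\<lambda>z. exp (\<phi> z) * Fx z + exp (\<phi> z) * fx z * F z)"
      by (rule ext) (auto simp: ze intro!: continuous_intros cf cFG)
  qed (use ze A(1) in auto)
  have IG: "(LINT z|lebesgue. exp (\<phi> z) * Gy z + exp (\<phi> z) * fy z * G z) = 0"
  proof (rule integral_has_pd_eq_0[where P = "\<lambda>z. exp (\<phi> z) * G z" and S = S and e = \<i>])
    show "has_pd \<i> (\<lambda>z. exp (\<phi> z) * G z) (\<lambda>z. exp (\<phi> z) * Gy z + exp (\<phi> z) * fy z * G z) UNIV"
      by (rule has_pd_extend[OF _ cs A(2)]) (use ze in \<open>auto intro!: has_pd_mult has_pd_exp pf pG\<close>)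
    show "continuous_on UNIV (\<lambda>z. exp (\<phi> z) * G z)"
      by (rule ext) (auto simp: ze intro!: continuous_intros cf cFG)
    show "continuous_on UNIV (\<lambda>z. exp (\<phi> z) * Gy z + exp (\<phi> z) * fy z * G z)"
      by (rule ext) (auto simp: ze intro!: continuous_intros cf cFG)
  qed (use ze A(1) in auto)
  \<comment> \<open>\<open>T1\<close> is \<open>|dz \<xi> - \<xi> * dzr \<psi>|^2\<close>.
    \<open>T2\<close> is the square that is dropped, \<open>|dzb \<xi> + \<xi> * q|^2\<close> with
    \<open>q\<close> the \<open>\<partial>\<close>-bar derivative of \<open>\<phi> + \<psi>\<close>.
    \<open>T3\<close> is the curvature term.\<close>
  define T1 where "T1 z = ((ax z + by' z - a z * gx z - b z * gy z)^2 + (bx z - ay z - b z * gx z + a z * gy z)^2) / 4" for z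
  define T2 where "T2 z = ((ax z - by' z + a z * (fx z + gx z) - b z * (fy z + gy z))^2 + (bx z + ay z + b z * (fx z + gx z) + a z * (fy z + gy z))^2) / 4" for z
  define T3 where "T3 z = ((fxx z + fyy z) / 4 + 2 * ((gxx z + gyy z) / 4)) * (a z * a z + b z * b z)" for z
  have key: "exp (\<phi> z) * Fx z + exp (\<phi> z) * fx z * F z + (exp (\<phi> z) * Gy z + exp (\<phi> z) * fy z * G z) = 2 * (T1 z * exp (\<phi> z) - T2 z * exp (\<phi> z) - T3 z * exp (\<phi> z))" for z
  proof -
    have "Fx z + fx z * F z + (Gy z + fy z * G z) = 2 * (T1 z - T2 z - T3 z)"
      unfolding Fx_def F_def Gy_def G_def T1_def T2_def T3_def
      by (simp add: power2_eq_square field_simps)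
    then have "exp (\<phi> z) * (Fx z + fx z * F z + (Gy z + fy z * G z)) = exp (\<phi> z) * (2 * (T1 z - T2 z - T3 z))" by simp
    then show ?thesis by (simp only: ring_distribs mult_ac)
  qed
  have i1: "integrable lebesgue (\<lambda>z. T1 z * exp (\<phi> z))" "integrable lebesgue (\<lambda>z. T2 z * exp (\<phi> z))" "integrable lebesgue (\<lambda>z. T3 z * exp (\<phi> z))"
    "integrable lebesgue (\<lambda>z. exp (\<phi> z) * Fx z + exp (\<phi> z) * fx z * F z)" "integrable lebesgue (\<lambda>z. exp (\<phi> z) * Gy z + exp (\<phi> z) * fy z * G z)"
    by (rule intg; use z0 ze in \<open>auto simp: T1_def[abs_def] T2_def[abs_def] T3_def[abs_def] intro!: continuous_intros cab cf cFG\<close>)+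
  have "0 = (LINT z|lebesgue. 2 * (T1 z * exp (\<phi> z) - T2 z * exp (\<phi> z) - T3 z * exp (\<phi> z)))"
    unfolding key[symmetric] using IP IG i1(4,5) by simp
  also have "\<dots> = 2 * ((LINT z|lebesgue. T1 z * exp (\<phi> z)) - (LINT z|lebesgue. T2 z * exp (\<phi> z)) - (LINT z|lebesgue. T3 z * exp (\<phi> z)))"
    using i1 by simp
  finally have "(LINT z|lebesgue. T3 z * exp (\<phi> z)) = (LINT z|lebesgue. T1 z * exp (\<phi> z)) - (LINT z|lebesgue. T2 z * exp (\<phi> z))" by simp
  moreover have "0 \<le> (LINT z|lebesgue. T2 z * exp (\<phi> z))"
    by (intro integral_nonneg_AE AE_I2) (auto simp: T2_def)
  moreover have e3: "(\<lambda>z. T3 z * exp (\<phi> z)) = (\<lambda>z. (lap \<phi> z + 2 * lap \<psi> z) * (cmod (\<xi> z))\<^sup>2 * exp (\<phi> z))"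
  proof -
    have "a z * a z + b z * b z = (cmod (\<xi> z))\<^sup>2" for z
      unfolding cmod_power2 by (simp add: d power2_eq_square)
    then show ?thesis by (simp only: T3_def lap_def df dg)
  qed
  moreover have e1: "(\<lambda>z. T1 z * exp (\<phi> z)) = (\<lambda>z. (cmod (dz \<xi> z - \<xi> z * dzr \<psi> z))\<^sup>2 * exp (\<phi> z))"
  proof
    fix z
    have r: "Re (dz \<xi> z - \<xi> z * dzr \<psi> z) = (ax z + by' z - a z * gx z - b z * gy z) / 2"
      "Im (dz \<xi> z - \<xi> z * dzr \<psi> z) = (bx z - ay z - b z * gx z + a z * gy z) / 2"
      by (simp_all add: dz_def dzr_def d dg field_simps)
    have "(cmod (dz \<xi> z - \<xi> z * dzr \<psi> z))\<^sup>2 = T1 z"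
      unfolding cmod_power2 r T1_def power_divide by (simp add: add_divide_distrib)
    then show "T1 z * exp (\<phi> z) = (cmod (dz \<xi> z - \<xi> z * dzr \<psi> z))\<^sup>2 * exp (\<phi> z)"
      by (simp only:)
  qed
  ultimately show "(LINT z|lebesgue. (lap \<phi> z + 2 * lap \<psi> z) * (cmod (\<xi> z))\<^sup>2 * exp (\<phi> z))
      \<le> (LINT z|lebesgue. (cmod (dz \<xi> z - \<xi> z * dzr \<psi> z))\<^sup>2 * exp (\<phi> z))" by simp
  show "integrable lebesgue (\<lambda>z. (lap \<phi> z + 2 * lap \<psi> z) * (cmod (\<xi> z))\<^sup>2 * exp (\<phi> z))" using i1(3) e3 by simp
  show "integrable lebesgue (\<lambda>z. (cmod (dz \<xi> z - \<xi> z * dzr \<psi> z))\<^sup>2 * exp (\<phi> z))" using i1(1) e1 by simp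
qed

lemma C2_zero: "C2_on S (\<lambda>_. 0)" "pd (\<lambda>_. 0) e = (\<lambda>_. 0)"
proof -
  show p: "pd (\<lambda>_. 0) e = (\<lambda>_. 0)" for e by (auto simp: pd_def fun_eq_iff)
  show "C2_on S (\<lambda>_. 0)" by (auto simp: C2_on_def pd_exists_def p)
qed

lemma cmod_diff_Young:
  assumes "0 < \<theta>"
  shows "(cmod (x - y))\<^sup>2 \<le> (1 + 1/\<theta>) * (cmod x)\<^sup>2 + (1 + \<theta>) * (cmod y)\<^sup>2"
proof -
  have "(cmod (x - y))\<^sup>2 \<le> (cmod x + cmod y)\<^sup>2" by (intro power_mono norm_triangle_ineq4) auto
  moreover have "0 \<le> (cmod x - \<theta> * cmod y)\<^sup>2 / \<theta>" using assms by simp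
  moreover have "(cmod x - \<theta> * cmod y)\<^sup>2 / \<theta> = (cmod x)\<^sup>2 / \<theta> - 2 * cmod x * cmod y + \<theta> * (cmod y)\<^sup>2"
    using assms by (simp add: power2_eq_square field_simps)
  ultimately show ?thesis by (simp add: power2_sum algebra_simps)
qed

context weighted
begin

text \<open>In the second case the twisting term \<open>\<xi> \<partial>\<psi>\<close> is absorbed by Young's inequality: it costs slightly
more than one \<open>\<Delta>\<psi>\<close>, while the curvature of \<open>\<phi> + 2 \<psi>\<close> is at least \<open>(2 + t) \<Delta>\<psi>\<close> with \<open>2 + t > 1\<close>.\<close>

lemma a_priori_estimate:
  assumes \<phi>: "C2_on disc \<phi>" "\<And>z. z \<in> disc \<Longrightarrow> w z = exp (- \<phi> z)"
    and cond: "(\<exists>c>0. \<forall>z\<in>disc. (tau w z)\<^sup>2 * lap \<phi> z \<ge> c) \<or>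
         (\<exists>\<psi> \<delta> t. C2_on disc \<psi> \<and> (\<forall>z\<in>disc. \<psi> z \<ge> 0 \<and> lap \<psi> z \<ge> 0) \<and>
            \<delta> > 0 \<and> -1 < t \<and> t < 0 \<and>
            (\<forall>z\<in>disc. (tau w z)\<^sup>2 * lap \<psi> z \<ge> \<delta> \<and> lap \<phi> z \<ge> t * lap \<psi> z \<and>
                       dsq \<psi> z \<le> lap \<psi> z))"
  obtains C where "0 < C" "\<And>\<xi>. \<xi> \<in> test \<Longrightarrow> (\<lambda>z. \<xi> z / of_real (tau w z * w z)) \<in> L2 M"
    "\<And>\<xi>. \<xi> \<in> test \<Longrightarrow> nrm M (\<lambda>z. \<xi> z / of_real (tau w z * w z)) \<le> C * nrm M (Dw \<xi>)"
proof -
  \<comment> \<open>Both alternatives are reduced to one curvature function \<open>l\<close>: it is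
    \<open>lap \<phi>\<close> with \<open>E = 1\<close>, from the inequality with
    \<open>\<psi> = 0\<close>, or \<open>lap \<psi>\<close>.\<close>
  obtain l D E where l: "0 < D" "0 < E" "\<And>z. z \<in> disc \<Longrightarrow> D \<le> (tau w z)\<^sup>2 * l z"
    and li: "\<And>\<xi>. \<xi> \<in> test \<Longrightarrow> integrable lebesgue (\<lambda>z. l z * (cmod (\<xi> z))\<^sup>2 * exp (\<phi> z))"
    and lE: "\<And>\<xi>. \<xi> \<in> test \<Longrightarrow> (LINT z|lebesgue. l z * (cmod (\<xi> z))\<^sup>2 * exp (\<phi> z)) \<le> E * (LINT z|lebesgue. (cmod (dz \<xi> z))\<^sup>2 * exp (\<phi> z))"
    using cond
  proof
    assume "\<exists>c>0. \<forall>z\<in>disc. (tau w z)\<^sup>2 * lap \<phi> z \<ge> c"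
    then obtain c where c: "0 < c" "\<And>z. z \<in> disc \<Longrightarrow> c \<le> (tau w z)\<^sup>2 * lap \<phi> z" by blast
    have z: "lap (\<lambda>_. 0) z = 0" "dzr (\<lambda>_. 0) z = 0" for z by (simp_all add: lap_def dzr_def C2_zero complex_eq_iff)
    show thesis
      by (rule that[of c 1 "lap \<phi>"]; use Morrey_Kohn_inequality[OF _ \<phi>(1) C2_zero(1)] c in \<open>simp add: z\<close>)
  next
    assume "\<exists>\<psi> \<delta> t. C2_on disc \<psi> \<and> (\<forall>z\<in>disc. \<psi> z \<ge> 0 \<and> lap \<psi> z \<ge> 0) \<and>
            \<delta> > 0 \<and> -1 < t \<and> t < 0 \<and>
            (\<forall>z\<in>disc. (tau w z)\<^sup>2 * lap \<psi> z \<ge> \<delta> \<and> lap \<phi> z \<ge> t * lap \<psi> z \<and>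
                       dsq \<psi> z \<le> lap \<psi> z)"
    then obtain \<psi> \<delta> t where \<psi>: "C2_on disc \<psi>" "\<And>z. z \<in> disc \<Longrightarrow> 0 \<le> lap \<psi> z" "0 < \<delta>" "-1 < t" "t < 0"
      "\<And>z. z \<in> disc \<Longrightarrow> \<delta> \<le> (tau w z)\<^sup>2 * lap \<psi> z" "\<And>z. z \<in> disc \<Longrightarrow> t * lap \<psi> z \<le> lap \<phi> z"
      "\<And>z. z \<in> disc \<Longrightarrow> dsq \<psi> z \<le> lap \<psi> z" by blast
    \<comment> \<open>Young's parameter: this choice leaves exactly
      \<open>(2 + t) - (1 + \<theta>) = \<theta>\<close> in front of the curvature integral.\<close>
    define \<theta> where "\<theta> = (1 + t) / 2"
    have \<theta>: "0 < \<theta>" using \<psi> by (simp add: \<theta>_def)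
    have cl: "continuous_on disc (lap \<psi>)" unfolding lap_def[abs_def]
      by (intro continuous_intros C2_pd[OF \<psi>(1)]) auto
    show thesis
    proof (rule that[of \<delta> "(1 + 1/\<theta>) / \<theta>" "lap \<psi>"])
      show "0 < (1 + 1/\<theta>) / \<theta>" using \<theta> by (simp add: add_pos_pos)
      fix \<xi> assume t: "\<xi> \<in> test"
      obtain S pp pq qq where "test_data \<xi> S pp pq qq"
        using testE[OF t] .
      note A = test_dataD[OF this]
      have intg: "integrable lebesgue h" if "continuous_on disc h" "\<And>z. z \<notin> S \<Longrightarrow> h z = 0" for h :: "complex \<Rightarrow> real"
        by (rule integrable_continuous_compact_support(2)[OF continuous_on_extend_zero[OF that(1) open_disc compact_imp_closed[OF A(1)] A(2) that(2)] A(1) that(2)])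
      have cc: "continuous_on disc \<xi>" "continuous_on disc (dz \<xi>)" "continuous_on disc \<phi>"
        using test_continuous[OF t] dz_continuous[OF t] C2_pd(2)[OF \<phi>(1), of 1] by (auto intro: continuous_on_subset)
      have dz0: "dz \<xi> z = 0" if "z \<notin> S" for z using A(4,5)[OF that] by (simp add: dz_def)
      show i1: "integrable lebesgue (\<lambda>z. lap \<psi> z * (cmod (\<xi> z))\<^sup>2 * exp (\<phi> z))"
        by (rule intg) (use A in \<open>auto intro!: continuous_intros cl cc\<close>)
      have i2: "integrable lebesgue (\<lambda>z. (cmod (dz \<xi> z))\<^sup>2 * exp (\<phi> z))"
        by (rule intg) (use dz0 in \<open>auto intro!: continuous_intros cc\<close>)
      note MK = Morrey_Kohn_inequality[OF t \<phi>(1) \<psi>(1)]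
      have "(2 + t) * (LINT z|lebesgue. lap \<psi> z * (cmod (\<xi> z))\<^sup>2 * exp (\<phi> z)) = (LINT z|lebesgue. (2 + t) * (lap \<psi> z * (cmod (\<xi> z))\<^sup>2 * exp (\<phi> z)))"
        by simp
      also have "\<dots> \<le> (LINT z|lebesgue. (lap \<phi> z + 2 * lap \<psi> z) * (cmod (\<xi> z))\<^sup>2 * exp (\<phi> z))"
      proof (rule integral_mono)
        fix z
        show "(2 + t) * (lap \<psi> z * (cmod (\<xi> z))\<^sup>2 * exp (\<phi> z)) \<le> (lap \<phi> z + 2 * lap \<psi> z) * (cmod (\<xi> z))\<^sup>2 * exp (\<phi> z)"
        proof (cases "z \<in> disc")
          case True
          have "(2 + t) * lap \<psi> z \<le> lap \<phi> z + 2 * lap \<psi> z" using \<psi>(7)[OF True] by (simp add: algebra_simps)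
          then have "((2 + t) * lap \<psi> z) * ((cmod (\<xi> z))\<^sup>2 * exp (\<phi> z)) \<le> (lap \<phi> z + 2 * lap \<psi> z) * ((cmod (\<xi> z))\<^sup>2 * exp (\<phi> z))"
            by (intro mult_right_mono) auto
          then show ?thesis by (simp add: mult.assoc)
        qed (simp add: test_outside[OF t])
      qed (use i1 MK(1) in auto)
      also have "\<dots> \<le> (LINT z|lebesgue. (cmod (dz \<xi> z - \<xi> z * dzr \<psi> z))\<^sup>2 * exp (\<phi> z))" by (rule MK(3))
      also have "\<dots> \<le> (LINT z|lebesgue. (1 + 1/\<theta>) * ((cmod (dz \<xi> z))\<^sup>2 * exp (\<phi> z)) + (1 + \<theta>) * (lap \<psi> z * (cmod (\<xi> z))\<^sup>2 * exp (\<phi> z)))"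
      proof (rule integral_mono[OF MK(2)])
        fix z
        show "(cmod (dz \<xi> z - \<xi> z * dzr \<psi> z))\<^sup>2 * exp (\<phi> z) \<le> (1 + 1/\<theta>) * ((cmod (dz \<xi> z))\<^sup>2 * exp (\<phi> z)) + (1 + \<theta>) * (lap \<psi> z * (cmod (\<xi> z))\<^sup>2 * exp (\<phi> z))"
        proof (cases "z \<in> disc")
          case True
          have "(cmod (\<xi> z * dzr \<psi> z))\<^sup>2 \<le> lap \<psi> z * (cmod (\<xi> z))\<^sup>2"
            using mult_right_mono[OF \<psi>(8)[OF True], of "(cmod (\<xi> z))\<^sup>2"]
            by (simp add: norm_mult power_mult_distrib dsq_dzr mult.commute)
          then have "(1 + \<theta>) * (cmod (\<xi> z * dzr \<psi> z))\<^sup>2 \<le> (1 + \<theta>) * (lap \<psi> z * (cmod (\<xi> z))\<^sup>2)"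
            using \<theta> by (intro mult_left_mono) auto
          with cmod_diff_Young[OF \<theta>, of "dz \<xi> z" "\<xi> z * dzr \<psi> z"]
          have "(cmod (dz \<xi> z - \<xi> z * dzr \<psi> z))\<^sup>2 \<le> (1 + 1/\<theta>) * (cmod (dz \<xi> z))\<^sup>2 + (1 + \<theta>) * (lap \<psi> z * (cmod (\<xi> z))\<^sup>2)" by linarith
          then have "(cmod (dz \<xi> z - \<xi> z * dzr \<psi> z))\<^sup>2 * exp (\<phi> z) \<le> ((1 + 1/\<theta>) * (cmod (dz \<xi> z))\<^sup>2 + (1 + \<theta>) * (lap \<psi> z * (cmod (\<xi> z))\<^sup>2)) * exp (\<phi> z)"
            by (intro mult_right_mono) auto
          then show ?thesis by (simp only: distrib_right mult.assoc)
        qed (simp add: test_outside[OF t])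
      qed (use i1 i2 in auto)
      also have "\<dots> = (1 + 1/\<theta>) * (LINT z|lebesgue. (cmod (dz \<xi> z))\<^sup>2 * exp (\<phi> z)) + (1 + \<theta>) * (LINT z|lebesgue. lap \<psi> z * (cmod (\<xi> z))\<^sup>2 * exp (\<phi> z))"
        using i1 i2 by simp
      finally have "((2 + t) - (1 + \<theta>)) * (LINT z|lebesgue. lap \<psi> z * (cmod (\<xi> z))\<^sup>2 * exp (\<phi> z)) \<le> (1 + 1/\<theta>) * (LINT z|lebesgue. (cmod (dz \<xi> z))\<^sup>2 * exp (\<phi> z))"
        by (simp only: left_diff_distrib)
      moreover have "(2 + t) - (1 + \<theta>) = \<theta>" by (simp add: \<theta>_def field_simps)
      ultimately have "\<theta> * (LINT z|lebesgue. lap \<psi> z * (cmod (\<xi> z))\<^sup>2 * exp (\<phi> z)) \<le> (1 + 1/\<theta>) * (LINT z|lebesgue. (cmod (dz \<xi> z))\<^sup>2 * exp (\<phi> z))"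
        by simp
      then show "(LINT z|lebesgue. lap \<psi> z * (cmod (\<xi> z))\<^sup>2 * exp (\<phi> z)) \<le> (1 + 1/\<theta>) / \<theta> * (LINT z|lebesgue. (cmod (dz \<xi> z))\<^sup>2 * exp (\<phi> z))"
        using \<theta> by (simp add: pos_le_divide_eq mult.commute)
    qed (use \<psi> in auto)
  qed
  have ex: "w z * exp (\<phi> z) = 1" if "z \<in> disc" for z
    using \<phi>(2)[OF that] by (simp flip: exp_add)
  have main: "(\<lambda>z. \<xi> z / of_real (tau w z * w z)) \<in> L2 M \<and> nrm M (\<lambda>z. \<xi> z / of_real (tau w z * w z)) \<le> sqrt (E / D) * nrm M (Dw \<xi>)"
    if t: "\<xi> \<in> test" for \<xi>
  proof -
    let ?h = "\<lambda>z. \<xi> z / of_real (tau w z * w z)"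
    have [measurable]: "\<xi> \<in> borel_measurable Ld" "dz \<xi> \<in> borel_measurable Ld"
      using test_continuous[OF t] dz_continuous[OF t] by (auto intro!: cont_meas intro: continuous_on_subset)
    have hm: "?h \<in> borel_measurable Ld" by measurable
    have hm2: "(\<lambda>z. (cmod (?h z))\<^sup>2) \<in> borel_measurable Ld" by measurable
    \<comment> \<open>The lower bound \<open>D \<le> tau^2 * l\<close> trades
      \<open>1 / tau^2\<close> for the curvature, and \<open>exp \<phi> = 1 / w\<close>.\<close>
    have pt: "indicator disc z *\<^sub>R (w z *\<^sub>R (cmod (?h z))\<^sup>2) \<le> (1/D) * (l z * (cmod (\<xi> z))\<^sup>2 * exp (\<phi> z))" for z
    proof (cases "z \<in> disc")
      case True
      have "w z * (cmod (?h z))\<^sup>2 = (cmod (\<xi> z))\<^sup>2 * exp (\<phi> z) * (1 / (tau w z)\<^sup>2)"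
      proof -
        have "exp (\<phi> z) = 1 / w z" using ex[OF True] w_pos[OF True] by (simp add: field_simps)
        then show ?thesis using w_pos[OF True] tau_pos[OF True]
          by (simp add: norm_divide norm_mult power_divide power_mult_distrib) (simp add: power2_eq_square)
      qed
      also have "\<dots> \<le> (cmod (\<xi> z))\<^sup>2 * exp (\<phi> z) * (l z / D)"
      proof (intro mult_left_mono)
        show "1 / (tau w z)\<^sup>2 \<le> l z / D" using l(3)[OF True] l(1) tau_pos[OF True] by (simp add: field_simps)
      qed auto
      finally show ?thesis using True by (simp add: mult_ac)
    qed (simp add: test_outside[OF t])
    have ih: "integrable lebesgue (\<lambda>z. indicator disc z *\<^sub>R (w z *\<^sub>R (cmod (?h z))\<^sup>2))"
    proof (rule Bochner_Integration.integrable_bound)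
      show "integrable lebesgue (\<lambda>z. (1/D) * (l z * (cmod (\<xi> z))\<^sup>2 * exp (\<phi> z)))" using li[OF t] by auto
      have "(\<lambda>z. w z *\<^sub>R (cmod (?h z))\<^sup>2) \<in> borel_measurable Ld" by measurable
      then show "(\<lambda>z. indicator disc z *\<^sub>R (w z *\<^sub>R (cmod (?h z))\<^sup>2)) \<in> borel_measurable lebesgue"
        by (simp only: meas_Ld_iff)
      show "AE z in lebesgue. norm (indicator disc z *\<^sub>R (w z *\<^sub>R (cmod (?h z))\<^sup>2)) \<le> norm ((1/D) * (l z * (cmod (\<xi> z))\<^sup>2 * exp (\<phi> z)))"
      proof (rule AE_I2)
        fix z
        have "0 \<le> indicator disc z *\<^sub>R (w z *\<^sub>R (cmod (?h z))\<^sup>2)"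
          using w_pos[of z] by (auto simp: indicator_def less_imp_le)
        then show "norm (indicator disc z *\<^sub>R (w z *\<^sub>R (cmod (?h z))\<^sup>2)) \<le> norm ((1/D) * (l z * (cmod (\<xi> z))\<^sup>2 * exp (\<phi> z)))"
          using pt[of z] unfolding real_norm_def by linarith
      qed
    qed
    have hL: "?h \<in> L2 M" using hm integrable_M[OF hm2] ih by (simp add: L2_def)
    have "(nrm M ?h)\<^sup>2 = (LINT z|lebesgue. indicator disc z *\<^sub>R (w z *\<^sub>R (cmod (?h z))\<^sup>2))"
      unfolding nrm_sq by (rule integral_M[OF hm2])
    also have "\<dots> \<le> (LINT z|lebesgue. (1/D) * (l z * (cmod (\<xi> z))\<^sup>2 * exp (\<phi> z)))"
      by (rule integral_mono[OF ih _ pt]) (use li[OF t] in auto)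
    also have "\<dots> = (1/D) * (LINT z|lebesgue. l z * (cmod (\<xi> z))\<^sup>2 * exp (\<phi> z))" by simp
    also have "\<dots> \<le> (1/D) * (E * (LINT z|lebesgue. (cmod (dz \<xi> z))\<^sup>2 * exp (\<phi> z)))"
      by (intro mult_left_mono lE t) (use l in auto)
    also have "(LINT z|lebesgue. (cmod (dz \<xi> z))\<^sup>2 * exp (\<phi> z)) = (nrm M (Dw \<xi>))\<^sup>2"
    proof -
      have m: "(\<lambda>z. (cmod (Dw \<xi> z))\<^sup>2) \<in> borel_measurable Ld" unfolding Dw_def by measurable
      have "(nrm M (Dw \<xi>))\<^sup>2 = (LINT z|lebesgue. indicator disc z *\<^sub>R (w z *\<^sub>R (cmod (Dw \<xi> z))\<^sup>2))"
        unfolding nrm_sq by (rule integral_M[OF m])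
      also have "\<dots> = (LINT z|lebesgue. (cmod (dz \<xi> z))\<^sup>2 * exp (\<phi> z))"
      proof (rule Bochner_Integration.integral_cong[OF refl])
        fix z
        show "indicator disc z *\<^sub>R (w z *\<^sub>R (cmod (Dw \<xi> z))\<^sup>2) = (cmod (dz \<xi> z))\<^sup>2 * exp (\<phi> z)"
        proof (cases "z \<in> disc")
          case True
          have "exp (\<phi> z) = 1 / w z" using ex[OF True] w_pos[OF True] by (simp add: field_simps)
          then show ?thesis using True w_pos[OF True]
            by (simp add: Dw_def norm_divide power_divide) (simp add: power2_eq_square)
        qed (simp add: test_outside[OF t])
      qed
      finally show ?thesis ..
    qed
    finally have "(nrm M ?h)\<^sup>2 \<le> (E / D) * (nrm M (Dw \<xi>))\<^sup>2" by simp
    also have "\<dots> = (sqrt (E / D) * nrm M (Dw \<xi>))\<^sup>2" using l by (simp add: power_mult_distrib)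
    finally have "nrm M ?h \<le> sqrt (E / D) * nrm M (Dw \<xi>)"
      by (rule power2_le_imp_le) (use l in auto)
    with hL show ?thesis by simp
  qed
  show ?thesis
    by (rule that[of "sqrt (E / D)"]) (use main l in auto)
qed

text \<open>Weak form of \<open>\<partial>\<close>-bar \<open>v = q\<close> with \<open>v\<close> orthogonal to \<open>A2w w\<close>; the factor \<open>tau w\<close> is distributed so
that both entries of the pairing on the right lie in \<open>L2 M\<close>.\<close>

definition dbar_sol :: "(complex \<Rightarrow> complex) \<Rightarrow> (complex \<Rightarrow> complex) \<Rightarrow> bool" where
  "dbar_sol q v \<longleftrightarrow> v \<in> L2 M \<and> (\<forall>h\<in>A2w w. ip M v h = 0) \<and>
     (\<forall>\<xi>\<in>test. ip M (Dw \<xi>) v = - ip M (\<lambda>z. \<xi> z / of_real (tau w z * w z)) (\<lambda>z. q z * of_real (tau w z)))"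

text \<open>Hormander's duality argument: the a priori estimate makes the right-hand side a bounded
  functional on the range of \<open>Dw\<close>. The solution is a limit of elements
  \<open>Dw (s n)\<close>, which are orthogonal to \<open>A2w w\<close>, so it is orthogonal as
  well.\<close>

lemma dbar_sol_exists:
  assumes C: "0 < C" "\<And>\<xi>. \<xi> \<in> test \<Longrightarrow> (\<lambda>z. \<xi> z / of_real (tau w z * w z)) \<in> L2 M"
    "\<And>\<xi>. \<xi> \<in> test \<Longrightarrow> nrm M (\<lambda>z. \<xi> z / of_real (tau w z * w z)) \<le> C * nrm M (Dw \<xi>)"
    and q: "(\<lambda>z. q z * of_real (tau w z)) \<in> L2 M"
  obtains v where "dbar_sol q v" "nrm M v \<le> C * nrm M (\<lambda>z. q z * of_real (tau w z))"
proof -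
  let ?q = "\<lambda>z. q z * of_real (tau w z)"
  let ?h = "\<lambda>\<xi> z. \<xi> z / of_real (tau w z * w z) :: complex"
  have hl: "?h (\<lambda>x. c * \<alpha> x + \<beta> x) = (\<lambda>z. c * ?h \<alpha> z + ?h \<beta> z)" for c \<alpha> \<beta>
    by (auto simp: fun_eq_iff add_divide_distrib)
  obtain v s where v: "v \<in> L2 M" "\<And>n::nat. s n \<in> test" "(\<lambda>n. nrm M (\<lambda>x. Dw (s n) x - v x)) \<longlonglongrightarrow> 0"
    "\<And>\<alpha>. \<alpha> \<in> test \<Longrightarrow> ip M (Dw \<alpha>) v = - ip M (?h \<alpha>) ?q" "nrm M v \<le> C * nrm M ?q"
  proof (rule L2_Riesz[where T = test and D = Dw and M = M and l = "\<lambda>\<xi>. - ip M (?h \<xi>) ?q" and B = "C * nrm M ?q"])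
    show "Dw (\<lambda>x. c * \<alpha> x + \<beta> x) = (\<lambda>x. c * Dw \<alpha> x + Dw \<beta> x)" if "\<alpha> \<in> test" "\<beta> \<in> test" for c \<alpha> \<beta>
      unfolding Dw_def[abs_def] test_lin(2)[OF that] by (auto simp: add_divide_distrib)
    show "- ip M (?h (\<lambda>x. c * \<alpha> x + \<beta> x)) ?q = c * - ip M (?h \<alpha>) ?q + - ip M (?h \<beta>) ?q" if "\<alpha> \<in> test" "\<beta> \<in> test" for c \<alpha> \<beta>
      unfolding hl by (subst ip_lin_left) (use C(2) that q in auto)
    show "cmod (- ip M (?h \<alpha>) ?q) \<le> C * nrm M ?q * nrm M (Dw \<alpha>)" if "\<alpha> \<in> test" for \<alpha>
    proof -
      have "cmod (ip M (?h \<alpha>) ?q) \<le> nrm M (?h \<alpha>) * nrm M ?q" by (intro L2_Cauchy_Schwarz C(2) that q)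
      also have "\<dots> \<le> (C * nrm M (Dw \<alpha>)) * nrm M ?q" by (intro mult_right_mono C(3) that) auto
      finally show ?thesis by (simp add: mult_ac)
    qed
    show "0 \<le> C * nrm M ?q" using C(1) by simp
  qed (use test_zero test_lin(1) Dw_L2 in auto)
  have "ip M v h = 0" if h: "h \<in> A2w w" for h
  proof -
    have "(\<lambda>n. ip M (Dw (s n)) h) \<longlonglongrightarrow> ip M v h"
      by (intro ip_limit A2w_L2 h v Dw_L2)
    moreover have "ip M (Dw (s n)) h = 0" for n
      using ip_A2w_Dw[OF h v(2)] by (subst ip_cnj) simp
    ultimately show ?thesis using LIMSEQ_unique by (simp add: LIMSEQ_const_iff)
  qed
  then have "dbar_sol q v" using v by (simp add: dbar_sol_def)
  then show ?thesis using that v(5) by blast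
qed

text \<open>Two solutions with the same data differ by some \<open>u\<close> orthogonal to the range
  of \<open>Dw\<close>, hence holomorphic up to a null set, and also orthogonal to
  \<open>A2w w\<close>. So \<open>u\<close> has norm zero, and the bound for the constructed
  solution holds for every solution.\<close>

lemma dbar_sol_bound:
  assumes C: "0 < C" "\<And>\<xi>. \<xi> \<in> test \<Longrightarrow> (\<lambda>z. \<xi> z / of_real (tau w z * w z)) \<in> L2 M"
    "\<And>\<xi>. \<xi> \<in> test \<Longrightarrow> nrm M (\<lambda>z. \<xi> z / of_real (tau w z * w z)) \<le> C * nrm M (Dw \<xi>)"
    and q: "(\<lambda>z. q z * of_real (tau w z)) \<in> L2 M" and v: "dbar_sol q v"
  shows "nrm M v \<le> C * nrm M (\<lambda>z. q z * of_real (tau w z))"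
proof -
  obtain v' where v': "dbar_sol q v'" "nrm M v' \<le> C * nrm M (\<lambda>z. q z * of_real (tau w z))"
    by (rule dbar_sol_exists[OF C q])
  define u where "u z = v z - v' z" for z
  have L: "v \<in> L2 M" "v' \<in> L2 M" using v v' by (auto simp: dbar_sol_def)
  then have uL: "u \<in> L2 M" unfolding u_def by (rule L2_diff)
  have "ip M u (Dw \<xi>) = 0" if "\<xi> \<in> test" for \<xi>
  proof -
    have "ip M (Dw \<xi>) u = 0" unfolding u_def
      using v v' that by (subst ip_diff_right) (auto simp: dbar_sol_def Dw_L2)
    then show ?thesis by (subst ip_cnj) simp
  qed
  then obtain V where V: "V \<in> A2w w" "AE z in M. u z = V z"
    using holomorphic_representative[OF uL] by blast
  have "ip M u u = ip M u V"
    by (rule ip_cong_AE(1)[OF V(2)]) (use uL A2w_L2[OF V(1)] L2M_meas in auto)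
  also have "\<dots> = ip M v V - ip M v' V" unfolding u_def by (intro ip_diff_left L A2w_L2 V)
  also have "\<dots> = 0" using v v' V by (simp add: dbar_sol_def)
  finally have "nrm M u = 0" by (simp add: ip_self)
  moreover have "nrm M v \<le> nrm M u + nrm M v'"
    using nrm_triangle[OF uL L(2)] by (simp add: u_def)
  ultimately show ?thesis using v'(2) by simp
qed

text \<open>Linearity of the weak equation. Square integrability of the data is carried along in the
  induction, because the pairing is split for members of \<open>L2 M\<close>.\<close>

lemma dbar_sol_diff_sum:
  assumes v: "dbar_sol q v" and I: "finite I" "\<And>i. i \<in> I \<Longrightarrow> dbar_sol (p i) (u i)"
    and q: "(\<lambda>z. q z * of_real (tau w z)) \<in> L2 M" "\<And>i. i \<in> I \<Longrightarrow> (\<lambda>z. p i z * of_real (tau w z)) \<in> L2 M"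
    and h: "\<And>\<xi>. \<xi> \<in> test \<Longrightarrow> (\<lambda>z. \<xi> z / of_real (tau w z * w z)) \<in> L2 M"
  shows "dbar_sol (\<lambda>z. q z - (\<Sum>i\<in>I. c i * p i z)) (\<lambda>z. v z - (\<Sum>i\<in>I. c i * u i z))
    \<and> (\<lambda>z. (q z - (\<Sum>i\<in>I. c i * p i z)) * of_real (tau w z)) \<in> L2 M"
  using I q(2)
proof (induction I rule: finite_induct)
  case empty
  then show ?case using v q by simp
next
  case (insert j J)
  let ?q = "\<lambda>z. q z - (\<Sum>i\<in>J. c i * p i z)" and ?v = "\<lambda>z. v z - (\<Sum>i\<in>J. c i * u i z)"
  have IH: "dbar_sol ?q ?v" "(\<lambda>z. ?q z * of_real (tau w z)) \<in> L2 M" using insert by auto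
  have s: "dbar_sol (p j) (u j)" "(\<lambda>z. p j z * of_real (tau w z)) \<in> L2 M" using insert by auto
  have e1: "q z - (\<Sum>i\<in>insert j J. c i * p i z) = ?q z - c j * p j z" for z using insert by simp
  have e2: "v z - (\<Sum>i\<in>insert j J. c i * u i z) = - c j * u j z + ?v z" for z using insert by simp
  have e3: "(?q z - c j * p j z) * of_real (tau w z) = - c j * (p j z * of_real (tau w z)) + ?q z * of_real (tau w z)" for z
    by (simp add: algebra_simps)
  have L: "u j \<in> L2 M" "?v \<in> L2 M" using s IH by (auto simp: dbar_sol_def)
  have r: "ip M g (\<lambda>x. c' * f x + f' x) = cnj c' * ip M g f + ip M g f'" if "f \<in> L2 M" "f' \<in> L2 M" "g \<in> L2 M" for f f' g c'
    by (subst (1 2 3) ip_cnj, subst ip_lin_left) (use that in auto)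
  show ?case unfolding e1 e2 e3
  proof
    show "(\<lambda>z. - c j * (p j z * of_real (tau w z)) + ?q z * of_real (tau w z)) \<in> L2 M" by (rule L2_lin[OF s(2) IH(2)])
    show "dbar_sol (\<lambda>z. ?q z - c j * p j z) (\<lambda>z. - c j * u j z + ?v z)"
      unfolding dbar_sol_def e3
    proof (intro conjI ballI)
      show "(\<lambda>z. - c j * u j z + ?v z) \<in> L2 M" by (rule L2_lin[OF L])
      show "ip M (\<lambda>z. - c j * u j z + ?v z) h = 0" if "h \<in> A2w w" for h
        by (subst ip_lin_left[OF L A2w_L2[OF that]]) (use s IH that in \<open>auto simp: dbar_sol_def\<close>)
      show "ip M (Dw \<xi>) (\<lambda>z. - c j * u j z + ?v z) = - ip M (\<lambda>z. \<xi> z / of_real (tau w z * w z)) (\<lambda>z. - c j * (p j z * of_real (tau w z)) + ?q z * of_real (tau w z))"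
        if "\<xi> \<in> test" for \<xi>
        unfolding r[OF L Dw_L2[OF that]] r[OF s(2) IH(2) h[OF that]]
        using s(1) IH(1) that by (simp add: dbar_sol_def)
    qed
  qed
qed

text \<open>\<open>hdom\<close> makes \<open>cnj b * f\<close> square integrable, so
  \<open>proj\<close> is a genuine projection there. The projected part is invisible to
  \<open>Dw\<close>, and the \<open>\<partial>\<close>-bar derivative of \<open>cnj b * f\<close> is
  \<open>cnj (deriv b) * f\<close>.\<close>

lemma hankel_dbar_sol:
  assumes b: "b holomorphic_on disc" and f: "f \<in> hdom w b"
  shows "dbar_sol (\<lambda>z. cnj (deriv b z) * f z) (hankel w b f)"
proof -
  have fA: "f \<in> A2w w" and FL: "(\<lambda>z. cnj (b z) * f z) \<in> L2 M"
    using f by (auto simp: hdom_def L2w_eq)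
  have fh: "f holomorphic_on disc" using fA by (simp add: A2w_eq)
  let ?F = "\<lambda>z. cnj (b z) * f z"
  note P = proj_props[OF FL]
  have he: "hankel w b f = (\<lambda>z. ?F z - proj w ?F z)" by (simp add: hankel_def)
  have HL: "hankel w b f \<in> L2 M" unfolding he by (intro L2_diff FL A2w_L2 P)
  have db: "continuous_on disc b" "continuous_on disc f" "continuous_on disc (deriv b)" "continuous_on disc (deriv f)"
    by (intro holomorphic_on_imp_continuous_on holomorphic_deriv b fh open_disc)+
  have "ip M (Dw \<xi>) (hankel w b f) = - ip M (\<lambda>z. \<xi> z / of_real (tau w z * w z)) (\<lambda>z. cnj (deriv b z) * f z * of_real (tau w z))"
    if t: "\<xi> \<in> test" for \<xi>
  proof -
    have "ip M (hankel w b f) (Dw \<xi>) = ip M ?F (Dw \<xi>) - ip M (proj w ?F) (Dw \<xi>)"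
      unfolding he by (intro ip_diff_left FL A2w_L2 P Dw_L2 t)
    also have "ip M (proj w ?F) (Dw \<xi>) = 0" by (rule ip_A2w_Dw[OF P(1) t])
    also have "ip M ?F (Dw \<xi>) = (LINT z|lebesgue. ?F z * cnj (dz \<xi> z))" by (rule ip_Dw[OF FL t])
    also have "\<dots> = (LINT z|lebesgue. ?F z * dzb (\<lambda>z. cnj (\<xi> z)) z)"
    proof -
      have "dz (\<lambda>z. cnj (cnj (\<xi> z))) = (\<lambda>z. cnj (dzb (\<lambda>z. cnj (\<xi> z)) z))"
        by (rule test_cnj(2)[OF test_cnj(1)[OF t]])
      then have "dz \<xi> = (\<lambda>z. cnj (dzb (\<lambda>z. cnj (\<xi> z)) z))" by simp
      then show ?thesis by simp
    qed
    also have "\<dots> = - (LINT z|lebesgue. ((cnj (b z) * (1 * deriv f z) + cnj (1 * deriv b z) * f z) + \<i> * (cnj (b z) * (\<i> * deriv f z) + cnj (\<i> * deriv b z) * f z)) / 2 * cnj (\<xi> z))"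
      by (rule test_by_parts[OF test_cnj(1)[OF t]])
         (intro has_pd_mult has_pd_cnj has_pd_holomorphic b fh open_disc continuous_intros db)+
    also have "\<dots> = - (LINT z|lebesgue. cnj (deriv b z) * f z * cnj (\<xi> z))"
      by (simp add: algebra_simps)
    also have "(LINT z|lebesgue. cnj (deriv b z) * f z * cnj (\<xi> z)) = ip M (\<lambda>z. cnj (deriv b z) * f z * of_real (tau w z)) (\<lambda>z. \<xi> z / of_real (tau w z * w z))"
    proof -
      have [measurable]: "\<xi> \<in> borel_measurable Ld" "deriv b \<in> borel_measurable Ld" "f \<in> borel_measurable Ld"
        using test_continuous[OF t] db by (auto intro!: cont_meas intro: continuous_on_subset)
      have m: "(\<lambda>z. (cnj (deriv b z) * f z * of_real (tau w z)) * cnj (\<xi> z / of_real (tau w z * w z))) \<in> borel_measurable Ld"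
        by measurable
      show ?thesis unfolding ip_def
      proof (subst integral_M[OF m], rule Bochner_Integration.integral_cong[OF refl])
        fix z
        show "cnj (deriv b z) * f z * cnj (\<xi> z) = indicator disc z *\<^sub>R (w z *\<^sub>R ((cnj (deriv b z) * f z * of_real (tau w z)) * cnj (\<xi> z / of_real (tau w z * w z))))"
          using w_nz[of z] tau_pos[of z] test_outside(1)[OF t, of z]
          by (cases "z \<in> disc") (auto simp: scaleR_conv_of_real)
      qed
    qed
    finally have "ip M (hankel w b f) (Dw \<xi>) = - ip M (\<lambda>z. cnj (deriv b z) * f z * of_real (tau w z)) (\<lambda>z. \<xi> z / of_real (tau w z * w z))"
      by simp
    then show ?thesis by (subst (1 2) ip_cnj) simp
  qed
  moreover have "ip M (hankel w b f) h = 0" if "h \<in> A2w w" for h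
    unfolding he by (rule P(2)[OF that])
  ultimately show ?thesis using HL by (simp add: dbar_sol_def)
qed

end

section \<open>Sub-mean values and packing\<close>

text \<open>\<open>ball z R\<close> is rescaled to the unit disc and the cut-off is bounded by
  \<open>s^3\<close> with \<open>s = (r/R)^2\<close>. The factors \<open>s^3 / (c0 * s^4)\<close>
  and \<open>R^-2\<close> combine to \<open>1 / (c0 * r^2)\<close>, so \<open>R\<close> drops
  out.\<close>

lemma mean_value_nn:
  assumes h: "h holomorphic_on ball z R" and r: "0 < r" "r < R"
  shows "ennreal (cmod (h z)) \<le> ennreal (1 / (c0 * r\<^sup>2)) * (\<integral>\<^sup>+\<zeta>. ennreal (cmod (h \<zeta>)) * indicator (cball z r) \<zeta> \<partial>lebesgue)"
proof -
  have R: "0 < R" using r by simp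
  define F where "F \<zeta> = ennreal (cmod (h \<zeta>)) * indicator (cball z r) \<zeta>" for \<zeta>
  have ch: "continuous_on (cball z r) h"
    using holomorphic_on_imp_continuous_on[OF h] by (rule continuous_on_subset) (use r in auto)
  have "(\<lambda>\<zeta>. indicator (cball z r) \<zeta> *\<^sub>R h \<zeta>) \<in> borel_measurable borel"
    by (rule borel_measurable_continuous_on_indicator[OF _ ch]) auto
  then have "(\<lambda>\<zeta>. ennreal (cmod (indicator (cball z r) \<zeta> *\<^sub>R h \<zeta>))) \<in> borel_measurable borel" by measurable
  also have "(\<lambda>\<zeta>. ennreal (cmod (indicator (cball z r) \<zeta> *\<^sub>R h \<zeta>))) = F"
    by (auto simp: F_def indicator_def fun_eq_iff)
  finally have Fm [measurable]: "F \<in> borel_measurable borel" .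
  define g where "g \<zeta> = h (z + of_real R * \<zeta>)" for \<zeta>
  have gh: "g holomorphic_on disc"
  proof -
    have "(h \<circ> (\<lambda>\<zeta>. z + of_real R * \<zeta>)) holomorphic_on disc"
    proof (rule holomorphic_on_compose_gen[OF _ h])
      show "(\<lambda>\<zeta>. z + of_real R * \<zeta>) ` disc \<subseteq> ball z R"
        using R by (auto simp: disc_def dist_norm norm_mult)
    qed (intro holomorphic_intros)
    then show ?thesis by (simp add: g_def[abs_def] o_def)
  qed
  define s where "s = (r / R)\<^sup>2"
  have s: "0 < s" "sqrt s = r / R" "r / R < 1" using r R by (auto simp: s_def)
  have B: "Bi 3 g s 0 = of_real (c0 * s^4) * h z"
    using mean_value_bump[OF gh s(1), of 0] s by (simp add: g_def)
  have lg: "locint g" using wkhol_holomorphic[OF gh] by (simp add: wkhol_def)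
  have "ennreal (cmod (Bi 3 g s 0)) \<le> (\<integral>\<^sup>+\<zeta>. ennreal (cmod (g \<zeta> * of_real (bump 3 s 0 \<zeta>))) \<partial>lebesgue)"
    unfolding Bi_def by (rule integral_norm_bound_ennreal) (use locint_bump_integrable'[OF lg, of 3 s 0] s in auto)
  also have "\<dots> \<le> (\<integral>\<^sup>+\<zeta>. ennreal (s^3) * F (z + R *\<^sub>R \<zeta>) \<partial>lebesgue)"
  proof (rule nn_integral_mono)
    fix \<zeta> :: complex
    show "ennreal (cmod (g \<zeta> * of_real (bump 3 s 0 \<zeta>))) \<le> ennreal (s^3) * F (z + R *\<^sub>R \<zeta>)"
    proof (cases "\<zeta> \<in> cball 0 (sqrt s)")
      case True
      then have "cmod \<zeta> \<le> r / R" using s by simp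
      then have "z + R *\<^sub>R \<zeta> \<in> cball z r" using R by (simp add: dist_norm field_simps)
      then have "F (z + R *\<^sub>R \<zeta>) = ennreal (cmod (g \<zeta>))" by (simp add: F_def g_def scaleR_conv_of_real)
      moreover have "cmod (g \<zeta> * of_real (bump 3 s 0 \<zeta>)) \<le> s^3 * cmod (g \<zeta>)"
        using bump_le[of 3 s 0 \<zeta>] s(1) by (simp add: norm_mult mult.commute mult_left_mono)
      ultimately show ?thesis using s(1) by (simp add: ennreal_mult' [symmetric] ennreal_leI)
    next
      case False
      then show ?thesis using bump_outside[of 3 \<zeta> 0 s] by simp
    qed
  qed
  also have "\<dots> = ennreal (s^3) * (\<integral>\<^sup>+\<zeta>. F (z + R *\<^sub>R \<zeta>) \<partial>lborel)"
    by (subst nn_integral_completion) (auto intro!: nn_integral_cmult)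
  also have "(\<integral>\<^sup>+\<zeta>. F (z + R *\<^sub>R \<zeta>) \<partial>lborel) = ennreal (1 / R\<^sup>2) * (\<integral>\<^sup>+\<zeta>. F \<zeta> \<partial>lborel)"
  proof -
    have "(\<integral>\<^sup>+\<zeta>. F \<zeta> \<partial>lborel) = (\<integral>\<^sup>+\<zeta>. F \<zeta> \<partial>density (distr lborel borel (\<lambda>x. z + R *\<^sub>R x)) (\<lambda>_. \<bar>R\<bar>^DIM(complex)))"
      using lborel_affine[of R z] R by simp
    also have "\<dots> = ennreal (R\<^sup>2) * (\<integral>\<^sup>+\<zeta>. F (z + R *\<^sub>R \<zeta>) \<partial>lborel)"
      using R by (simp add: nn_integral_density nn_integral_cmult nn_integral_distr)
    finally have f: "(\<integral>\<^sup>+\<zeta>. F \<zeta> \<partial>lborel) = ennreal (R\<^sup>2) * (\<integral>\<^sup>+\<zeta>. F (z + R *\<^sub>R \<zeta>) \<partial>lborel)" .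
    have "ennreal (1 / R\<^sup>2) * ennreal (R\<^sup>2) = ennreal (1 / R\<^sup>2 * R\<^sup>2)" by (rule ennreal_mult[symmetric]) auto
    then have "ennreal (1 / R\<^sup>2) * (\<integral>\<^sup>+\<zeta>. F \<zeta> \<partial>lborel) = ennreal (1 / R\<^sup>2 * R\<^sup>2) * (\<integral>\<^sup>+\<zeta>. F (z + R *\<^sub>R \<zeta>) \<partial>lborel)"
      unfolding f mult.assoc[symmetric] by simp
    then show ?thesis using R by simp
  qed
  finally have fin: "ennreal (cmod (Bi 3 g s 0)) \<le> ennreal (s^3) * (ennreal (1 / R\<^sup>2) * (\<integral>\<^sup>+\<zeta>. F \<zeta> \<partial>lborel))" .
  have FF: "(\<integral>\<^sup>+\<zeta>. F \<zeta> \<partial>lebesgue) = (\<integral>\<^sup>+\<zeta>. F \<zeta> \<partial>lborel)" by (rule nn_integral_completion)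
  have "ennreal (cmod (h z)) \<le> ennreal (1 / (c0 * r\<^sup>2)) * (\<integral>\<^sup>+\<zeta>. F \<zeta> \<partial>lebesgue)"
  proof (cases "(\<integral>\<^sup>+\<zeta>. F \<zeta> \<partial>lborel)")
    case (real j)
    have "ennreal (s^3) * (ennreal (1 / R\<^sup>2) * ennreal j) = ennreal (s^3 * (1 / R\<^sup>2 * j))"
      using s(1) real(1) by (simp only: ennreal_mult' zero_le_power zero_le_divide_1_iff zero_le_power2 less_imp_le)
    then have "cmod (Bi 3 g s 0) \<le> s^3 * (1 / R\<^sup>2 * j)"
      using fin real s(1) by (simp only: ennreal_le_iff zero_le_mult_iff zero_le_power zero_le_divide_1_iff zero_le_power2 less_imp_le simp_thms)
    then have "c0 * s^4 * cmod (h z) \<le> s^3 * (1 / R\<^sup>2 * j)"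
      using c0_pos s(1) unfolding B norm_mult norm_of_real by simp
    moreover have "c0 * s^4 = s^3 * (c0 * s)" by (simp add: power_numeral_reduce)
    ultimately have "s^3 * (c0 * s * cmod (h z)) \<le> s^3 * (1 / R\<^sup>2 * j)" by (simp add: mult_ac)
    then have "c0 * s * cmod (h z) \<le> 1 / R\<^sup>2 * j" using s(1) by (simp only: mult_le_cancel_left_pos zero_less_power)
    then have "c0 * (s * R\<^sup>2) * cmod (h z) \<le> j" using R by (simp add: field_simps)
    moreover have "s * R\<^sup>2 = r\<^sup>2" using R by (simp add: s_def power_divide)
    ultimately have "cmod (h z) \<le> 1 / (c0 * r\<^sup>2) * j" using c0_pos r by (simp add: field_simps)
    then have "ennreal (cmod (h z)) \<le> ennreal (1 / (c0 * r\<^sup>2) * j)" by (rule ennreal_leI)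
    also have "\<dots> = ennreal (1 / (c0 * r\<^sup>2)) * ennreal j" using c0_pos real by (intro ennreal_mult) auto
    finally show ?thesis using FF real by simp
  next
    case top
    then show ?thesis using FF c0_pos r by (simp add: ennreal_mult_top)
  qed
  then show ?thesis by (simp add: F_def)
qed

text \<open>The factor 4 comes from using half of the distance to the circle, the power of 2 from
  the size of \<open>h\<close> on that half disc in \<open>submean_powr\<close>.\<close>

definition Ksub :: "real \<Rightarrow> real" where
  "Ksub p = 4 * 2 powr ((2/p) * (1 - p)) / c0"

lemma Ksub_pos: "0 < Ksub p"
  using c0_pos by (simp add: Ksub_def)

text \<open>Powers of \<open>h\<close> itself are avoided, since \<open>h\<close> may have zeros.
  Let \<open>(r - |\<zeta> - z|)^(2/p) * |h|\<close> attain its maximum at \<open>\<zeta>0\<close>.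
  Near that point \<open>|h|\<close> is at most a multiple of \<open>|h \<zeta>0|\<close>, so in the
  mean value at \<open>\<zeta>0\<close> one can write \<open>|h| = |h|^(1-p) * |h|^p\<close>, bound
  the first factor and divide it out.\<close>

lemma submean_powr:
  assumes h: "h holomorphic_on ball z R" and r: "0 < r" "r < R" and p: "0 < p" "p \<le> 1"
  shows "ennreal (cmod (h z) powr p) \<le> ennreal (Ksub p / r\<^sup>2) * (\<integral>\<^sup>+\<zeta>. ennreal (cmod (h \<zeta>) powr p) * indicator (cball z r) \<zeta> \<partial>lebesgue)"
    (is "_ \<le> _ * ?J")
proof (cases "h z = 0 \<or> ?J = \<infinity>")
  case True
  then show ?thesis using Ksub_pos[of p] r by (auto simp: ennreal_mult_top)
next
  case False
  then obtain j where j: "?J = ennreal j" "0 \<le> j" by (cases ?J) auto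
  \<comment> \<open>Chosen so that raising the weight to the power \<open>p\<close> gives the square
    of a distance, which matches the scaling of area.\<close>
  define q where "q = 2 / p"
  have q: "0 < q" "q * p = 2" using p by (auto simp: q_def)
  have ch: "continuous_on (cball z r) h"
    using holomorphic_on_imp_continuous_on[OF h] by (rule continuous_on_subset) (use r in auto)
  define \<Phi> where "\<Phi> \<zeta> = (r - cmod (\<zeta> - z)) powr q * cmod (h \<zeta>)" for \<zeta>
  have "continuous_on (cball z r) \<Phi>" unfolding \<Phi>_def
    by (intro continuous_intros continuous_on_powr' ch) (use q in \<open>auto simp: dist_norm norm_minus_commute\<close>)
  then obtain \<zeta>0 where z0: "\<zeta>0 \<in> cball z r" "\<And>\<zeta>. \<zeta> \<in> cball z r \<Longrightarrow> \<Phi> \<zeta> \<le> \<Phi> \<zeta>0"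
    using continuous_attains_sup[of "cball z r" \<Phi>] r by auto
  define d H where "d = r - cmod (\<zeta>0 - z)" and "H = cmod (h \<zeta>0)"
  have max_z: "r powr q * cmod (h z) \<le> d powr q * H"
    using z0(2)[of z] r by (simp add: \<Phi>_def d_def H_def)
  have d: "0 < d" and H: "0 < H"
  proof -
    have "0 < d powr q * H" using max_z False r by (intro less_le_trans[OF _ max_z]) simp
    then show "0 < H" unfolding H_def by (metis mult_zero_right norm_eq_zero less_irrefl zero_less_norm_iff)
    have "0 \<le> d" using z0(1) by (simp add: d_def dist_norm norm_minus_commute)
    moreover have "d \<noteq> 0" using \<open>0 < d powr q * H\<close> by auto
    ultimately show "0 < d" by simp
  qed
  have sub: "cball \<zeta>0 (d/2) \<subseteq> cball z r" "ball \<zeta>0 d \<subseteq> ball z R"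
  proof -
    have dz: "dist z \<zeta>0 = r - d" by (simp add: d_def dist_norm norm_minus_commute)
    show "cball \<zeta>0 (d/2) \<subseteq> cball z r"
    proof
      fix x assume "x \<in> cball \<zeta>0 (d/2)"
      then show "x \<in> cball z r" using dist_triangle[of z x \<zeta>0] dz d by simp
    qed
    show "ball \<zeta>0 d \<subseteq> ball z R"
    proof
      fix x assume "x \<in> ball \<zeta>0 d"
      then show "x \<in> ball z R" using dist_triangle[of z x \<zeta>0] dz d r by simp
    qed
  qed
  have pw: "cmod (h \<zeta>) \<le> (2 powr q * H) powr (1 - p) * cmod (h \<zeta>) powr p" if "\<zeta> \<in> cball \<zeta>0 (d/2)" for \<zeta>
  proof (cases "h \<zeta> = 0")
    case False
    have "\<Phi> \<zeta> \<le> d powr q * H" using z0(2)[of \<zeta>] sub that by (auto simp: \<Phi>_def d_def H_def)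
    moreover have "d / 2 \<le> r - cmod (\<zeta> - z)"
      using that norm_triangle_ineq[of "\<zeta> - \<zeta>0" "\<zeta>0 - z"] by (simp add: d_def dist_norm norm_minus_commute field_simps)
    then have "(d / 2) powr q * cmod (h \<zeta>) \<le> \<Phi> \<zeta>" unfolding \<Phi>_def
      using d q by (intro mult_right_mono powr_mono2) auto
    ultimately have "(d / 2) powr q * cmod (h \<zeta>) \<le> d powr q * H" by linarith
    moreover have "(d/2) powr q = d powr q / 2 powr q" using d by (simp add: powr_divide)
    ultimately have "cmod (h \<zeta>) \<le> 2 powr q * H" using d by (simp add: field_simps)
    then have "cmod (h \<zeta>) powr (1 - p) \<le> (2 powr q * H) powr (1 - p)" using p by (intro powr_mono2) auto
    then have "cmod (h \<zeta>) powr (1 - p) * cmod (h \<zeta>) powr p \<le> (2 powr q * H) powr (1 - p) * cmod (h \<zeta>) powr p"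
      by (intro mult_right_mono) auto
    then show ?thesis using False by (simp add: powr_add[symmetric])
  qed simp
  let ?c = "(2 powr q * H) powr (1 - p)"
  have "ennreal H \<le> ennreal (1 / (c0 * (d/2)\<^sup>2)) * (\<integral>\<^sup>+\<zeta>. ennreal (cmod (h \<zeta>)) * indicator (cball \<zeta>0 (d/2)) \<zeta> \<partial>lebesgue)"
    unfolding H_def by (rule mean_value_nn[of _ _ d]) (use d holomorphic_on_subset[OF h sub(2)] in auto)
  also have "\<dots> \<le> ennreal (1 / (c0 * (d/2)\<^sup>2)) * (\<integral>\<^sup>+\<zeta>. ennreal ?c * (ennreal (cmod (h \<zeta>) powr p) * indicator (cball z r) \<zeta>) \<partial>lebesgue)"
  proof (intro mult_left_mono nn_integral_mono)
    fix \<zeta>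
    show "ennreal (cmod (h \<zeta>)) * indicator (cball \<zeta>0 (d/2)) \<zeta> \<le> ennreal ?c * (ennreal (cmod (h \<zeta>) powr p) * indicator (cball z r) \<zeta>)"
    proof (cases "\<zeta> \<in> cball \<zeta>0 (d/2)")
      case True
      then have "\<zeta> \<in> cball z r" using sub by blast
      then show ?thesis using True pw[OF True] by (simp add: ennreal_mult'[symmetric] ennreal_leI)
    qed simp
  qed simp
  also have "(\<integral>\<^sup>+\<zeta>. ennreal ?c * (ennreal (cmod (h \<zeta>) powr p) * indicator (cball z r) \<zeta>) \<partial>lebesgue) = ennreal ?c * ?J"
  proof (rule nn_integral_cmult)
    have "(\<lambda>\<zeta>. indicator (cball z r) \<zeta> *\<^sub>R h \<zeta>) \<in> borel_measurable borel"
      by (rule borel_measurable_continuous_on_indicator[OF _ ch]) auto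
    then have "(\<lambda>\<zeta>. ennreal (cmod (indicator (cball z r) \<zeta> *\<^sub>R h \<zeta>) powr p)) \<in> borel_measurable lborel" by measurable
    also have "(\<lambda>\<zeta>. ennreal (cmod (indicator (cball z r) \<zeta> *\<^sub>R h \<zeta>) powr p)) = (\<lambda>\<zeta>. ennreal (cmod (h \<zeta>) powr p) * indicator (cball z r) \<zeta>)"
      by (auto simp: indicator_def fun_eq_iff)
    finally show "(\<lambda>\<zeta>. ennreal (cmod (h \<zeta>) powr p) * indicator (cball z r) \<zeta>) \<in> borel_measurable lebesgue"
      by (rule measurable_completion)
  qed
  finally have f: "ennreal H \<le> ennreal (1 / (c0 * (d/2)\<^sup>2)) * (ennreal ?c * ennreal j)" unfolding j(1) .
  have "ennreal (1 / (c0 * (d/2)\<^sup>2) * (?c * j)) = ennreal (1 / (c0 * (d/2)\<^sup>2)) * ennreal (?c * j)"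
    using c0_pos j by (intro ennreal_mult) auto
  moreover have "ennreal (?c * j) = ennreal ?c * ennreal j" using j by (intro ennreal_mult) auto
  ultimately have "ennreal H \<le> ennreal (1 / (c0 * (d/2)\<^sup>2) * (?c * j))" using f by simp
  moreover have "0 \<le> 1 / (c0 * (d/2)\<^sup>2) * (?c * j)" using c0_pos j by simp
  ultimately have "H \<le> 1 / (c0 * (d/2)\<^sup>2) * (?c * j)" by (simp only: ennreal_le_iff)
  then have HJ: "H \<le> 4 / (c0 * d\<^sup>2) * (?c * j)" by (simp add: power_divide mult_ac)
  have "H powr p = H powr (p - 1) * H" using H by (simp add: powr_diff)
  also have "\<dots> \<le> H powr (p - 1) * (4 / (c0 * d\<^sup>2) * (?c * j))" by (intro mult_left_mono HJ) simp
  also have "?c = 2 powr (q * (1 - p)) * H powr (1 - p)" using H by (simp add: powr_mult powr_powr)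
  also have "H powr (p - 1) * (4 / (c0 * d\<^sup>2) * (2 powr (q * (1 - p)) * H powr (1 - p) * j))
      = (H powr (p - 1) * H powr (1 - p)) * (4 / (c0 * d\<^sup>2) * (2 powr (q * (1 - p)) * j))" by (simp add: mult_ac)
  also have "H powr (p - 1) * H powr (1 - p) = 1" using H by (simp add: powr_add[symmetric])
  finally have HP: "H powr p * d\<^sup>2 \<le> Ksub p * j"
    using d c0_pos by (simp add: Ksub_def q_def field_simps)
  have "r\<^sup>2 * cmod (h z) powr p = (r powr q * cmod (h z)) powr p"
    using r q by (simp add: powr_mult powr_powr powr_numeral)
  also have "\<dots> \<le> (d powr q * H) powr p" using max_z p r by (intro powr_mono2) auto
  also have "\<dots> = d\<^sup>2 * H powr p" using d H q by (simp add: powr_mult powr_powr powr_numeral)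
  also have "\<dots> \<le> Ksub p * j" using HP by (simp add: mult.commute)
  finally have "cmod (h z) powr p \<le> Ksub p / r\<^sup>2 * j" using r by (simp add: field_simps)
  then have "ennreal (cmod (h z) powr p) \<le> ennreal (Ksub p / r\<^sup>2 * j)" by (rule ennreal_leI)
  also have "\<dots> = ennreal (Ksub p / r\<^sup>2) * ennreal j"
    using j Ksub_pos[of p] by (intro ennreal_mult) auto
  finally show ?thesis by (simp add: j(1))
qed

text \<open>Cauchy estimates at radius \<open>\<rho>\<close>, evaluated at distance at most
  \<open>\<rho> / 2\<close>, give a geometric series of ratio 1/2. The coefficient bound serves to
  make Taylor coefficients bounded functionals.\<close>

lemma Taylor_remainder:
  assumes h: "h holomorphic_on ball z R" and \<rho>: "0 < \<rho>" "\<rho> < R"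
    and B: "\<And>\<zeta>. cmod (z - \<zeta>) = \<rho> \<Longrightarrow> cmod (h \<zeta>) \<le> B" and x: "cmod (x - z) \<le> \<rho> / 2"
  shows "cmod (h x - (\<Sum>i<N. (deriv ^^ i) h z / fact i * (x - z)^i)) \<le> 2 * B * (1/2)^N"
    and "cmod ((deriv ^^ i) h z / fact i) \<le> B / \<rho>^i"
proof -
  have c: "cmod ((deriv ^^ i) h z / fact i) \<le> B / \<rho>^i" for i
  proof -
    have "cmod ((deriv ^^ i) h z) \<le> fact i * B / \<rho>^i"
    proof (rule Cauchy_inequality[OF _ _ \<rho>(1) B])
      show "h holomorphic_on ball z \<rho>" by (rule holomorphic_on_subset[OF h]) (use \<rho> in auto)
      show "continuous_on (cball z \<rho>) h"
        using holomorphic_on_imp_continuous_on[OF h] by (rule continuous_on_subset) (use \<rho> in auto)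
    qed
    then show ?thesis by (simp add: norm_divide field_simps)
  qed
  then show "cmod ((deriv ^^ i) h z / fact i) \<le> B / \<rho>^i" .
  let ?t = "\<lambda>i. (deriv ^^ i) h z / fact i * (x - z)^i"
  have xb: "x \<in> ball z R" using x \<rho> by (simp add: dist_norm norm_minus_commute)
  have s: "?t sums h x" by (rule holomorphic_power_series[OF h xb])
  have s1: "(\<lambda>i. ?t (i + N)) sums (h x - (\<Sum>i<N. ?t i))"
    using sums_split_initial_segment[OF s, of N] .
  have "0 \<le> B / \<rho>^0" by (rule order_trans[OF norm_ge_zero c])
  then have B0: "0 \<le> B" by simp
  have s2: "(\<lambda>i. (B * (1/2)^N) * (1/2)^i) sums ((B * (1/2)^N) * (1 / (1 - 1/2)))"
    by (intro sums_mult geometric_sums) simp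
  have "cmod (h x - (\<Sum>i<N. ?t i)) \<le> (B * (1/2)^N) * (1 / (1 - 1/2))"
  proof (rule norm_sums_le[OF s1 s2])
    fix i
    have "cmod (?t (i + N)) \<le> (B / \<rho>^(i+N)) * (\<rho>/2)^(i+N)"
      unfolding norm_mult norm_power using c[of "i+N"] x B0 \<rho> by (intro mult_mono power_mono) auto
    also have "\<dots> = B * (1/2)^N * (1/2)^i" using \<rho> by (simp add: power_divide power_add field_simps)
    finally show "norm (?t (i + N)) \<le> B * (1/2)^N * (1/2)^i" .
  qed
  then show "cmod (h x - (\<Sum>i<N. ?t i)) \<le> 2 * B * (1/2)^N" by (simp add: mult_ac)
qed

lemma emeasure_cball_complex: "0 \<le> r \<Longrightarrow> emeasure lebesgue (cball (c::complex) r) = ennreal (pi * r\<^sup>2)"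
  by (simp add: emeasure_cball unit_ball_vol_2)

text \<open>Comparison of areas: the separation makes the discs of radius \<open>r\<close> pairwise
  disjoint.\<close>

lemma ball_packing:
  fixes c :: "'i \<Rightarrow> complex"
  assumes Z: "finite Z" and r: "0 < r" and sub: "\<And>i. i \<in> Z \<Longrightarrow> ball (c i) r \<subseteq> ball x R"
    and dj: "\<And>i j. i \<in> Z \<Longrightarrow> j \<in> Z \<Longrightarrow> i \<noteq> j \<Longrightarrow> 2 * r \<le> dist (c i) (c j)"
  shows "real (card Z) * r\<^sup>2 \<le> R\<^sup>2"
proof (cases "Z = {}")
  case False
  then obtain i where i: "i \<in> Z" by blast
  have "c i \<in> ball (c i) r" using r by simp
  then have "c i \<in> ball x R" using sub[OF i] by blast
  then have "dist x (c i) < R" by simp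
  then have "0 < R" using zero_le_dist[of x "c i"] by linarith
  have dj': "disjoint_family_on (\<lambda>i. ball (c i) r) Z"
    unfolding disjoint_family_on_def
  proof (intro ballI impI)
    fix i j assume ij: "i \<in> Z" "j \<in> Z" "i \<noteq> j"
    show "ball (c i) r \<inter> ball (c j) r = {}"
    proof (rule equals0I)
      fix y assume "y \<in> ball (c i) r \<inter> ball (c j) r"
      then show False using dj[OF ij] dist_triangle2[of "c i" "c j" y] by simp
    qed
  qed
  have "real (card Z) * (pi * r\<^sup>2) = (\<Sum>i\<in>Z. measure lborel (ball (c i) r))"
    using r by (simp add: content_ball unit_ball_vol_2)
  also have "\<dots> = measure lborel (\<Union>i\<in>Z. ball (c i) r)"
    by (rule measure_finite_Union[symmetric, OF Z _ dj'])
       (auto simp: emeasure_ball r[THEN less_imp_le])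
  also have "\<dots> \<le> measure lborel (ball x R)"
    by (rule measure_mono_fmeasurable)
       (use sub Z \<open>0 < R\<close> in \<open>auto simp: fmeasurable_def emeasure_ball\<close>)
  also have "\<dots> = pi * R\<^sup>2" using \<open>0 < R\<close> by (simp add: content_ball unit_ball_vol_2)
  finally have "pi * (real (card Z) * r\<^sup>2) \<le> pi * R\<^sup>2" by (simp add: mult_ac)
  then show ?thesis by (subst (asm) mult_le_cancel_left_pos) auto
qed simp

lemma ennreal_mult3: "0 \<le> a \<Longrightarrow> 0 \<le> b \<Longrightarrow> 0 \<le> c \<Longrightarrow> ennreal (a * (b * c)) = ennreal a * (ennreal b * ennreal c)"
  by (simp add: ennreal_mult)

lemma ennreal_mult_add: "0 \<le> n \<Longrightarrow> 0 \<le> a \<Longrightarrow> 0 \<le> c \<Longrightarrow> 0 \<le> d \<Longrightarrow>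
    ennreal n * (ennreal a * ennreal c + ennreal d) = ennreal (n * (a * c + d))"
  by (simp add: ennreal_mult)

section \<open>Counting cells on which the symbol oscillates\<close>

text \<open>\<open>room\<close> keeps the cells inside \<open>disc\<close>. \<open>comp\<close> is
  the last condition of \<open>classW\<close>; it makes \<open>kern w z\<close> zero free on the
  cell of \<open>z\<close>, of the size of \<open>knorm w z * knorm w \<zeta>\<close>.\<close>

locale cells = weighted +
  fixes \<beta> C :: real
  assumes \<beta>: "0 < \<beta>" and C1: "1 \<le> C"
    and room: "\<And>z. z \<in> disc \<Longrightarrow> \<beta> * tau w z \<le> (1 - cmod z) / 2"
    and comp: "\<And>z \<zeta>. z \<in> disc \<Longrightarrow> \<zeta> \<in> disc \<Longrightarrow> cmod (z - \<zeta>) \<le> \<beta> * tau w z \<Longrightarrow>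
      tau w z \<le> C * tau w \<zeta> \<and> tau w \<zeta> \<le> C * tau w z \<and> knorm w z * knorm w \<zeta> \<le> C * cmod (kern w z \<zeta>)"
begin

definition cell :: "complex \<Rightarrow> complex set" where
  "cell z = cball z (\<beta> * tau w z)"

text \<open>Fixed by \<open>2 * asep * C = \<beta> / 4\<close>: a point too close to
  \<open>z\<close> for separation then lies in the quarter cell of \<open>z\<close>, even if its own
  \<open>tau\<close> is the larger one.\<close>

definition asep :: real where "asep = \<beta> / (8 * C)"

definition sep :: "complex set \<Rightarrow> bool" where
  "sep Z \<longleftrightarrow> (\<forall>z\<in>Z. \<forall>z'\<in>Z. z \<noteq> z' \<longrightarrow> 2 * asep * max (tau w z) (tau w z') \<le> dist z z')"

text \<open>A squared ratio of radii: discs of radius \<open>asep * tau / C\<close> about the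
  centres are disjoint, and all lie in a disc of radius \<open>(\<beta> + asep) * C * tau\<close>
  about a common point of the cells, \<open>tau\<close> being taken at that point.\<close>

definition N0 :: real where "N0 = ((\<beta> + asep) * C\<^sup>2 / asep)\<^sup>2"

lemma C0: "0 < C" using C1 by simp

lemma asep: "0 < asep" "asep \<le> \<beta>" "2 * asep * C = \<beta> / 4" "2 * asep \<le> \<beta> / 4"
proof -
  show "0 < asep" using \<beta> C0 by (simp add: asep_def)
  show e: "2 * asep * C = \<beta> / 4" using C0 by (simp add: asep_def)
  have "2 * asep * 1 \<le> 2 * asep * C" using C1 \<open>0 < asep\<close> by (intro mult_left_mono) auto
  then show "2 * asep \<le> \<beta> / 4" using e by simp
  then show "asep \<le> \<beta>" using \<beta> by simp
qed

lemma cell_sub: assumes "z \<in> disc" shows "cell z \<subseteq> disc"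
proof -
  have "cmod z < 1" using assms by (simp add: disc_def)
  then have "\<beta> * tau w z < 1 - cmod z" using room[OF assms] by simp
  then show ?thesis unfolding cell_def by (rule cball_subset_disc)
qed

lemma cellD:
  assumes "z \<in> disc" "\<zeta> \<in> cell z"
  shows "\<zeta> \<in> disc" "tau w z \<le> C * tau w \<zeta>" "tau w \<zeta> \<le> C * tau w z" "knorm w z * knorm w \<zeta> \<le> C * cmod (kern w z \<zeta>)"
proof -
  show d: "\<zeta> \<in> disc" using cell_sub assms by blast
  have "cmod (z - \<zeta>) \<le> \<beta> * tau w z" using assms(2) by (simp add: cell_def dist_norm)
  from comp[OF assms(1) d this]
  show "tau w z \<le> C * tau w \<zeta>" "tau w \<zeta> \<le> C * tau w z" "knorm w z * knorm w \<zeta> \<le> C * cmod (kern w z \<zeta>)" by auto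
qed

text \<open>An area count bounds the size of separated subsets of \<open>E\<close>, so one of
  greatest cardinality exists. Every point of \<open>E\<close> is then a member or too close to some
  member, which gives the covering by quarter cells.\<close>

lemma maximal_net:
  assumes E: "E \<subseteq> cball 0 r" "0 \<le> r" "r < 1"
  obtains Z where "finite Z" "Z \<subseteq> E" "sep Z" "\<And>x. x \<in> E \<Longrightarrow> \<exists>z\<in>Z. cmod (x - z) \<le> \<beta> / 4 * tau w z"
proof -
  obtain c where c: "0 < c" "\<And>z. cmod z \<le> r \<Longrightarrow> c \<le> tau w z"
    using tau_bounded_below[OF E(2,3)] by metis
  have Ed: "z \<in> disc" "cmod z \<le> r" if "z \<in> E" for z using that E by (auto simp: disc_def)
  define P where "P n \<longleftrightarrow> (\<exists>Z. finite Z \<and> Z \<subseteq> E \<and> sep Z \<and> card Z = n)" for n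
  \<comment> \<open>\<open>2^2 / (asep * c)^2\<close>: disjoint discs of radius
    \<open>asep * c\<close> fit into \<open>ball 0 2\<close>.\<close>
  have bound: "n \<le> nat \<lceil>4 / (asep * c)\<^sup>2\<rceil>" if "P n" for n
  proof -
    from \<open>P n\<close> obtain Z where Z: "finite Z" "Z \<subseteq> E" "sep Z" "card Z = n" by (auto simp: P_def)
    have ac: "0 < asep * c" using asep c by simp
    have "real (card Z) * (asep * c)\<^sup>2 \<le> 2\<^sup>2"
    proof (rule ball_packing[of _ _ "\<lambda>z. z" 0, OF Z(1) ac])
      fix z assume z: "z \<in> Z"
      then have z': "cmod z \<le> r" "z \<in> disc" using Ed Z by auto
      have "asep * c \<le> \<beta> * tau w z" using asep c(1) c(2)[OF z'(1)] \<beta> by (intro mult_mono) auto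
      also have "\<dots> \<le> 1"
      proof (rule order_trans[OF room[OF z'(2)]])
        have "1 - cmod z \<le> 2" using norm_ge_zero[of z] by linarith
        then show "(1 - cmod z) / 2 \<le> 1" by simp
      qed
      finally have ac1: "asep * c \<le> 1" .
      show "ball z (asep * c) \<subseteq> ball 0 2"
      proof
        fix y assume "y \<in> ball z (asep * c)"
        then have "cmod (y - z) < 1" using ac1 by (simp add: dist_norm norm_minus_commute)
        then show "y \<in> ball 0 2" using norm_triangle_ineq2[of y z] z'(1) E by simp
      qed
    next
      fix z z' assume z: "z \<in> Z" "z' \<in> Z" "z \<noteq> z'"
      have "c \<le> max (tau w z) (tau w z')" using c(2) Ed Z z by (meson le_max_iff_disj subsetD)
      then have "2 * (asep * c) \<le> 2 * asep * max (tau w z) (tau w z')" using asep by simp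
      also have "\<dots> \<le> dist z z'" using Z(3) z unfolding sep_def by blast
      finally show "2 * (asep * c) \<le> dist z z'" .
    qed
    moreover have "0 < (asep * c)\<^sup>2" using ac by (rule zero_less_power)
    ultimately have "real n \<le> 4 / (asep * c)\<^sup>2" using Z(4) by (simp add: pos_le_divide_eq)
    also have "\<dots> \<le> real (nat \<lceil>4 / (asep * c)\<^sup>2\<rceil>)" by (rule real_nat_ceiling_ge)
    finally show ?thesis by simp
  qed
  have "P 0" unfolding P_def by (intro exI[of _ "{}"]) (auto simp: sep_def)
  then have n: "P (Greatest P)" "\<And>m. P m \<Longrightarrow> m \<le> Greatest P"
    using bound by (blast intro: GreatestI_nat Greatest_le_nat)+
  define n where "n = Greatest P"
  have "P n" using n(1) by (simp only: n_def)
  then obtain Z where Z: "finite Z" "Z \<subseteq> E" "sep Z" "card Z = n" unfolding P_def by blast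
  have "\<exists>z\<in>Z. cmod (x - z) \<le> \<beta> / 4 * tau w z" if x: "x \<in> E" for x
  proof (cases "x \<in> Z")
    case True
    then show ?thesis using \<beta> tau_pos[OF Ed(1)[OF x]] by (intro bexI[of _ x]) auto
  next
    case False
    have "\<not> sep (insert x Z)"
    proof
      assume "sep (insert x Z)"
      then have "P (Suc n)" unfolding P_def using Z x False by (intro exI[of _ "insert x Z"]) auto
      then show False using n(2)[of "Suc n"] by (simp add: n_def)
    qed
    then obtain z where z: "z \<in> Z" "dist x z < 2 * asep * max (tau w x) (tau w z)"
      using Z(3) unfolding sep_def by (auto simp: dist_commute max.commute not_le)
    have zd: "z \<in> disc" "x \<in> disc" using z Z Ed x by auto
    note tp = tau_pos[OF zd(1)] tau_pos[OF zd(2)]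
    have "dist x z \<le> \<beta> / 4 * tau w z"
    proof (cases "tau w x \<le> tau w z")
      case True
      then have "dist x z < 2 * asep * tau w z" using z by (simp add: max_def)
      also have "\<dots> \<le> \<beta> / 4 * tau w z" using asep tp by (intro mult_right_mono) auto
      finally show ?thesis by simp
    next
      case False
      then have d: "dist x z < 2 * asep * tau w x" using z by (simp add: max_def)
      also have "\<dots> \<le> \<beta> * tau w x" using asep \<beta> tp by (intro mult_right_mono) auto
      finally have "cmod (x - z) \<le> \<beta> * tau w x" by (simp add: dist_norm)
      then have "tau w x \<le> C * tau w z" using comp zd by blast
      then have "2 * asep * tau w x \<le> 2 * asep * (C * tau w z)" using asep by (intro mult_left_mono) auto
      then show ?thesis using d asep(3) by (simp add: mult.assoc[symmetric])
    qed
    then show ?thesis using z by (auto simp: dist_norm)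
  qed
  then show ?thesis using that Z by blast
qed

lemma overlap:
  assumes Z: "finite Z" "Z \<subseteq> disc" "sep Z" and x: "x \<in> disc"
  shows "real (card {z\<in>Z. x \<in> cell z}) \<le> N0"
proof -
  let ?Z = "{z\<in>Z. x \<in> cell z}"
  have tx: "0 < tau w x" by (rule tau_pos[OF x])
  have t: "tau w x / C \<le> tau w z" "tau w z \<le> C * tau w x" "dist z x \<le> \<beta> * tau w z" if "z \<in> ?Z" for z
  proof -
    have "z \<in> disc" "x \<in> cell z" using that Z by auto
    from cellD[OF this] show "tau w x / C \<le> tau w z" "tau w z \<le> C * tau w x" using C0 by (auto simp: field_simps)
    show "dist z x \<le> \<beta> * tau w z" using \<open>x \<in> cell z\<close> by (simp add: cell_def)
  qed
  have r: "0 < asep * (tau w x / C)" using asep tx C0 by simp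
  have "real (card ?Z) * (asep * (tau w x / C))\<^sup>2 \<le> ((\<beta> + asep) * C * tau w x)\<^sup>2"
  proof (rule ball_packing[of _ _ "\<lambda>z. z" x, OF _ r])
    show "finite ?Z" using Z by simp
    fix z assume z: "z \<in> ?Z"
    show "ball z (asep * (tau w x / C)) \<subseteq> ball x ((\<beta> + asep) * C * tau w x)"
    proof
      fix y assume "y \<in> ball z (asep * (tau w x / C))"
      then have "dist z y < asep * (tau w x / C)" by simp
      also have "\<dots> \<le> asep * (C * tau w x)"
        using t(1,2)[OF z] asep by (intro mult_left_mono) auto
      finally have "dist z y < asep * (C * tau w x)" .
      moreover have "dist z x \<le> \<beta> * (C * tau w x)"
        using t(2,3)[OF z] \<beta> by (meson mult_left_mono order_trans less_imp_le)
      ultimately show "y \<in> ball x ((\<beta> + asep) * C * tau w x)"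
        using dist_triangle3[of x y z] by (simp add: distrib_right mult.assoc)
    qed
  next
    fix z z' assume z: "z \<in> ?Z" "z' \<in> ?Z" "z \<noteq> z'"
    have "tau w x / C \<le> max (tau w z) (tau w z')" using t(1)[OF z(1)] by (rule max.coboundedI1)
    then have "(2 * asep) * (tau w x / C) \<le> (2 * asep) * max (tau w z) (tau w z')"
      using asep(1) by (intro mult_left_mono) auto
    then have "2 * (asep * (tau w x / C)) \<le> 2 * asep * max (tau w z) (tau w z')" by (simp only: mult.assoc)
    also have "\<dots> \<le> dist z z'" using Z(3) z unfolding sep_def by blast
    finally show "2 * (asep * (tau w x / C)) \<le> dist z z'" .
  qed
  then have "real (card ?Z) * (asep\<^sup>2 * (tau w x)\<^sup>2) \<le> (((\<beta> + asep) * C\<^sup>2)\<^sup>2) * (tau w x)\<^sup>2"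
    using C0 by (simp add: power_mult_distrib power_divide field_simps power2_eq_square)
  then have "real (card ?Z) * asep\<^sup>2 \<le> ((\<beta> + asep) * C\<^sup>2)\<^sup>2"
    using tx by (simp only: mult.assoc[symmetric] mult_le_cancel_right_pos zero_less_power)
  then show ?thesis unfolding N0_def power_divide using asep by (simp add: field_simps)
qed

lemma N0_nonneg: "0 \<le> N0" by (simp add: N0_def)

lemma cell_meas [measurable]: "cell z \<in> sets lebesgue" "cell z \<in> sets borel"
  by (auto simp: cell_def)

lemma meas_ind:
  fixes f :: "complex \<Rightarrow> real"
  assumes "f \<in> borel_measurable Ld" "A \<in> sets lebesgue" "A \<subseteq> disc"
  shows "(\<lambda>\<zeta>. ennreal (f \<zeta>) * indicator A \<zeta>) \<in> borel_measurable lebesgue"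
proof -
  have "(\<lambda>\<zeta>. ennreal (indicator disc \<zeta> *\<^sub>R f \<zeta>) * indicator A \<zeta>) \<in> borel_measurable lebesgue"
    using assms(1)[unfolded meas_Ld_iff] assms(2) by measurable
  also have "(\<lambda>\<zeta>. ennreal (indicator disc \<zeta> *\<^sub>R f \<zeta>) * indicator A \<zeta>) = (\<lambda>\<zeta>. ennreal (f \<zeta>) * indicator A \<zeta>)"
    using assms(3) by (auto simp: indicator_def fun_eq_iff)
  finally show ?thesis .
qed

lemma sum_cells:
  assumes Z: "finite Z" "Z \<subseteq> disc" "sep Z" and f: "f \<in> borel_measurable Ld"
    and A: "\<And>z. z \<in> Z \<Longrightarrow> cell z \<subseteq> A" "A \<subseteq> disc" "A \<in> sets lebesgue"
  shows "(\<Sum>z\<in>Z. \<integral>\<^sup>+\<zeta>. ennreal (f \<zeta>) * indicator (cell z) \<zeta> \<partial>lebesgue) \<le> ennreal N0 * (\<integral>\<^sup>+\<zeta>. ennreal (f \<zeta>) * indicator A \<zeta> \<partial>lebesgue)"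
proof -
  have m: "(\<lambda>\<zeta>. ennreal (f \<zeta>) * indicator (cell z) \<zeta>) \<in> borel_measurable lebesgue" if "z \<in> Z" for z
    by (rule meas_ind[OF f]) (use cell_sub that Z in auto)
  have "(\<Sum>z\<in>Z. \<integral>\<^sup>+\<zeta>. ennreal (f \<zeta>) * indicator (cell z) \<zeta> \<partial>lebesgue) = (\<integral>\<^sup>+\<zeta>. (\<Sum>z\<in>Z. ennreal (f \<zeta>) * indicator (cell z) \<zeta>) \<partial>lebesgue)"
    by (rule nn_integral_sum[symmetric, OF m])
  also have "\<dots> \<le> (\<integral>\<^sup>+\<zeta>. ennreal N0 * (ennreal (f \<zeta>) * indicator A \<zeta>) \<partial>lebesgue)"
  proof (rule nn_integral_mono)
    fix \<zeta>
    show "(\<Sum>z\<in>Z. ennreal (f \<zeta>) * indicator (cell z) \<zeta>) \<le> ennreal N0 * (ennreal (f \<zeta>) * indicator A \<zeta>)"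
    proof (cases "\<exists>z\<in>Z. \<zeta> \<in> cell z")
      case True
      then have zA: "\<zeta> \<in> A" using A by blast
      have "(\<Sum>z\<in>Z. ennreal (f \<zeta>) * indicator (cell z) \<zeta>) = ennreal (f \<zeta>) * (\<Sum>z\<in>Z. indicator (cell z) \<zeta>)"
        by (rule sum_distrib_left[symmetric])
      also have "(\<Sum>z\<in>Z. indicator (cell z) \<zeta>) = (of_nat (card {z\<in>Z. \<zeta> \<in> cell z}) :: ennreal)"
        using Z(1) by (simp add: indicator_def sum.If_cases Int_def)
      also have "\<dots> = ennreal (real (card {z\<in>Z. \<zeta> \<in> cell z}))" by (simp add: ennreal_of_nat_eq_real_of_nat)
      also have "\<dots> \<le> ennreal N0" using overlap[OF Z, of \<zeta>] zA A(2) by (intro ennreal_leI) auto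
      finally show ?thesis using zA by (simp add: mult.commute mult_right_mono)
    next
      case False
      then show ?thesis by simp
    qed
  qed
  also have "\<dots> = ennreal N0 * (\<integral>\<^sup>+\<zeta>. ennreal (f \<zeta>) * indicator A \<zeta> \<partial>lebesgue)"
    by (rule nn_integral_cmult[OF meas_ind[OF f A(3,2)]])
  finally show ?thesis .
qed

lemma lam_cell:
  assumes "z \<in> disc"
  shows "(\<integral>\<^sup>+\<zeta>. ennreal (1 / (tau w \<zeta>)\<^sup>2) * indicator (cell z) \<zeta> \<partial>lebesgue) \<le> ennreal (pi * \<beta>\<^sup>2 * C\<^sup>2)"
proof -
  have tz: "0 < tau w z" by (rule tau_pos[OF assms])
  have "(\<integral>\<^sup>+\<zeta>. ennreal (1 / (tau w \<zeta>)\<^sup>2) * indicator (cell z) \<zeta> \<partial>lebesgue) \<le> (\<integral>\<^sup>+\<zeta>. ennreal (C\<^sup>2 / (tau w z)\<^sup>2) * indicator (cell z) \<zeta> \<partial>lebesgue)"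
  proof (rule nn_integral_mono)
    fix \<zeta>
    show "ennreal (1 / (tau w \<zeta>)\<^sup>2) * indicator (cell z) \<zeta> \<le> ennreal (C\<^sup>2 / (tau w z)\<^sup>2) * indicator (cell z) \<zeta>"
    proof (cases "\<zeta> \<in> cell z")
      case True
      note c = cellD[OF assms True]
      have "(tau w z)\<^sup>2 \<le> (C * tau w \<zeta>)\<^sup>2" using c(2) tz by (intro power_mono) auto
      then have "1 / (tau w \<zeta>)\<^sup>2 \<le> C\<^sup>2 / (tau w z)\<^sup>2"
        using tz tau_pos[OF c(1)] by (simp add: power_mult_distrib field_simps)
      then show ?thesis by (intro mult_right_mono ennreal_leI) auto
    qed simp
  qed
  also have "\<dots> = ennreal (C\<^sup>2 / (tau w z)\<^sup>2) * emeasure lebesgue (cell z)"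
    by (rule nn_integral_cmult_indicator) simp
  also have "emeasure lebesgue (cell z) = ennreal (pi * (\<beta> * tau w z)\<^sup>2)"
    unfolding cell_def using \<beta> tz by (intro emeasure_cball_complex) simp
  also have "ennreal (C\<^sup>2 / (tau w z)\<^sup>2) * ennreal (pi * (\<beta> * tau w z)\<^sup>2) = ennreal (C\<^sup>2 / (tau w z)\<^sup>2 * (pi * (\<beta> * tau w z)\<^sup>2))"
    by (rule ennreal_mult[symmetric]) auto
  also have "C\<^sup>2 / (tau w z)\<^sup>2 * (pi * (\<beta> * tau w z)\<^sup>2) = pi * \<beta>\<^sup>2 * C\<^sup>2"
    using tz by (simp add: power_mult_distrib)
  finally show ?thesis .
qed

end

locale hankel_cells = cells +
  fixes b :: "complex \<Rightarrow> complex" and Gm :: real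
  assumes b: "b holomorphic_on disc"
    and Gm: "\<And>z. z \<in> disc \<Longrightarrow> tau w z * cmod (deriv b z) \<le> Gm"
begin

definition g :: "complex \<Rightarrow> real" where "g z = tau w z * cmod (deriv b z)"

lemma g_nonneg: "z \<in> disc \<Longrightarrow> 0 \<le> g z" using tau_pos[of z] by (simp add: g_def)

lemma db_holo: "deriv b holomorphic_on disc" by (intro holomorphic_deriv b open_disc)

lemma db_meas [measurable]: "deriv b \<in> borel_measurable Ld"
  by (intro cont_meas holomorphic_on_imp_continuous_on db_holo)

lemma g_meas [measurable]: "g \<in> borel_measurable Ld"
  unfolding g_def[abs_def] by measurable

definition J :: "real \<Rightarrow> complex \<Rightarrow> ennreal" where
  "J p z = (\<integral>\<^sup>+\<zeta>. ennreal (g \<zeta> powr p / (tau w \<zeta>)\<^sup>2) * indicator (cell z) \<zeta> \<partial>lebesgue)"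

text \<open>\<open>4 / \<beta>^2\<close> stems from the radius \<open>\<beta> * tau / 2\<close>. The
  factors \<open>C powr (2 * p)\<close> and \<open>C^2\<close> come from comparing
  \<open>tau\<close> with its value at the centre, twice in \<open>g\<close> and once in the measure
  \<open>dA / tau^2\<close>.\<close>

definition K1 :: "real \<Rightarrow> real" where
  "K1 p = 4 * Ksub p * C powr (2 * p) * C\<^sup>2 / \<beta>\<^sup>2"

lemma K1_pos: "0 < K1 p"
  using Ksub_pos[of p] C0 \<beta> by (simp add: K1_def)

lemma submean_g:
  assumes z: "z \<in> disc" and x: "cmod (x - z) \<le> \<beta> / 4 * tau w z" and p: "0 < p" "p \<le> 1"
  shows "ennreal (g x powr p) \<le> ennreal (K1 p) * J p z"
proof -
  have tz: "0 < tau w z" by (rule tau_pos[OF z])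
  define r where "r = \<beta> / 2 * tau w z"
  have r: "0 < r" using \<beta> tz by (simp add: r_def)
  \<comment> \<open>A quarter plus three quarters of the cell radius; \<open>r\<close> is half of
    it, which leaves the room that \<open>submean_powr\<close> requires.\<close>
  have sub: "ball x (\<beta> * (3/4) * tau w z) \<subseteq> cell z"
  proof
    fix y assume "y \<in> ball x (\<beta> * (3/4) * tau w z)"
    then have "dist x y < \<beta> * (3/4) * tau w z" by simp
    moreover have "dist z x \<le> \<beta> / 4 * tau w z" using x by (simp add: dist_norm norm_minus_commute)
    moreover have "\<beta> / 4 * tau w z + \<beta> * (3/4) * tau w z = \<beta> * tau w z" by (simp add: field_simps)
    ultimately show "y \<in> cell z" using dist_triangle[of z y x] by (simp add: cell_def)
  qed
  have rR: "r < \<beta> * (3/4) * tau w z" using \<beta> tz by (simp add: r_def)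
  have subr: "cball x r \<subseteq> cell z" using sub rR by (meson cball_subset_ball_iff order_trans subsetD subsetI mem_ball mem_cball le_less_trans)
  have xc: "x \<in> cell z" using subr r by auto
  note cx = cellD[OF z xc]
  have "ennreal (cmod (deriv b x) powr p) \<le> ennreal (Ksub p / r\<^sup>2) * (\<integral>\<^sup>+\<zeta>. ennreal (cmod (deriv b \<zeta>) powr p) * indicator (cball x r) \<zeta> \<partial>lebesgue)"
    by (rule submean_powr[OF holomorphic_on_subset[OF db_holo] r rR p]) (use sub cell_sub[OF z] in auto)
  also have "(\<integral>\<^sup>+\<zeta>. ennreal (cmod (deriv b \<zeta>) powr p) * indicator (cball x r) \<zeta> \<partial>lebesgue)
    \<le> (\<integral>\<^sup>+\<zeta>. ennreal ((C / tau w z) powr p * (C * tau w z)\<^sup>2) * (ennreal (g \<zeta> powr p / (tau w \<zeta>)\<^sup>2) * indicator (cell z) \<zeta>) \<partial>lebesgue)"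
  proof (rule nn_integral_mono)
    fix \<zeta>
    show "ennreal (cmod (deriv b \<zeta>) powr p) * indicator (cball x r) \<zeta> \<le> ennreal ((C / tau w z) powr p * (C * tau w z)\<^sup>2) * (ennreal (g \<zeta> powr p / (tau w \<zeta>)\<^sup>2) * indicator (cell z) \<zeta>)"
    proof (cases "\<zeta> \<in> cball x r")
      case True
      then have zc: "\<zeta> \<in> cell z" using subr by blast
      note c = cellD[OF z zc]
      have t: "0 < tau w \<zeta>" by (rule tau_pos[OF c(1)])
      have "cmod (deriv b \<zeta>) = g \<zeta> / tau w \<zeta>" using t by (simp add: g_def)
      also have "\<dots> = g \<zeta> * (1 / tau w \<zeta>)" by simp
      also have "\<dots> \<le> g \<zeta> * (C / tau w z)"
        using c(2) t tz g_nonneg[OF c(1)] by (intro mult_left_mono) (auto simp: field_simps)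
      finally have "cmod (deriv b \<zeta>) powr p \<le> (g \<zeta> * (C / tau w z)) powr p"
        using p by (intro powr_mono2) auto
      also have "\<dots> = (C / tau w z) powr p * g \<zeta> powr p"
        using g_nonneg[OF c(1)] C0 tz by (subst powr_mult) (simp_all add: mult.commute)
      also have "\<dots> \<le> (C / tau w z) powr p * (g \<zeta> powr p * ((C * tau w z)\<^sup>2 / (tau w \<zeta>)\<^sup>2))"
      proof (intro mult_left_mono mult_right_le_one_le)
        have "(tau w \<zeta>)\<^sup>2 \<le> (C * tau w z)\<^sup>2" using c(3) t by (intro power_mono) auto
        then have "1 \<le> (C * tau w z)\<^sup>2 / (tau w \<zeta>)\<^sup>2" using t by (simp add: field_simps)
        then have "g \<zeta> powr p * 1 \<le> g \<zeta> powr p * ((C * tau w z)\<^sup>2 / (tau w \<zeta>)\<^sup>2)" by (intro mult_left_mono) auto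
        then show "g \<zeta> powr p \<le> g \<zeta> powr p * ((C * tau w z)\<^sup>2 / (tau w \<zeta>)\<^sup>2)" by simp
      qed auto
      finally have "cmod (deriv b \<zeta>) powr p \<le> ((C / tau w z) powr p * (C * tau w z)\<^sup>2) * (g \<zeta> powr p / (tau w \<zeta>)\<^sup>2)"
        by (simp add: mult_ac)
      then have "ennreal (cmod (deriv b \<zeta>) powr p) \<le> ennreal ((C / tau w z) powr p * (C * tau w z)\<^sup>2) * ennreal (g \<zeta> powr p / (tau w \<zeta>)\<^sup>2)"
        by (subst ennreal_mult[symmetric]) (auto intro: ennreal_leI)
      then show ?thesis using True zc by simp
    qed simp
  qed
  also have "\<dots> = ennreal ((C / tau w z) powr p * (C * tau w z)\<^sup>2) * J p z"
    unfolding J_def by (intro nn_integral_cmult meas_ind) (use cell_sub[OF z] in \<open>auto\<close>)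
  finally have "ennreal (cmod (deriv b x) powr p) \<le> ennreal (Ksub p / r\<^sup>2) * (ennreal ((C / tau w z) powr p * (C * tau w z)\<^sup>2) * J p z)"
    by (simp add: mult_left_mono)
  then have "ennreal ((C * tau w z) powr p) * ennreal (cmod (deriv b x) powr p) \<le> ennreal ((C * tau w z) powr p) * (ennreal (Ksub p / r\<^sup>2) * (ennreal ((C / tau w z) powr p * (C * tau w z)\<^sup>2) * J p z))"
    by (rule mult_left_mono) simp
  also have "\<dots> = ennreal ((C * tau w z) powr p * (Ksub p / r\<^sup>2 * ((C / tau w z) powr p * (C * tau w z)\<^sup>2))) * J p z"
    using Ksub_pos[of p] by (subst ennreal_mult3) (simp_all only: mult.assoc, simp_all)
  also have "(C * tau w z) powr p * (Ksub p / r\<^sup>2 * ((C / tau w z) powr p * (C * tau w z)\<^sup>2)) = K1 p"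
  proof -
    have 1: "(C * tau w z) powr p * (C / tau w z) powr p = C powr (2 * p)"
    proof -
      have "(C * tau w z) powr p * (C / tau w z) powr p = ((C * tau w z) * (C / tau w z)) powr p"
        by (rule powr_mult[symmetric])
      also have "(C * tau w z) * (C / tau w z) = C powr 2" using C0 tz by (simp add: power2_eq_square)
      finally show ?thesis by (simp only: powr_powr)
    qed
    have 2: "1 / r\<^sup>2 * (C * tau w z)\<^sup>2 = 4 * C\<^sup>2 / \<beta>\<^sup>2"
      using \<beta> tz by (simp add: r_def power_mult_distrib power_divide)
    have "(C * tau w z) powr p * (Ksub p / r\<^sup>2 * ((C / tau w z) powr p * (C * tau w z)\<^sup>2))
      = Ksub p * ((C * tau w z) powr p * (C / tau w z) powr p) * (1 / r\<^sup>2 * (C * tau w z)\<^sup>2)"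
      by (simp only: divide_inverse mult_ac mult_1)
    also have "\<dots> = K1 p" unfolding 1 2 K1_def by simp
    finally show ?thesis .
  qed
  finally have "ennreal ((C * tau w z) powr p) * ennreal (cmod (deriv b x) powr p) \<le> ennreal (K1 p) * J p z" .
  moreover have "g x powr p \<le> (C * tau w z) powr p * cmod (deriv b x) powr p"
  proof -
    have "g x powr p = tau w x powr p * cmod (deriv b x) powr p"
      using tau_pos[OF cx(1)] by (simp add: g_def powr_mult)
    also have "\<dots> \<le> (C * tau w z) powr p * cmod (deriv b x) powr p"
      using cx(3) tau_pos[OF cx(1)] p by (intro mult_right_mono powr_mono2) auto
    finally show ?thesis .
  qed
  then have "ennreal (g x powr p) \<le> ennreal ((C * tau w z) powr p) * ennreal (cmod (deriv b x) powr p)"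
    by (subst ennreal_mult[symmetric]) (auto intro: ennreal_leI)
  ultimately show ?thesis by (rule order_trans[rotated])
qed

lemma Rfun_g: "Rfun w b t = (\<integral>\<^sup>+\<zeta>. ennreal (1 / (tau w \<zeta>)\<^sup>2) * indicator {z\<in>disc. g z > t} \<zeta> \<partial>lebesgue)"
  by (simp add: Rfun_def g_def)

lemma level_meas: "{z\<in>disc. g z > t} \<in> sets lebesgue"
proof -
  have "{z \<in> space Ld. g z > t} \<in> sets Ld" by measurable
  then show ?thesis by (simp add: space_restrict_space sets_restrict_space_iff)
qed

text \<open>Where \<open>g \<le> t\<close> the integrand is bounded by
  \<open>t powr p / tau^2\<close>; a point with \<open>2^k * t < g \<le> 2^(k+1) * t\<close> is
  charged to the level set of index \<open>k\<close>. The level sets are not cut down to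
  \<open>A\<close>, so the sum is controlled by \<open>Rfun\<close> alone.\<close>

lemma layer_cake:
  assumes t: "0 < t" and p: "0 < p" and A: "A \<subseteq> disc" "A \<in> sets lebesgue"
  shows "(\<integral>\<^sup>+\<zeta>. ennreal (g \<zeta> powr p / (tau w \<zeta>)\<^sup>2) * indicator A \<zeta> \<partial>lebesgue)
    \<le> ennreal (t powr p) * (\<integral>\<^sup>+\<zeta>. ennreal (1 / (tau w \<zeta>)\<^sup>2) * indicator A \<zeta> \<partial>lebesgue)
      + (\<Sum>k. ennreal ((2^Suc k * t) powr p) * Rfun w b (2^k * t))"
proof -
  let ?T = "\<lambda>\<zeta>. ennreal (1 / (tau w \<zeta>)\<^sup>2)"
  let ?L = "\<lambda>k. {z\<in>disc. g z > 2^k * t}"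
  have mA: "(\<lambda>\<zeta>. ?T \<zeta> * indicator A \<zeta>) \<in> borel_measurable lebesgue" by (rule meas_ind) (use A in auto)
  have mL: "(\<lambda>\<zeta>. ?T \<zeta> * indicator (?L k) \<zeta>) \<in> borel_measurable lebesgue" for k
    by (rule meas_ind) (use level_meas in auto)
  have "(\<integral>\<^sup>+\<zeta>. ennreal (g \<zeta> powr p / (tau w \<zeta>)\<^sup>2) * indicator A \<zeta> \<partial>lebesgue)
    \<le> (\<integral>\<^sup>+\<zeta>. ennreal (t powr p) * (?T \<zeta> * indicator A \<zeta>) + (\<Sum>k. ennreal ((2^Suc k * t) powr p) * (?T \<zeta> * indicator (?L k) \<zeta>)) \<partial>lebesgue)"
  proof (rule nn_integral_mono)
    fix \<zeta>
    show "ennreal (g \<zeta> powr p / (tau w \<zeta>)\<^sup>2) * indicator A \<zeta>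
      \<le> ennreal (t powr p) * (?T \<zeta> * indicator A \<zeta>) + (\<Sum>k. ennreal ((2^Suc k * t) powr p) * (?T \<zeta> * indicator (?L k) \<zeta>))"
    proof (cases "\<zeta> \<in> A")
      case True
      then have zd: "\<zeta> \<in> disc" using A by auto
      show ?thesis
      proof (cases "g \<zeta> \<le> t")
        case True
        then have "g \<zeta> powr p \<le> t powr p" using g_nonneg[OF zd] p by (intro powr_mono2) auto
        then have "g \<zeta> powr p / (tau w \<zeta>)\<^sup>2 \<le> t powr p * (1 / (tau w \<zeta>)\<^sup>2)" by (simp add: divide_right_mono)
        then have "ennreal (g \<zeta> powr p / (tau w \<zeta>)\<^sup>2) \<le> ennreal (t powr p) * ?T \<zeta>"
          by (subst ennreal_mult[symmetric]) (auto intro: ennreal_leI)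
        then show ?thesis using \<open>\<zeta> \<in> A\<close> by (simp add: add_increasing2)
      next
        case False
        define k where "k = (LEAST k. g \<zeta> \<le> 2^Suc k * t)"
        have "\<exists>k. g \<zeta> \<le> 2^Suc k * t"
        proof -
          obtain n where "g \<zeta> / t < 2^n" using real_arch_pow[of 2 "g \<zeta> / t"] by auto
          also have "(2::real)^n \<le> 2^Suc n" by simp
          finally show ?thesis using t by (intro exI[of _ n]) (simp add: field_simps)
        qed
        then have k1: "g \<zeta> \<le> 2^Suc k * t" unfolding k_def by (rule LeastI_ex)
        have k2: "2^k * t < g \<zeta>"
        proof (cases k)
          case 0 then show ?thesis using False by simp
        next
          case (Suc j)
          then have "\<not> g \<zeta> \<le> 2^Suc j * t" using not_less_Least[of j "\<lambda>k. g \<zeta> \<le> 2^Suc k * t"] by (simp add: k_def)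
          then show ?thesis using Suc by simp
        qed
        have "g \<zeta> powr p \<le> (2^Suc k * t) powr p" using g_nonneg[OF zd] p k1 by (intro powr_mono2) auto
        then have "g \<zeta> powr p / (tau w \<zeta>)\<^sup>2 \<le> (2^Suc k * t) powr p * (1 / (tau w \<zeta>)\<^sup>2)" by (simp add: divide_right_mono)
        then have "ennreal (g \<zeta> powr p / (tau w \<zeta>)\<^sup>2) \<le> ennreal ((2^Suc k * t) powr p) * ?T \<zeta>"
          by (subst ennreal_mult[symmetric]) (auto intro: ennreal_leI)
        also have "\<dots> = ennreal ((2^Suc k * t) powr p) * (?T \<zeta> * indicator (?L k) \<zeta>)" using k2 zd by simp
        also have "\<dots> = (\<Sum>k\<in>{k}. ennreal ((2^Suc k * t) powr p) * (?T \<zeta> * indicator (?L k) \<zeta>))" by simp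
        also have "\<dots> \<le> (\<Sum>k. ennreal ((2^Suc k * t) powr p) * (?T \<zeta> * indicator (?L k) \<zeta>))"
          by (rule sum_le_suminf) auto
        finally show ?thesis using \<open>\<zeta> \<in> A\<close> by (simp add: add_increasing)
      qed
    qed simp
  qed
  also have "\<dots> = (\<integral>\<^sup>+\<zeta>. ennreal (t powr p) * (?T \<zeta> * indicator A \<zeta>) \<partial>lebesgue) + (\<integral>\<^sup>+\<zeta>. (\<Sum>k. ennreal ((2^Suc k * t) powr p) * (?T \<zeta> * indicator (?L k) \<zeta>)) \<partial>lebesgue)"
    by (intro nn_integral_add borel_measurable_suminf_order borel_measurable_times_ennreal borel_measurable_const mA mL)
  also have "(\<integral>\<^sup>+\<zeta>. (\<Sum>k. ennreal ((2^Suc k * t) powr p) * (?T \<zeta> * indicator (?L k) \<zeta>)) \<partial>lebesgue)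
      = (\<Sum>k. \<integral>\<^sup>+\<zeta>. ennreal ((2^Suc k * t) powr p) * (?T \<zeta> * indicator (?L k) \<zeta>) \<partial>lebesgue)"
    by (intro nn_integral_suminf borel_measurable_times_ennreal borel_measurable_const mL)
  also have "\<dots> = (\<Sum>k. ennreal ((2^Suc k * t) powr p) * Rfun w b (2^k * t))"
    unfolding Rfun_g by (intro suminf_cong nn_integral_cmult mL)
  also have "(\<integral>\<^sup>+\<zeta>. ennreal (t powr p) * (?T \<zeta> * indicator A \<zeta>) \<partial>lebesgue) = ennreal (t powr p) * (\<integral>\<^sup>+\<zeta>. ?T \<zeta> * indicator A \<zeta> \<partial>lebesgue)"
    by (rule nn_integral_cmult[OF mA])
  finally show ?thesis .
qed

text \<open>Normalised by \<open>K1\<close> so that it dominates \<open>g\<close> on the quarter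
  cell. By \<open>J_finite\<close>, no infinite value is lost in \<open>enn2real\<close> for
  \<open>p > 0\<close> and \<open>z\<close> in \<open>disc\<close>.\<close>

definition G :: "real \<Rightarrow> complex \<Rightarrow> real" where
  "G p z = (K1 p * enn2real (J p z)) powr (1 / p)"

lemma J_finite:
  assumes z: "z \<in> disc" and p: "0 < p"
  shows "J p z < \<infinity>"
proof -
  have "J p z \<le> (\<integral>\<^sup>+\<zeta>. ennreal (Gm powr p) * (ennreal (1 / (tau w \<zeta>)\<^sup>2) * indicator (cell z) \<zeta>) \<partial>lebesgue)"
    unfolding J_def
  proof (rule nn_integral_mono)
    fix \<zeta>
    show "ennreal (g \<zeta> powr p / (tau w \<zeta>)\<^sup>2) * indicator (cell z) \<zeta> \<le> ennreal (Gm powr p) * (ennreal (1 / (tau w \<zeta>)\<^sup>2) * indicator (cell z) \<zeta>)"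
    proof (cases "\<zeta> \<in> cell z")
      case True
      then have zd: "\<zeta> \<in> disc" using cell_sub[OF z] by auto
      have "g \<zeta> powr p \<le> Gm powr p" using Gm[OF zd] g_nonneg[OF zd] p by (intro powr_mono2) (auto simp: g_def)
      then have "g \<zeta> powr p / (tau w \<zeta>)\<^sup>2 \<le> Gm powr p * (1 / (tau w \<zeta>)\<^sup>2)" by (simp add: divide_right_mono)
      then have "ennreal (g \<zeta> powr p / (tau w \<zeta>)\<^sup>2) \<le> ennreal (Gm powr p) * ennreal (1 / (tau w \<zeta>)\<^sup>2)"
        by (subst ennreal_mult[symmetric]) (auto intro: ennreal_leI)
      then show ?thesis using True by simp
    qed simp
  qed
  also have "\<dots> = ennreal (Gm powr p) * (\<integral>\<^sup>+\<zeta>. ennreal (1 / (tau w \<zeta>)\<^sup>2) * indicator (cell z) \<zeta> \<partial>lebesgue)"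
    by (intro nn_integral_cmult meas_ind) (use cell_sub[OF z] in auto)
  also have "\<dots> \<le> ennreal (Gm powr p) * ennreal (pi * \<beta>\<^sup>2 * C\<^sup>2)"
    by (intro mult_left_mono lam_cell z) simp
  also have "\<dots> < \<infinity>" by (simp add: ennreal_mult_less_top)
  finally show ?thesis .
qed

lemma g_le_G:
  assumes z: "z \<in> disc" and x: "cmod (x - z) \<le> \<beta> / 4 * tau w z" and p: "0 < p" "p \<le> 1"
  shows "g x \<le> G p z"
proof -
  have J: "J p z = ennreal (enn2real (J p z))" using J_finite[OF z p(1)] by simp
  have "ennreal (g x powr p) \<le> ennreal (K1 p * enn2real (J p z))"
    using submean_g[OF assms] K1_pos[of p] by (subst (asm) J) (simp add: ennreal_mult)
  then have le: "g x powr p \<le> K1 p * enn2real (J p z)"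
    using K1_pos[of p] by (simp add: ennreal_le_iff)
  have "\<beta> / 4 * tau w z \<le> \<beta> * tau w z" using \<beta> tau_pos[OF z] by (intro mult_right_mono) auto
  then have "cmod (x - z) \<le> \<beta> * tau w z" using x by linarith
  then have "x \<in> cell z" by (simp add: cell_def dist_norm norm_minus_commute)
  then have gx: "0 \<le> g x" using g_nonneg cellD(1)[OF z] by blast
  have "g x = (g x powr p) powr (1 / p)" using gx p by (simp add: powr_powr)
  also have "\<dots> \<le> G p z" unfolding G_def using le p by (intro powr_mono2) auto
  finally show ?thesis .
qed

lemma G_powr: "0 < p \<Longrightarrow> G p z powr p = K1 p * enn2real (J p z)"
  using K1_pos[of p] by (simp add: G_def powr_powr)

text \<open>The layer cake bounds the sum of \<open>G powr p\<close> by a multiple of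
  \<open>x * t powr p\<close> plus the part below level \<open>t\<close>, which is at most a
  constant times \<open>t powr p\<close> times the number of cells. Since
  \<open>G > \<kappa> * t\<close> at every centre, for \<open>\<kappa>\<close> large the low part is
  at most half of the sum and is absorbed.\<close>

lemma counting:
  assumes p: "0 < p" "p \<le> 1" and \<theta>: "0 < \<theta>" "2 powr p * \<theta> < 1"
  obtains C3 \<kappa> where "0 < C3" "1 \<le> \<kappa>"
    "\<And>x t Z. 0 < x \<Longrightarrow> 0 < t \<Longrightarrow> (\<And>k. Rfun w b (2^k * t) \<le> ennreal (x * \<theta>^k)) \<Longrightarrow>
      finite Z \<Longrightarrow> Z \<subseteq> disc \<Longrightarrow> sep Z \<Longrightarrow> (\<And>z. z \<in> Z \<Longrightarrow> g z > \<kappa> * t) \<Longrightarrow>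
      (\<Sum>z\<in>Z. (G p z / (\<kappa> * t)) powr p) \<le> C3 * x"
proof -
  define L0 where "L0 = pi * \<beta>\<^sup>2 * C\<^sup>2"
  define T where "T = 2 powr p / (1 - 2 powr p * \<theta>)"
  \<comment> \<open>Twice the constant of the low part, plus 1 to have
    \<open>\<kappa> \<ge> 1\<close>; \<open>\<kappa>\<close> is chosen with
    \<open>\<kappa> powr p = B\<close>.\<close>
  define B where "B = 2 * (K1 p * N0 * L0) + 1"
  define \<kappa> where "\<kappa> = B powr (1 / p)"
  have L0: "0 \<le> L0" by (simp add: L0_def)
  have T: "0 < T" using \<theta> by (simp add: T_def)
  have B1: "1 \<le> B" using K1_pos[of p] N0_nonneg L0 by (simp add: B_def)
  have \<kappa>1: "1 \<le> \<kappa>" using B1 p by (simp add: \<kappa>_def ge_one_powr_ge_zero)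
  have \<kappa>p: "\<kappa> powr p = B" using B1 p by (simp add: \<kappa>_def powr_powr)
  have KN: "0 \<le> K1 p * N0" using K1_pos[of p] N0_nonneg by simp
  have main: "(\<Sum>z\<in>Z. (G p z / (\<kappa> * t)) powr p) \<le> (2 * (K1 p * N0 * T) + 1) * x"
    if x: "0 < x" and t: "0 < t" and R: "\<And>k. Rfun w b (2^k * t) \<le> ennreal (x * \<theta>^k)"
      and Z: "finite Z" "Z \<subseteq> disc" "sep Z" and gZ: "\<And>z. z \<in> Z \<Longrightarrow> g z > \<kappa> * t" for x t Z
  proof -
    define j where "j z = enn2real (J p z)" for z
    have J: "J p z = ennreal (j z)" if "z \<in> Z" for z
      using J_finite[of z p] that Z p by (auto simp: j_def)
    have j0: "0 \<le> j z" for z by (simp add: j_def)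
    define A where "A = (\<Union>z\<in>Z. cell z)"
    have A: "A \<subseteq> disc" "A \<in> sets lebesgue" "\<And>z. z \<in> Z \<Longrightarrow> cell z \<subseteq> A"
      using cell_sub Z by (auto simp: A_def)
    \<comment> \<open>A geometric series of ratio \<open>2 powr p * \<theta>\<close>, whose sum is
      the origin of \<open>T\<close>.\<close>
    have sumT: "(\<Sum>k. ennreal ((2^Suc k * t) powr p) * Rfun w b (2^k * t)) \<le> ennreal (t powr p * T * x)"
    proof -
      let ?s = "\<lambda>k. (t powr p * x * 2 powr p) * (2 powr p * \<theta>)^k"
      have "ennreal ((2^Suc k * t) powr p) * Rfun w b (2^k * t) \<le> ennreal (?s k)" for k
      proof -
        have "ennreal ((2^Suc k * t) powr p) * Rfun w b (2^k * t) \<le> ennreal ((2^Suc k * t) powr p) * ennreal (x * \<theta>^k)"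
          by (intro mult_left_mono R) simp
        also have "\<dots> = ennreal ((2^Suc k * t) powr p * (x * \<theta>^k))" using x \<theta> by (intro ennreal_mult[symmetric]) auto
        also have "(2^Suc k * t) powr p * (x * \<theta>^k) = ?s k"
        proof -
          have "(2^Suc k * t) powr p = 2 powr p * (2 powr p)^k * t powr p"
            using t by (simp add: powr_mult powr_power powr_realpow[symmetric] powr_powr powr_add[symmetric] algebra_simps)
          then show ?thesis by (simp add: power_mult_distrib mult_ac)
        qed
        finally show ?thesis .
      qed
      then have "(\<Sum>k. ennreal ((2^Suc k * t) powr p) * Rfun w b (2^k * t)) \<le> (\<Sum>k. ennreal (?s k))"
        by (intro suminf_le) auto
      also have "\<dots> = ennreal (\<Sum>k. ?s k)"
        by (rule suminf_ennreal2) (use x \<theta> in \<open>auto intro!: summable_mult summable_geometric\<close>)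
      also have "(\<Sum>k. ?s k) = (t powr p * x * 2 powr p) * (1 / (1 - 2 powr p * \<theta>))"
        using \<theta> by (subst suminf_mult) (auto intro!: summable_geometric simp: suminf_geometric)
      also have "\<dots> = t powr p * T * x" by (simp add: T_def)
      finally show ?thesis .
    qed
    have lamA: "(\<integral>\<^sup>+\<zeta>. ennreal (1 / (tau w \<zeta>)\<^sup>2) * indicator A \<zeta> \<partial>lebesgue) \<le> ennreal (real (card Z) * L0)"
    proof -
      have "(\<integral>\<^sup>+\<zeta>. ennreal (1 / (tau w \<zeta>)\<^sup>2) * indicator A \<zeta> \<partial>lebesgue) \<le> (\<integral>\<^sup>+\<zeta>. (\<Sum>z\<in>Z. ennreal (1 / (tau w \<zeta>)\<^sup>2) * indicator (cell z) \<zeta>) \<partial>lebesgue)"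
      proof (rule nn_integral_mono)
        fix \<zeta>
        show "ennreal (1 / (tau w \<zeta>)\<^sup>2) * indicator A \<zeta> \<le> (\<Sum>z\<in>Z. ennreal (1 / (tau w \<zeta>)\<^sup>2) * indicator (cell z) \<zeta>)"
        proof (cases "\<zeta> \<in> A")
          case True
          then obtain z where z: "z \<in> Z" "\<zeta> \<in> cell z" by (auto simp: A_def)
          have "ennreal (1 / (tau w \<zeta>)\<^sup>2) * indicator (cell z) \<zeta> \<le> (\<Sum>z\<in>Z. ennreal (1 / (tau w \<zeta>)\<^sup>2) * indicator (cell z) \<zeta>)"
            by (rule member_le_sum[OF z(1)]) (use Z in auto)
          then show ?thesis using z True by simp
        qed simp
      qed
      also have "\<dots> = (\<Sum>z\<in>Z. \<integral>\<^sup>+\<zeta>. ennreal (1 / (tau w \<zeta>)\<^sup>2) * indicator (cell z) \<zeta> \<partial>lebesgue)"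
        by (intro nn_integral_sum meas_ind) (use cell_sub Z in auto)
      also have "\<dots> \<le> (\<Sum>z\<in>Z. ennreal L0)"
        unfolding L0_def by (intro sum_mono lam_cell) (use Z in auto)
      also have "\<dots> = ennreal (real (card Z) * L0)" by (simp add: ennreal_mult ennreal_of_nat_eq_real_of_nat L0)
      finally show ?thesis .
    qed
    have "ennreal (\<Sum>z\<in>Z. j z) = (\<Sum>z\<in>Z. ennreal (j z))" using j0 by (intro sum_ennreal[symmetric])
    also have "\<dots> = (\<Sum>z\<in>Z. J p z)" using J by (intro sum.cong) auto
    also have "\<dots> \<le> ennreal N0 * (\<integral>\<^sup>+\<zeta>. ennreal (g \<zeta> powr p / (tau w \<zeta>)\<^sup>2) * indicator A \<zeta> \<partial>lebesgue)"
      unfolding J_def by (rule sum_cells[OF Z _ A(3,1,2)]) measurable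
    also have "\<dots> \<le> ennreal N0 * (ennreal (t powr p) * ennreal (real (card Z) * L0) + ennreal (t powr p * T * x))"
      by (intro mult_left_mono order_trans[OF layer_cake[OF t p(1) A(1,2)]] add_mono sumT lamA) auto
    also have "\<dots> = ennreal (N0 * (t powr p * (real (card Z) * L0) + t powr p * T * x))"
      by (rule ennreal_mult_add) (use N0_nonneg L0 T x in auto)
    finally have sj: "(\<Sum>z\<in>Z. j z) \<le> N0 * (t powr p * (real (card Z) * L0) + t powr p * T * x)"
      using N0_nonneg L0 T x by (subst (asm) ennreal_le_iff) auto
    define S where "S = (\<Sum>z\<in>Z. G p z powr p)"
    have "S = K1 p * (\<Sum>z\<in>Z. j z)" by (simp add: S_def G_powr p j_def sum_distrib_left)
    also have "\<dots> \<le> K1 p * (N0 * (t powr p * (real (card Z) * L0) + t powr p * T * x))"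
      using K1_pos[of p] by (intro mult_left_mono sj) auto
    finally have S1: "S \<le> (K1 p * N0 * L0) * (t powr p * real (card Z)) + (K1 p * N0 * T) * (t powr p * x)"
      by (simp add: algebra_simps)
    have S2: "B * (t powr p * real (card Z)) \<le> S"
    proof -
      have "(\<kappa> * t) powr p = B * t powr p" by (simp add: powr_mult \<kappa>p)
      then have "B * (t powr p * real (card Z)) = (\<Sum>z\<in>Z. (\<kappa> * t) powr p)" by (simp add: mult_ac)
      also have "\<dots> \<le> S" unfolding S_def
      proof (rule sum_mono)
        fix z assume z: "z \<in> Z"
        have "g z \<le> G p z" by (rule g_le_G) (use z Z p \<beta> tau_pos[of z] in auto)
        then have "\<kappa> * t \<le> G p z" using gZ[OF z] by simp
        then show "(\<kappa> * t) powr p \<le> G p z powr p" using \<kappa>1 t p by (intro powr_mono2) auto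
      qed
      finally show ?thesis .
    qed
    have "(K1 p * N0 * L0) * (t powr p * real (card Z)) \<le> S / 2"
    proof -
      have "2 * (K1 p * N0 * L0) * (t powr p * real (card Z)) \<le> B * (t powr p * real (card Z))"
        by (intro mult_right_mono) (auto simp: B_def)
      then show ?thesis using S2 by simp
    qed
    then have S3: "S \<le> 2 * (K1 p * N0 * T) * (t powr p * x)" using S1 by simp
    have "(\<Sum>z\<in>Z. (G p z / (\<kappa> * t)) powr p) = S / (B * t powr p)"
    proof -
      have "(\<Sum>z\<in>Z. (G p z / (\<kappa> * t)) powr p) = (\<Sum>z\<in>Z. G p z powr p / (B * t powr p))"
        using \<kappa>1 t by (intro sum.cong) (auto simp: powr_divide powr_mult \<kappa>p G_def)
      then show ?thesis by (simp add: S_def sum_divide_distrib)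
    qed
    also have "\<dots> \<le> S / (t powr p)"
    proof (rule divide_left_mono)
      show "t powr p \<le> B * t powr p" using B1 by (simp add: mult_le_cancel_right1)
      show "0 \<le> S" by (auto simp: S_def intro!: sum_nonneg)
    qed (use B1 t in auto)
    also have "\<dots> \<le> 2 * (K1 p * N0 * T) * x" using S3 t by (simp add: field_simps)
    also have "\<dots> \<le> (2 * (K1 p * N0 * T) + 1) * x" using x by (simp add: algebra_simps)
    finally show ?thesis .
  qed
  show ?thesis
  proof (rule that[OF _ \<kappa>1 main])
    show "0 < 2 * (K1 p * N0 * T) + 1" using KN T by (simp add: add_nonneg_pos)
  qed
qed

end

section \<open>Approximation by operators of finite rank\<close>

lemma half_power_sq: "((1/2::real)^n)\<^sup>2 = (1/4)^n"
  by (simp only: power2_eq_square power_mult_distrib[symmetric]) simp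

context cells
begin

lemma tau_rel: "\<zeta> \<in> disc \<Longrightarrow> w \<zeta> * (knorm w \<zeta>)\<^sup>2 * (tau w \<zeta>)\<^sup>2 = 1"
  using w_pos[of \<zeta>] knorm_pos[of \<zeta>] by (simp add: tau_def power_divide power_mult_distrib)

lemma kern_upper: "z \<in> disc \<Longrightarrow> \<zeta> \<in> disc \<Longrightarrow> cmod (kern w z \<zeta>) \<le> knorm w z * knorm w \<zeta>"
  using eval_le_knorm[OF _ kern_props(1)[of z], of \<zeta>] by (simp add: knorm_eq)

lemma kern_nz: "z \<in> disc \<Longrightarrow> \<zeta> \<in> cell z \<Longrightarrow> kern w z \<zeta> \<noteq> 0"
  using cellD[of z \<zeta>] knorm_pos[of z] knorm_pos[of \<zeta>] by (auto simp: mult_le_0_iff)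

definition loc :: "(complex \<Rightarrow> complex) \<Rightarrow> complex \<Rightarrow> real" where
  "loc f z = enn2real (\<integral>\<^sup>+\<zeta>. ennreal ((cmod (f \<zeta>))\<^sup>2 * w \<zeta>) * indicator (cell z) \<zeta> \<partial>lebesgue)"

text \<open>16 comes from the mean value on radius \<open>\<beta> * tau / 4\<close>; of the four
  powers of \<open>C\<close>, two are due to the lower bound for the kernel and two to the
  comparison of \<open>tau\<close>.\<close>

definition Qc :: real where "Qc = 16 * C^4 / (c0 * \<beta>\<^sup>2)"

definition coef :: "complex \<Rightarrow> nat \<Rightarrow> (complex \<Rightarrow> complex) \<Rightarrow> complex" where
  "coef z i f = (deriv ^^ i) (\<lambda>\<zeta>. f \<zeta> / kern w z \<zeta>) z / fact i"

lemma Qc_pos: "0 < Qc" using C0 c0_pos \<beta> by (simp add: Qc_def)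

lemma loc_nonneg [simp]: "0 \<le> loc f z" by (simp add: loc_def)

lemma nsq_nn: "f \<in> L2 M \<Longrightarrow> (\<integral>\<^sup>+\<zeta>. ennreal ((cmod (f \<zeta>))\<^sup>2 * w \<zeta>) * indicator disc \<zeta> \<partial>lebesgue) = ennreal ((nrm M f)\<^sup>2)"
  using nsq_L2[of f] by (simp add: nsq_def)

lemma loc_eq:
  assumes "f \<in> L2 M" "z \<in> disc"
  shows "(\<integral>\<^sup>+\<zeta>. ennreal ((cmod (f \<zeta>))\<^sup>2 * w \<zeta>) * indicator (cell z) \<zeta> \<partial>lebesgue) = ennreal (loc f z)"
    and "loc f z \<le> (nrm M f)\<^sup>2"
proof -
  have le: "(\<integral>\<^sup>+\<zeta>. ennreal ((cmod (f \<zeta>))\<^sup>2 * w \<zeta>) * indicator (cell z) \<zeta> \<partial>lebesgue) \<le> ennreal ((nrm M f)\<^sup>2)"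
    unfolding nsq_nn[OF assms(1), symmetric]
    by (intro nn_integral_mono mult_left_mono) (use cell_sub[OF assms(2)] in \<open>auto simp: indicator_def\<close>)
  then have fin: "(\<integral>\<^sup>+\<zeta>. ennreal ((cmod (f \<zeta>))\<^sup>2 * w \<zeta>) * indicator (cell z) \<zeta> \<partial>lebesgue) < \<infinity>"
    by (simp add: le_less_trans)
  then show e: "(\<integral>\<^sup>+\<zeta>. ennreal ((cmod (f \<zeta>))\<^sup>2 * w \<zeta>) * indicator (cell z) \<zeta> \<partial>lebesgue) = ennreal (loc f z)"
    by (simp add: loc_def)
  show "loc f z \<le> (nrm M f)\<^sup>2" using le unfolding e by (simp add: ennreal_le_iff)
qed

lemma sum_loc:
  assumes "finite Z" "Z \<subseteq> disc" "sep Z" "f \<in> L2 M"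
  shows "(\<Sum>z\<in>Z. loc f z) \<le> N0 * (nrm M f)\<^sup>2"
proof -
  have [measurable]: "f \<in> borel_measurable Ld" using L2M_meas[OF assms(4)] .
  have "ennreal (\<Sum>z\<in>Z. loc f z) = (\<Sum>z\<in>Z. ennreal (loc f z))" by (intro sum_ennreal[symmetric]) simp
  also have "\<dots> = (\<Sum>z\<in>Z. \<integral>\<^sup>+\<zeta>. ennreal ((cmod (f \<zeta>))\<^sup>2 * w \<zeta>) * indicator (cell z) \<zeta> \<partial>lebesgue)"
    by (intro sum.cong refl loc_eq(1)[symmetric] assms) (use assms in auto)
  also have "\<dots> \<le> ennreal N0 * (\<integral>\<^sup>+\<zeta>. ennreal ((cmod (f \<zeta>))\<^sup>2 * w \<zeta>) * indicator disc \<zeta> \<partial>lebesgue)"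
    by (rule sum_cells[OF assms(1,2,3)]) (use cell_sub assms in auto)
  also have "\<dots> = ennreal (N0 * (nrm M f)\<^sup>2)" unfolding nsq_nn[OF assms(4)] by (rule ennreal_mult[symmetric]) (auto simp: N0_nonneg)
  finally show ?thesis by (subst (asm) ennreal_le_iff) (auto simp: N0_nonneg)
qed

lemma quotient_holomorphic:
  assumes "z \<in> disc" "f \<in> A2w w"
  shows "(\<lambda>\<zeta>. f \<zeta> / kern w z \<zeta>) holomorphic_on ball z (\<beta> * tau w z)"
proof -
  have s: "ball z (\<beta> * tau w z) \<subseteq> cell z" by (auto simp: cell_def)
  have "f holomorphic_on ball z (\<beta> * tau w z)" "kern w z holomorphic_on ball z (\<beta> * tau w z)"
    using assms kern_props(1)[OF assms(1)] s cell_sub[OF assms(1)]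
    by (auto simp: A2w_eq intro: holomorphic_on_subset)
  then show ?thesis using kern_nz[OF assms(1)] s by (intro holomorphic_intros) auto
qed

text \<open>Mean value for the square of \<open>f / kern w z\<close>. By \<open>tau_rel\<close>, the
  lower bound for the kernel says that \<open>1 / |kern w z \<zeta>|^2\<close> is at most a multiple
  of \<open>w \<zeta> * tau^2 / knorm^2\<close> on the cell, with \<open>tau\<close> and
  \<open>knorm\<close> taken at \<open>z\<close>. So the unweighted integral is controlled by the
  weighted local norm.\<close>

lemma quotient_bound:
  assumes z: "z \<in> disc" and f: "f \<in> A2w w" and x: "cmod (x - z) \<le> \<beta> * tau w z / 2"
  shows "cmod (f x / kern w z x) \<le> sqrt (Qc * loc f z) / knorm w z"
proof -
  define r where "r = \<beta> * tau w z"
  have tz: "0 < tau w z" and kz: "0 < knorm w z" using tau_pos knorm_pos z by auto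
  have r: "0 < r" using \<beta> tz by (simp add: r_def)
  let ?h = "\<lambda>\<zeta>. f \<zeta> / kern w z \<zeta>"
  have sub: "ball x (r/2) \<subseteq> ball z r" "cball x (r/4) \<subseteq> cell z"
  proof -
    have dx: "dist z x \<le> r/2" using x by (simp add: r_def dist_norm norm_minus_commute)
    show "ball x (r/2) \<subseteq> ball z r"
    proof
      fix y assume "y \<in> ball x (r/2)"
      then show "y \<in> ball z r" using dx dist_triangle[of z y x] by simp
    qed
    show "cball x (r/4) \<subseteq> cell z"
    proof
      fix y assume "y \<in> cball x (r/4)"
      then show "y \<in> cell z" using dx dist_triangle[of z y x] r by (simp add: cell_def r_def[symmetric])
    qed
  qed
  have hh: "(\<lambda>\<zeta>. (?h \<zeta>)\<^sup>2) holomorphic_on ball x (r/2)"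
    by (intro holomorphic_on_power holomorphic_on_subset[OF quotient_holomorphic[OF z f]]) (use sub in \<open>simp add: r_def\<close>)
  have fm [measurable]: "f \<in> borel_measurable Ld" using L2M_meas[OF A2w_L2[OF f]] .
  define c where "c = C^4 * (tau w z)\<^sup>2 / (knorm w z)\<^sup>2"
  have c: "0 \<le> c" by (simp add: c_def)
  have "ennreal (cmod ((?h x)\<^sup>2)) \<le> ennreal (1 / (c0 * (r/4)\<^sup>2)) * (\<integral>\<^sup>+\<zeta>. ennreal (cmod ((?h \<zeta>)\<^sup>2)) * indicator (cball x (r/4)) \<zeta> \<partial>lebesgue)"
    by (rule mean_value_nn[OF hh]) (use r in auto)
  also have "\<dots> \<le> ennreal (1 / (c0 * (r/4)\<^sup>2)) * (\<integral>\<^sup>+\<zeta>. ennreal c * (ennreal ((cmod (f \<zeta>))\<^sup>2 * w \<zeta>) * indicator (cell z) \<zeta>) \<partial>lebesgue)"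
  proof (intro mult_left_mono nn_integral_mono)
    fix \<zeta>
    show "ennreal (cmod ((?h \<zeta>)\<^sup>2)) * indicator (cball x (r/4)) \<zeta> \<le> ennreal c * (ennreal ((cmod (f \<zeta>))\<^sup>2 * w \<zeta>) * indicator (cell z) \<zeta>)"
    proof (cases "\<zeta> \<in> cball x (r/4)")
      case True
      then have zc: "\<zeta> \<in> cell z" using sub by blast
      note D = cellD[OF z zc]
      have p: "0 < tau w \<zeta>" "0 < knorm w \<zeta>" "0 < w \<zeta>" using tau_pos knorm_pos w_pos D(1) by auto
      have k0: "0 < cmod (kern w z \<zeta>)" using kern_nz[OF z zc] by simp
      have "(knorm w z * knorm w \<zeta>)\<^sup>2 \<le> (C * cmod (kern w z \<zeta>))\<^sup>2" using D(4) kz p by (intro power_mono) auto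
      then have "(knorm w z)\<^sup>2 * (knorm w \<zeta>)\<^sup>2 / (cmod (kern w z \<zeta>))\<^sup>2 \<le> C\<^sup>2"
        using k0 by (simp add: power_mult_distrib pos_divide_le_eq)
      moreover have "(tau w \<zeta>)\<^sup>2 \<le> C\<^sup>2 * (tau w z)\<^sup>2"
        using power_mono[OF D(3), of 2] p by (simp add: power_mult_distrib)
      ultimately have "((knorm w z)\<^sup>2 * (knorm w \<zeta>)\<^sup>2 / (cmod (kern w z \<zeta>))\<^sup>2) * (tau w \<zeta>)\<^sup>2 \<le> C\<^sup>2 * (C\<^sup>2 * (tau w z)\<^sup>2)"
        by (intro mult_mono) auto
      then have "w \<zeta> * (((knorm w z)\<^sup>2 * (knorm w \<zeta>)\<^sup>2 / (cmod (kern w z \<zeta>))\<^sup>2) * (tau w \<zeta>)\<^sup>2) \<le> w \<zeta> * (C\<^sup>2 * (C\<^sup>2 * (tau w z)\<^sup>2))"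
        using p by (intro mult_left_mono) auto
      moreover have "w \<zeta> * (((knorm w z)\<^sup>2 * (knorm w \<zeta>)\<^sup>2 / (cmod (kern w z \<zeta>))\<^sup>2) * (tau w \<zeta>)\<^sup>2)
        = (w \<zeta> * (knorm w \<zeta>)\<^sup>2 * (tau w \<zeta>)\<^sup>2) * ((knorm w z)\<^sup>2 / (cmod (kern w z \<zeta>))\<^sup>2)"
        by (simp only: divide_inverse mult_ac)
      ultimately have "(w \<zeta> * (knorm w \<zeta>)\<^sup>2 * (tau w \<zeta>)\<^sup>2) * ((knorm w z)\<^sup>2 / (cmod (kern w z \<zeta>))\<^sup>2) \<le> w \<zeta> * (C\<^sup>2 * (C\<^sup>2 * (tau w z)\<^sup>2))"
        by (simp only:)
      then have "(knorm w z)\<^sup>2 / (cmod (kern w z \<zeta>))\<^sup>2 \<le> w \<zeta> * (C^4 * (tau w z)\<^sup>2)"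
        unfolding tau_rel[OF D(1)] by (simp add: power_numeral_reduce mult_ac power2_eq_square)
      then have "1 / (cmod (kern w z \<zeta>))\<^sup>2 \<le> c * w \<zeta>"
        using kz by (simp add: c_def field_simps)
      then have "(cmod (f \<zeta>))\<^sup>2 * (1 / (cmod (kern w z \<zeta>))\<^sup>2) \<le> (cmod (f \<zeta>))\<^sup>2 * (c * w \<zeta>)"
        by (intro mult_left_mono) auto
      then have "cmod ((?h \<zeta>)\<^sup>2) \<le> c * ((cmod (f \<zeta>))\<^sup>2 * w \<zeta>)"
        by (simp add: norm_power norm_divide power_divide mult_ac)
      then have "ennreal (cmod ((?h \<zeta>)\<^sup>2)) \<le> ennreal c * ennreal ((cmod (f \<zeta>))\<^sup>2 * w \<zeta>)"
        using c p by (subst ennreal_mult[symmetric]) (auto intro: ennreal_leI)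
      then show ?thesis using True zc by simp
    qed simp
  qed simp
  also have "(\<integral>\<^sup>+\<zeta>. ennreal c * (ennreal ((cmod (f \<zeta>))\<^sup>2 * w \<zeta>) * indicator (cell z) \<zeta>) \<partial>lebesgue) = ennreal c * ennreal (loc f z)"
    unfolding loc_eq(1)[OF A2w_L2[OF f] z, symmetric]
    by (intro nn_integral_cmult meas_ind) (use cell_sub[OF z] in auto)
  also have "ennreal (1 / (c0 * (r/4)\<^sup>2)) * (ennreal c * ennreal (loc f z)) = ennreal (1 / (c0 * (r/4)\<^sup>2) * (c * loc f z))"
    by (rule ennreal_mult3[symmetric]) (use c c0_pos in auto)
  finally have "cmod ((?h x)\<^sup>2) \<le> 1 / (c0 * (r/4)\<^sup>2) * (c * loc f z)"
    using c c0_pos by (subst (asm) ennreal_le_iff) auto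
  also have "\<dots> = Qc * loc f z / (knorm w z)\<^sup>2"
    using \<beta> tz c0_pos kz by (simp add: Qc_def c_def r_def power_mult_distrib power_divide field_simps)
  also have "\<dots> = (sqrt (Qc * loc f z) / knorm w z)\<^sup>2"
    using Qc_pos by (simp add: power_divide)
  finally have "(cmod (?h x))\<^sup>2 \<le> (sqrt (Qc * loc f z) / knorm w z)\<^sup>2" by (simp add: norm_power)
  then show ?thesis by (rule power2_le_imp_le) (use Qc_pos kz in simp)
qed

text \<open>The Cauchy bound makes each Taylor coefficient of \<open>f / kern w z\<close> a bounded
  functional, hence a pairing with a vector, which is the form that \<open>finrank\<close>
  demands.\<close>

lemma coef_functional:
  assumes z: "z \<in> disc"
  obtains u where "u \<in> A2w w" "\<And>f. f \<in> A2w w \<Longrightarrow> ip M f u = coef z i f"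
proof -
  define r where "r = \<beta> * tau w z"
  have r: "0 < r" using \<beta> tau_pos[OF z] by (simp add: r_def)
  have kz: "0 < knorm w z" using knorm_pos z by auto
  have zb: "z \<in> ball z r" using r by simp
  obtain V where "V \<in> A2w w" "\<And>\<alpha>. \<alpha> \<in> A2w w \<Longrightarrow> ip M \<alpha> V = coef z i \<alpha>"
  proof (rule A2w_Riesz[of "coef z i" "(sqrt Qc / knorm w z) / (r/2)^i"])
    fix c \<alpha> \<beta> assume a: "\<alpha> \<in> A2w w" "\<beta> \<in> A2w w"
    note h = quotient_holomorphic[OF z a(1), folded r_def] quotient_holomorphic[OF z a(2), folded r_def]
    have "(deriv ^^ i) (\<lambda>\<zeta>. (c * \<alpha> \<zeta> + \<beta> \<zeta>) / kern w z \<zeta>) z = (deriv ^^ i) (\<lambda>\<zeta>. c * (\<alpha> \<zeta> / kern w z \<zeta>) + \<beta> \<zeta> / kern w z \<zeta>) z"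
      by (simp add: add_divide_distrib)
    also have "\<dots> = (deriv ^^ i) (\<lambda>\<zeta>. c * (\<alpha> \<zeta> / kern w z \<zeta>)) z + (deriv ^^ i) (\<lambda>\<zeta>. \<beta> \<zeta> / kern w z \<zeta>) z"
      by (rule higher_deriv_add[OF _ h(2) open_ball zb]) (intro holomorphic_intros h)
    also have "(deriv ^^ i) (\<lambda>\<zeta>. c * (\<alpha> \<zeta> / kern w z \<zeta>)) z = c * (deriv ^^ i) (\<lambda>\<zeta>. \<alpha> \<zeta> / kern w z \<zeta>) z"
      by (rule higher_deriv_cmult[OF h(1) zb open_ball])
    finally show "coef z i (\<lambda>x. c * \<alpha> x + \<beta> x) = c * coef z i \<alpha> + coef z i \<beta>"
      by (simp add: coef_def add_divide_distrib)
  next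
    fix f assume f: "f \<in> A2w w"
    have "cmod (coef z i f) \<le> (sqrt (Qc * loc f z) / knorm w z) / (r/2)^i"
      unfolding coef_def
      by (rule Taylor_remainder(2)[OF quotient_holomorphic[OF z f, folded r_def], where x = z])
         (use r quotient_bound[OF z f] in \<open>auto simp: r_def norm_minus_commute\<close>)
    also have "\<dots> \<le> ((sqrt Qc * nrm M f) / knorm w z) / (r/2)^i"
    proof (intro divide_right_mono)
      have "sqrt (Qc * loc f z) \<le> sqrt (Qc * (nrm M f)\<^sup>2)"
        using loc_eq(2)[OF A2w_L2[OF f] z] Qc_pos by simp
      then show "sqrt (Qc * loc f z) \<le> sqrt Qc * nrm M f" by (simp add: real_sqrt_mult)
    qed (use kz r in auto)
    finally show "cmod (coef z i f) \<le> (sqrt Qc / knorm w z) / (r/2)^i * nrm M f" by simp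
  qed (use Qc_pos kz r in auto)
  then show ?thesis using that by blast
qed

text \<open>The Taylor remainder of \<open>f / kern w z\<close> is multiplied back by the kernel.
  Here the upper bound \<open>knorm w z * knorm w x\<close> enters, and \<open>knorm w z\<close>
  cancels against \<open>quotient_bound\<close>.\<close>

lemma local_approx:
  assumes z: "z \<in> disc" and f: "f \<in> A2w w" and x: "cmod (x - z) \<le> \<beta> / 4 * tau w z"
  shows "(cmod (f x - (\<Sum>i<N. coef z i f * ((x - z)^i * kern w z x))))\<^sup>2 * w x \<le> 4 * C\<^sup>2 * Qc * loc f z * (1/4)^N / (tau w z)\<^sup>2"
proof -
  define r where "r = \<beta> * tau w z"
  have tz: "0 < tau w z" and kz: "0 < knorm w z" using tau_pos knorm_pos z by auto
  have r: "0 < r" using \<beta> tz by (simp add: r_def)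
  have xc: "x \<in> cell z" using x r by (simp add: cell_def dist_norm norm_minus_commute r_def)
  note D = cellD[OF z xc]
  have p: "0 < tau w x" "0 < knorm w x" "0 < w x" using tau_pos knorm_pos w_pos D(1) by auto
  let ?h = "\<lambda>\<zeta>. f \<zeta> / kern w z \<zeta>" and ?k = "kern w z x"
  define B where "B = sqrt (Qc * loc f z) / knorm w z"
  have B: "cmod (?h x - (\<Sum>i<N. (deriv ^^ i) ?h z / fact i * (x - z)^i)) \<le> 2 * B * (1/2)^N"
    by (rule Taylor_remainder(1)[OF quotient_holomorphic[OF z f, folded r_def], where \<rho> = "r/2"])
       (use r quotient_bound[OF z f] x in \<open>auto simp: r_def B_def norm_minus_commute\<close>)
  have "f x - (\<Sum>i<N. coef z i f * ((x - z)^i * ?k)) = ?k * (?h x - (\<Sum>i<N. (deriv ^^ i) ?h z / fact i * (x - z)^i))"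
    using kern_nz[OF z xc] by (simp add: right_diff_distrib sum_distrib_left coef_def mult_ac)
  then have "(cmod (f x - (\<Sum>i<N. coef z i f * ((x - z)^i * ?k))))\<^sup>2 * w x
     = ((cmod ?k)\<^sup>2 * w x) * (cmod (?h x - (\<Sum>i<N. (deriv ^^ i) ?h z / fact i * (x - z)^i)))\<^sup>2"
    by (simp add: norm_mult power_mult_distrib mult_ac)
  also have "\<dots> \<le> ((knorm w z)\<^sup>2 * C\<^sup>2 / (tau w z)\<^sup>2) * (2 * B * (1/2)^N)\<^sup>2"
  proof (intro mult_mono power_mono B)
    have "(cmod ?k)\<^sup>2 * w x \<le> (knorm w z * knorm w x)\<^sup>2 * w x"
      using kern_upper[OF z D(1)] p by (intro mult_right_mono power_mono) auto
    also have "\<dots> = (knorm w z)\<^sup>2 * (1 / (tau w x)\<^sup>2)"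
      using tau_rel[OF D(1)] p by (simp add: power_mult_distrib field_simps)
    also have "\<dots> \<le> (knorm w z)\<^sup>2 * (C\<^sup>2 / (tau w z)\<^sup>2)"
    proof (intro mult_left_mono)
      have "(tau w z)\<^sup>2 \<le> (C * tau w x)\<^sup>2" using D(2) tz by (intro power_mono) auto
      then show "1 / (tau w x)\<^sup>2 \<le> C\<^sup>2 / (tau w z)\<^sup>2" using tz p by (simp add: power_mult_distrib field_simps)
    qed simp
    finally show "(cmod ?k)\<^sup>2 * w x \<le> (knorm w z)\<^sup>2 * C\<^sup>2 / (tau w z)\<^sup>2" by simp
  qed auto
  also have "(2 * B * (1/2)^N)\<^sup>2 = 4 * (Qc * loc f z / (knorm w z)\<^sup>2) * (1/4)^N"
  proof -
    have "((1/2::real)^N)\<^sup>2 = (1/4)^N" by (rule half_power_sq)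
    moreover have "B\<^sup>2 = Qc * loc f z / (knorm w z)\<^sup>2" using Qc_pos by (simp add: B_def power_divide)
    ultimately show ?thesis by (simp only: power_mult_distrib) simp
  qed
  also have "((knorm w z)\<^sup>2 * C\<^sup>2 / (tau w z)\<^sup>2) * (4 * (Qc * loc f z / (knorm w z)\<^sup>2) * (1/4)^N) = 4 * C\<^sup>2 * Qc * loc f z * (1/4)^N / (tau w z)\<^sup>2"
    using kz by simp
  finally show ?thesis .
qed

end

locale hankel_apriori = hankel_cells +
  fixes Ca :: real
  assumes Ca: "0 < Ca"
    and ap1: "\<And>\<xi>. \<xi> \<in> test \<Longrightarrow> (\<lambda>z. \<xi> z / of_real (tau w z * w z)) \<in> L2 M"
    and ap2: "\<And>\<xi>. \<xi> \<in> test \<Longrightarrow> nrm M (\<lambda>z. \<xi> z / of_real (tau w z * w z)) \<le> Ca * nrm M (Dw \<xi>)"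
begin

text \<open>Under the root, 1 accounts for the region where \<open>g \<le> s\<close>, the other term
  for the quarter cells: \<open>pi * \<beta>^2 / 16\<close> is their area divided by
  \<open>tau^2\<close>, and \<open>N0\<close> is the overlap.\<close>

definition K4 :: real where "K4 = Ca * sqrt (1 + 4 * C\<^sup>2 * Qc * (pi * \<beta>\<^sup>2 / 16) * N0)"

text \<open>After subtracting the truncated data, the remainder \<open>R\<close> satisfies
  \<open>tau * |R| \<le> s * |f|\<close> off the covering. On it, the Taylor gain
  \<open>2^-(N z)\<close> compensates for the size \<open>G p z\<close> of \<open>g\<close>, which
  gives order \<open>s\<close> again. \<open>dbar_sol_bound\<close> turns this into an operator
  norm.\<close>

lemma finite_rank_approx:
  assumes Z: "finite Z" "Z \<subseteq> disc" "sep Z" and s: "0 < s" and p: "0 < p" "p \<le> 1"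
    and cov: "\<And>x. x \<in> disc \<Longrightarrow> s < g x \<Longrightarrow> \<exists>z\<in>Z. cmod (x - z) \<le> \<beta> / 4 * tau w z"
    and N: "\<And>z. z \<in> Z \<Longrightarrow> G p z * (1/2)^(N z) \<le> s"
    and n: "(\<Sum>z\<in>Z. N z) < n"
  shows "sv_sq w b n \<le> ennreal ((K4 * s)\<^sup>2)"
proof -
  define D where "D z = cball z (\<beta> / 4 * tau w z)" for z
  \<comment> \<open>An enumeration of \<open>Z\<close> used to make the covering discs disjoint:
    each point goes to the first disc that contains it.\<close>
  define e where "e = to_nat_on Z"
  have e: "inj_on e Z" unfolding e_def using Z(1) by (intro inj_on_to_nat_on countable_finite)
  define part where "part z = D z - (\<Union>z'\<in>{z'\<in>Z. e z' < e z}. D z')" for z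
  have part_D: "part z \<subseteq> D z" for z by (auto simp: part_def)
  have part_m [measurable]: "part z \<in> sets lebesgue" for z
    unfolding part_def D_def using Z(1) by (intro sets.Diff sets.finite_UN) auto
  have D_cell: "D z \<subseteq> cell z" if "z \<in> disc" for z
    unfolding D_def cell_def using \<beta> tau_pos[OF that] by (intro subset_cball mult_right_mono) auto
  have part_disj: "z = z'" if "z \<in> Z" "z' \<in> Z" "x \<in> part z" "x \<in> part z'" for z z' x
  proof (rule ccontr)
    assume "z \<noteq> z'"
    then have "e z \<noteq> e z'" using e that by (auto dest: inj_onD)
    then show False using that by (auto simp: part_def nat_neq_iff)
  qed
  have part_cov: "\<exists>z\<in>Z. x \<in> part z" if "z0 \<in> Z" "x \<in> D z0" for x z0
  proof -
    define z where "z = arg_min_on e {z\<in>Z. x \<in> D z}"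
    have ne: "finite {z\<in>Z. x \<in> D z}" "{z\<in>Z. x \<in> D z} \<noteq> {}" using Z that by auto
    have z: "z \<in> Z" "x \<in> D z" using arg_min_if_finite(1)[OF ne, of e] by (auto simp: z_def)
    have "\<not> e z' < e z" if "z' \<in> Z" "x \<in> D z'" for z'
      using arg_min_if_finite(2)[OF ne, of e] that by (auto simp: z_def)
    then show ?thesis using z by (auto simp: part_def)
  qed
  define I where "I = (SIGMA z:Z. {..<N z})"
  have I: "finite I" "card I = (\<Sum>z\<in>Z. N z)" using Z by (auto simp: I_def card_SigmaI)
  have "\<forall>j\<in>Z \<times> (UNIV :: nat set). \<exists>u. u \<in> A2w w \<and> (\<forall>f\<in>A2w w. ip M f u = coef (fst j) (snd j) f)"
  proof
    fix j assume "j \<in> Z \<times> (UNIV :: nat set)"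
    then have "fst j \<in> disc" using Z by auto
    then show "\<exists>u. u \<in> A2w w \<and> (\<forall>f\<in>A2w w. ip M f u = coef (fst j) (snd j) f)"
      by (rule coef_functional[where i = "snd j"]) blast
  qed
  from bchoice[OF this] obtain u' where
    u': "\<forall>j\<in>Z \<times> (UNIV :: nat set). u' j \<in> A2w w \<and> (\<forall>f\<in>A2w w. ip M f (u' j) = coef (fst j) (snd j) f)" ..
  define u where "u z i = u' (z, i)" for z i
  have u: "u z i \<in> A2w w" "f \<in> A2w w \<Longrightarrow> ip M f (u z i) = coef z i f" if "z \<in> Z" for z i f
    using bspec[OF u', of "(z, i)"] that by (auto simp: u_def)
  \<comment> \<open>Data of a single Taylor monomial. The sharp cut-off destroys continuity, which
    the weak equation tolerates. The crude factor \<open>2^i\<close> below only serves membership in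
    \<open>L2 M\<close>.\<close>
  define q where "q z i \<zeta> = indicator (part z) \<zeta> * cnj (deriv b \<zeta>) * ((\<zeta> - z)^i * kern w z \<zeta>)" for z i \<zeta>
  have qL: "(\<lambda>\<zeta>. q z i \<zeta> * of_real (tau w \<zeta>)) \<in> L2 M" if z: "z \<in> Z" for z i
  proof (rule L2_bound[where g = "kern w z" and c = "Gm * 2^i"])
    have zd: "z \<in> disc" using z Z by auto
    show kL: "kern w z \<in> L2 M" by (intro A2w_L2 kern_props zd)
    have [measurable]: "kern w z \<in> borel_measurable Ld" using L2M_meas[OF kL] .
    have [measurable]: "(\<lambda>\<zeta>. indicator (part z) \<zeta> :: complex) \<in> borel_measurable Ld"
      by (intro measurable_restrict_space1 borel_measurable_indicator part_m)
    have [measurable]: "(\<lambda>\<zeta>. (\<zeta> - z)^i) \<in> borel_measurable Ld" by (intro cont_meas continuous_intros)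
    show "(\<lambda>\<zeta>. q z i \<zeta> * of_real (tau w \<zeta>)) \<in> borel_measurable M"
      unfolding q_def[abs_def] borel_M by measurable
    fix \<zeta> assume "\<zeta> \<in> space M"
    then have d: "\<zeta> \<in> disc" by simp
    have Gm0: "0 \<le> Gm" using Gm[OF d] tau_pos[OF d] by (meson mult_nonneg_nonneg norm_ge_zero order_trans less_imp_le)
    have "cmod (\<zeta> - z) \<le> 2" using d zd norm_triangle_ineq4[of \<zeta> z] by (simp add: disc_def)
    then have p2: "cmod (\<zeta> - z)^i \<le> 2^i" by (intro power_mono) auto
    have "cmod (q z i \<zeta> * of_real (tau w \<zeta>)) = indicator (part z) \<zeta> * ((tau w \<zeta> * cmod (deriv b \<zeta>)) * (cmod (\<zeta> - z)^i * cmod (kern w z \<zeta>)))"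
      using tau_pos[OF d] by (simp add: q_def norm_mult norm_power indicator_def)
    also have "\<dots> \<le> 1 * (Gm * (2^i * cmod (kern w z \<zeta>)))"
      using Gm[OF d] Gm0 p2 tau_pos[OF d] by (intro mult_mono) (auto simp: indicator_def)
    finally show "cmod (q z i \<zeta> * of_real (tau w \<zeta>)) \<le> Gm * 2^i * cmod (kern w z \<zeta>)" by (simp add: mult.assoc)
  qed
  have "\<forall>j\<in>Z \<times> (UNIV :: nat set). \<exists>v. dbar_sol (q (fst j) (snd j)) v"
  proof
    fix j assume "j \<in> Z \<times> (UNIV :: nat set)"
    then have "fst j \<in> Z" by auto
    show "\<exists>v. dbar_sol (q (fst j) (snd j)) v"
      by (rule dbar_sol_exists[OF Ca ap1 ap2 qL[OF \<open>fst j \<in> Z\<close>, of "snd j"]]) auto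
  qed
  from bchoice[OF this] obtain v' where v': "\<forall>j\<in>Z \<times> (UNIV :: nat set). dbar_sol (q (fst j) (snd j)) (v' j)" ..
  define v where "v z i = v' (z, i)" for z i
  have v: "dbar_sol (q z i) (v z i)" if "z \<in> Z" for z i
    using bspec[OF v', of "(z, i)"] that by (simp add: v_def)
  \<comment> \<open>One rank-one term for each pair \<open>(z, i)\<close> with
    \<open>i < N z\<close>, so the number of terms is strictly below \<open>n\<close>, as
    \<open>finrank\<close> demands.\<close>
  define F where "F f \<zeta> = (\<Sum>j\<in>I. winner w f (case_prod u j) * case_prod v j \<zeta>)" for f \<zeta>
  have FF: "F \<in> finrank w n"
  proof -
    obtain h where h: "bij_betw h {0..<card I} I" using ex_bij_betw_nat_finite[OF I(1)] by blast
    then have h': "bij_betw h {..<card I} I" by (simp add: lessThan_atLeast0)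
    have hI: "h i \<in> I" if "i < card I" for i using h' that by (auto simp: bij_betw_def)
    have "case_prod u (h i) \<in> L2w w \<and> case_prod v (h i) \<in> L2w w" if "i < card I" for i
      using hI[OF that] u(1) v A2w_L2 by (auto simp: I_def L2w_eq dbar_sol_def split_beta)
    moreover have "F = (\<lambda>f \<zeta>. \<Sum>i<card I. winner w f (case_prod u (h i)) * case_prod v (h i) \<zeta>)"
      unfolding F_def[abs_def] by (intro ext sum.reindex_bij_betw[OF h', symmetric])
    ultimately show ?thesis
      unfolding finrank_def mem_Collect_eq
      by (intro exI[of _ "card I"] conjI, use I(2) n in simp)
         (rule exI[of _ "\<lambda>i. case_prod u (h i)"], rule exI[of _ "\<lambda>i. case_prod v (h i)"], blast)
  qed
  have main: "nsq w (\<lambda>z. hankel w b f z - F f z) \<le> ennreal ((K4 * s)\<^sup>2)" if f: "f \<in> hdom w b" and f1: "nsq w f \<le> 1" for f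
  proof -
    have fA: "f \<in> A2w w" using f by (simp add: hdom_def)
    have fL: "f \<in> L2 M" by (rule A2w_L2[OF fA])
    have [measurable]: "f \<in> borel_measurable Ld" by (rule L2M_meas[OF fL])
    define nf where "nf = nrm M f"
    have nf: "0 \<le> nf" "nf\<^sup>2 \<le> 1"
      using f1 nsq_L2[OF fL] by (auto simp: nf_def ennreal_le_1)
    let ?Q = "\<lambda>\<zeta>. cnj (deriv b \<zeta>) * f \<zeta>"
    have QL: "(\<lambda>\<zeta>. ?Q \<zeta> * of_real (tau w \<zeta>)) \<in> L2 M"
    proof (rule L2_bound[OF fL, where c = Gm])
      show "(\<lambda>\<zeta>. ?Q \<zeta> * of_real (tau w \<zeta>)) \<in> borel_measurable M" unfolding borel_M by measurable
      fix \<zeta> assume "\<zeta> \<in> space M"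
      then have d: "\<zeta> \<in> disc" by simp
      have "cmod (?Q \<zeta> * of_real (tau w \<zeta>)) = (tau w \<zeta> * cmod (deriv b \<zeta>)) * cmod (f \<zeta>)"
        using tau_pos[OF d] by (simp add: norm_mult)
      also have "\<dots> \<le> Gm * cmod (f \<zeta>)" by (intro mult_right_mono Gm d) simp
      finally show "cmod (?Q \<zeta> * of_real (tau w \<zeta>)) \<le> Gm * cmod (f \<zeta>)" .
    qed
    let ?c = "\<lambda>j. winner w f (case_prod u j)"
    define R where "R \<zeta> = ?Q \<zeta> - (\<Sum>j\<in>I. ?c j * case_prod q j \<zeta>)" for \<zeta>
    have sol: "dbar_sol R (\<lambda>\<zeta>. hankel w b f \<zeta> - F f \<zeta>) \<and> (\<lambda>\<zeta>. R \<zeta> * of_real (tau w \<zeta>)) \<in> L2 M"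
      unfolding R_def F_def
      by (rule dbar_sol_diff_sum[OF hankel_dbar_sol[OF b f] I(1) _ QL _ ap1])
         (use v qL in \<open>auto simp: I_def\<close>)
    then have RL: "(\<lambda>\<zeta>. R \<zeta> * of_real (tau w \<zeta>)) \<in> L2 M" by simp
    define KK where "KK = 4 * C\<^sup>2 * Qc"
    have KK: "0 \<le> KK" using Qc_pos by (simp add: KK_def)
    have sum_eq: "(\<Sum>j\<in>I. ?c j * case_prod q j \<zeta>) = (\<Sum>z\<in>Z. indicator (part z) \<zeta> * cnj (deriv b \<zeta>) * (\<Sum>i<N z. coef z i f * ((\<zeta> - z)^i * kern w z \<zeta>)))" for \<zeta>
    proof -
      have "(\<Sum>j\<in>I. ?c j * case_prod q j \<zeta>) = (\<Sum>z\<in>Z. \<Sum>i<N z. winner w f (u z i) * q z i \<zeta>)"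
        unfolding I_def by (subst sum.Sigma) (use Z in \<open>auto simp: split_beta\<close>)
      also have "\<dots> = (\<Sum>z\<in>Z. indicator (part z) \<zeta> * cnj (deriv b \<zeta>) * (\<Sum>i<N z. coef z i f * ((\<zeta> - z)^i * kern w z \<zeta>)))"
      proof (rule sum.cong[OF refl])
        fix z assume z: "z \<in> Z"
        have "winner w f (u z i) = coef z i f" for i
          using u[OF z] fA fL A2w_L2 by (simp add: winner_L2)
        then show "(\<Sum>i<N z. winner w f (u z i) * q z i \<zeta>) = indicator (part z) \<zeta> * cnj (deriv b \<zeta>) * (\<Sum>i<N z. coef z i f * ((\<zeta> - z)^i * kern w z \<zeta>))"
          by (simp add: q_def sum_distrib_left mult_ac)
      qed
      finally show ?thesis .
    qed
    \<comment> \<open>On a part, \<open>g \<le> G p z\<close> and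
      \<open>G p z * (1/2)^(N z) \<le> s\<close>, so the factor \<open>(1/4)^(N z)\<close> of the
      squared remainder is just what is needed; off all parts \<open>g \<le> s\<close> by
      \<open>cov\<close>.\<close>
    have pt: "(cmod (R x * of_real (tau w x)))\<^sup>2 * w x \<le> s\<^sup>2 * ((cmod (f x))\<^sup>2 * w x) + (\<Sum>z\<in>Z. (KK * loc f z * s\<^sup>2 / (tau w z)\<^sup>2) * indicator (D z) x)"
      if x: "x \<in> disc" for x
    proof (cases "\<exists>z\<in>Z. x \<in> part z")
      case True
      then obtain z where z: "z \<in> Z" "x \<in> part z" by blast
      have zd: "z \<in> disc" using z Z by auto
      have xD: "x \<in> D z" using z part_D by blast
      have xz: "cmod (x - z) \<le> \<beta> / 4 * tau w z" using xD by (simp add: D_def dist_norm norm_minus_commute)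
      let ?P = "\<Sum>i<N z. coef z i f * ((x - z)^i * kern w z x)"
      have "(\<Sum>z\<in>Z. indicator (part z) x * cnj (deriv b x) * (\<Sum>i<N z. coef z i f * ((x - z)^i * kern w z x)))
         = (\<Sum>z'\<in>Z. if z' = z then cnj (deriv b x) * ?P else 0)"
        by (rule sum.cong) (use z part_disj in \<open>auto simp: indicator_def\<close>)
      also have "\<dots> = cnj (deriv b x) * ?P" using z Z by simp
      finally have "R x = cnj (deriv b x) * (f x - ?P)" by (simp add: R_def sum_eq right_diff_distrib)
      then have "(cmod (R x * of_real (tau w x)))\<^sup>2 * w x = (g x)\<^sup>2 * ((cmod (f x - ?P))\<^sup>2 * w x)"
        by (simp add: g_def norm_mult power_mult_distrib mult_ac)
      also have "\<dots> \<le> (G p z)\<^sup>2 * (KK * loc f z * (1/4)^N z / (tau w z)\<^sup>2)"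
        unfolding KK_def
        by (intro mult_mono power_mono g_le_G[OF zd xz p] local_approx[OF zd fA xz] g_nonneg x) (use w_pos[OF x] in auto)
      also have "\<dots> = (G p z * (1/2)^(N z))\<^sup>2 * (KK * loc f z / (tau w z)\<^sup>2)"
      proof -
        have "((1/2::real)^N z)\<^sup>2 = (1/4)^N z" by (rule half_power_sq)
        then show ?thesis by (simp add: power_mult_distrib)
      qed
      also have "\<dots> \<le> s\<^sup>2 * (KK * loc f z / (tau w z)\<^sup>2)"
      proof (intro mult_right_mono power_mono N z)
        show "0 \<le> G p z * (1/2)^(N z)" by (simp add: G_def)
        show "0 \<le> KK * loc f z / (tau w z)\<^sup>2" using KK by simp
      qed
      also have "\<dots> = (KK * loc f z * s\<^sup>2 / (tau w z)\<^sup>2) * indicator (D z) x" using xD by simp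
      also have "\<dots> \<le> (\<Sum>z\<in>Z. (KK * loc f z * s\<^sup>2 / (tau w z)\<^sup>2) * indicator (D z) x)"
        by (rule member_le_sum[OF z(1)]) (use Z KK in auto)
      finally show ?thesis using w_pos[OF x] by (simp add: add_increasing)
    next
      case False
      then have "R x = ?Q x" by (simp add: R_def sum_eq indicator_def)
      have "\<not> s < g x"
      proof
        assume "s < g x"
        from cov[OF x this] obtain z where z: "z \<in> Z" "cmod (x - z) \<le> \<beta> / 4 * tau w z" by blast
        then have "x \<in> D z" by (simp add: D_def dist_norm norm_minus_commute)
        then show False using part_cov[OF z(1)] False by blast
      qed
      then have "(g x)\<^sup>2 \<le> s\<^sup>2" using g_nonneg[OF x] by (intro power_mono) auto
      then have "(g x)\<^sup>2 * ((cmod (f x))\<^sup>2 * w x) \<le> s\<^sup>2 * ((cmod (f x))\<^sup>2 * w x)"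
        using w_pos[OF x] by (intro mult_right_mono) auto
      moreover have "(cmod (R x * of_real (tau w x)))\<^sup>2 * w x = (g x)\<^sup>2 * ((cmod (f x))\<^sup>2 * w x)"
        unfolding \<open>R x = ?Q x\<close> by (simp add: g_def norm_mult power_mult_distrib mult_ac)
      moreover have "0 \<le> (\<Sum>z\<in>Z. (KK * loc f z * s\<^sup>2 / (tau w z)\<^sup>2) * indicator (D z) x)"
        using KK by (intro sum_nonneg) auto
      ultimately show ?thesis by linarith
    qed
    let ?d = "\<lambda>z. KK * loc f z * s\<^sup>2 / (tau w z)\<^sup>2"
    have d0: "0 \<le> ?d z" for z using KK by simp
    have dI: "0 \<le> ?d z * indicator (D z) x" for z x by (intro mult_nonneg_nonneg d0) simp
    have "ennreal ((nrm M (\<lambda>\<zeta>. R \<zeta> * of_real (tau w \<zeta>)))\<^sup>2) = (\<integral>\<^sup>+x. ennreal ((cmod (R x * of_real (tau w x)))\<^sup>2 * w x) * indicator disc x \<partial>lebesgue)"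
      by (rule nsq_nn[OF RL, symmetric])
    also have "\<dots> \<le> (\<integral>\<^sup>+x. ennreal (s\<^sup>2) * (ennreal ((cmod (f x))\<^sup>2 * w x) * indicator disc x) + (\<Sum>z\<in>Z. ennreal (?d z) * indicator (D z) x) \<partial>lebesgue)"
    proof (rule nn_integral_mono)
      fix x
      show "ennreal ((cmod (R x * of_real (tau w x)))\<^sup>2 * w x) * indicator disc x
        \<le> ennreal (s\<^sup>2) * (ennreal ((cmod (f x))\<^sup>2 * w x) * indicator disc x) + (\<Sum>z\<in>Z. ennreal (?d z) * indicator (D z) x)"
      proof (cases "x \<in> disc")
        case True
        have "ennreal ((cmod (R x * of_real (tau w x)))\<^sup>2 * w x) \<le> ennreal (s\<^sup>2 * ((cmod (f x))\<^sup>2 * w x) + (\<Sum>z\<in>Z. ?d z * indicator (D z) x))"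
          by (intro ennreal_leI pt True)
        also have "\<dots> = ennreal (s\<^sup>2 * ((cmod (f x))\<^sup>2 * w x)) + ennreal (\<Sum>z\<in>Z. ?d z * indicator (D z) x)"
          by (rule ennreal_plus) (use w_pos[OF True] in simp, intro sum_nonneg dI)
        also have "ennreal (s\<^sup>2 * ((cmod (f x))\<^sup>2 * w x)) = ennreal (s\<^sup>2) * ennreal ((cmod (f x))\<^sup>2 * w x)"
          by (rule ennreal_mult) (use w_pos[OF True] in auto)
        also have "ennreal (\<Sum>z\<in>Z. ?d z * indicator (D z) x) = (\<Sum>z\<in>Z. ennreal (?d z * indicator (D z) x))"
          by (rule sum_ennreal[symmetric]) (rule dI)
        also have "\<dots> = (\<Sum>z\<in>Z. ennreal (?d z) * indicator (D z) x)"
          by (rule sum.cong) (auto simp: indicator_def)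
        finally show ?thesis using True by simp
      qed simp
    qed
    also have "\<dots> = (\<integral>\<^sup>+x. ennreal (s\<^sup>2) * (ennreal ((cmod (f x))\<^sup>2 * w x) * indicator disc x) \<partial>lebesgue) + (\<integral>\<^sup>+x. (\<Sum>z\<in>Z. ennreal (?d z) * indicator (D z) x) \<partial>lebesgue)"
      by (intro nn_integral_add borel_measurable_times_ennreal borel_measurable_const meas_ind borel_measurable_sum borel_measurable_indicator)
         (auto simp: D_def)
    also have "(\<integral>\<^sup>+x. ennreal (s\<^sup>2) * (ennreal ((cmod (f x))\<^sup>2 * w x) * indicator disc x) \<partial>lebesgue) = ennreal (s\<^sup>2) * ennreal (nf\<^sup>2)"
      unfolding nf_def nsq_nn[OF fL, symmetric] by (intro nn_integral_cmult meas_ind) auto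
    also have "(\<integral>\<^sup>+x. (\<Sum>z\<in>Z. ennreal (?d z) * indicator (D z) x) \<partial>lebesgue) = (\<Sum>z\<in>Z. \<integral>\<^sup>+x. ennreal (?d z) * indicator (D z) x \<partial>lebesgue)"
      by (intro nn_integral_sum borel_measurable_times_ennreal borel_measurable_const borel_measurable_indicator) (auto simp: D_def)
    \<comment> \<open>The area of \<open>D z\<close> cancels \<open>1 / tau^2\<close>, leaving local
      norms, whose sum is at most \<open>N0 * nf^2\<close> by bounded overlap.\<close>
    also have "\<dots> = (\<Sum>z\<in>Z. ennreal (KK * (pi * \<beta>\<^sup>2 / 16) * s\<^sup>2 * loc f z))"
    proof (rule sum.cong[OF refl])
      fix z assume "z \<in> Z"
      then have tz: "0 < tau w z" using tau_pos Z by auto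
      have "(\<integral>\<^sup>+x. ennreal (?d z) * indicator (D z) x \<partial>lebesgue) = ennreal (?d z) * emeasure lebesgue (D z)"
        by (rule nn_integral_cmult_indicator) (simp add: D_def)
      also have "emeasure lebesgue (D z) = ennreal (pi * (\<beta> / 4 * tau w z)\<^sup>2)"
        unfolding D_def using \<beta> tz by (intro emeasure_cball_complex) simp
      also have "ennreal (?d z) * \<dots> = ennreal (?d z * (pi * (\<beta> / 4 * tau w z)\<^sup>2))"
        by (rule ennreal_mult[symmetric]) (use d0 in auto)
      also have "?d z * (pi * (\<beta> / 4 * tau w z)\<^sup>2) = KK * (pi * \<beta>\<^sup>2 / 16) * s\<^sup>2 * loc f z"
        using tz by (simp add: power_mult_distrib power_divide)
      finally show "(\<integral>\<^sup>+x. ennreal (?d z) * indicator (D z) x \<partial>lebesgue) = ennreal (KK * (pi * \<beta>\<^sup>2 / 16) * s\<^sup>2 * loc f z)" .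
    qed
    also have "\<dots> = ennreal (\<Sum>z\<in>Z. KK * (pi * \<beta>\<^sup>2 / 16) * s\<^sup>2 * loc f z)"
      by (rule sum_ennreal) (use KK in auto)
    also have "(\<Sum>z\<in>Z. KK * (pi * \<beta>\<^sup>2 / 16) * s\<^sup>2 * loc f z) = KK * (pi * \<beta>\<^sup>2 / 16) * s\<^sup>2 * (\<Sum>z\<in>Z. loc f z)"
      by (rule sum_distrib_left[symmetric])
    also have "ennreal (s\<^sup>2) * ennreal (nf\<^sup>2) = ennreal (s\<^sup>2 * nf\<^sup>2)" by (rule ennreal_mult[symmetric]) auto
    also have "ennreal (s\<^sup>2 * nf\<^sup>2) + ennreal (KK * (pi * \<beta>\<^sup>2 / 16) * s\<^sup>2 * (\<Sum>z\<in>Z. loc f z)) = ennreal (s\<^sup>2 * nf\<^sup>2 + KK * (pi * \<beta>\<^sup>2 / 16) * s\<^sup>2 * (\<Sum>z\<in>Z. loc f z))"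
      by (rule ennreal_plus[symmetric]) (use KK in \<open>auto intro!: mult_nonneg_nonneg sum_nonneg\<close>)
    finally have "(nrm M (\<lambda>\<zeta>. R \<zeta> * of_real (tau w \<zeta>)))\<^sup>2 \<le> s\<^sup>2 * nf\<^sup>2 + KK * (pi * \<beta>\<^sup>2 / 16) * s\<^sup>2 * (\<Sum>z\<in>Z. loc f z)"
      using KK by (subst (asm) ennreal_le_iff) (auto intro!: add_nonneg_nonneg mult_nonneg_nonneg sum_nonneg)
    also have "\<dots> \<le> s\<^sup>2 * 1 + KK * (pi * \<beta>\<^sup>2 / 16) * s\<^sup>2 * (N0 * 1)"
    proof (intro add_mono mult_left_mono nf)
      have "(\<Sum>z\<in>Z. loc f z) \<le> N0 * nf\<^sup>2" unfolding nf_def by (rule sum_loc[OF Z fL])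
      also have "\<dots> \<le> N0 * 1" by (intro mult_left_mono nf N0_nonneg)
      finally show "(\<Sum>z\<in>Z. loc f z) \<le> N0 * 1" .
      show "0 \<le> KK * (pi * \<beta>\<^sup>2 / 16) * s\<^sup>2" using KK by simp
    qed simp
    finally have R2: "(nrm M (\<lambda>\<zeta>. R \<zeta> * of_real (tau w \<zeta>)))\<^sup>2 \<le> (1 + KK * (pi * \<beta>\<^sup>2 / 16) * N0) * s\<^sup>2"
      by (simp add: algebra_simps)
    have "nrm M (\<lambda>\<zeta>. hankel w b f \<zeta> - F f \<zeta>) \<le> Ca * nrm M (\<lambda>\<zeta>. R \<zeta> * of_real (tau w \<zeta>))"
      by (rule dbar_sol_bound[OF Ca ap1 ap2 RL]) (use sol in auto)
    then have "(nrm M (\<lambda>\<zeta>. hankel w b f \<zeta> - F f \<zeta>))\<^sup>2 \<le> (Ca * nrm M (\<lambda>\<zeta>. R \<zeta> * of_real (tau w \<zeta>)))\<^sup>2"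
      by (intro power_mono) auto
    also have "\<dots> \<le> Ca\<^sup>2 * ((1 + KK * (pi * \<beta>\<^sup>2 / 16) * N0) * s\<^sup>2)"
      unfolding power_mult_distrib by (intro mult_left_mono R2) simp
    also have "\<dots> = (K4 * s)\<^sup>2"
    proof -
      have "0 \<le> KK * (pi * \<beta>\<^sup>2 / 16) * N0" using KK N0_nonneg by simp
      then have "(sqrt (1 + 4 * C\<^sup>2 * Qc * (pi * \<beta>\<^sup>2 / 16) * N0))\<^sup>2 = 1 + KK * (pi * \<beta>\<^sup>2 / 16) * N0"
        unfolding KK_def by (intro real_sqrt_pow2) simp
      then show ?thesis unfolding K4_def power_mult_distrib by (simp only: mult.assoc)
    qed
    finally have fin: "(nrm M (\<lambda>\<zeta>. hankel w b f \<zeta> - F f \<zeta>))\<^sup>2 \<le> (K4 * s)\<^sup>2" .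
    have HL: "(\<lambda>\<zeta>. hankel w b f \<zeta> - F f \<zeta>) \<in> L2 M" using sol by (simp add: dbar_sol_def)
    show ?thesis unfolding nsq_L2[OF HL] by (intro ennreal_leI fin)
  qed
  have "sv_sq w b n \<le> Sup ((\<lambda>f. nsq w (\<lambda>z. hankel w b f z - F f z)) ` {f \<in> hdom w b. nsq w f \<le> 1})"
    unfolding sv_sq_def by (rule INF_lower[OF FF])
  also have "\<dots> \<le> ennreal ((K4 * s)\<^sup>2)" by (rule SUP_least) (use main in auto)
  finally show ?thesis .
qed

lemma K4_pos: "0 < K4"
proof -
  have "0 \<le> 4 * C\<^sup>2 * Qc * (pi * \<beta>\<^sup>2 / 16) * N0" using Qc_pos N0_nonneg by simp
  then show ?thesis unfolding K4_def using Ca by (intro mult_pos_pos) auto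
qed

text \<open>\<open>lim\<close> confines the level set of \<open>g\<close> above
  \<open>s = \<kappa> * t\<close> to a compact disc, so that a finite net exists; the rank it needs
  is then compared with \<open>counting\<close>.\<close>

lemma hankel_sv_bound:
  assumes p: "0 < p" "p \<le> 1" and \<theta>: "0 < \<theta>" "2 powr p * \<theta> < 1"
    and lim: "\<And>\<epsilon>. 0 < \<epsilon> \<Longrightarrow> \<exists>r. 0 \<le> r \<and> r < 1 \<and> (\<forall>z\<in>disc. \<epsilon> < g z \<longrightarrow> cmod z \<le> r)"
  obtains C4 C5 where "0 < C4" "0 < C5"
    "\<And>x t n. 0 < x \<Longrightarrow> 0 < t \<Longrightarrow> (\<And>k. Rfun w b (2^k * t) \<le> ennreal (x * \<theta>^k)) \<Longrightarrow> C4 * x < real n \<Longrightarrow>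
      hankel_sv w b n \<le> C5 * t"
proof -
  obtain C3 \<kappa> where c: "0 < C3" "1 \<le> \<kappa>"
    "\<And>x t Z. 0 < x \<Longrightarrow> 0 < t \<Longrightarrow> (\<And>k. Rfun w b (2^k * t) \<le> ennreal (x * \<theta>^k)) \<Longrightarrow>
      finite Z \<Longrightarrow> Z \<subseteq> disc \<Longrightarrow> sep Z \<Longrightarrow> (\<And>z. z \<in> Z \<Longrightarrow> g z > \<kappa> * t) \<Longrightarrow>
      (\<Sum>z\<in>Z. (G p z / (\<kappa> * t)) powr p) \<le> C3 * x"
    using counting[OF p \<theta>] by blast
  \<comment> \<open>For \<open>y \<ge> 1\<close>,
    \<open>log 2 y + 1 \<le> (1 / (p * ln 2) + 1) * y powr p\<close>, by
    \<open>ln y \<le> y powr p / p\<close> and \<open>1 \<le> y powr p\<close>.\<close>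
  define Cp where "Cp = 1 / (p * ln 2) + 1"
  have Cp: "0 < Cp" using p by (simp add: Cp_def add_pos_pos)
  show ?thesis
  proof (rule that[of "Cp * C3" "K4 * \<kappa>"])
    show "0 < Cp * C3" using Cp c by simp
    show "0 < K4 * \<kappa>" using K4_pos c by simp
    fix x t :: real and n :: nat
    assume x: "0 < x" and t: "0 < t" and R: "\<And>k. Rfun w b (2^k * t) \<le> ennreal (x * \<theta>^k)" and n: "Cp * C3 * x < real n"
    define s where "s = \<kappa> * t"
    have s: "0 < s" using c t by (simp add: s_def)
    obtain r where r: "0 \<le> r" "r < 1" "\<And>z. z \<in> disc \<Longrightarrow> s < g z \<Longrightarrow> cmod z \<le> r" using lim[OF s] by blast
    have E: "{z\<in>disc. s < g z} \<subseteq> cball 0 r" using r(3) by auto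
    obtain Z where Z: "finite Z" "Z \<subseteq> {z\<in>disc. s < g z}" "sep Z" "\<And>x. x \<in> {z\<in>disc. s < g z} \<Longrightarrow> \<exists>z\<in>Z. cmod (x - z) \<le> \<beta> / 4 * tau w z"
      using maximal_net[OF E r(1,2)] by metis
    have Zd: "Z \<subseteq> disc" using Z by auto
    have cnt: "(\<Sum>z\<in>Z. (G p z / s) powr p) \<le> C3 * x"
      unfolding s_def by (rule c(3)[OF x t R Z(1) Zd Z(3)]) (use Z(2) in \<open>auto simp: s_def\<close>)
    \<comment> \<open>The least number of terms with \<open>2 ^ N z \<ge> G p z / s\<close>; the
      quotient is at least 1, so \<open>nat\<close> loses nothing.\<close>
    define N where "N z = nat \<lceil>log 2 (G p z / s)\<rceil>" for z
    have y1: "1 \<le> G p z / s" if z: "z \<in> Z" for z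
    proof -
      have "g z \<le> G p z" by (rule g_le_G) (use z Zd p \<beta> tau_pos[of z] in auto)
      moreover have "s < g z" using z Z(2) by auto
      ultimately show ?thesis using s by simp
    qed
    have NG: "G p z * (1/2)^(N z) \<le> s" if z: "z \<in> Z" for z
    proof -
      have "G p z / s = 2 powr (log 2 (G p z / s))" using y1[OF z] by simp
      also have "\<dots> \<le> 2 powr (real (N z))" unfolding N_def by (intro powr_mono real_nat_ceiling_ge) simp
      also have "\<dots> = 2^(N z)" by (simp add: powr_realpow)
      finally show ?thesis using s by (simp add: field_simps power_one_over)
    qed
    have NC: "real (N z) \<le> Cp * (G p z / s) powr p" if z: "z \<in> Z" for z
    proof -
      have "0 \<le> log 2 (G p z / s)" using y1[OF z] by simp
      then have "real (N z) \<le> log 2 (G p z / s) + 1" unfolding N_def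
        by (simp add: of_nat_nat)
      also have "log 2 (G p z / s) = ln (G p z / s) / ln 2" by (simp add: log_def)
      also have "\<dots> \<le> ((G p z / s) powr p / p) / ln 2"
        by (intro divide_right_mono ln_powr_bound y1 z p) simp
      also have "1 \<le> (G p z / s) powr p" using y1[OF z] p by (intro ge_one_powr_ge_zero) auto
      finally show ?thesis by (simp add: Cp_def algebra_simps)
    qed
    have "real (\<Sum>z\<in>Z. N z) \<le> (\<Sum>z\<in>Z. Cp * (G p z / s) powr p)"
      unfolding of_nat_sum by (intro sum_mono NC)
    also have "\<dots> = Cp * (\<Sum>z\<in>Z. (G p z / s) powr p)" by (rule sum_distrib_left[symmetric])
    also have "\<dots> \<le> Cp * (C3 * x)" using Cp by (intro mult_left_mono cnt) auto
    also have "\<dots> < real n" using n by (simp only: mult.assoc)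
    finally have "(\<Sum>z\<in>Z. N z) < n" by (simp only: of_nat_less_iff)
    then have "sv_sq w b n \<le> ennreal ((K4 * s)\<^sup>2)"
      by (intro finite_rank_approx[OF Z(1) Zd Z(3) s p _ NG]) (use Z(4) in auto)
    then have "enn2real (sv_sq w b n) \<le> (K4 * s)\<^sup>2" by (intro enn2real_leI) auto
    then have "hankel_sv w b n \<le> sqrt ((K4 * s)\<^sup>2)" unfolding hankel_sv_def by (rule real_sqrt_le_mono)
    also have "\<dots> = K4 * \<kappa> * t" using K4_pos s by (simp add: s_def mult.assoc)
    finally show "hankel_sv w b n \<le> K4 * \<kappa> * t" .
  qed
qed

end

section \<open>The decay rate\<close>

lemma eventually_to_bdryE:
  assumes "eventually P to_bdry"
  obtains r where "r < 1" "\<And>z. r < cmod z \<Longrightarrow> cmod z < 1 \<Longrightarrow> P z"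
proof -
  obtain Q where Q: "eventually Q (at_left (1::real))" "\<And>z. Q (cmod z) \<Longrightarrow> P z"
    using assms unfolding to_bdry_def eventually_filtercomap by auto
  then obtain r where "r < 1" "\<And>y. r < y \<Longrightarrow> y < 1 \<Longrightarrow> Q y" unfolding eventually_at_left_field by auto
  with Q(2) show thesis by (intro that[of r]) auto
qed

context hankel_cells
begin

lemma supn_le: "0 \<le> supn w b" "supn w b \<le> Gm" "z \<in> disc \<Longrightarrow> g z \<le> supn w b"
proof -
  have bd: "bdd_above (g ` disc)" using Gm by (auto simp: g_def bdd_above_def)
  have e: "supn w b = Sup (g ` disc)" by (simp add: supn_def g_def)
  have 0: "0 \<in> disc" by (simp add: disc_def)
  show 1: "g z \<le> supn w b" if "z \<in> disc" for z unfolding e by (rule cSup_upper[OF _ bd]) (use that in auto)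
  show "0 \<le> supn w b" using 1[OF 0] g_nonneg[OF 0] by linarith
  show "supn w b \<le> Gm" unfolding e using 0 Gm by (intro cSup_least) (auto simp: g_def)
qed

lemma Rplus_bdd: "bdd_above ({t. 0 < t \<and> t \<le> supn w b \<and> Rfun w b t \<ge> ennreal x} \<union> {0})"
  unfolding bdd_above_def using supn_le(1) by (intro exI[of _ "supn w b"]) auto

lemma Rplus_nonneg: "0 \<le> Rplus w b x"
  unfolding Rplus_def by (rule cSup_upper[OF _ Rplus_bdd]) simp

lemma Rplus_le: "Rplus w b x \<le> Gm"
proof -
  have "Rplus w b x \<le> supn w b" unfolding Rplus_def using supn_le(1) by (intro cSup_least) auto
  then show ?thesis using supn_le(2) by linarith
qed

text \<open>Contrapositive of the definition of the generalised inverse. Values of \<open>t\<close>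
  above the supremum of \<open>g\<close> are excluded from that definition, but there the level set
  is empty.\<close>

lemma Rfun_le_of_Rplus_less:
  assumes t: "Rplus w b x < t"
  shows "Rfun w b t \<le> ennreal x"
proof (cases "t \<le> supn w b")
  case True
  show ?thesis
  proof (rule ccontr)
    assume "\<not> Rfun w b t \<le> ennreal x"
    then have "t \<in> {t. 0 < t \<and> t \<le> supn w b \<and> Rfun w b t \<ge> ennreal x} \<union> {0}"
      using True t Rplus_nonneg[of x] by auto
    then have "t \<le> Rplus w b x" unfolding Rplus_def by (rule cSup_upper[OF _ Rplus_bdd])
    then show False using t by simp
  qed
next
  case False
  then have "{z\<in>disc. g z > t} = {}" using supn_le(3) by force
  then show ?thesis unfolding Rfun_g by simp
qed

end

theorem theorem4p5:
  fixes w :: "complex \<Rightarrow> real" and b :: "complex \<Rightarrow> complex" and \<rho> :: "real \<Rightarrow> real" and A :: real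
  assumes "classWstar w"
    and "b \<in> B0w w"
    and "\<forall>x>0. \<rho> x > 0"
    and "\<forall>x y. 0 < x \<and> x \<le> y \<longrightarrow> \<rho> x \<le> \<rho> y"
    and "A > 0"
    and "\<forall>x y. 0 < x \<and> x \<le> y \<longrightarrow> \<rho> y / y powr A \<le> \<rho> x / x powr A"
    and "Rplus w b \<in> O[at_top](\<lambda>x. 1 / \<rho> x)"
  shows "(\<lambda>n. hankel_sv w b n) \<in> O[at_top](\<lambda>n::nat. 1 / \<rho> (real n))"
proof -
  note \<rho>pos = assms(3)[rule_format] and \<rho>mono = assms(4)[rule_format] and A = assms(5)
  obtain \<phi> where \<phi>: "C2_on disc \<phi>" "\<forall>z\<in>disc. w z = exp (- \<phi> z)"
    and cond: "(\<exists>c>0. \<forall>z\<in>disc. (tau w z)\<^sup>2 * lap \<phi> z \<ge> c) \<or>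
         (\<exists>\<psi> \<delta> t. C2_on disc \<psi> \<and> (\<forall>z\<in>disc. \<psi> z \<ge> 0 \<and> lap \<psi> z \<ge> 0) \<and>
            \<delta> > 0 \<and> -1 < t \<and> t < 0 \<and>
            (\<forall>z\<in>disc. (tau w z)\<^sup>2 * lap \<psi> z \<ge> \<delta> \<and> lap \<phi> z \<ge> t * lap \<psi> z \<and>
                       dsq \<psi> z \<le> lap \<psi> z))"
    using assms(1) unfolding classWstar_def by (elim conjE exE) (rule that; assumption)
  have W: "classW w" using assms(1) unfolding classWstar_def by (rule conjunct1)
  then have wt: "is_weight w" unfolding classW_def by (rule conjunct1)
  have "continuous_on disc (\<lambda>z. exp (- \<phi> z))"
    using C2_pd(2)[OF \<phi>(1), of 1] by (intro continuous_intros) simp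
  then have wc: "continuous_on disc w" by (rule continuous_on_eq) (simp add: \<phi>(2))
  interpret weighted w by (rule weighted.intro[OF wt wc])
  obtain Ca where Ca: "0 < Ca" "\<And>\<xi>. \<xi> \<in> test \<Longrightarrow> (\<lambda>z. \<xi> z / of_real (tau w z * w z)) \<in> L2 M"
    "\<And>\<xi>. \<xi> \<in> test \<Longrightarrow> nrm M (\<lambda>z. \<xi> z / of_real (tau w z * w z)) \<le> Ca * nrm M (Dw \<xi>)"
    by (rule a_priori_estimate[OF \<phi>(1) \<phi>(2)[rule_format] cond]) (assumption, rule that)
  obtain C\<tau> where C\<tau>: "\<forall>z\<in>disc. tau w z \<le> C\<tau> * (1 - cmod z)"
    using W unfolding classW_def by (elim conjE exE) (rule that)
  obtain \<eta> C0 where \<eta>: "0 < \<eta>" and C0: "\<forall>z\<in>disc. \<forall>\<zeta>\<in>disc. cmod (z - \<zeta>) \<le> \<eta> * tau w z \<longrightarrow>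
         tau w z \<le> C0 * tau w \<zeta> \<and> tau w \<zeta> \<le> C0 * tau w z \<and>
         knorm w z * knorm w \<zeta> \<le> C0 * cmod (K w \<zeta> z)"
    using W unfolding classW_def by (elim conjE exE) (rule that; assumption)
  \<comment> \<open>The given constant may be small or negative; \<open>B \<ge> 1\<close> makes
    division by it safe.\<close>
  define B where "B = \<bar>C\<tau>\<bar> + 1"
  have B: "1 \<le> B" by (simp add: B_def)
  have tauB: "tau w z \<le> B * (1 - cmod z)" if z: "z \<in> disc" for z
  proof -
    have "tau w z \<le> C\<tau> * (1 - cmod z)" using C\<tau> z by blast
    also have "\<dots> \<le> B * (1 - cmod z)" using z by (intro mult_right_mono) (auto simp: B_def disc_def)
    finally show ?thesis .
  qed
  \<comment> \<open>\<open>1 / (2 * B)\<close> yields \<open>room\<close>, and \<open>\<eta>\<close>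
    yields \<open>comp\<close>.\<close>
  define \<beta> where "\<beta> = min \<eta> (1 / (2 * B))"
  define C where "C = max C0 1"
  have cl: "cells w \<beta> C"
  proof
    show "0 < \<beta>" using \<eta> B by (simp add: \<beta>_def)
    show "1 \<le> C" by (simp add: C_def)
    fix z assume z: "z \<in> disc"
    note tp = tau_pos[OF z]
    have "\<beta> * tau w z \<le> 1 / (2 * B) * tau w z" using tp by (intro mult_right_mono) (auto simp: \<beta>_def)
    also have "\<dots> \<le> 1 / (2 * B) * (B * (1 - cmod z))" using B by (intro mult_left_mono tauB z) auto
    also have "\<dots> = (1 - cmod z) / 2" using B by simp
    finally show "\<beta> * tau w z \<le> (1 - cmod z) / 2" .
    fix \<zeta> assume \<zeta>: "\<zeta> \<in> disc" and d: "cmod (z - \<zeta>) \<le> \<beta> * tau w z"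
    have "\<beta> * tau w z \<le> \<eta> * tau w z" using tp by (intro mult_right_mono) (auto simp: \<beta>_def)
    with d have "cmod (z - \<zeta>) \<le> \<eta> * tau w z" by linarith
    with C0 z \<zeta> have h: "tau w z \<le> C0 * tau w \<zeta>" "tau w \<zeta> \<le> C0 * tau w z"
      "knorm w z * knorm w \<zeta> \<le> C0 * cmod (kern w z \<zeta>)" unfolding K_def by blast+
    have up: "C0 * y \<le> C * y" if "0 \<le> y" for y
      using that by (intro mult_right_mono) (auto simp: C_def)
    show "tau w z \<le> C * tau w \<zeta> \<and> tau w \<zeta> \<le> C * tau w z \<and> knorm w z * knorm w \<zeta> \<le> C * cmod (kern w z \<zeta>)"
      using order_trans[OF h(1) up] order_trans[OF h(2) up] order_trans[OF h(3) up] tp tau_pos[OF \<zeta>]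
      by (simp add: less_imp_le)
  qed
  have hol: "b holomorphic_on disc" and b0: "((\<lambda>z. tau w z * cmod (deriv b z)) \<longlongrightarrow> 0) to_bdry"
    using assms(2) by (auto simp: B0w_def)
  have lim: "\<exists>r. 0 \<le> r \<and> r < 1 \<and> (\<forall>z\<in>disc. \<epsilon> < tau w z * cmod (deriv b z) \<longrightarrow> cmod z \<le> r)" if e: "0 < \<epsilon>" for \<epsilon>
  proof -
    have "eventually (\<lambda>z. tau w z * cmod (deriv b z) < \<epsilon>) to_bdry" by (rule order_tendstoD(2)[OF b0 e])
    then obtain r where r: "r < 1" "\<And>z. r < cmod z \<Longrightarrow> cmod z < 1 \<Longrightarrow> tau w z * cmod (deriv b z) < \<epsilon>"
      by (rule eventually_to_bdryE) (rule that)
    have "cmod z \<le> max r 0" if "z \<in> disc" "\<epsilon> < tau w z * cmod (deriv b z)" for z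
      using r(2)[of z] that by (cases "r < cmod z") (auto simp: disc_def)
    then show ?thesis using r(1) by (intro exI[of _ "max r 0"]) auto
  qed
  \<comment> \<open>Origin of the global bound \<open>Gm\<close>: the product exceeds 1 only in a
    compact disc, where \<open>deriv b\<close> and \<open>tau\<close> are bounded.\<close>
  obtain r where r: "0 \<le> r" "r < 1" "\<And>z. z \<in> disc \<Longrightarrow> 1 < tau w z * cmod (deriv b z) \<Longrightarrow> cmod z \<le> r"
    using lim[of 1] by auto
  have cb: "cball 0 r \<subseteq> disc" using r by (auto simp: disc_def)
  have "continuous_on (cball 0 r) (deriv b)"
    using hol cb by (intro continuous_on_subset[OF holomorphic_on_imp_continuous_on[OF holomorphic_deriv]])
      (auto simp: disc_def)
  then have "bounded (deriv b ` cball 0 r)" by (intro compact_imp_bounded compact_continuous_image) auto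
  then obtain D where D: "\<And>z. cmod z \<le> r \<Longrightarrow> cmod (deriv b z) \<le> D" unfolding bounded_iff by (force simp: dist_norm)
  have Dn: "0 \<le> D" using order_trans[OF norm_ge_zero D[of 0]] r(1) by simp
  define Gm where "Gm = B * D + 1"
  have Gm: "tau w z * cmod (deriv b z) \<le> Gm" if z: "z \<in> disc" for z
  proof (cases "1 < tau w z * cmod (deriv b z)")
    case True
    have "tau w z \<le> B" 
      using order_trans[OF tauB[OF z] mult_left_mono[of "1 - cmod z" 1 B]] B by simp
    then have "tau w z * cmod (deriv b z) \<le> B * D" using B by (intro mult_mono D r(3)[OF z True]) auto
    then show ?thesis by (simp add: Gm_def)
  next
    case False
    have "0 \<le> B * D" using B Dn by simp
    then show ?thesis using False by (simp add: Gm_def)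
  qed
  interpret hc: hankel_apriori w \<beta> C b Gm Ca
    using cl hol Gm Ca
    by (auto simp: hankel_apriori_def hankel_apriori_axioms_def hankel_cells_def hankel_cells_axioms_def)
  \<comment> \<open>\<open>p < 1 / A\<close> makes \<open>2 powr p * \<theta> < 1\<close>; the
    minimum with 1 is for the sub-mean value property.\<close>
  define p where "p = min 1 (1 / (2 * A))"
  define \<theta> where "\<theta> = 2 powr (- (1 / A))"
  have p: "0 < p" "p \<le> 1" using A by (auto simp: p_def)
  have \<theta>: "0 < \<theta>" by (simp add: \<theta>_def)
  have "p < 1 / A" using A by (auto simp: p_def min_def field_simps)
  then have "p - 1 / A < 0" by simp
  then have "2 powr (p - 1 / A) < 2 powr (0::real)" by (intro powr_less_mono) auto
  then have \<theta>2: "2 powr p * \<theta> < 1" unfolding \<theta>_def by (simp only: powr_add[symmetric]) simp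
  obtain C4 C5 where C45: "0 < C4" "0 < C5"
    and bound: "\<And>x t n. 0 < x \<Longrightarrow> 0 < t \<Longrightarrow> (\<And>k. Rfun w b (2^k * t) \<le> ennreal (x * \<theta>^k)) \<Longrightarrow> C4 * x < real n \<Longrightarrow>
      hankel_sv w b n \<le> C5 * t"
    using hc.hankel_sv_bound[OF p \<theta> \<theta>2 lim[folded hc.g_def]] by blast
  have "Gm \<ge> 0" using B Dn by (simp add: Gm_def)
  \<comment> \<open>The hypothesis concerns large \<open>x\<close>, but it is used at
    \<open>x * \<theta>^k\<close> for all \<open>k\<close>, which tends to 0. Below
    \<open>X\<close>, the bound \<open>Rplus \<le> Gm\<close> and monotonicity of
    \<open>\<rho>\<close> supply it. The extra 1 makes the inequality strict, as
    \<open>Rfun_le_of_Rplus_less\<close> requires.\<close>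
  obtain E where E: "0 < E" "\<And>x. 0 < x \<Longrightarrow> Rplus w b x < E / \<rho> x"
  proof -
    obtain c where "eventually (\<lambda>x. norm (Rplus w b x) \<le> c * norm (1 / \<rho> x)) at_top"
      using assms(7) by (elim landau_o.bigE) 
    then obtain X0 where X0: "\<And>x. X0 \<le> x \<Longrightarrow> norm (Rplus w b x) \<le> c * norm (1 / \<rho> x)"
      unfolding eventually_at_top_linorder by blast
    define X where "X = max X0 1"
    have X: "0 < X" by (simp add: X_def)
    show thesis
    proof (rule that[of "\<bar>c\<bar> + Gm * \<rho> X + 1"])
      have s: "0 \<le> Gm * \<rho> X" using \<open>Gm \<ge> 0\<close> \<rho>pos[OF X] by simp
      then show "0 < \<bar>c\<bar> + Gm * \<rho> X + 1" by linarith
      fix x :: real assume x: "0 < x"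
      have "Rplus w b x * \<rho> x \<le> \<bar>c\<bar> + Gm * \<rho> X"
      proof (cases "X \<le> x")
        case True
        then have "Rplus w b x \<le> c / \<rho> x" using X0[of x] \<rho>pos[OF x] by (simp add: X_def)
        then have "Rplus w b x * \<rho> x \<le> c" using \<rho>pos[OF x] by (simp add: pos_le_divide_eq)
        then show ?thesis using s by linarith
      next
        case False
        have "Rplus w b x * \<rho> x \<le> Gm * \<rho> X"
          using hc.Rplus_le[of x] \<rho>mono[of x X] x False \<rho>pos[OF x] \<open>Gm \<ge> 0\<close> by (intro mult_mono) auto
        then show ?thesis by linarith
      qed
      then show "Rplus w b x < (\<bar>c\<bar> + Gm * \<rho> X + 1) / \<rho> x"
        using \<rho>pos[OF x] by (simp add: pos_less_divide_eq)
    qed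
  qed
  have scale: "\<rho> y \<le> \<rho> x * (y / x) powr A" if "0 < x" "x \<le> y" for x y
  proof -
    have "\<rho> y / y powr A \<le> \<rho> x / x powr A" using assms(6) that by blast
    then show ?thesis using that by (simp add: powr_divide divide_simps mult.commute)
  qed
  have \<theta>1: "\<theta> \<le> 1" using A powr_mono[of "- (1 / A)" 0 "2::real"] by (simp add: \<theta>_def)
  have \<theta>A: "\<theta> powr A = 1/2" 
    using A powr_powr[of "2::real" "- (1 / A)" A] by (simp add: \<theta>_def powr_minus)
  have bnd: "hankel_sv w b n \<le> C5 * E * (C4 + 1) powr A * (1 / \<rho> (real n))" if n: "1 \<le> n" for n
  proof -
    \<comment> \<open>Dividing by \<open>C4 + 1\<close> instead of \<open>C4\<close> gives the
      strict inequality \<open>C4 * x < real n\<close> and also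
      \<open>x \<le> real n\<close>.\<close>
    define x where "x = real n / (C4 + 1)"
    have x: "0 < x" using n C45 by (simp add: x_def)
    have "C4 * x < (C4 + 1) * x" using x by (simp add: distrib_right)
    also have "\<dots> = real n" using C45 by (simp add: x_def)
    finally have nx: "C4 * x < real n" .
    define t where "t = E / \<rho> x"
    have t: "0 < t" using E(1) \<rho>pos[OF x] by (simp add: t_def)
    have "Rfun w b (2^k * t) \<le> ennreal (x * \<theta>^k)" for k
    proof (rule hc.Rfun_le_of_Rplus_less)
      have xk: "0 < x * \<theta>^k" using x \<theta> by simp
      have "x * \<theta>^k \<le> x" using x \<theta> \<theta>1 by (simp add: mult_left_le power_le_one)
      \<comment> \<open>From \<open>x * \<theta>^k\<close> to \<open>x\<close> the function
        \<open>\<rho>\<close> grows at most by the factor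
        \<open>(1 / \<theta>^k) powr A = 2^k\<close>, exactly the ratio of the dyadic levels; this
        dictates the choice of \<open>\<theta>\<close>.\<close>
      from scale[OF xk this] have "\<rho> x \<le> \<rho> (x * \<theta>^k) * (1 / \<theta>^k) powr A" using x by simp
      also have "(1 / \<theta>^k) powr A = 1 / (\<theta> powr A)^k"
        using \<theta> by (simp add: powr_divide powr_realpow[symmetric] powr_powr mult.commute)
      also have "\<dots> = 2^k" by (simp add: \<theta>A power_one_over)
      finally have "E / \<rho> (x * \<theta>^k) \<le> 2^k * (E / \<rho> x)"
        using \<rho>pos[OF x] \<rho>pos[OF xk] E(1) by (simp add: divide_simps mult_ac)
      then show "Rplus w b (x * \<theta>^k) < 2^k * t" using E(2)[OF xk] by (simp add: t_def)
    qed
    then have "hankel_sv w b n \<le> C5 * t" by (rule bound[OF x t _ nx])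
    moreover have "t \<le> E * (C4 + 1) powr A * (1 / \<rho> (real n))"
    proof -
      have "x \<le> real n" using n C45 by (simp add: x_def divide_simps)
      from scale[OF x this] have "\<rho> (real n) \<le> \<rho> x * (C4 + 1) powr A" using n C45 by (simp add: x_def)
      then show ?thesis using \<rho>pos[OF x] \<rho>pos[of "real n"] n E(1) by (simp add: t_def divide_simps mult_ac)
    qed
    then have "C5 * t \<le> C5 * (E * (C4 + 1) powr A * (1 / \<rho> (real n)))"
      using C45 by (intro mult_left_mono) auto
    ultimately show ?thesis by (simp only: mult.assoc)
  qed
  show ?thesis
  proof (rule bigoI[of _ "C5 * E * (C4 + 1) powr A"])
    show "\<forall>\<^sub>F n in at_top. norm (hankel_sv w b n) \<le> C5 * E * (C4 + 1) powr A * norm (1 / \<rho> (real n))"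
      unfolding eventually_at_top_linorder
    proof (intro exI[of _ 1] allI impI)
      fix n :: nat assume n: "1 \<le> n"
      have "norm (hankel_sv w b n) = hankel_sv w b n" by (simp add: hankel_sv_def)
      also note bnd[OF n]
      also have "1 / \<rho> (real n) = norm (1 / \<rho> (real n))" using \<rho>pos[of "real n"] n by simp
      finally show "norm (hankel_sv w b n) \<le> C5 * E * (C4 + 1) powr A * norm (1 / \<rho> (real n))" .
    qed
  qed
qed

end
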